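(* Let $1\le p\le\infty$, $p\ne2$, and let $X$ be a reflexive Banach space with a normalized monotone basis which is asymptotically $\ell_p$. Then the interpolation of $X$ with its antidual $\hat X^*$ at $1/2$ induces a singular twisted Hilbert space: $(X,\hat X^* )_{1/2}=\ell_2$ and the induced quasi-linear map $\Omega_{1/2}$ on $\ell_2$ is singular, i.e. in the exact sequence $$0\to\ell_2\to d_{\Omega_{1/2}}(\ell_2)\to\ell_2\to0$$ the quotient map is strictly singular.
   Context: Scalars are complex. A Banach space $X$ with a basis $(e_n)$ is asymptotically $\ell_p$ if there is $C\ge1$ such that for all $n$ and all normalized vectors $n<x_1<\dots<x_n$ in $X$ (successive finitely supported vectors, supported after $n$), $(x_i)_{i=1}^n$ is $C$-equivalent to the unit vector basis of $\ell_p^n$. With $(e_n^* )$ the biorthogonal functionals, $X$ is identified with $\{(e_n^*(x))_n:x\in X\}$ and its antidual $\hat X^*$ with $\{(\overline{x^*(e_n)})_n: x^*\in X^*\}$ (with the norms of $X$ and $X^*$), both linear subspaces of $\ell_\infty$. Complex interpolation: let $\mathbb S=\{z\in\mathbb C:0\le\mathrm{Re}\,z\le1\}$. For a compatible pair $(X_0,X_1)$ with $\Sigma=X_0+X_1$, $\mathcal H$ is the Banach space of functions $g:\mathbb S\to\Sigma$ which are $\Sigma$-bounded, $\Sigma$-continuous on $\mathbb S$, analytic in the interior, and such that $t\mapsto g(j+it)\in X_j$ is bounded and continuous for $j=0,1$, with norm $\|g\|_{\mathcal H}=\sup\{\|g(j+it)\|_{X_j}:j=0,1,\ t\in\mathbb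 R\}$. For $0<\theta<1$, $(X_0,X_1)_\theta=X_\theta=\{g(\theta):g\in\mathcal H\}$ with the quotient norm. Choose a homogeneous map $B_\theta:X_\theta\to\mathcal H$ with $B_\theta(x)(\theta)=x$ and $\|B_\theta(x)\|_{\mathcal H}\le C\|x\|_{X_\theta}$; the induced quasi-linear map is $\Omega_\theta(x)=B_\theta(x)'(\theta)\in\Sigma$. Another choice of $B_\theta$ changes $\Omega_\theta$ only by a bounded map $X_\theta\to X_\theta$. Set $d_{\Omega_\theta}(X_\theta)=\{(w,x)\in\Sigma\times X_\theta: w-\Omega_\theta x\in X_\theta\}$ with quasi-norm $\|w-\Omega_\theta x\|_{X_\theta}+\|x\|_{X_\theta}$, embedding $y\mapsto(y,0)$ and quotient map $(w,x)\mapsto x$. An operator is strictly singular if no restriction of it to an infinite dimensional closed subspace is an isomorphism onto its image. *)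

theory Defs
  imports "HOL-Analysis.Analysis" "HOL-Library.Function_Algebras"
begin

class scaleC =
  fixes scaleC :: "complex \<Rightarrow> 'a \<Rightarrow> 'a" (infixr "*\<^sub>C" 75)

class complex_vector = scaleC + ab_group_add +
  assumes scaleC_add_right: "a *\<^sub>C (x + y) = a *\<^sub>C x + a *\<^sub>C y"
    and scaleC_add_left: "(a + b) *\<^sub>C x = a *\<^sub>C x + b *\<^sub>C x"
    and scaleC_scaleC: "a *\<^sub>C b *\<^sub>C x = (a * b) *\<^sub>C x"
    and scaleC_one: "1 *\<^sub>C x = x"

class complex_normed_vector = complex_vector + real_normed_vector +
  assumes scaleR_scaleC: "r *\<^sub>R x = complex_of_real r *\<^sub>C x"
    and norm_scaleC: "norm (a *\<^sub>C x) = cmod a * norm x"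

class complex_banach = complex_normed_vector + banach

global_interpretation complex_vector:
  vector_space "scaleC :: complex \<Rightarrow> 'a \<Rightarrow> 'a :: complex_vector"
  defines csubspace = complex_vector.subspace
    and cspan = complex_vector.span
  by standard (simp_all add: scaleC_add_right scaleC_add_left scaleC_scaleC scaleC_one)

instantiation complex :: complex_banach
begin

definition scaleC_complex_def: "scaleC (a::complex) (x::complex) = a * x"

instance
  by standard
    (simp_all add: scaleC_complex_def algebra_simps norm_mult scaleR_conv_of_real)

end

instantiation "fun" :: (type, complex_vector) complex_vector
begin

definition scaleC_fun_def: "scaleC a f = (\<lambda>i. a *\<^sub>C f i)"

instance
  by standard
    (simp_all add: scaleC_fun_def fun_eq_iff
      scaleC_add_right scaleC_add_left scaleC_scaleC scaleC_one)

end

instantiation prod :: (complex_vector, complex_vector) complex_vector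
begin

definition scaleC_prod_def: "scaleC a v = (a *\<^sub>C fst v, a *\<^sub>C snd v)"

instance
  by standard
    (simp_all add: scaleC_prod_def prod_eq_iff
      scaleC_add_right scaleC_add_left scaleC_scaleC scaleC_one)

end

definition cdual :: "('a::complex_normed_vector \<Rightarrow> complex) set" where
  "cdual = {f. bounded_linear f \<and> (\<forall>c x. f (c *\<^sub>C x) = c * f x)}"

text \<open>Reflexivity: every bounded linear functional on the dual (normed by
  \<^const>\<open>onorm\<close>) is evaluation at a point.\<close>

definition reflexive_space :: "'a::complex_normed_vector itself \<Rightarrow> bool" where
  "reflexive_space _ \<longleftrightarrow>
    (\<forall>\<phi> :: ('a \<Rightarrow> complex) \<Rightarrow> complex.
       (\<forall>f\<in>cdual. \<forall>g\<in>cdual. \<phi> (f + g) = \<phi> f + \<phi> g) \<and>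
       (\<forall>c. \<forall>f\<in>cdual. \<phi> (c *\<^sub>C f) = c * \<phi> f) \<and>
       (\<exists>K. \<forall>f\<in>cdual. cmod (\<phi> f) \<le> K * onorm f)
       \<longrightarrow> (\<exists>x. \<forall>f\<in>cdual. \<phi> f = f x))"

definition schauder_basis :: "(nat \<Rightarrow> 'a::complex_normed_vector) \<Rightarrow> bool" where
  "schauder_basis e \<longleftrightarrow> (\<forall>x. \<exists>!a. (\<lambda>n. a n *\<^sub>C e n) sums x)"

definition coords :: "(nat \<Rightarrow> 'a::complex_normed_vector) \<Rightarrow> 'a \<Rightarrow> nat \<Rightarrow> complex" where
  "coords e x = (THE a. (\<lambda>n. a n *\<^sub>C e n) sums x)"

definition normalized_basis :: "(nat \<Rightarrow> 'a::complex_normed_vector) \<Rightarrow> bool" where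
  "normalized_basis e \<longleftrightarrow> schauder_basis e \<and> (\<forall>n. norm (e n) = 1)"

definition monotone_basis :: "(nat \<Rightarrow> 'a::complex_normed_vector) \<Rightarrow> bool" where
  "monotone_basis e \<longleftrightarrow> schauder_basis e \<and>
     (\<forall>x n. norm (\<Sum>i<n. coords e x i *\<^sub>C e i) \<le> norm x)"

definition supp :: "(nat \<Rightarrow> 'a::complex_normed_vector) \<Rightarrow> 'a \<Rightarrow> nat set" where
  "supp e x = {k. coords e x k \<noteq> 0}"

text \<open>Meaningful for \<open>n \<ge> 1\<close> only.\<close>

definition lp_norm :: "ereal \<Rightarrow> nat \<Rightarrow> (nat \<Rightarrow> complex) \<Rightarrow> real" where
  "lp_norm p n a =
    (if p = \<infinity> then Max ((\<lambda>i. cmod (a i)) ` {..<n})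
     else (\<Sum>i<n. cmod (a i) powr real_of_ereal p) powr (1 / real_of_ereal p))"

text \<open>The basis is indexed from 0 here, so ``supported after the first \<open>n\<close> basis
  vectors'' means that all indices in the support are at least \<open>n\<close>.\<close>

definition asymptotically_lp ::
    "ereal \<Rightarrow> (nat \<Rightarrow> 'a::complex_normed_vector) \<Rightarrow> bool" where
  "asymptotically_lp p e \<longleftrightarrow>
    (\<exists>C\<ge>1. \<forall>n\<ge>1. \<forall>x :: nat \<Rightarrow> 'a.
       (\<forall>i<n. norm (x i) = 1 \<and> finite (supp e (x i)) \<and> supp e (x i) \<subseteq> {n..}) \<and>
       (\<forall>i j. i < j \<and> j < n \<longrightarrow> (\<forall>k\<in>supp e (x i). \<forall>l\<in>supp e (x j). k < l))
       \<longrightarrow> (\<forall>a :: nat \<Rightarrow> complex.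
              lp_norm p n a / C \<le> norm (\<Sum>i<n. a i *\<^sub>C x i) \<and>
              norm (\<Sum>i<n. a i *\<^sub>C x i) \<le> C * lp_norm p n a))"

text \<open>A (quasi-)normed space given by a linear subspace of an ambient vector space and a
  (quasi-)norm, whose values outside the subspace are irrelevant.\<close>

record 'v nspace =
  elems :: "'v set"
  nrm :: "'v \<Rightarrow> real"

definition same_nspace :: "'v nspace \<Rightarrow> 'v nspace \<Rightarrow> bool" where
  "same_nspace V W \<longleftrightarrow> elems V = elems W \<and> (\<forall>x\<in>elems V. nrm V x = nrm W x)"

definition ell2 :: "(nat \<Rightarrow> complex) nspace" where
  "ell2 = \<lparr>elems = {x. summable (\<lambda>n. (cmod (x n))\<^sup>2)},
           nrm = (\<lambda>x. sqrt (\<Sum>n. (cmod (x n))\<^sup>2))\<rparr>"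

definition coord_space :: "(nat \<Rightarrow> 'a::complex_normed_vector) \<Rightarrow> (nat \<Rightarrow> complex) nspace" where
  "coord_space e = \<lparr>elems = range (coords e), nrm = (\<lambda>s. norm (inv (coords e) s))\<rparr>"

definition anti_coords ::
    "(nat \<Rightarrow> 'a::complex_normed_vector) \<Rightarrow> ('a \<Rightarrow> complex) \<Rightarrow> nat \<Rightarrow> complex" where
  "anti_coords e f = (\<lambda>n. cnj (f (e n)))"

definition antidual_space ::
    "(nat \<Rightarrow> 'a::complex_normed_vector) \<Rightarrow> (nat \<Rightarrow> complex) nspace" where
  "antidual_space e =
    \<lparr>elems = anti_coords e ` cdual,
     nrm = (\<lambda>s. onorm (inv_into cdual (anti_coords e) s))\<rparr>"

definition sum_space :: "'v::complex_vector nspace \<Rightarrow> 'v nspace \<Rightarrow> 'v nspace" where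
  "sum_space X0 X1 =
    \<lparr>elems = {x0 + x1 | x0 x1. x0 \<in> elems X0 \<and> x1 \<in> elems X1},
     nrm = (\<lambda>x. Inf {nrm X0 x0 + nrm X1 x1 | x0 x1.
                       x0 \<in> elems X0 \<and> x1 \<in> elems X1 \<and> x = x0 + x1})\<rparr>"

definition strip :: "complex set" where
  "strip = {z. 0 \<le> Re z \<and> Re z \<le> 1}"

definition has_nderivative ::
    "'v::complex_vector nspace \<Rightarrow> (complex \<Rightarrow> 'v) \<Rightarrow> complex \<Rightarrow> 'v \<Rightarrow> bool" where
  "has_nderivative V g z d \<longleftrightarrow> d \<in> elems V \<and>
    ((\<lambda>w. nrm V (inverse (w - z) *\<^sub>C (g w - g z) - d)) \<longlongrightarrow> 0) (at z)"

text \<open>Only the restriction of \<open>g\<close> to the strip is relevant.\<close>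

definition calderon_space ::
    "'v::complex_vector nspace \<Rightarrow> 'v nspace \<Rightarrow> (complex \<Rightarrow> 'v) set" where
  "calderon_space X0 X1 = {g.
     (\<forall>z\<in>strip. g z \<in> elems (sum_space X0 X1)) \<and>
     (\<exists>M. \<forall>z\<in>strip. nrm (sum_space X0 X1) (g z) \<le> M) \<and>
     (\<forall>z\<in>strip.
        ((\<lambda>w. nrm (sum_space X0 X1) (g w - g z)) \<longlongrightarrow> 0) (at z within strip)) \<and>
     (\<forall>z\<in>interior strip. \<exists>d. has_nderivative (sum_space X0 X1) g z d) \<and>
     (\<forall>(j, X) \<in> {(0, X0), (1, X1)}.
        (\<forall>t. g (Complex j t) \<in> elems X) \<and>
        (\<exists>M. \<forall>t. nrm X (g (Complex j t)) \<le> M) \<and>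
        (\<forall>t. ((\<lambda>s. nrm X (g (Complex j s) - g (Complex j t))) \<longlongrightarrow> 0) (at t)))}"

definition calderon_norm ::
    "'v::complex_vector nspace \<Rightarrow> 'v nspace \<Rightarrow> (complex \<Rightarrow> 'v) \<Rightarrow> real" where
  "calderon_norm X0 X1 g =
    Sup (range (\<lambda>t. nrm X0 (g (Complex 0 t))) \<union> range (\<lambda>t. nrm X1 (g (Complex 1 t))))"

definition interp_space ::
    "'v::complex_vector nspace \<Rightarrow> 'v nspace \<Rightarrow> real \<Rightarrow> 'v nspace" where
  "interp_space X0 X1 \<theta> =
    \<lparr>elems = {g (of_real \<theta>) | g. g \<in> calderon_space X0 X1},
     nrm = (\<lambda>x. Inf {calderon_norm X0 X1 g | g.
                       g \<in> calderon_space X0 X1 \<and> g (of_real \<theta>) = x})\<rparr>"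

definition bounded_selection ::
    "'v::complex_vector nspace \<Rightarrow> 'v nspace \<Rightarrow> real \<Rightarrow> ('v \<Rightarrow> complex \<Rightarrow> 'v) \<Rightarrow> bool" where
  "bounded_selection X0 X1 \<theta> B \<longleftrightarrow>
    (\<forall>x\<in>elems (interp_space X0 X1 \<theta>).
       B x \<in> calderon_space X0 X1 \<and> B x (of_real \<theta>) = x) \<and>
    (\<forall>c. \<forall>x\<in>elems (interp_space X0 X1 \<theta>). \<forall>z\<in>strip. B (c *\<^sub>C x) z = c *\<^sub>C B x z) \<and>
    (\<exists>C. \<forall>x\<in>elems (interp_space X0 X1 \<theta>).
       calderon_norm X0 X1 (B x) \<le> C * nrm (interp_space X0 X1 \<theta>) x)"

definition induced_map ::
    "'v::complex_vector nspace \<Rightarrow> 'v nspace \<Rightarrow> real \<Rightarrow> ('v \<Rightarrow> complex \<Rightarrow> 'v) \<Rightarrow> 'v \<Rightarrow> 'v" where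
  "induced_map X0 X1 \<theta> B x =
    (THE d. has_nderivative (sum_space X0 X1) (B x) (of_real \<theta>) d)"

text \<open>The space \<open>d\<^bsub>\<Omega>\<^esub>(Y) \<subseteq> \<Sigma> \<times> Y\<close>; the quotient map onto \<open>Y\<close> is \<^const>\<open>snd\<close>.\<close>

definition twisted_sum ::
    "'v::complex_vector nspace \<Rightarrow> ('v \<Rightarrow> 'v) \<Rightarrow> 'v nspace \<Rightarrow> ('v \<times> 'v) nspace" where
  "twisted_sum S \<Omega> Y =
    \<lparr>elems = {(w, x). w \<in> elems S \<and> x \<in> elems Y \<and> w - \<Omega> x \<in> elems Y},
     nrm = (\<lambda>(w, x). nrm Y (w - \<Omega> x) + nrm Y x)\<rparr>"

definition closed_in :: "'v::complex_vector nspace \<Rightarrow> 'v set \<Rightarrow> bool" where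
  "closed_in V U \<longleftrightarrow>
    (\<forall>u. \<forall>v\<in>elems V. (\<forall>n. u n \<in> U) \<and> (\<lambda>n. nrm V (u n - v)) \<longlonglongrightarrow> 0 \<longrightarrow> v \<in> U)"

definition infinite_dimensional :: "'v::complex_vector set \<Rightarrow> bool" where
  "infinite_dimensional U \<longleftrightarrow> \<not> (\<exists>F. finite F \<and> U \<subseteq> cspan F)"

definition iso_onto_image ::
    "'v::complex_vector nspace \<Rightarrow> 'w::complex_vector nspace \<Rightarrow> ('v \<Rightarrow> 'w) \<Rightarrow> 'v set \<Rightarrow> bool" where
  "iso_onto_image V W T U \<longleftrightarrow> inj_on T U \<and>
    (\<exists>K. \<forall>u\<in>U. nrm W (T u) \<le> K * nrm V u) \<and>
    (\<exists>K. \<forall>u\<in>U. nrm V u \<le> K * nrm W (T u))"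

definition strictly_singular ::
    "'v::complex_vector nspace \<Rightarrow> 'w::complex_vector nspace \<Rightarrow> ('v \<Rightarrow> 'w) \<Rightarrow> bool" where
  "strictly_singular V W T \<longleftrightarrow>
    \<not> (\<exists>U \<subseteq> elems V. csubspace U \<and> closed_in V U \<and> infinite_dimensional U \<and>
          iso_onto_image V W T U)"

end

theory Submission
  imports Defs "HOL-Computational_Algebra.Polynomial" "HOL-Complex_Analysis.Complex_Analysis"
begin

text \<open>Everything rests on one symmetry: the reflection \<open>z \<mapsto> 1 - cnj z\<close> of the strip exchanges its sides, and
the two spaces on the sides are antidual to each other.

For \<open>g\<close> in the Calderon space the function
\<open>z \<mapsto> \<Sum>k<n. g(z)\<^sub>k * cnj (g(1 - cnj z)\<^sub>k)\<close> is analytic. On the sides it is the value of a functional at a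
basis projection of a vector, so monotonicity of the basis bounds it by \<open>\<parallel>g\<parallel>\<^sup>2\<close>, and at \<open>1/2\<close> it is
\<open>\<Sum>k<n. \<bar>g(1/2)\<^sub>k\<bar>\<^sup>2\<close>. The three lines theorem therefore gives a contraction of the interpolation
space into \<open>\<ell>\<^sub>2\<close> (\<open>H_value_l2\<close>); applied to \<open>g(z) / (z - 1/2)\<close> it shows that two functions with the
same value at \<open>1/2\<close> have derivatives there that differ by an element of \<open>\<ell>\<^sub>2\<close> (\<open>H_deriv_diff\<close>).

The reverse inequality is a duality argument in finite dimensions, carried out on the disc, where
the sides become the lower and the upper half of the unit circle, equipped with a norm \<open>N0\<close> and its
dual \<open>N1\<close>, and the reflection becomes \<open>\<zeta> \<mapsto> cnj \<zeta>\<close>. Among vector polynomials \<open>p\<close>, nearly minimise the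
mean of half the squared norm of \<open>p\<close> on the circle minus \<open>Re \<langle>p(0), x\<rangle>\<close>. The derivative \<open>h\<close> of the
energy at \<open>p\<close> is then almost orthogonal to the analytic functions that vanish at \<open>0\<close>, hence almost
antianalytic, with mean \<open>x\<close>; and by Legendre duality together with the inequality of the first part
its dual energy is at most about \<open>\<bar>x\<bar>\<^sup>2 / 2\<close>. Reflected, \<open>h\<close> becomes an analytic polynomial with
value \<open>x\<close> at the centre and mean square norm at most about \<open>\<bar>x\<bar>\<^sup>2\<close> (\<open>factorization_L2\<close>). The norms
need not be differentiable, so Moreau envelopes take their place; their proximal points also supply
norming functionals. Division by a scalar outer function turns the mean square bound into a uniform
one (\<open>factorization_sup\<close>), and a series over blocks extends the result from finitely supported
sequences to all of \<open>\<ell>\<^sub>2\<close> (\<open>ell2_lift\<close>).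

For singularity, suppose that the quotient map is an isomorphism on an infinite dimensional
subspace, so that on its image \<open>W\<close> the map \<open>\<Omega>\<close> is a linear map \<open>L\<close> plus a bounded one. Choose \<open>n\<close> normalised
vectors \<open>x\<^sub>i\<close> in \<open>W\<close> that are almost successive blocks supported after \<open>n\<close>, and lifts \<open>h\<^sub>i\<close> of them
which are almost supported on the same blocks. On the sides, sums of \<open>n\<close> such blocks grow like
\<open>n\<^bsup>\<alpha>\<^esup>\<close> and \<open>n\<^bsup>1-\<alpha>\<^esup>\<close>, where \<open>\<alpha> = 1/p\<close>, so \<open>n\<^bsup>-(\<alpha> + (1 - 2 \<alpha>) z)\<^esup> * (\<Sum>i. \<plusminus> h\<^sub>i(z))\<close> is bounded
uniformly in \<open>n\<close>. Its value at \<open>1/2\<close> is \<open>n\<^bsup>-1/2\<^esup> * (\<Sum>i. \<plusminus> x\<^sub>i)\<close>, of norm close to \<open>1\<close>, but differentiating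
the scalar factor contributes \<open>(1 - 2 \<alpha>) * ln n\<close> times this vector. All other terms stay bounded in
\<open>\<ell>\<^sub>2\<close>: signs make the sum of the \<open>h\<^sub>i'(1/2) - L x\<^sub>i\<close> of order \<open>n\<^bsup>1/2\<^esup>\<close>. As \<open>p \<noteq> 2\<close> means \<open>\<alpha> \<noteq> 1/2\<close>, this
is impossible for large \<open>n\<close>.\<close>

section \<open>Moreau envelopes of norms on finite-dimensional spaces\<close>

text \<open>The vectors of an \<open>n\<close>-dimensional space are all sequences, of which only the first \<open>n\<close> coordinates
matter; the dimension can then vary inside a proof. Convexity only involves the real inner product.\<close>

definition vinner :: "nat \<Rightarrow> (nat \<Rightarrow> complex) \<Rightarrow> (nat \<Rightarrow> complex) \<Rightarrow> real" where
  "vinner n a b = (\<Sum>k<n. a k \<bullet> b k)"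

definition vnorm :: "nat \<Rightarrow> (nat \<Rightarrow> complex) \<Rightarrow> real" where
  "vnorm n a = L2_set (\<lambda>k. cmod (a k)) {..<n}"

lemma vnorm_sq: "(vnorm n a)\<^sup>2 = vinner n a a"
  by (simp add: vnorm_def L2_set_def vinner_def sum_nonneg dot_square_norm)

lemma vnorm_nonneg [simp]: "0 \<le> vnorm n a"
  by (simp add: vnorm_def)

lemma vnorm_triangle: "vnorm n (\<lambda>k. a k + b k) \<le> vnorm n a + vnorm n b"
proof -
  have "vnorm n (\<lambda>k. a k + b k) \<le> L2_set (\<lambda>k. cmod (a k) + cmod (b k)) {..<n}"
    unfolding vnorm_def by (rule L2_set_mono) (auto simp: norm_triangle_ineq)
  also have "\<dots> \<le> vnorm n a + vnorm n b"
    unfolding vnorm_def by (rule L2_set_triangle_ineq)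
  finally show ?thesis .
qed

lemma vnorm_scale: "vnorm n (\<lambda>k. c * a k) = cmod c * vnorm n a"
  by (simp add: vnorm_def L2_set_def norm_mult power_mult_distrib
      flip: sum_distrib_left) (simp add: real_sqrt_mult)

lemma vnorm_minus_commute: "vnorm n (\<lambda>k. a k - b k) = vnorm n (\<lambda>k. b k - a k)"
  by (simp add: vnorm_def norm_minus_commute)

lemma norm_le_vnorm: "k < n \<Longrightarrow> cmod (a k) \<le> vnorm n a"
  unfolding vnorm_def using member_le_L2_set[of "{..<n}" k "\<lambda>k. cmod (a k)"] by simp

lemma vinner_le: "\<bar>vinner n a b\<bar> \<le> vnorm n a * vnorm n b"
proof -
  have "\<bar>vinner n a b\<bar> \<le> (\<Sum>k<n. \<bar>a k \<bullet> b k\<bar>)"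
    unfolding vinner_def by (rule sum_abs)
  also have "\<dots> \<le> (\<Sum>k<n. \<bar>cmod (a k)\<bar> * \<bar>cmod (b k)\<bar>)"
    by (rule sum_mono) (simp add: Cauchy_Schwarz_ineq2)
  also have "\<dots> \<le> vnorm n a * vnorm n b"
    unfolding vnorm_def by (rule L2_set_mult_ineq)
  finally show ?thesis .
qed

lemma vinner_commute: "vinner n a b = vinner n b a"
  by (simp add: vinner_def inner_commute)
lemma vinner_add_left: "vinner n (\<lambda>k. a k + b k) c = vinner n a c + vinner n b c"
  by (simp add: vinner_def inner_add_left sum.distrib)
lemma vinner_diff_left: "vinner n (\<lambda>k. a k - b k) c = vinner n a c - vinner n b c"
  by (simp add: vinner_def inner_diff_left sum_subtractf)
lemma vinner_add_right: "vinner n c (\<lambda>k. a k + b k) = vinner n c a + vinner n c b"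
  by (simp add: vinner_def inner_add_right sum.distrib)
lemma vinner_diff_right: "vinner n c (\<lambda>k. a k - b k) = vinner n c a - vinner n c b"
  by (simp add: vinner_def inner_diff_right sum_subtractf)
lemma vinner_scale_left: "vinner n (\<lambda>k. complex_of_real s * a k) c = s * vinner n a c"
  by (simp add: vinner_def sum_distrib_left flip: scaleR_conv_of_real)
lemma vinner_scale_right: "vinner n c (\<lambda>k. complex_of_real s * a k) = s * vinner n c a"
  by (simp add: vinner_def sum_distrib_left flip: scaleR_conv_of_real)
lemmas vinner_simps = vinner_add_left vinner_diff_left vinner_add_right vinner_diff_right
  vinner_scale_left vinner_scale_right

text \<open>First-order conditions are extracted from quadratic perturbation inequalities by letting the step
tend to zero.\<close>

lemma slope_nonneg:
  fixes a b :: real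
  assumes "\<And>s. 0 < s \<Longrightarrow> s \<le> 1 \<Longrightarrow> 0 \<le> s * a + s\<^sup>2 * b"
  shows "0 \<le> a"
proof (rule tendsto_lowerbound)
  have "((\<lambda>s::real. a + s * b) \<longlongrightarrow> a + 0 * b) (at_right 0)"
    by (intro tendsto_intros)
  then show "((\<lambda>s::real. a + s * b) \<longlongrightarrow> a) (at_right 0)" by simp
  have "0 \<le> a + s * b" if "0 < s" "s < 1" for s
  proof -
    have "0 \<le> s * (a + s * b)"
      using assms[of s] that by (simp add: power2_eq_square algebra_simps)
    then show ?thesis using that by (simp add: zero_le_mult_iff)
  qed
  then show "\<forall>\<^sub>F s in at_right 0. 0 \<le> a + s * b"
    unfolding eventually_at_right_field by (auto intro!: exI[of _ 1])
qed simp

text \<open>One constant \<open>C\<close> compares the norm with the Euclidean one in both directions. It never enters a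
final bound: it is always multiplied by a quantity that tends to zero.\<close>

locale fin_norm =
  fixes n :: nat and N :: "(nat \<Rightarrow> complex) \<Rightarrow> real" and C :: real
  assumes tri: "N (\<lambda>k. a k + b k) \<le> N a + N b"
    and hom: "N (\<lambda>k. c * a k) = cmod c * N a"
    and up: "N a \<le> C * vnorm n a"
    and low: "vnorm n a \<le> C * N a"
    and C_ge: "1 \<le> C"
begin

lemma N_nonneg: "0 \<le> N a"
proof -
  have "0 \<le> C * N a" using low[of a] vnorm_nonneg[of n a] by linarith
  then show ?thesis using C_ge by (simp add: zero_le_mult_iff)
qed

lemma N_diff: "N a \<le> N b + C * vnorm n (\<lambda>k. a k - b k)"
proof -
  have "N (\<lambda>k. b k + (a k - b k)) \<le> N b + N (\<lambda>k. a k - b k)" by (rule tri)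
  then show ?thesis using up[of "\<lambda>k. a k - b k"] by simp
qed

lemma N_lipschitz: "\<bar>N a - N b\<bar> \<le> C * vnorm n (\<lambda>k. a k - b k)"
  using N_diff[of a b] N_diff[of b a] by (simp add: vnorm_minus_commute[of n b a])

lemma N_sq_convex:
  assumes "0 \<le> s" "s \<le> 1"
  shows "(N (\<lambda>k. u k + complex_of_real s * (w k - u k)))\<^sup>2 \<le> (1 - s) * (N u)\<^sup>2 + s * (N w)\<^sup>2"
proof -
  have "N (\<lambda>k. of_real (1 - s) * u k + of_real s * w k)
      \<le> N (\<lambda>k. of_real (1 - s) * u k) + N (\<lambda>k. of_real s * w k)"
    by (rule tri)
  also have "\<dots> = (1 - s) * N u + s * N w"
    unfolding hom norm_of_real using assms by simp
  finally have "N (\<lambda>k. u k + of_real s * (w k - u k)) \<le> (1 - s) * N u + s * N w"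
    by (simp add: algebra_simps)
  then have "(N (\<lambda>k. u k + complex_of_real s * (w k - u k)))\<^sup>2 \<le> ((1 - s) * N u + s * N w)\<^sup>2"
    using N_nonneg power_mono by blast
  also have "\<dots> = (1 - s) * (N u)\<^sup>2 + s * (N w)\<^sup>2 - s * (1 - s) * (N u - N w)\<^sup>2"
    by (simp add: power2_eq_square algebra_simps)
  also have "\<dots> \<le> (1 - s) * (N u)\<^sup>2 + s * (N w)\<^sup>2"
    using assms by simp
  finally show ?thesis .
qed

text \<open>The objective whose minimiser over \<open>u\<close> is the proximal point of \<open>v\<close> for half the squared norm. The
minimal value is the Moreau envelope, which is differentiable whatever the norm is.\<close>

definition energy :: "real \<Rightarrow> (nat \<Rightarrow> complex) \<Rightarrow> (nat \<Rightarrow> complex) \<Rightarrow> real" where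
  "energy l v u = (N u)\<^sup>2 / 2 + (vnorm n (\<lambda>k. u k - v k))\<^sup>2 / (2 * l)"

definition prox :: "real \<Rightarrow> (nat \<Rightarrow> complex) \<Rightarrow> nat \<Rightarrow> complex" where
  "prox l v = (SOME u. \<forall>w. energy l v u \<le> energy l v w)"

text \<open>The gradient of the Moreau envelope at \<open>v\<close>.\<close>

definition slope :: "real \<Rightarrow> (nat \<Rightarrow> complex) \<Rightarrow> nat \<Rightarrow> complex" where
  "slope l v k = (v k - prox l v k) / of_real l"

definition env :: "real \<Rightarrow> (nat \<Rightarrow> complex) \<Rightarrow> real" where
  "env l v = energy l v (prox l v)"

lemma energy_nonneg: "0 < l \<Longrightarrow> 0 \<le> energy l v u"
  by (simp add: energy_def)

text \<open>The quadratic penalty makes the objective uniformly convex, so that minimising sequences are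
Cauchy.\<close>

lemma energy_midpoint:
  assumes "0 < l"
  shows "energy l v (\<lambda>k. u k + complex_of_real (1/2) * (w k - u k))
     \<le> (energy l v u + energy l v w) / 2 - (vnorm n (\<lambda>k. u k - w k))\<^sup>2 / (8 * l)"
proof -
  have N: "(N (\<lambda>k. u k + complex_of_real (1/2) * (w k - u k)))\<^sup>2 \<le> (1 - 1/2) * (N u)\<^sup>2 + 1/2 * (N w)\<^sup>2"
    by (rule N_sq_convex) auto
  have "vnorm n (\<lambda>k. u k + complex_of_real (1/2) * (w k - u k) - v k) ^ 2
     = (vnorm n (\<lambda>k. u k - v k) ^ 2 + vnorm n (\<lambda>k. w k - v k) ^ 2) / 2
        - (vnorm n (\<lambda>k. u k - w k))\<^sup>2 / 4"
    unfolding vnorm_sq vinner_simps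
    by (simp add: vinner_commute field_simps)
  note V = this
  have arith: "n1 / 2 + v1 / (2 * l) \<le> (n2 / 2 + v2 / (2 * l) + (n3 / 2 + v3 / (2 * l))) / 2 - d / (8 * l)"
    if "n1 \<le> (1 - 1/2) * n2 + 1/2 * n3" "v1 = (v2 + v3) / 2 - d / 4" for n1 n2 n3 v1 v2 v3 d :: real
  proof -
    have "v1 / (2 * l) = (v2 / (2 * l) + v3 / (2 * l)) / 2 - d / (8 * l)"
      unfolding that(2) using assms by (simp add: field_simps)
    then show ?thesis using that(1) by argo
  qed
  show ?thesis unfolding energy_def by (rule arith[OF N V])
qed

lemma prox_exists:
  assumes l: "0 < l"
  shows "\<exists>u. \<forall>w. energy l v u \<le> energy l v w"
proof -
  define m where "m = Inf (range (energy l v))"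
  have bdd: "bdd_below (range (energy l v))"
    using energy_nonneg[OF l] by (auto intro: bdd_belowI[of _ 0])
  have m_le: "m \<le> energy l v w" for w
    unfolding m_def by (rule cInf_lower[OF _ bdd]) simp
  have "\<exists>u. energy l v u < m + 1 / real (Suc i)" for i
    using cInf_lessD[of "range (energy l v)" "m + 1 / real (Suc i)"] unfolding m_def by auto
  then obtain U where U: "\<And>i. energy l v (U i) < m + 1 / real (Suc i)" by metis
  have close: "(vnorm n (\<lambda>k. U i k - U j k))\<^sup>2 \<le> 4 * l * (1 / real (Suc i) + 1 / real (Suc j))" for i j
  proof -
    have "m \<le> (energy l v (U i) + energy l v (U j)) / 2 - (vnorm n (\<lambda>k. U i k - U j k))\<^sup>2 / (8 * l)"
      using m_le energy_midpoint[OF l, of v "U i" "U j"] by (meson order_trans)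
    then have "(vnorm n (\<lambda>k. U i k - U j k))\<^sup>2 / (8 * l) \<le> (1 / real (Suc i) + 1 / real (Suc j)) / 2"
      using U[of i] U[of j] by argo
    then have "(vnorm n (\<lambda>k. U i k - U j k))\<^sup>2 \<le> (1 / real (Suc i) + 1 / real (Suc j)) / 2 * (8 * l)"
      using l by (subst (asm) pos_divide_le_eq) auto
    then show ?thesis by (simp only: mult.commute) argo
  qed
  have inv0: "(\<lambda>i. 1 / real (Suc i)) \<longlonglongrightarrow> 0"
    using LIMSEQ_inverse_real_of_nat by (simp only: inverse_eq_divide)
  have "Cauchy (\<lambda>i. U i k)" if "k < n" for k
  proof (rule metric_CauchyI)
    fix e :: real assume e: "0 < e"
    have "\<forall>\<^sub>F i in sequentially. 1 / real (Suc i) < e\<^sup>2 / (8 * l)"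
      using inv0 e l by (intro order_tendstoD(2)) auto
    then obtain M where M: "\<And>i. i \<ge> M \<Longrightarrow> 1 / real (Suc i) < e\<^sup>2 / (8 * l)"
      unfolding eventually_sequentially by blast
    have "dist (U i k) (U j k) < e" if "i \<ge> M" "j \<ge> M" for i j
    proof -
      have "(dist (U i k) (U j k))\<^sup>2 \<le> (vnorm n (\<lambda>k. U i k - U j k))\<^sup>2"
        unfolding dist_norm using norm_le_vnorm[OF \<open>k < n\<close>] by (intro power_mono) auto
      also have "\<dots> \<le> 4 * l * (1 / real (Suc i) + 1 / real (Suc j))" by (rule close)
      also have "\<dots> < 4 * l * (e\<^sup>2 / (8 * l) + e\<^sup>2 / (8 * l))"
        using M[OF that(1)] M[OF that(2)] l by (intro mult_strict_left_mono) auto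
      also have "\<dots> = e\<^sup>2" using l by (simp add: field_simps)
      finally show ?thesis using e by (simp add: power2_less_imp_less)
    qed
    then show "\<exists>M. \<forall>m\<ge>M. \<forall>n\<ge>M. dist (U m k) (U n k) < e" by blast
  qed
  then have "\<forall>k. k < n \<longrightarrow> (\<exists>L. (\<lambda>i. U i k) \<longlonglongrightarrow> L)"
    using Cauchy_convergent convergent_def by blast
  then obtain u where u: "\<And>k. k < n \<Longrightarrow> (\<lambda>i. U i k) \<longlonglongrightarrow> u k" by metis
  have lim: "(\<lambda>i. vnorm n (\<lambda>k. U i k - u k)) \<longlonglongrightarrow> 0"
  proof -
    have "(\<lambda>i. sqrt (\<Sum>k<n. (cmod (U i k - u k))\<^sup>2)) \<longlonglongrightarrow> sqrt (\<Sum>k<n. 0\<^sup>2)"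
      by (intro tendsto_intros) (auto intro: tendsto_norm_zero simp: LIM_zero_iff u)
    then show ?thesis by (simp add: vnorm_def L2_set_def)
  qed
  have "(\<lambda>i. N (U i)) \<longlonglongrightarrow> N u"
  proof (rule LIM_zero_cancel, rule Lim_null_comparison)
    show "\<forall>\<^sub>F i in sequentially. norm (N (U i) - N u) \<le> C * vnorm n (\<lambda>k. U i k - u k)"
      using N_lipschitz by simp
    show "(\<lambda>i. C * vnorm n (\<lambda>k. U i k - u k)) \<longlonglongrightarrow> 0"
      using tendsto_mult_left[OF lim, of C] by simp
  qed
  moreover have "(\<lambda>i. vnorm n (\<lambda>k. U i k - v k)) \<longlonglongrightarrow> vnorm n (\<lambda>k. u k - v k)"
    unfolding vnorm_def L2_set_def by (intro tendsto_intros) (auto simp: u)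
  ultimately have "(\<lambda>i. energy l v (U i)) \<longlonglongrightarrow> energy l v u"
    unfolding energy_def using l by (intro tendsto_intros) auto
  moreover have "(\<lambda>i. m + 1 / real (Suc i)) \<longlonglongrightarrow> m + 0"
    by (intro tendsto_intros inv0)
  ultimately have "energy l v u \<le> m + 0"
    using U by (intro LIMSEQ_le) (auto intro: less_imp_le)
  then show ?thesis using m_le by (auto intro: order_trans)
qed

lemma prox_min: "0 < l \<Longrightarrow> env l v \<le> energy l v w"
  unfolding env_def prox_def using someI_ex[OF prox_exists] by blast

lemma slope_prox: "0 < l \<Longrightarrow> v k = prox l v k + of_real l * slope l v k"
  by (simp add: slope_def)

text \<open>First-order optimality of the proximal point: compare it with the points of the segment towards
\<open>w\<close>.\<close>

lemma slope_subgradient: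
  assumes l: "0 < l"
  shows "(N (prox l v))\<^sup>2 / 2 + vinner n (slope l v) (\<lambda>k. w k - prox l v k) \<le> (N w)\<^sup>2 / 2"
proof -
  let ?u = "prox l v" and ?h = "slope l v"
  have "0 \<le> s * ((N w)\<^sup>2 / 2 - (N ?u)\<^sup>2 / 2 - vinner n ?h (\<lambda>k. w k - ?u k))
      + s\<^sup>2 * ((vnorm n (\<lambda>k. w k - ?u k))\<^sup>2 / (2 * l))" if s: "0 < s" "s \<le> 1" for s
  proof -
    let ?w = "\<lambda>k. ?u k + complex_of_real s * (w k - ?u k)"
    have 1: "(N ?w)\<^sup>2 \<le> (1 - s) * (N ?u)\<^sup>2 + s * (N w)\<^sup>2"
      using N_sq_convex[of s] s by simp
    have "(\<lambda>k. ?w k - v k) = (\<lambda>k. complex_of_real s * (w k - ?u k) - complex_of_real l * ?h k)"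
      using slope_prox[OF l, of v] by (auto simp: fun_eq_iff algebra_simps)
    then have 2: "(vnorm n (\<lambda>k. ?w k - v k))\<^sup>2 = s\<^sup>2 * (vnorm n (\<lambda>k. w k - ?u k))\<^sup>2
        - 2 * s * l * vinner n ?h (\<lambda>k. w k - ?u k) + l\<^sup>2 * (vnorm n ?h)\<^sup>2"
      unfolding vnorm_sq
      by (simp add: vinner_simps vinner_commute power2_eq_square algebra_simps)
    have "(\<lambda>k. ?u k - v k) = (\<lambda>k. complex_of_real (- l) * ?h k)"
      using slope_prox[OF l, of v] by (auto simp: fun_eq_iff algebra_simps)
    then have 3: "(vnorm n (\<lambda>k. ?u k - v k))\<^sup>2 = l\<^sup>2 * (vnorm n ?h)\<^sup>2"
      by (simp add: vnorm_scale power_mult_distrib del: of_real_minus)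
    have "energy l v ?u \<le> energy l v ?w"
      using prox_min[OF l, of v ?w] unfolding env_def .
    then have "0 \<le> ((N ?w)\<^sup>2 - (N ?u)\<^sup>2) / 2 +
        ((vnorm n (\<lambda>k. ?w k - v k))\<^sup>2 - (vnorm n (\<lambda>k. ?u k - v k))\<^sup>2) / (2 * l)"
      unfolding energy_def by (simp add: diff_divide_distrib)
    also have "\<dots> = ((N ?w)\<^sup>2 - (N ?u)\<^sup>2) / 2 - s * vinner n ?h (\<lambda>k. w k - ?u k)
      + s\<^sup>2 * ((vnorm n (\<lambda>k. w k - ?u k))\<^sup>2 / (2 * l))"
      unfolding 2 3 using l by (simp add: field_simps)
    finally have 4: "0 \<le> ((N ?w)\<^sup>2 - (N ?u)\<^sup>2) / 2 - s * vinner n ?h (\<lambda>k. w k - ?u k)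
      + s\<^sup>2 * ((vnorm n (\<lambda>k. w k - ?u k))\<^sup>2 / (2 * l))" .
    have arith: "0 \<le> s * (c / 2 - b / 2 - h) + d"
      if "0 \<le> (a - b) / 2 - s * h + d" "a \<le> (1 - s) * b + s * c" for a b c d h :: real
    proof -
      have "(1 - s) * b + s * c - b = s * (c - b)" by (simp add: algebra_simps)
      then have "(a - b) / 2 \<le> s * ((c - b) / 2)" using that(2) by simp
      moreover have "s * (c / 2 - b / 2 - h) = s * ((c - b) / 2) - s * h" by (simp add: algebra_simps)
      ultimately show ?thesis using that(1) by linarith
    qed
    show ?thesis by (rule arith[OF 4 1])
  qed
  then have "0 \<le> (N w)\<^sup>2 / 2 - (N ?u)\<^sup>2 / 2 - vinner n ?h (\<lambda>k. w k - ?u k)"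
    by (rule slope_nonneg)
  then show ?thesis by simp
qed

lemma env_eq: "0 < l \<Longrightarrow> env l v = (N (prox l v))\<^sup>2 / 2 + l / 2 * (vnorm n (slope l v))\<^sup>2"
proof -
  assume l: "0 < l"
  have "(\<lambda>k. prox l v k - v k) = (\<lambda>k. complex_of_real (- l) * slope l v k)"
    using slope_prox[OF l, of v] by (auto simp: fun_eq_iff algebra_simps)
  then have "(vnorm n (\<lambda>k. prox l v k - v k))\<^sup>2 = l\<^sup>2 * (vnorm n (slope l v))\<^sup>2"
    by (simp add: vnorm_scale power_mult_distrib del: of_real_minus)
  then show ?thesis unfolding env_def energy_def using l by (simp add: power2_eq_square)
qed

text \<open>Insert the proximal point of \<open>v\<close> as a competitor for \<open>v'\<close>. This one-sided quadratic estimate is all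
the differentiability of the envelope that the variational argument uses.\<close>

lemma env_upper:
  assumes l: "0 < l"
  shows "env l v' \<le> env l v + vinner n (slope l v) (\<lambda>k. v' k - v k)
     + (vnorm n (\<lambda>k. v' k - v k))\<^sup>2 / (2 * l)"
proof -
  let ?u = "prox l v" and ?h = "slope l v"
  have "(\<lambda>k. ?u k - v' k) = (\<lambda>k. complex_of_real (- l) * ?h k - (v' k - v k))"
    using slope_prox[OF l, of v] by (auto simp: fun_eq_iff algebra_simps)
  then have "(vnorm n (\<lambda>k. ?u k - v' k))\<^sup>2 = l\<^sup>2 * (vnorm n ?h)\<^sup>2
      + 2 * l * vinner n ?h (\<lambda>k. v' k - v k) + (vnorm n (\<lambda>k. v' k - v k))\<^sup>2"
    unfolding vnorm_sq
    by (simp add: vinner_simps vinner_commute power2_eq_square algebra_simps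
        del: of_real_minus)
  then have "energy l v' ?u = env l v + vinner n ?h (\<lambda>k. v' k - v k)
     + (vnorm n (\<lambda>k. v' k - v k))\<^sup>2 / (2 * l)"
    unfolding energy_def env_eq[OF l] using l by (simp add: power2_eq_square field_simps)
  then show ?thesis using prox_min[OF l, of v' ?u] by simp
qed

text \<open>Subgradients are monotone; this makes the proximal points and slopes along a continuous curve
continuous.\<close>

lemma prox_nonexpansive:
  assumes l: "0 < l"
  shows "vnorm n (\<lambda>k. prox l v k - prox l v' k) \<le> vnorm n (\<lambda>k. v k - v' k)"
proof -
  let ?u = "prox l v" and ?h = "slope l v" and ?u' = "prox l v'" and ?h' = "slope l v'"
  let ?d = "\<lambda>k. ?u k - ?u' k"
  have "(N ?u)\<^sup>2 / 2 + vinner n ?h (\<lambda>k. ?u' k - ?u k) \<le> (N ?u')\<^sup>2 / 2"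
       "(N ?u')\<^sup>2 / 2 + vinner n ?h' (\<lambda>k. ?u k - ?u' k) \<le> (N ?u)\<^sup>2 / 2"
    by (rule slope_subgradient[OF l])+
  then have mono: "0 \<le> vinner n (\<lambda>k. ?h k - ?h' k) ?d"
    by (simp add: vinner_simps)
  have "(\<lambda>k. v k - v' k) = (\<lambda>k. ?d k + complex_of_real l * (?h k - ?h' k))"
    using slope_prox[OF l, of v] slope_prox[OF l, of v'] by (auto simp: fun_eq_iff algebra_simps)
  then have "vinner n (\<lambda>k. v k - v' k) ?d = vinner n ?d ?d + l * vinner n (\<lambda>k. ?h k - ?h' k) ?d"
    by (simp only: vinner_add_left vinner_scale_left)
  then have "(vnorm n ?d)\<^sup>2 \<le> vinner n (\<lambda>k. v k - v' k) ?d"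
    using mono l by (simp add: vnorm_sq)
  also have "\<dots> \<le> vnorm n (\<lambda>k. v k - v' k) * vnorm n ?d"
    using vinner_le[of n "\<lambda>k. v k - v' k" ?d] by linarith
  finally have "vnorm n ?d * vnorm n ?d \<le> vnorm n (\<lambda>k. v k - v' k) * vnorm n ?d"
    by (simp add: power2_eq_square)
  then show ?thesis
    by (metis mult_le_cancel_right order_le_less vnorm_nonneg)
qed

lemma slope_lipschitz:
  assumes l: "0 < l" and k: "k < n"
  shows "cmod (slope l v k - slope l v' k) \<le> 2 / l * vnorm n (\<lambda>k. v k - v' k)"
proof -
  have "cmod (slope l v k - slope l v' k) = cmod ((v k - v' k) - (prox l v k - prox l v' k)) / l"
    using l by (simp add: slope_def norm_divide diff_divide_distrib[symmetric] algebra_simps)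
  also have "\<dots> \<le> (vnorm n (\<lambda>k. v k - v' k) + vnorm n (\<lambda>k. v k - v' k)) / l"
  proof (rule divide_right_mono)
    have "cmod ((v k - v' k) - (prox l v k - prox l v' k)) \<le> cmod (v k - v' k) + cmod (prox l v k - prox l v' k)"
      by (rule norm_triangle_ineq4)
    also have "\<dots> \<le> vnorm n (\<lambda>k. v k - v' k) + vnorm n (\<lambda>k. prox l v k - prox l v' k)"
      using norm_le_vnorm[OF k, of "\<lambda>k. v k - v' k"] norm_le_vnorm[OF k, of "\<lambda>k. prox l v k - prox l v' k"]
      by simp
    finally show "cmod ((v k - v' k) - (prox l v k - prox l v' k)) \<le> vnorm n (\<lambda>k. v k - v' k) + vnorm n (\<lambda>k. v k - v' k)"
      using prox_nonexpansive[OF l, of v v'] by linarith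
  qed (use l in simp)
  finally show ?thesis by simp
qed

text \<open>Passing to the envelope loses only a factor that tends to \<open>1\<close> with \<open>l\<close>.\<close>

lemma env_lower:
  assumes l: "0 < l"
  shows "(N v)\<^sup>2 / 2 \<le> (1 + C\<^sup>2 * l) * env l v"
proof -
  let ?u = "prox l v"
  define s where "s = N ?u" define t where "t = vnorm n (\<lambda>k. ?u k - v k)"
  have "N v \<le> s + C * t"
    using N_diff[of v ?u] unfolding s_def t_def by (simp add: vnorm_minus_commute[of n v])
  then have "(N v)\<^sup>2 \<le> (s + C * t)\<^sup>2" using N_nonneg power_mono by blast
  also have "\<dots> \<le> (1 + C\<^sup>2 * l) * (s\<^sup>2 + t\<^sup>2 / l)"
  proof -
    have "(1 + C\<^sup>2 * l) * (s\<^sup>2 + t\<^sup>2 / l) - (s + C * t)\<^sup>2 = (C * l * s - t)\<^sup>2 / l"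
      using l by (simp add: field_simps power2_eq_square)
    moreover have "0 \<le> (C * l * s - t)\<^sup>2 / l" using l by simp
    ultimately show ?thesis by linarith
  qed
  also have "s\<^sup>2 + t\<^sup>2 / l = 2 * env l v"
    unfolding env_def energy_def s_def t_def using l by (simp add: field_simps)
  finally show ?thesis by simp
qed

lemma prox_near:
  assumes l: "0 < l"
  shows "vnorm n (\<lambda>k. prox l v k - v k) \<le> sqrt l * N v"
proof -
  have "vnorm n (\<lambda>k. v k - v k) = 0" by (simp add: vnorm_def L2_set_def)
  then have "energy l v v = (N v)\<^sup>2 / 2" by (simp add: energy_def)
  moreover have "(vnorm n (\<lambda>k. prox l v k - v k))\<^sup>2 / (2 * l) \<le> env l v"
    by (simp add: env_def energy_def)
  ultimately have "(vnorm n (\<lambda>k. prox l v k - v k))\<^sup>2 \<le> l * (N v)\<^sup>2"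
    using mult_left_mono[OF prox_min[OF l, of v v], of "2 * l"] l
    by (simp add: field_simps) (smt (verit) mult_left_mono)
  then have "vnorm n (\<lambda>k. prox l v k - v k) \<le> sqrt (l * (N v)\<^sup>2)"
    by (rule real_le_rsqrt)
  then show ?thesis using N_nonneg by (simp add: real_sqrt_mult)
qed

text \<open>The value of the Legendre conjugate of half the squared norm at the slope, written through the
proximal point, where the supremum is attained.\<close>

definition conj_value :: "real \<Rightarrow> (nat \<Rightarrow> complex) \<Rightarrow> real" where
  "conj_value l v = vinner n (prox l v) (slope l v) - (N (prox l v))\<^sup>2 / 2"

text \<open>The subgradient inequality says that the supremum defining the conjugate is attained at the proximal
point; by homogeneity a bound of the conjugate is a bound of the dual norm.\<close>

lemma slope_dual_bound:
  assumes l: "0 < l"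
  shows "0 \<le> conj_value l v" "vinner n w (slope l v) \<le> sqrt (2 * conj_value l v) * N w"
proof -
  let ?k = "conj_value l v"
  have *: "vinner n w (slope l v) - (N w)\<^sup>2 / 2 \<le> ?k" for w
    using slope_subgradient[OF l, of v w]
    by (simp add: conj_value_def vinner_simps vinner_commute[of n "slope l v"])
  have N0: "N (\<lambda>k. 0) = 0" using hom[of 0 "\<lambda>k. 0"] by simp
  show k0: "0 \<le> ?k"
    using *[of "\<lambda>k. 0"] N0 by (simp add: vinner_def)
  show "vinner n w (slope l v) \<le> sqrt (2 * ?k) * N w"
  proof (cases "N w = 0")
    case True
    have "vnorm n w = 0" using low[of w] True by (simp add: antisym)
    then show ?thesis using True vinner_le[of n w "slope l v"] by simp
  next
    case False
    then have Nw: "0 < N w" using N_nonneg[of w] by linarith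
    define c where "c = vinner n w (slope l v)"
    have "s * c - s\<^sup>2 * (N w)\<^sup>2 / 2 \<le> ?k" for s
      using *[of "\<lambda>k. complex_of_real s * w k"]
      by (simp add: vinner_scale_left hom c_def power_mult_distrib)
    from this[of "c / (N w)\<^sup>2"] have "c\<^sup>2 / (N w)\<^sup>2 \<le> 2 * ?k"
      using Nw by (simp add: power2_eq_square field_simps)
    then have "c\<^sup>2 \<le> 2 * ?k * (N w)\<^sup>2" using Nw by (simp add: field_simps)
    then have "c \<le> sqrt (2 * ?k * (N w)\<^sup>2)" by (rule real_le_rsqrt)
    then show ?thesis using Nw by (simp add: c_def real_sqrt_mult)
  qed
qed

end

text \<open>Only \<open>N1\<close> is assumed to be the dual norm of \<open>N0\<close>; that \<open>N0\<close> is the dual norm of \<open>N1\<close> is a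
theorem (\<open>bipolar\<close>).\<close>

locale half_dual_pair = X: fin_norm n N0 C + Y: fin_norm n N1 C
  for n :: nat and N0 N1 :: "(nat \<Rightarrow> complex) \<Rightarrow> real" and C :: real +
  assumes pair_le: "vinner n a b \<le> N0 a * N1 b"
    and dual_least: "(\<And>a. vinner n a b \<le> K * N0 a) \<Longrightarrow> 0 \<le> K \<Longrightarrow> N1 b \<le> K"
begin

text \<open>The slope at the proximal point of \<open>a\<close> attains its norm there, and the proximal point tends to \<open>a\<close>
with \<open>l\<close>. These norming functionals do the work of the Hahn--Banach theorem.\<close>

lemma bipolar:
  assumes K: "0 \<le> K" and le: "\<And>b. vinner n a b \<le> K * N1 b"
  shows "N0 a \<le> K"
proof -
  have step: "N0 a \<le> K + C * (sqrt l * N0 a)" if l: "0 < l" for l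
  proof -
    let ?u = "X.prox l a" and ?h = "X.slope l a" and ?k = "X.conj_value l a"
    have k0: "0 \<le> ?k" using X.slope_dual_bound(1)[OF l] .
    have "N1 ?h \<le> sqrt (2 * ?k)"
      by (rule dual_least[OF X.slope_dual_bound(2)[OF l]]) (use k0 in simp)
    then have "(N1 ?h)\<^sup>2 \<le> 2 * ?k"
      using k0 Y.N_nonneg real_sqrt_le_iff by (metis abs_of_nonneg real_sqrt_abs real_sqrt_ge_0_iff sqrt_le_D)
    then have 1: "N0 ?u * N1 ?h \<le> vinner n ?u ?h"
      using sum_squares_bound[of "N0 ?u" "N1 ?h"] unfolding X.conj_value_def by simp
    have "vinner n a ?h = vinner n (\<lambda>k. ?u k + of_real l * ?h k) ?h"
      using X.slope_prox[OF l, of a] by (intro arg_cong[where f = "\<lambda>x. vinner n x ?h"]) (simp add: fun_eq_iff)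
    then have "vinner n ?u ?h \<le> vinner n a ?h"
      using l by (simp add: vinner_simps flip: vnorm_sq)
    then have 2: "N0 ?u * N1 ?h \<le> K * N1 ?h" using 1 le[of ?h] by linarith
    have "N0 ?u \<le> K"
    proof (cases "N1 ?h = 0")
      case True
      then have "vnorm n ?h = 0" using Y.low[of ?h] by (simp add: antisym)
      then have "vinner n ?u ?h \<le> 0" using vinner_le[of n ?u ?h] by simp
      then have "(N0 ?u)\<^sup>2 \<le> 0" using k0 unfolding X.conj_value_def by linarith
      then show ?thesis using K by simp
    next
      case False
      then show ?thesis using 2 Y.N_nonneg[of ?h] by simp
    qed
    moreover have "N0 a \<le> N0 ?u + C * (sqrt l * N0 a)"
    proof -
      have "C * vnorm n (\<lambda>k. a k - ?u k) \<le> C * (sqrt l * N0 a)"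
        using X.prox_near[OF l, of a] X.C_ge
        by (intro mult_left_mono) (simp_all add: vnorm_minus_commute[of n a])
      then show ?thesis using X.N_diff[of a ?u] by linarith
    qed
    ultimately show ?thesis by linarith
  qed
  show ?thesis
  proof (rule tendsto_lowerbound)
    have "((\<lambda>l. K + C * (sqrt l * N0 a)) \<longlongrightarrow> K + C * (sqrt 0 * N0 a)) (at_right 0)"
      by (intro tendsto_intros)
    then show "((\<lambda>l. K + C * (sqrt l * N0 a)) \<longlongrightarrow> K) (at_right 0)" by simp
    show "\<forall>\<^sub>F l in at_right 0. N0 a \<le> K + C * (sqrt l * N0 a)"
      using step by (simp add: eventually_at_right_field) (auto intro: exI[of _ 1])
  qed simp
qed

text \<open>In both directions the dual energy of the slope is at most the conjugate value; the second one uses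
the bipolar theorem.\<close>

lemma slope_dual_norms:
  assumes l: "0 < l"
  shows "(N1 (X.slope l v))\<^sup>2 / 2 \<le> X.conj_value l v"
    and "(N0 (Y.slope l v))\<^sup>2 / 2 \<le> Y.conj_value l v"
proof -
  have "N1 (X.slope l v) \<le> sqrt (2 * X.conj_value l v)"
    by (rule dual_least[OF X.slope_dual_bound(2)[OF l]])
       (use X.slope_dual_bound(1)[OF l] in simp)
  then have "(N1 (X.slope l v))\<^sup>2 \<le> (sqrt (2 * X.conj_value l v))\<^sup>2"
    using Y.N_nonneg power_mono by blast
  then show "(N1 (X.slope l v))\<^sup>2 / 2 \<le> X.conj_value l v"
    using X.slope_dual_bound(1)[OF l] by simp
  have "N0 (Y.slope l v) \<le> sqrt (2 * Y.conj_value l v)"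
    by (rule bipolar)
       (use Y.slope_dual_bound[OF l] in \<open>auto simp: vinner_commute[of n "Y.slope l v"]\<close>)
  then have "(N0 (Y.slope l v))\<^sup>2 \<le> (sqrt (2 * Y.conj_value l v))\<^sup>2"
    using X.N_nonneg power_mono by blast
  then show "(N0 (Y.slope l v))\<^sup>2 / 2 \<le> Y.conj_value l v"
    using Y.slope_dual_bound(1)[OF l] by simp
qed

end

section \<open>Means and trigonometric approximation on the unit circle\<close>

text \<open>Functions on the unit circle with jumps at \<open>\<plusminus>1\<close> are given by two functions on \<open>[0, pi]\<close>, one for each
half: \<open>False\<close> is the lower and \<open>True\<close> the upper half. Continuity on both closed arcs then makes
every integral exist, and conjugation only negates the index.\<close>

definition arc_point :: "bool \<Rightarrow> real \<Rightarrow> complex" where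
  "arc_point b t = cis (if b then t else - t)"

definition arc_cont :: "(bool \<Rightarrow> real \<Rightarrow> 'b::topological_space) \<Rightarrow> bool" where
  "arc_cont F \<longleftrightarrow> (\<forall>b. continuous_on {0..pi} (F b))"

definition circle_mean :: "(bool \<Rightarrow> real \<Rightarrow> real) \<Rightarrow> real" where
  "circle_mean F = (integral {0..pi} (F False) + integral {0..pi} (F True)) / (2 * pi)"

lemma norm_arc [simp]: "cmod (arc_point b t) = 1"
  by (simp add: arc_point_def)

lemma arc_not: "arc_point (\<not> b) t = cnj (arc_point b t)"
  by (simp add: arc_point_def cis_cnj)

lemma arc_contI: "(\<And>b. continuous_on {0..pi} (F b)) \<Longrightarrow> arc_cont F"
  by (simp add: arc_cont_def)

lemma arc_contD: "arc_cont F \<Longrightarrow> continuous_on {0..pi} (F b)"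
  by (simp add: arc_cont_def)

lemma arc_contD_not: "arc_cont F \<Longrightarrow> arc_cont (\<lambda>b. F (\<not> b))"
  by (simp add: arc_cont_def)

lemma continuous_on_arc [continuous_intros]: "continuous_on S (arc_point b)"
  unfolding arc_point_def[abs_def] by (cases b) (auto intro!: continuous_intros)

lemma arc_cont_poly: "arc_cont (\<lambda>b t. poly p (arc_point b t))"
  by (intro arc_contI continuous_intros)

lemma arc_cont_add: "arc_cont F \<Longrightarrow> arc_cont G \<Longrightarrow> arc_cont (\<lambda>b t. F b t + G b t :: 'b::real_normed_vector)"
  by (auto simp: arc_cont_def intro!: continuous_intros)
lemma arc_cont_diff: "arc_cont F \<Longrightarrow> arc_cont G \<Longrightarrow> arc_cont (\<lambda>b t. F b t - G b t :: 'b::real_normed_vector)"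
  by (auto simp: arc_cont_def intro!: continuous_intros)
lemma arc_cont_mult: "arc_cont F \<Longrightarrow> arc_cont G \<Longrightarrow> arc_cont (\<lambda>b t. F b t * G b t :: 'b::real_normed_algebra)"
  by (auto simp: arc_cont_def intro!: continuous_intros)
lemma arc_cont_const: "arc_cont (\<lambda>b t. c)"
  by (auto simp: arc_cont_def intro!: continuous_intros)
lemma arc_cont_power: "arc_cont F \<Longrightarrow> arc_cont (\<lambda>b t. F b t ^ m :: 'b::real_normed_div_algebra)"
  by (auto simp: arc_cont_def intro!: continuous_intros)
lemma arc_cont_divide: "arc_cont F \<Longrightarrow> arc_cont (\<lambda>b t. F b t / c :: real)"
  by (auto simp: arc_cont_def divide_inverse intro!: continuous_intros)
lemma arc_cont_norm: "arc_cont F \<Longrightarrow> arc_cont (\<lambda>b t. norm (F b t :: 'b::real_normed_vector))"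
  by (auto simp: arc_cont_def intro!: continuous_intros)
lemma arc_cont_Re: "arc_cont F \<Longrightarrow> arc_cont (\<lambda>b t. Re (F b t))"
  by (auto simp: arc_cont_def intro!: continuous_intros)
lemma arc_cont_sum: "(\<And>i. i \<in> I \<Longrightarrow> arc_cont (F i)) \<Longrightarrow> arc_cont (\<lambda>b t. \<Sum>i\<in>I. F i b t :: 'b::real_normed_vector)"
  by (auto simp: arc_cont_def intro!: continuous_intros)
lemma arc_cont_inner: "arc_cont F \<Longrightarrow> arc_cont G \<Longrightarrow> arc_cont (\<lambda>b t. F b t \<bullet> G b t :: real)"
  by (auto simp: arc_cont_def intro!: continuous_intros)
lemma arc_cont_cnj: "arc_cont F \<Longrightarrow> arc_cont (\<lambda>b t. cnj (F b t))"
  by (auto simp: arc_cont_def intro!: continuous_intros)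
lemma arc_cont_arc: "arc_cont arc_point"
  by (auto simp: arc_cont_def intro!: continuous_intros)
lemma arc_cont_polyc: "arc_cont F \<Longrightarrow> arc_cont (\<lambda>b t. poly p (F b t :: complex))"
  by (auto simp: arc_cont_def intro!: continuous_intros)
lemma arc_cont_vinner:
  "(\<And>k. k < n \<Longrightarrow> arc_cont (\<lambda>b t. F b t k)) \<Longrightarrow> (\<And>k. k < n \<Longrightarrow> arc_cont (\<lambda>b t. G b t k))
    \<Longrightarrow> arc_cont (\<lambda>b t. vinner n (F b t) (G b t))"
  unfolding vinner_def by (intro arc_cont_sum arc_cont_inner) auto

lemmas arc_cont_intros = arc_cont_poly arc_cont_add arc_cont_diff arc_cont_mult arc_cont_const
  arc_cont_power arc_cont_divide arc_cont_norm arc_cont_Re arc_cont_sum arc_cont_inner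
  arc_cont_vinner arc_cont_cnj arc_cont_arc arc_cont_polyc

lemma arc_cont_integrable: "arc_cont F \<Longrightarrow> F b integrable_on {0..pi}" for F :: "bool \<Rightarrow> real \<Rightarrow> real"
  by (simp add: arc_cont_def integrable_continuous_interval)

lemma circle_mean_add:
  "arc_cont F \<Longrightarrow> arc_cont G \<Longrightarrow> circle_mean (\<lambda>b t. F b t + G b t) = circle_mean F + circle_mean G"
  by (simp add: circle_mean_def integral_add arc_cont_integrable add_divide_distrib)

lemma circle_mean_diff:
  "arc_cont F \<Longrightarrow> arc_cont G \<Longrightarrow> circle_mean (\<lambda>b t. F b t - G b t) = circle_mean F - circle_mean G"
  by (simp add: circle_mean_def integral_diff arc_cont_integrable add_divide_distrib diff_divide_distrib)

lemma circle_mean_cmult: "circle_mean (\<lambda>b t. c * F b t) = c * circle_mean F"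
  by (simp add: circle_mean_def integral_mult_right algebra_simps)

lemma circle_mean_divide: "circle_mean (\<lambda>b t. F b t / c) = circle_mean F / c"
  using circle_mean_cmult[of "1 / c" F] by simp

lemma circle_mean_const [simp]: "circle_mean (\<lambda>b t. c) = c"
  by (simp add: circle_mean_def)

lemma circle_mean_mono:
  assumes "arc_cont F" "arc_cont G" "\<And>b t. 0 \<le> t \<Longrightarrow> t \<le> pi \<Longrightarrow> F b t \<le> G b t"
  shows "circle_mean F \<le> circle_mean G"
  unfolding circle_mean_def
  by (intro divide_right_mono add_mono integral_le arc_cont_integrable) (use assms in auto)

lemma circle_mean_nonneg:
  assumes "arc_cont F" "\<And>b t. 0 \<le> t \<Longrightarrow> t \<le> pi \<Longrightarrow> 0 \<le> F b t"
  shows "0 \<le> circle_mean F"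
  using circle_mean_mono[OF arc_cont_const[of 0] assms(1)] assms(2) by simp

lemma circle_mean_sum:
  "finite I \<Longrightarrow> (\<And>i. i \<in> I \<Longrightarrow> arc_cont (F i)) \<Longrightarrow> circle_mean (\<lambda>b t. \<Sum>i\<in>I. F i b t) = (\<Sum>i\<in>I. circle_mean (F i))"
  by (induction I rule: finite_induct) (simp_all add: circle_mean_add arc_cont_sum)

lemma circle_mean_not: "circle_mean (\<lambda>b. F (\<not> b)) = circle_mean F"
  by (simp add: circle_mean_def add.commute)

lemma integral_cos_multiple:
  assumes "0 < j"
  shows "integral {0..pi} (\<lambda>t. cos (real j * t)) = 0"
proof -
  have "((\<lambda>t. cos (real j * t)) has_integral (sin (real j * pi) / real j - sin (real j * 0) / real j)) {0..pi}"
    by (rule fundamental_theorem_of_calculus)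
       (use assms in \<open>auto intro!: derivative_eq_intros simp flip: has_real_derivative_iff_has_vector_derivative\<close>)
  then show ?thesis by (simp add: integral_unique)
qed

text \<open>The mean value property. On the two arcs together each power \<open>z\<^sup>j\<close> contributes \<open>2 cos (j t)\<close>.\<close>

lemma circle_mean_poly: "circle_mean (\<lambda>b t. Re (poly p (arc_point b t))) = Re (poly p 0)"
proof -
  have mono: "circle_mean (\<lambda>b t. Re (c * arc_point b t ^ j)) = (if j = 0 then Re c else 0)" for c j
  proof (cases "j = 0")
    case False
    have "circle_mean (\<lambda>b t. Re (c * arc_point b t ^ j))
      = integral {0..pi} (\<lambda>t. Re (c * arc_point False t ^ j) + Re (c * arc_point True t ^ j)) / (2 * pi)"
      unfolding circle_mean_def
      by (subst integral_add) (auto intro!: integrable_continuous_interval continuous_intros)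
    also have "(\<lambda>t. Re (c * arc_point False t ^ j) + Re (c * arc_point True t ^ j)) = (\<lambda>t. 2 * Re c * cos (real j * t))"
      by (simp add: fun_eq_iff arc_point_def Complex.DeMoivre algebra_simps)
    also have "integral {0..pi} \<dots> = 0"
      using integral_cos_multiple[of j] False by (simp add: integral_mult_right)
    finally show ?thesis using False by simp
  qed simp
  have "circle_mean (\<lambda>b t. Re (poly p (arc_point b t)))
      = circle_mean (\<lambda>b t. \<Sum>j\<le>degree p. Re (coeff p j * arc_point b t ^ j))"
    by (simp add: poly_altdef)
  also have "\<dots> = (\<Sum>j\<le>degree p. circle_mean (\<lambda>b t. Re (coeff p j * arc_point b t ^ j)))"
    by (rule circle_mean_sum) (auto intro!: arc_contI continuous_intros)
  also have "\<dots> = Re (coeff p 0)"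
    unfolding mono by (simp add: sum.delta)
  finally show ?thesis by (simp add: poly_0_coeff_0)
qed

definition trig_poly :: "(complex \<Rightarrow> complex) \<Rightarrow> bool" where
  "trig_poly f \<longleftrightarrow> (\<exists>A B. \<forall>z. cmod z = 1 \<longrightarrow> f z = poly A z + poly B (cnj z))"

lemma trig_polyI: "(\<And>z. cmod z = 1 \<Longrightarrow> f z = poly A z + poly B (cnj z)) \<Longrightarrow> trig_poly f"
  unfolding trig_poly_def by blast

lemma trig_poly_const: "trig_poly (\<lambda>z. c)"
  by (rule trig_polyI[of _ "[:c:]" 0]) simp

lemma trig_poly_add: "trig_poly f \<Longrightarrow> trig_poly g \<Longrightarrow> trig_poly (\<lambda>z. f z + g z)"
proof -
  assume "trig_poly f" "trig_poly g"
  then obtain A B A' B' where "\<And>z. cmod z = 1 \<Longrightarrow> f z = poly A z + poly B (cnj z)"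
    "\<And>z. cmod z = 1 \<Longrightarrow> g z = poly A' z + poly B' (cnj z)"
    unfolding trig_poly_def by auto
  then show ?thesis by (intro trig_polyI[of _ "A + A'" "B + B'"]) simp
qed

lemma trig_poly_cmult: "trig_poly f \<Longrightarrow> trig_poly (\<lambda>z. c * f z)"
proof -
  assume "trig_poly f"
  then obtain A B where "\<And>z. cmod z = 1 \<Longrightarrow> f z = poly A z + poly B (cnj z)"
    unfolding trig_poly_def by auto
  then show ?thesis by (intro trig_polyI[of _ "smult c A" "smult c B"]) (simp add: algebra_simps)
qed

text \<open>The form in which \<open>z * cnj z = 1\<close> is a terminating rewrite rule.\<close>

lemma circle_cancel: "cmod z = 1 \<Longrightarrow> z * (cnj z * w) = w" "cmod z = 1 \<Longrightarrow> cnj z * (z * w) = w"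
  using complex_norm_square[of z] by (simp_all add: mult.assoc[symmetric] mult.commute[of "cnj z"])

text \<open>Multiplication by \<open>z\<close> cancels one conjugate factor from the antianalytic part, except for its
constant term, which moves to the analytic part.\<close>

lemma trig_poly_shift:
  assumes "trig_poly f"
  shows "trig_poly (\<lambda>z. z * f z)" "trig_poly (\<lambda>z. cnj z * f z)"
proof -
  obtain A B where AB: "\<And>z. cmod z = 1 \<Longrightarrow> f z = poly A z + poly B (cnj z)"
    using assms unfolding trig_poly_def by auto
  obtain a A' where A: "A = pCons a A'" by (cases A)
  obtain b B' where B: "B = pCons b B'" by (cases B)
  show "trig_poly (\<lambda>z. z * f z)"
    by (rule trig_polyI[of _ "pCons 0 (A + [:b:])" B'])
       (simp add: AB B algebra_simps circle_cancel)
  show "trig_poly (\<lambda>z. cnj z * f z)"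
    by (rule trig_polyI[of _ A' "pCons 0 (B + [:a:])"])
       (simp add: AB A algebra_simps circle_cancel)
qed

lemma trig_poly_mult_poly:
  assumes "trig_poly f"
  shows "trig_poly (\<lambda>z. poly A z * f z)" "trig_poly (\<lambda>z. poly A (cnj z) * f z)"
proof (induction A)
  case 0
  { case 1 show ?case using trig_poly_const[of 0] by simp }
  { case 2 show ?case using trig_poly_const[of 0] by simp }
next
  case (pCons a A)
  { case 1
    have "trig_poly (\<lambda>z. a * f z + z * (poly A z * f z))"
      by (intro trig_poly_add trig_poly_cmult trig_poly_shift pCons assms)
    then show ?case by (simp add: distrib_right mult.assoc) }
  { case 2
    have "trig_poly (\<lambda>z. a * f z + cnj z * (poly A (cnj z) * f z))"
      by (intro trig_poly_add trig_poly_cmult trig_poly_shift pCons assms)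
    then show ?case by (simp add: distrib_right mult.assoc) }
qed

lemma trig_poly_mult:
  assumes "trig_poly f" "trig_poly g"
  shows "trig_poly (\<lambda>z. f z * g z)"
proof -
  obtain A B where AB: "\<And>z. cmod z = 1 \<Longrightarrow> f z = poly A z + poly B (cnj z)"
    using assms unfolding trig_poly_def by auto
  have "trig_poly (\<lambda>z. poly A z * g z + poly B (cnj z) * g z)"
    by (intro trig_poly_add trig_poly_mult_poly assms)
  then show ?thesis unfolding trig_poly_def using AB by (simp add: distrib_right)
qed

lemma trig_poly_real_polynomial:
  assumes "real_polynomial_function r"
  shows "trig_poly (\<lambda>z. complex_of_real (r z))"
  using assms
proof (induction rule: real_polynomial_function.induct)
  case (linear f)
  have lin: "Real_Vector_Spaces.linear f" using linear by (rule bounded_linear.linear)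
  have fz: "f z = Re z * f 1 + Im z * f \<i>" for z
  proof -
    have "z = Re z *\<^sub>R 1 + Im z *\<^sub>R \<i>" by (simp add: complex_eq_iff)
    then have "f z = f (Re z *\<^sub>R 1 + Im z *\<^sub>R \<i>)" by (rule arg_cong)
    also have "\<dots> = f (Re z *\<^sub>R 1) + f (Im z *\<^sub>R \<i>)" by (rule linear_add[OF lin])
    also have "\<dots> = Re z * f 1 + Im z * f \<i>"
      unfolding linear_scale[OF lin] real_scaleR_def ..
    finally show ?thesis .
  qed
  have *: "complex_of_real (f z) = (of_real (f 1) - \<i> * of_real (f \<i>)) / 2 * z
      + (of_real (f 1) + \<i> * of_real (f \<i>)) / 2 * cnj z" for z
    by (subst fz) (simp add: complex_eq_iff field_simps)
  show ?case
    by (intro trig_polyI[of _ "[:0, (of_real (f 1) - \<i> * of_real (f \<i>)) / 2:]"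
          "[:0, (of_real (f 1) + \<i> * of_real (f \<i>)) / 2:]"]) (subst *, simp add: mult.commute)
next
  case (const c)
  show ?case by (rule trig_poly_const)
next
  case (add f g)
  then show ?case using trig_poly_add by fastforce
next
  case (mult f g)
  then show ?case using trig_poly_mult by fastforce
qed

text \<open>The Stone--Weierstrass theorem provides polynomials in the real coordinates; on the circle they are
trigonometric.\<close>

lemma trig_poly_polynomial:
  assumes "polynomial_function (g :: complex \<Rightarrow> complex)"
  shows "trig_poly g"
proof -
  have "real_polynomial_function (Re \<circ> g)" "real_polynomial_function (Im \<circ> g)"
    using assms bounded_linear_Re bounded_linear_Im unfolding polynomial_function_def by auto
  then have "trig_poly (\<lambda>z. of_real (Re (g z)) + \<i> * of_real (Im (g z)))"
    using trig_poly_real_polynomial by (intro trig_poly_add trig_poly_cmult) (auto simp: o_def)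
  then show ?thesis by (simp only: complex_eq[symmetric])
qed

text \<open>If the values on the two arcs agree at \<open>\<plusminus>1\<close>, they form one continuous function on the circle.\<close>

lemma trig_approx_uniform:
  fixes F :: "bool \<Rightarrow> real \<Rightarrow> complex"
  assumes F: "arc_cont F" and m0: "F False 0 = F True 0" and mpi: "F False pi = F True pi"
    and e: "0 < e"
  shows "\<exists>A B. \<forall>b t. 0 \<le> t \<longrightarrow> t \<le> pi \<longrightarrow>
      cmod (F b t - (poly A (arc_point b t) + poly B (cnj (arc_point b t)))) < e"
proof -
  define G where "G z = (if 0 \<le> Im z then F True (arccos (Re z)) else F False (arccos (Re z)))" for z
  let ?S = "sphere (0::complex) 1 \<inter> {z. 0 \<le> Im z}" and ?T = "sphere (0::complex) 1 \<inter> {z. Im z \<le> 0}"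
  have cl: "closed ?S" "closed ?T"
    by (intro closed_Int closed_sphere closed_halfspace_Im_ge closed_halfspace_Im_le)+
  have Re1: "\<bar>Re z\<bar> \<le> 1" if "z \<in> sphere 0 1" for z :: complex
    using that abs_Re_le_cmod[of z] by simp
  have cont: "continuous_on (sphere 0 1) (\<lambda>z. F b (arccos (Re z)))" for b
  proof (rule continuous_on_compose2[OF arc_contD[OF F]])
    show "continuous_on (sphere 0 1) (\<lambda>z. arccos (Re z))"
      by (rule continuous_on_arccos) (auto intro!: continuous_intros dest!: Re1 simp: abs_le_iff)
    show "(\<lambda>z. arccos (Re z)) ` sphere 0 1 \<subseteq> {0..pi}"
      using Re1 by (auto simp: arccos_lbound arccos_ubound abs_le_iff)
  qed
  have "continuous_on (?S \<union> ?T) G"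
    unfolding G_def
  proof (rule continuous_on_cases[OF cl])
    show "continuous_on ?S (\<lambda>z. F True (arccos (Re z)))" "continuous_on ?T (\<lambda>z. F False (arccos (Re z)))"
      by (rule continuous_on_subset[OF cont]; auto)+
    show "\<forall>x. x \<in> ?S \<and> \<not> 0 \<le> Im x \<or> x \<in> ?T \<and> 0 \<le> Im x \<longrightarrow> F True (arccos (Re x)) = F False (arccos (Re x))"
    proof (intro allI impI)
      fix z assume "z \<in> ?S \<and> \<not> 0 \<le> Im z \<or> z \<in> ?T \<and> 0 \<le> Im z"
      then have z: "Im z = 0" "cmod z = 1" by auto
      then have "\<bar>Re z\<bar> = 1" by (simp add: cmod_def)
      then have "Re z = 1 \<or> Re z = -1" by linarith
      then show "F True (arccos (Re z)) = F False (arccos (Re z))"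
        using m0 mpi by auto
    qed
  qed
  moreover have "?S \<union> ?T = sphere 0 1" by auto
  ultimately have "continuous_on (sphere 0 1) G" by simp
  then obtain g where g: "polynomial_function g" "\<And>z. z \<in> sphere 0 1 \<Longrightarrow> cmod (G z - g z) < e"
    using Stone_Weierstrass_polynomial_function[of "sphere 0 1" G e] e by auto
  obtain A B where AB: "\<And>z. cmod z = 1 \<Longrightarrow> g z = poly A z + poly B (cnj z)"
    using trig_poly_polynomial[OF g(1)] unfolding trig_poly_def by auto
  have G: "G (arc_point b t) = F b t" if "0 \<le> t" "t \<le> pi" for b t
  proof (cases b)
    case True
    then show ?thesis using that by (simp add: G_def arc_point_def sin_ge_zero arccos_cos)
  next
    case False
    show ?thesis
    proof (cases "sin t = 0")
      case True
      then have "t = 0 \<or> t = pi" using that sin_gt_zero[of t] by (cases "t = 0 \<or> t = pi") auto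
      then show ?thesis using False m0 mpi by (auto simp: G_def arc_point_def)
    next
      case sn: False
      then have "0 < sin t" using that sin_ge_zero[of t] by simp
      then show ?thesis using False that by (simp add: G_def arc_point_def arccos_cos)
    qed
  qed
  show ?thesis
  proof (intro exI allI impI)
    fix b t assume "0 \<le> t" "t \<le> pi"
    then show "cmod (F b t - (poly A (arc_point b t) + poly B (cnj (arc_point b t)))) < e"
      using g(2)[of "arc_point b t"] AB[of "arc_point b t"] G[of t b] by simp
  qed
qed

text \<open>Equal to \<open>1\<close> at both ends of the interval and of small integral for large \<open>m\<close>: it serves to alter a
function near the jumps at small cost in the mean.\<close>

definition bump :: "nat \<Rightarrow> real \<Rightarrow> real" where
  "bump m t = (2 * t / pi - 1) ^ (2 * m)"

lemma bump_bounds: "0 \<le> bump m t" "0 \<le> t \<Longrightarrow> t \<le> pi \<Longrightarrow> bump m t \<le> 1"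
proof -
  show "0 \<le> bump m t" by (simp add: bump_def)
  assume t: "0 \<le> t" "t \<le> pi"
  have "2 * t / pi \<le> 2" using \<open>t \<le> pi\<close> by (subst pos_divide_le_eq) auto
  moreover have "0 \<le> 2 * t / pi" using \<open>0 \<le> t\<close> by simp
  ultimately have "\<bar>2 * t / pi - 1\<bar> \<le> 1" by linarith
  then have "(2 * t / pi - 1)\<^sup>2 \<le> 1" by (rule iffD2[OF abs_square_le_1])
  then show "bump m t \<le> 1" unfolding bump_def power_mult by (rule power_le_one[OF zero_le_power2])
qed

lemma bump_ends [simp]: "bump m 0 = 1" "bump m pi = 1"
  by (simp_all add: bump_def)

lemma arc_cont_bump: "arc_cont (\<lambda>b. bump m)"
  unfolding arc_cont_def bump_def by (auto intro!: continuous_intros)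

lemma circle_mean_bump: "circle_mean (\<lambda>b. bump m) = 1 / real (2 * m + 1)"
proof -
  let ?F = "\<lambda>t. pi / 2 * (2 * t / pi - 1) ^ Suc (2 * m) / real (Suc (2 * m))"
  have "(bump m has_integral (?F pi - ?F 0)) {0..pi}"
    unfolding bump_def
    by (rule fundamental_theorem_of_calculus)
       (auto intro!: derivative_eq_intros simp del: of_nat_Suc power_Suc
         simp flip: has_real_derivative_iff_has_vector_derivative)
  then have "integral {0..pi} (bump m) = pi / real (2 * m + 1)"
    by (simp add: integral_unique) (simp add: field_simps)
  then show ?thesis by (simp add: circle_mean_def)
qed

lemma small_bump:
  assumes "0 < e"
  shows "\<exists>m. circle_mean (\<lambda>b. bump m) * K < e"
proof -
  obtain m where m: "K / e < real m" using reals_Archimedean2 by blast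
  then have "K < e * real m" using assms by (simp add: pos_divide_less_eq mult.commute)
  moreover have "e * real m \<le> e * real (2 * m + 1)" using assms by (intro mult_left_mono) auto
  ultimately have "K < e * real (2 * m + 1)" by linarith
  then show ?thesis by (intro exI[of _ m]) (simp add: circle_mean_bump field_simps)
qed

lemma arc_cont_bounded:
  assumes "arc_cont (F :: bool \<Rightarrow> real \<Rightarrow> 'b::real_normed_vector)"
  shows "\<exists>R>0. \<forall>b t. 0 \<le> t \<longrightarrow> t \<le> pi \<longrightarrow> norm (F b t) \<le> R"
proof -
  have "bounded (F b ` {0..pi})" for b
    by (intro compact_imp_bounded compact_continuous_image arc_contD[OF assms]) simp
  then have "bounded (F True ` {0..pi} \<union> F False ` {0..pi})" by simp
  then obtain R where "R > 0" "\<forall>x\<in>F True ` {0..pi} \<union> F False ` {0..pi}. norm x \<le> R"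
    unfolding bounded_pos by blast
  then show ?thesis by (intro exI[of _ R]) (metis (full_types) UnI1 UnI2 atLeastAtMost_iff imageI)
qed

text \<open>Jumps are harmless in mean square: multiply by \<open>1 - bump m\<close> and approximate uniformly.\<close>

lemma trig_approx_L2:
  fixes F :: "bool \<Rightarrow> real \<Rightarrow> complex"
  assumes F: "arc_cont F" and e: "0 < e"
  shows "\<exists>A B. circle_mean (\<lambda>b t. (cmod (F b t - (poly A (arc_point b t) + poly B (cnj (arc_point b t)))))\<^sup>2) \<le> e"
proof -
  obtain R where R: "R > 0" "\<And>b t. 0 \<le> t \<Longrightarrow> t \<le> pi \<Longrightarrow> cmod (F b t) \<le> R"
    using arc_cont_bounded[OF F] by blast
  obtain m where m: "circle_mean (\<lambda>b. bump m) * (2 * R\<^sup>2) < e / 2" using small_bump[of "e/2" "2 * R\<^sup>2"] e by auto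
  let ?G = "\<lambda>b t. (1 - complex_of_real (bump m t)) * F b t"
  have G: "arc_cont ?G"
    using F unfolding arc_cont_def bump_def by (auto intro!: continuous_intros)
  obtain A B where AB: "\<And>b t. 0 \<le> t \<Longrightarrow> t \<le> pi \<Longrightarrow>
      cmod (?G b t - (poly A (arc_point b t) + poly B (cnj (arc_point b t)))) < sqrt (e / 4)"
    using trig_approx_uniform[OF G, of "sqrt (e / 4)"] e by auto
  have "circle_mean (\<lambda>b t. (cmod (F b t - (poly A (arc_point b t) + poly B (cnj (arc_point b t)))))\<^sup>2)
      \<le> circle_mean (\<lambda>b t. bump m t * (2 * R\<^sup>2) + e / 2)"
  proof (rule circle_mean_mono)
    show "arc_cont (\<lambda>b t. (cmod (F b t - (poly A (arc_point b t) + poly B (cnj (arc_point b t)))))\<^sup>2)"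
      by (intro arc_cont_intros F)
    show "arc_cont (\<lambda>b t. bump m t * (2 * R\<^sup>2) + e / 2)"
      by (intro arc_cont_intros arc_cont_bump)
    fix b :: bool and t :: real assume t: "0 \<le> t" "t \<le> pi"
    let ?T = "poly A (arc_point b t) + poly B (cnj (arc_point b t))"
    have bb: "0 \<le> bump m t" "bump m t \<le> 1" using bump_bounds t by auto
    have d: "F b t - ?T = (F b t - ?G b t) + (?G b t - ?T)" by simp
    have "cmod (F b t - ?G b t) = bump m t * cmod (F b t)"
      using bb by (simp add: algebra_simps norm_mult)
    also have "\<dots> \<le> bump m t * R" using R(2)[OF t] bb by (intro mult_left_mono)
    finally have "cmod (F b t - ?T) \<le> bump m t * R + sqrt (e / 4)"
      using norm_triangle_ineq[of "F b t - ?G b t" "?G b t - ?T"] AB[OF t, of b] unfolding d by linarith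
    then have "(cmod (F b t - ?T))\<^sup>2 \<le> (bump m t * R + sqrt (e / 4))\<^sup>2"
      by (intro power_mono) auto
    also have "\<dots> \<le> 2 * (bump m t * R)\<^sup>2 + 2 * (sqrt (e / 4))\<^sup>2"
      using sum_squares_bound[of "bump m t * R" "sqrt (e/4)"] by (simp add: power2_sum)
    also have "\<dots> \<le> bump m t * (2 * R\<^sup>2) + e / 2"
    proof -
      have "(bump m t)\<^sup>2 \<le> bump m t" using bb by (simp add: power2_eq_square mult_left_le)
      then have "(bump m t)\<^sup>2 * R\<^sup>2 \<le> bump m t * R\<^sup>2" by (intro mult_right_mono) auto
      then show ?thesis using e by (simp add: power_mult_distrib)
    qed
    finally show "(cmod (F b t - ?T))\<^sup>2 \<le> bump m t * (2 * R\<^sup>2) + e / 2" .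
  qed
  also have "\<dots> = circle_mean (\<lambda>b. bump m) * (2 * R\<^sup>2) + e / 2"
    using circle_mean_cmult[of "2 * R\<^sup>2" "\<lambda>b. bump m"]
    by (subst circle_mean_add) (auto intro!: arc_cont_intros arc_cont_bump simp: mult.commute)
  finally show ?thesis using m by (intro exI[of _ A] exI[of _ B]) linarith
qed

text \<open>Raise the function to its maximum near the jumps, approximate uniformly, and shift up. A real
trigonometric polynomial is the real part of an analytic one: conjugate the coefficients of the
antianalytic part.\<close>

lemma trig_majorant:
  fixes f :: "bool \<Rightarrow> real \<Rightarrow> real"
  assumes f: "arc_cont f" and e: "0 < e"
  shows "\<exists>P. (\<forall>b t. 0 \<le> t \<longrightarrow> t \<le> pi \<longrightarrow> f b t \<le> Re (poly P (arc_point b t))) \<and> Re (poly P 0) \<le> circle_mean f + e"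
proof -
  obtain R where R: "R > 0" "\<And>b t. 0 \<le> t \<Longrightarrow> t \<le> pi \<Longrightarrow> \<bar>f b t\<bar> \<le> R"
    using arc_cont_bounded[OF f] by auto
  obtain m where m: "circle_mean (\<lambda>b. bump m) * (2 * R) < e / 4" using small_bump[of "e/4" "2 * R"] e by auto
  let ?g = "\<lambda>b t. (1 - bump m t) * f b t + bump m t * R + e / 4"
  let ?G = "\<lambda>b t. complex_of_real (?g b t)"
  have G: "arc_cont ?G"
    using f unfolding arc_cont_def bump_def by (auto intro!: continuous_intros)
  obtain A B where AB: "\<And>b t. 0 \<le> t \<Longrightarrow> t \<le> pi \<Longrightarrow>
      cmod (?G b t - (poly A (arc_point b t) + poly B (cnj (arc_point b t)))) < e / 4"
    using trig_approx_uniform[OF G, of "e / 4"] e by auto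
  define P where "P = A + map_poly cnj B"
  have P: "\<bar>?g b t - Re (poly P (arc_point b t))\<bar> < e / 4" if "0 \<le> t" "t \<le> pi" for b t
    using AB[OF that, of b] abs_Re_le_cmod[of "?G b t - (poly A (arc_point b t) + poly B (cnj (arc_point b t)))"]
    by (simp add: P_def)
  have up: "f b t + e / 4 \<le> ?g b t" "?g b t \<le> f b t + bump m t * (2 * R) + e / 4" if t: "0 \<le> t" "t \<le> pi" for b t
  proof -
    have bb: "0 \<le> bump m t" using bump_bounds by auto
    have "\<bar>bump m t * f b t\<bar> \<le> bump m t * R"
      using R(2)[OF t, of b] bb by (simp add: abs_mult mult_left_mono)
 moreover have "(1 - bump m t) * f b t = f b t - bump m t * f b t" "bump m t * (2 * R) = 2 * (bump m t * R)"
      by (simp_all add: left_diff_distrib)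
    ultimately show "f b t + e / 4 \<le> ?g b t" "?g b t \<le> f b t + bump m t * (2 * R) + e / 4"
      by linarith+
  qed
  have "Re (poly P 0) = circle_mean (\<lambda>b t. Re (poly P (arc_point b t)))" by (simp add: circle_mean_poly)
  also have "\<dots> \<le> circle_mean (\<lambda>b t. f b t + bump m t * (2 * R) + e / 2)"
  proof (rule circle_mean_mono)
    fix b :: bool and t :: real assume t: "0 \<le> t" "t \<le> pi"
    show "Re (poly P (arc_point b t)) \<le> f b t + bump m t * (2 * R) + e / 2"
      using P[OF t, of b] up(2)[OF t, of b] by argo
  qed (intro arc_cont_intros arc_cont_bump f)+
  also have "\<dots> = circle_mean f + circle_mean (\<lambda>b. bump m) * (2 * R) + e / 2"
    using circle_mean_cmult[of "2 * R" "\<lambda>b. bump m"] f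
    by (simp add: circle_mean_add arc_cont_intros arc_cont_bump mult.commute)
  finally have "Re (poly P 0) \<le> circle_mean f + e" using m e by linarith
  moreover have "f b t \<le> Re (poly P (arc_point b t))" if t: "0 \<le> t" "t \<le> pi" for b t
    using P[OF t, of b] up(1)[OF t, of b] by argo
  ultimately show ?thesis by blast
qed

section \<open>An extremal problem for a pair of dual norms\<close>

definition poly_vec :: "(nat \<Rightarrow> complex poly) \<Rightarrow> complex \<Rightarrow> nat \<Rightarrow> complex" where
  "poly_vec p z k = poly (p k) z"

lemma lipschitz_continuous_vnorm:
  fixes F :: "(nat \<Rightarrow> complex) \<Rightarrow> 'b::real_normed_vector"
  assumes lip: "\<And>a b. norm (F a - F b) \<le> L * vnorm n (\<lambda>k. a k - b k)"
    and v: "\<And>k. k < n \<Longrightarrow> continuous_on S (\<lambda>t. v t k)"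
  shows "continuous_on S (\<lambda>t. F (v t))"
  unfolding continuous_on_def
proof
  fix t assume t: "t \<in> S"
  have "((\<lambda>s. vnorm n (\<lambda>k. v s k - v t k)) \<longlongrightarrow> vnorm n (\<lambda>k. v t k - v t k)) (at t within S)"
    unfolding vnorm_def L2_set_def
    by (intro tendsto_intros) (use v t in \<open>auto simp: continuous_on_def\<close>)
  then have "((\<lambda>s. L * vnorm n (\<lambda>k. v s k - v t k)) \<longlongrightarrow> L * 0) (at t within S)"
    by (intro tendsto_intros) (simp add: vnorm_def L2_set_def)
  then have "((\<lambda>s. L * vnorm n (\<lambda>k. v s k - v t k)) \<longlongrightarrow> 0) (at t within S)" by simp
  then have "((\<lambda>s. F (v s) - F (v t)) \<longlongrightarrow> 0) (at t within S)"
    by (rule Lim_null_comparison[rotated]) (use lip in simp)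
  then show "((\<lambda>s. F (v s)) \<longlongrightarrow> F (v t)) (at t within S)" by (rule LIM_zero_cancel)
qed

definition arc_vec :: "nat \<Rightarrow> (bool \<Rightarrow> real \<Rightarrow> nat \<Rightarrow> complex) \<Rightarrow> bool" where
  "arc_vec n v \<longleftrightarrow> (\<forall>k<n. arc_cont (\<lambda>b t. v b t k))"

lemma arc_vec_poly: "arc_vec n (\<lambda>b t. poly_vec p (arc_point b t))"
  by (simp add: arc_vec_def poly_vec_def arc_cont_poly)

lemma arc_vec_diff: "arc_vec n u \<Longrightarrow> arc_vec n v \<Longrightarrow> arc_vec n (\<lambda>b t k. u b t k - v b t k)"
  by (simp add: arc_vec_def arc_cont_diff)

lemma arc_vec_vinner: "arc_vec n u \<Longrightarrow> arc_vec n v \<Longrightarrow> arc_cont (\<lambda>b t. vinner n (u b t) (v b t))"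
  by (intro arc_cont_vinner) (auto simp: arc_vec_def)

lemma arc_vec_const: "arc_vec n (\<lambda>b t. x)"
  by (simp add: arc_vec_def arc_cont_const)

lemma arc_vec_vnorm: "arc_vec n u \<Longrightarrow> arc_cont (\<lambda>b t. vnorm n (u b t))"
  unfolding arc_vec_def arc_cont_def vnorm_def L2_set_def by (auto intro!: continuous_intros)

lemma arc_vec_vnorm_sq: "arc_vec n u \<Longrightarrow> arc_cont (\<lambda>b t. (vnorm n (u b t))\<^sup>2)"
  by (intro arc_cont_power arc_vec_vnorm)

context fin_norm
begin

lemma arc_cont_N:
  assumes "\<And>k. k < n \<Longrightarrow> continuous_on S (\<lambda>t. v t k)"
  shows "continuous_on S (\<lambda>t. N (v t))"
  by (rule lipschitz_continuous_vnorm[of N C, OF _ assms]) (auto simp: N_lipschitz)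

lemma continuous_on_slope:
  assumes "0 < l" "j < n" "\<And>k. k < n \<Longrightarrow> continuous_on S (\<lambda>t. v t k)"
  shows "continuous_on S (\<lambda>t. slope l (v t) j)"
  using slope_lipschitz[OF assms(1,2)]
  by (rule lipschitz_continuous_vnorm[of "\<lambda>v. slope l v j", OF _ assms(3)])

lemma continuous_on_prox:
  assumes "0 < l" "j < n" "\<And>k. k < n \<Longrightarrow> continuous_on S (\<lambda>t. v t k)"
  shows "continuous_on S (\<lambda>t. prox l (v t) j)"
proof -
  have "prox l (v t) j = v t j - of_real l * slope l (v t) j" for t
    using slope_prox[OF assms(1), of "v t" j] by (simp add: algebra_simps)
  then show ?thesis
    by (simp, intro continuous_intros continuous_on_slope assms)
qed

lemma continuous_on_env:
  assumes "0 < l" "\<And>k. k < n \<Longrightarrow> continuous_on S (\<lambda>t. v t k)"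
  shows "continuous_on S (\<lambda>t. env l (v t))"
  unfolding env_eq[OF assms(1)] vnorm_def L2_set_def
  by (intro continuous_intros arc_cont_N continuous_on_prox continuous_on_slope assms) (use assms in auto)

end

text \<open>A point where a quadratic functional is within \<open>h\<^sup>2\<close> of its infimum has derivative of order \<open>h\<close>.\<close>

lemma quadratic_bound_linear:
  fixes a b h :: real
  assumes "\<And>s. 0 \<le> h\<^sup>2 + s * a + s\<^sup>2 * b" "0 \<le> b" "0 \<le> h"
  shows "\<bar>a\<bar> \<le> 2 * h * sqrt b"
proof (cases "b = 0")
  case True
  have "a = 0"
  proof (rule ccontr)
    assume "a \<noteq> 0"
    then show False using assms(1)[of "- (h\<^sup>2 + 1) / a"] True by simp
  qed
  then show ?thesis using assms by simp
next
  case False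
  then have b: "0 < b" using assms(2) by simp
  have "0 \<le> h\<^sup>2 + (- a / (2 * b)) * a + (- a / (2 * b))\<^sup>2 * b" by (rule assms(1))
  also have "\<dots> = h\<^sup>2 - a\<^sup>2 / (4 * b)" using b by (simp add: field_simps power2_eq_square)
  finally have "a\<^sup>2 \<le> h\<^sup>2 * (4 * b)" using b by (simp add: field_simps)
  then have "\<bar>a\<bar> \<le> sqrt (h\<^sup>2 * (4 * b))" by (simp add: real_le_rsqrt)
  then show ?thesis using assms(3) by (simp add: real_sqrt_mult)
qed

context half_dual_pair
begin

text \<open>The norm on the lower arc is \<open>N0\<close> and on the upper arc \<open>N1\<close>, so negating the index is passing to the
dual norm.\<close>

definition arc_norm :: "bool \<Rightarrow> (nat \<Rightarrow> complex) \<Rightarrow> real" where "arc_norm b = (if b then N1 else N0)"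
definition arc_slope :: "real \<Rightarrow> bool \<Rightarrow> (nat \<Rightarrow> complex) \<Rightarrow> nat \<Rightarrow> complex" where
  "arc_slope l b = (if b then Y.slope l else X.slope l)"
definition arc_env :: "real \<Rightarrow> bool \<Rightarrow> (nat \<Rightarrow> complex) \<Rightarrow> real" where
  "arc_env l b = (if b then Y.env l else X.env l)"

lemma fin_norm_arc_norm: "fin_norm n (arc_norm b) C"
  unfolding arc_norm_def using X.fin_norm_axioms Y.fin_norm_axioms by simp

lemma arc_norm_pair: "vinner n a c \<le> arc_norm b a * arc_norm (\<not> b) c"
  using pair_le[of a c] pair_le[of c a] by (simp add: arc_norm_def vinner_commute mult.commute)

lemma arc_env_upper:
  "0 < l \<Longrightarrow> arc_env l b v' \<le> arc_env l b v + vinner n (arc_slope l b v) (\<lambda>k. v' k - v k)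
     + (vnorm n (\<lambda>k. v' k - v k))\<^sup>2 / (2 * l)"
  unfolding arc_env_def arc_slope_def using X.env_upper Y.env_upper by (cases b) auto

lemma arc_env_lower: "0 < l \<Longrightarrow> (arc_norm b v)\<^sup>2 / 2 \<le> (1 + C\<^sup>2 * l) * arc_env l b v"
  unfolding arc_env_def arc_norm_def using X.env_lower Y.env_lower by (cases b) auto

lemma arc_env_zero: "0 < l \<Longrightarrow> arc_env l b (\<lambda>k. 0) \<le> 0"
proof -
  assume l: "0 < l"
  have "vnorm n (\<lambda>k. 0) = 0" "N0 (\<lambda>k. 0) = 0" "N1 (\<lambda>k. 0) = 0"
    using X.hom[of 0 "\<lambda>k. 0"] Y.hom[of 0 "\<lambda>k. 0"] by (simp_all add: vnorm_def L2_set_def)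
  then show ?thesis
    using X.prox_min[OF l, of "\<lambda>k. 0" "\<lambda>k. 0"] Y.prox_min[OF l, of "\<lambda>k. 0" "\<lambda>k. 0"]
    by (simp add: arc_env_def X.energy_def Y.energy_def)
qed

text \<open>The Fenchel equality at the slope, with the quadratic part of the envelope discarded.\<close>

lemma arc_slope_dual:
  assumes l: "0 < l"
  shows "(arc_norm (\<not> b) (arc_slope l b v))\<^sup>2 / 2 \<le> vinner n v (arc_slope l b v) - arc_env l b v"
proof -
  have "(N1 (X.slope l v))\<^sup>2 / 2 \<le> vinner n v (X.slope l v) - X.env l v"
  proof -
    have "vinner n (\<lambda>k. X.prox l v k + of_real l * X.slope l v k) (X.slope l v) = vinner n v (X.slope l v)"
      using X.slope_prox[OF l, of v] by (intro arg_cong[where f = "\<lambda>x. vinner n x (X.slope l v)"]) (simp add: fun_eq_iff)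
    then have "vinner n v (X.slope l v) = vinner n (X.prox l v) (X.slope l v) + l * (vnorm n (X.slope l v))\<^sup>2"
      by (simp add: vinner_simps vnorm_sq)
    moreover have "0 \<le> l * (vnorm n (X.slope l v))\<^sup>2" using l by simp
    ultimately show ?thesis using slope_dual_norms(1)[OF l, of v]
      unfolding X.env_eq[OF l] X.conj_value_def by linarith
  qed
  moreover have "(N0 (Y.slope l v))\<^sup>2 / 2 \<le> vinner n v (Y.slope l v) - Y.env l v"
  proof -
    have "vinner n (\<lambda>k. Y.prox l v k + of_real l * Y.slope l v k) (Y.slope l v) = vinner n v (Y.slope l v)"
      using Y.slope_prox[OF l, of v] by (intro arg_cong[where f = "\<lambda>x. vinner n x (Y.slope l v)"]) (simp add: fun_eq_iff)
    then have "vinner n v (Y.slope l v) = vinner n (Y.prox l v) (Y.slope l v) + l * (vnorm n (Y.slope l v))\<^sup>2"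
      by (simp add: vinner_simps vnorm_sq)
    moreover have "0 \<le> l * (vnorm n (Y.slope l v))\<^sup>2" using l by simp
    ultimately show ?thesis using slope_dual_norms(2)[OF l, of v]
      unfolding Y.env_eq[OF l] Y.conj_value_def by linarith
  qed
  ultimately show ?thesis by (cases b) (simp_all add: arc_norm_def arc_slope_def arc_env_def)
qed

lemma arc_cont_arc_norm: "arc_vec n v \<Longrightarrow> arc_cont (\<lambda>b t. arc_norm b (v b t))"
proof (rule arc_contI)
  fix b assume "arc_vec n v"
  then show "continuous_on {0..pi} (\<lambda>t. arc_norm b (v b t))"
    by (intro fin_norm.arc_cont_N[OF fin_norm_arc_norm]) (auto simp: arc_vec_def arc_cont_def)
qed

lemma arc_cont_arc_norm_not: "arc_vec n v \<Longrightarrow> arc_cont (\<lambda>b t. arc_norm (\<not> b) (v b t))"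
proof (rule arc_contI)
  fix b assume "arc_vec n v"
  then show "continuous_on {0..pi} (\<lambda>t. arc_norm (\<not> b) (v b t))"
    by (intro fin_norm.arc_cont_N[OF fin_norm_arc_norm]) (auto simp: arc_vec_def arc_cont_def)
qed

lemma arc_cont_arc_env: "0 < l \<Longrightarrow> arc_vec n v \<Longrightarrow> arc_cont (\<lambda>b t. arc_env l b (v b t))"
proof (rule arc_contI)
  fix b assume "0 < l" "arc_vec n v"
  then have "continuous_on {0..pi} (\<lambda>t. X.env l (v b t))" "continuous_on {0..pi} (\<lambda>t. Y.env l (v b t))"
    by (auto intro!: X.continuous_on_env Y.continuous_on_env simp: arc_vec_def arc_cont_def)
  then show "continuous_on {0..pi} (\<lambda>t. arc_env l b (v b t))" by (cases b) (simp_all add: arc_env_def)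
qed

lemma arc_vec_arc_slope: "0 < l \<Longrightarrow> arc_vec n v \<Longrightarrow> arc_vec n (\<lambda>b t. arc_slope l b (v b t))"
  unfolding arc_vec_def
proof (intro allI impI arc_contI)
  fix j b assume a: "0 < l" "\<forall>k<n. arc_cont (\<lambda>b t. v b t k)" "j < n"
  then have "continuous_on {0..pi} (\<lambda>t. X.slope l (v b t) j)" "continuous_on {0..pi} (\<lambda>t. Y.slope l (v b t) j)"
    by (auto intro!: X.continuous_on_slope Y.continuous_on_slope simp: arc_cont_def)
  then show "continuous_on {0..pi} (\<lambda>t. arc_slope l b (v b t) j)" by (cases b) (simp_all add: arc_slope_def)
qed

text \<open>Pair \<open>p(\<zeta>)\<close> with \<open>p(cnj \<zeta>)\<close>. The result is a polynomial with constant term \<open>\<bar>p(0)\<bar>\<^sup>2\<close>, while on the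
circle the two factors are measured in dual norms. This bounds the variational functional from
below.\<close>

lemma mean_pair: "(vnorm n (poly_vec p 0))\<^sup>2 / 2 \<le> circle_mean (\<lambda>b t. (arc_norm b (poly_vec p (arc_point b t)))\<^sup>2 / 2)"
proof -
  define r where "r = (\<Sum>k<n. p k * map_poly cnj (p k))"
  have r: "Re (poly r z) = vinner n (poly_vec p z) (poly_vec p (cnj z))" for z
    by (simp add: r_def poly_sum vinner_def poly_vec_def inner_complex_def)
  have ac1: "arc_cont (\<lambda>b t. (arc_norm b (poly_vec p (arc_point b t)))\<^sup>2 / 2)"
    by (intro arc_cont_divide arc_cont_power arc_cont_arc_norm arc_vec_poly)
  have ac2: "arc_cont (\<lambda>b t. (arc_norm (\<not> b) (poly_vec p (arc_point (\<not> b) t)))\<^sup>2 / 2)"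
    using arc_contD_not[OF ac1] .
  have "(vnorm n (poly_vec p 0))\<^sup>2 = circle_mean (\<lambda>b t. Re (poly r (arc_point b t)))"
    unfolding circle_mean_poly vnorm_sq by (simp add: r)
  also have "\<dots> \<le> circle_mean (\<lambda>b t. (arc_norm b (poly_vec p (arc_point b t)))\<^sup>2 / 2 + (arc_norm (\<not> b) (poly_vec p (arc_point (\<not> b) t)))\<^sup>2 / 2)"
  proof (rule circle_mean_mono)
    show "arc_cont (\<lambda>b t. (arc_norm b (poly_vec p (arc_point b t)))\<^sup>2 / 2 + (arc_norm (\<not> b) (poly_vec p (arc_point (\<not> b) t)))\<^sup>2 / 2)"
      by (intro arc_cont_add ac1 ac2)
    fix b t
    have "Re (poly r (arc_point b t)) \<le> arc_norm b (poly_vec p (arc_point b t)) * arc_norm (\<not> b) (poly_vec p (arc_point (\<not> b) t))"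
      unfolding r arc_not by (rule arc_norm_pair)
    also have "\<dots> \<le> (arc_norm b (poly_vec p (arc_point b t)))\<^sup>2 / 2 + (arc_norm (\<not> b) (poly_vec p (arc_point (\<not> b) t)))\<^sup>2 / 2"
      using sum_squares_bound[of "arc_norm b (poly_vec p (arc_point b t))" "arc_norm (\<not> b) (poly_vec p (arc_point (\<not> b) t))"] by simp
    finally show "Re (poly r (arc_point b t)) \<le> (arc_norm b (poly_vec p (arc_point b t)))\<^sup>2 / 2 + (arc_norm (\<not> b) (poly_vec p (arc_point (\<not> b) t)))\<^sup>2 / 2" .
  qed (intro arc_cont_intros)
  also have "\<dots> = circle_mean (\<lambda>b t. (arc_norm b (poly_vec p (arc_point b t)))\<^sup>2 / 2) + circle_mean (\<lambda>b t. (arc_norm (\<not> b) (poly_vec p (arc_point (\<not> b) t)))\<^sup>2 / 2)"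
    by (intro circle_mean_add ac1 ac2)
  also have "circle_mean (\<lambda>b t. (arc_norm (\<not> b) (poly_vec p (arc_point (\<not> b) t)))\<^sup>2 / 2) = circle_mean (\<lambda>b t. (arc_norm b (poly_vec p (arc_point b t)))\<^sup>2 / 2)"
    using circle_mean_not[of "\<lambda>b t. (arc_norm b (poly_vec p (arc_point b t)))\<^sup>2 / 2"] by simp
  finally show ?thesis by simp
qed

text \<open>Here \<open>h\<close> is the slope along a near-minimiser of the envelope energy minus \<open>Re \<langle>p(0), x\<rangle>\<close> over all
vector polynomials. Near-minimality against perturbations by every polynomial \<open>q\<close>, of whatever
degree, says that \<open>h\<close> tests like the constant \<open>x\<close> on analytic functions up to a small multiple of
the mean square norm, so a minimiser and a compactness argument can be avoided. The bound on the
dual energy of \<open>h\<close> is the Fenchel equality combined with the lower bound of the functional.\<close>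

lemma near_minimiser:
  assumes l: "0 < l" and d: "0 < d"
  shows "\<exists>h. arc_vec n h \<and> circle_mean (\<lambda>b t. (arc_norm (\<not> b) (h b t))\<^sup>2) \<le> (1 + C\<^sup>2 * l) * (vnorm n x)\<^sup>2 + d \<and>
    (\<forall>q. \<bar>circle_mean (\<lambda>b t. vinner n (h b t) (poly_vec q (arc_point b t))) - vinner n (poly_vec q 0) x\<bar>
        \<le> d * sqrt (circle_mean (\<lambda>b t. (vnorm n (poly_vec q (arc_point b t)))\<^sup>2)))"
proof -
  define a where "a = 1 + C\<^sup>2 * l"
  have a: "1 \<le> a" using l by (simp add: a_def)
  define D where "D = (vnorm n x)\<^sup>2"
  have D: "0 \<le> D" by (simp add: D_def)
  define E where "E p = circle_mean (\<lambda>b t. arc_env l b (poly_vec p (arc_point b t)))" for p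
  define P where "P p = E p - vinner n (poly_vec p 0) x" for p
  define S where "S q = circle_mean (\<lambda>b t. (vnorm n (poly_vec q (arc_point b t)))\<^sup>2)" for q
  have S0: "0 \<le> S q" for q
    unfolding S_def by (rule circle_mean_nonneg) (auto intro!: arc_vec_vnorm_sq arc_vec_poly)
  note env_ac = arc_cont_arc_env[OF l arc_vec_poly]
  have E_lower: "circle_mean (\<lambda>b t. (arc_norm b (poly_vec p (arc_point b t)))\<^sup>2 / 2) \<le> a * E p" for p
    unfolding E_def circle_mean_cmult[symmetric] a_def
    by (rule circle_mean_mono) (intro arc_cont_divide arc_cont_power arc_cont_mult arc_cont_const arc_cont_arc_norm
        arc_vec_poly env_ac arc_env_lower[OF l])+
  have p0: "(vnorm n (poly_vec p 0))\<^sup>2 \<le> 2 * (a * E p)" for p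
    using mean_pair[of p] E_lower[of p] by linarith
  have lin: "vinner n (poly_vec p 0) x \<le> (vnorm n (poly_vec p 0))\<^sup>2 / (2 * a) / r + a * D / 2 * r" if r: "0 < r" for p r
  proof -
    have "vinner n (poly_vec p 0) x \<le> vnorm n (poly_vec p 0) * vnorm n x"
      using vinner_le[of n "poly_vec p 0" x] by linarith
    also have "\<dots> \<le> (vnorm n (poly_vec p 0))\<^sup>2 / (2 * a) / r + a * D / 2 * r"
    proof -
      have "0 \<le> (vnorm n (poly_vec p 0) - a * r * vnorm n x)\<^sup>2 / (2 * a * r)" using a r by simp
      also have "\<dots> = (vnorm n (poly_vec p 0))\<^sup>2 / (2 * a) / r + a * D / 2 * r - vnorm n (poly_vec p 0) * vnorm n x"
        unfolding D_def using a r by (simp add: power2_diff power_mult_distrib field_simps) (simp add: power2_eq_square)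
      finally show ?thesis by simp
    qed
    finally show ?thesis .
  qed
  have P_lower: "- (a * D / 2) \<le> P p" for p
  proof -
    have "(vnorm n (poly_vec p 0))\<^sup>2 / (2 * a) \<le> E p" using p0[of p] a by (simp add: field_simps)
    then show ?thesis using lin[of 1 p] unfolding P_def by simp
  qed
  define R where "R = sqrt (2 * a * C\<^sup>2 * (2 + 2 * a * D))"
  have R0: "0 \<le> R" using a D by (simp add: R_def)
  \<comment> \<open>\<open>R\<close> bounds the mean square norm of every near-minimiser, so the accuracy can be fixed beforehand.\<close>
  define eta where "eta = min 1 (d / (2 * sqrt (1 / (2 * l)) * (2 + 2 * R)))"
  have s0: "0 < sqrt (1 / (2 * l))" using l by simp
  have eta: "0 < eta" "eta \<le> 1"
    unfolding eta_def using d s0 R0 by (auto simp: min_def intro!: divide_pos_pos mult_pos_pos)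
  have eta_d: "2 * eta * sqrt (1 / (2 * l)) * (2 + 2 * R) \<le> d"
  proof -
    have "eta \<le> d / (2 * sqrt (1 / (2 * l)) * (2 + 2 * R))" by (simp add: eta_def)
    then have "eta * (2 * sqrt (1 / (2 * l)) * (2 + 2 * R)) \<le> d"
      using s0 R0 by (subst (asm) pos_le_divide_eq) (auto intro!: mult_pos_pos)
    then show ?thesis by (simp only: mult_ac)
  qed
  \<comment> \<open>The infimum is over polynomials of all degrees.\<close>
  define m where "m = Inf (range P)"
  have bdd: "bdd_below (range P)" using P_lower by (intro bdd_belowI2)
  have m_le: "m \<le> P q" for q unfolding m_def by (rule cInf_lower[OF _ bdd]) simp
  obtain p where p: "P p < m + eta\<^sup>2"
    using cInf_lessD[of "range P" "m + eta\<^sup>2"] eta unfolding m_def by auto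
  define h where "h b t = arc_slope l b (poly_vec p (arc_point b t))" for b t
  have h_ac: "arc_vec n h" unfolding h_def[abs_def] by (rule arc_vec_arc_slope[OF l arc_vec_poly])
  define L where "L q = circle_mean (\<lambda>b t. vinner n (h b t) (poly_vec q (arc_point b t))) - vinner n (poly_vec q 0) x" for q
  have L: "\<bar>L q\<bar> \<le> 2 * eta * sqrt (1 / (2 * l)) * sqrt (S q)" for q
  proof -
    have "0 \<le> eta\<^sup>2 + s * L q + s\<^sup>2 * (S q / (2 * l))" for s
    proof -
      define p' where "p' = (\<lambda>k. p k + smult (complex_of_real s) (q k))"
      have p': "poly_vec p' z = (\<lambda>k. poly_vec p z k + complex_of_real s * poly_vec q z k)" for z
        by (simp add: poly_vec_def p'_def fun_eq_iff)
      have "E p' \<le> circle_mean (\<lambda>b t. arc_env l b (poly_vec p (arc_point b t)) + (s * vinner n (h b t) (poly_vec q (arc_point b t))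
            + s\<^sup>2 / (2 * l) * (vnorm n (poly_vec q (arc_point b t)))\<^sup>2))"
        unfolding E_def
      proof (rule circle_mean_mono)
        show "arc_cont (\<lambda>b t. arc_env l b (poly_vec p' (arc_point b t)))" by (rule env_ac)
        show "arc_cont (\<lambda>b t. arc_env l b (poly_vec p (arc_point b t)) + (s * vinner n (h b t) (poly_vec q (arc_point b t))
            + s\<^sup>2 / (2 * l) * (vnorm n (poly_vec q (arc_point b t)))\<^sup>2))"
          by (intro arc_cont_add arc_cont_mult arc_cont_const env_ac arc_vec_vinner arc_vec_vnorm_sq h_ac arc_vec_poly)
        fix b t
        show "arc_env l b (poly_vec p' (arc_point b t)) \<le> arc_env l b (poly_vec p (arc_point b t)) + (s * vinner n (h b t) (poly_vec q (arc_point b t))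
            + s\<^sup>2 / (2 * l) * (vnorm n (poly_vec q (arc_point b t)))\<^sup>2)"
          using arc_env_upper[OF l, of b "poly_vec p' (arc_point b t)" "poly_vec p (arc_point b t)"]
          by (simp add: p' h_def vinner_scale_right vnorm_scale power_mult_distrib)
      qed
      also have "\<dots> = E p + (s * circle_mean (\<lambda>b t. vinner n (h b t) (poly_vec q (arc_point b t))) + s\<^sup>2 / (2 * l) * S q)"
        unfolding E_def S_def circle_mean_cmult[symmetric]
        by (subst circle_mean_add, (intro arc_cont_add arc_cont_mult arc_cont_const env_ac arc_vec_vinner arc_vec_vnorm_sq h_ac arc_vec_poly)+)+
           simp
      finally have "P p' \<le> P p + s * L q + s\<^sup>2 / (2 * l) * S q"
        unfolding P_def L_def by (simp add: p' vinner_simps algebra_simps)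
      then show ?thesis using m_le[of p'] p by simp
    qed
    then have "\<bar>L q\<bar> \<le> 2 * eta * sqrt (S q / (2 * l))"
      by (rule quadratic_bound_linear) (use S0[of q] l eta in auto)
    then show ?thesis by (simp add: real_sqrt_mult real_sqrt_divide)
  qed
  have "P (\<lambda>k. 0) \<le> 0"
  proof -
    have "E (\<lambda>k. 0) \<le> circle_mean (\<lambda>b t. 0)"
      unfolding E_def by (rule circle_mean_mono[OF env_ac arc_cont_const]) (simp add: poly_vec_def[abs_def] arc_env_zero[OF l])
    then show ?thesis by (simp add: P_def poly_vec_def[abs_def] vinner_def)
  qed
  then have Pp: "P p \<le> 1" using p m_le[of "\<lambda>k. 0"] eta power_le_one[of eta 2] by linarith
  have SR: "sqrt (S p) \<le> R"
  proof -
    have "(vnorm n (poly_vec p 0))\<^sup>2 / (2 * a) / 2 \<le> E p / 2" using p0[of p] a by (simp add: field_simps)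
    then have Ep: "E p \<le> 2 + 2 * a * D" using Pp lin[of 2 p] unfolding P_def by argo
    have "S p \<le> circle_mean (\<lambda>b t. 2 * C\<^sup>2 * ((arc_norm b (poly_vec p (arc_point b t)))\<^sup>2 / 2))"
      unfolding S_def
    proof (rule circle_mean_mono)
      fix b t
      have "vnorm n (poly_vec p (arc_point b t)) \<le> C * arc_norm b (poly_vec p (arc_point b t))"
        using fin_norm.low[OF fin_norm_arc_norm] .
      then show "(vnorm n (poly_vec p (arc_point b t)))\<^sup>2 \<le> 2 * C\<^sup>2 * ((arc_norm b (poly_vec p (arc_point b t)))\<^sup>2 / 2)"
        using power_mono[of "vnorm n (poly_vec p (arc_point b t))" "C * arc_norm b (poly_vec p (arc_point b t))" 2]
        by (simp add: power_mult_distrib)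
    qed (intro arc_vec_vnorm_sq arc_vec_poly arc_cont_intros arc_cont_arc_norm)+
    also have "\<dots> \<le> 2 * C\<^sup>2 * (a * E p)"
      unfolding circle_mean_cmult by (intro mult_left_mono E_lower) simp
    also have "\<dots> \<le> 2 * C\<^sup>2 * (a * (2 + 2 * a * D))"
      using Ep a by (intro mult_left_mono) auto
    finally show ?thesis unfolding R_def by (intro real_sqrt_le_mono) (simp only: mult_ac)
  qed
  have "circle_mean (\<lambda>b t. (arc_norm (\<not> b) (h b t))\<^sup>2) \<le> a * D + d"
  proof -
    have "circle_mean (\<lambda>b t. (arc_norm (\<not> b) (h b t))\<^sup>2 / 2)
      \<le> circle_mean (\<lambda>b t. vinner n (h b t) (poly_vec p (arc_point b t)) - arc_env l b (poly_vec p (arc_point b t)))"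
    proof (rule circle_mean_mono)
      show "arc_cont (\<lambda>b t. (arc_norm (\<not> b) (h b t))\<^sup>2 / 2)"
        by (intro arc_cont_intros arc_cont_arc_norm_not h_ac)
      show "arc_cont (\<lambda>b t. vinner n (h b t) (poly_vec p (arc_point b t)) - arc_env l b (poly_vec p (arc_point b t)))"
        by (intro arc_cont_diff env_ac arc_vec_vinner h_ac arc_vec_poly)
      fix b t
      show "(arc_norm (\<not> b) (h b t))\<^sup>2 / 2 \<le> vinner n (h b t) (poly_vec p (arc_point b t)) - arc_env l b (poly_vec p (arc_point b t))"
        unfolding h_def using arc_slope_dual[OF l, of b "poly_vec p (arc_point b t)"] by (simp add: vinner_commute)
    qed
    also have "\<dots> = L p - P p"
      unfolding L_def P_def E_def
      by (subst circle_mean_diff) (auto intro!: env_ac arc_vec_vinner h_ac arc_vec_poly)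
    finally have "circle_mean (\<lambda>b t. (arc_norm (\<not> b) (h b t))\<^sup>2) / 2 \<le> L p - P p"
      by (simp add: circle_mean_divide)
    moreover have "2 * L p \<le> d"
    proof -
      have "L p \<le> 2 * eta * sqrt (1 / (2 * l)) * sqrt (S p)" using L[of p] by simp
      also have "\<dots> \<le> 2 * eta * sqrt (1 / (2 * l)) * R"
        using SR eta s0 by (intro mult_left_mono) auto
      finally have "L p \<le> 2 * eta * sqrt (1 / (2 * l)) * R" .
      moreover have "0 \<le> 2 * eta * sqrt (1 / (2 * l))" using eta s0 by simp
      moreover have "2 * eta * sqrt (1 / (2 * l)) * (2 + 2 * R)
         = 2 * (2 * eta * sqrt (1 / (2 * l))) + 2 * (2 * eta * sqrt (1 / (2 * l)) * R)"
        by (simp add: algebra_simps)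
      ultimately show ?thesis using eta_d by linarith
    qed
    ultimately show ?thesis using P_lower[of p] by linarith
  qed
  moreover have "\<bar>L q\<bar> \<le> d * sqrt (S q)" for q
  proof -
    have "0 \<le> 2 * eta * sqrt (1 / (2 * l)) * (1 + 2 * R)" using eta s0 R0 by simp
    moreover have "2 * eta * sqrt (1 / (2 * l)) * (2 + 2 * R)
         = 2 * eta * sqrt (1 / (2 * l)) + 2 * eta * sqrt (1 / (2 * l)) * (1 + 2 * R)"
      by (simp add: algebra_simps)
    ultimately have "2 * eta * sqrt (1 / (2 * l)) \<le> d" using eta_d by linarith
    then have "2 * eta * sqrt (1 / (2 * l)) * sqrt (S q) \<le> d * sqrt (S q)"
      using S0[of q] by (intro mult_right_mono) auto
    then show ?thesis using L[of q] by linarith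
  qed
  ultimately show ?thesis using h_ac unfolding L_def S_def a_def D_def by blast
qed

lemma arc_norm_sq_perturb:
  assumes "0 < s"
  shows "(arc_norm b u)\<^sup>2 \<le> (1 + s) * (arc_norm b v)\<^sup>2 + (1 + 1 / s) * C\<^sup>2 * (vnorm n (\<lambda>k. u k - v k))\<^sup>2"
proof -
  let ?w = "C * vnorm n (\<lambda>k. u k - v k)"
  interpret N: fin_norm n "arc_norm b" C by (rule fin_norm_arc_norm)
  have "(arc_norm b u)\<^sup>2 \<le> (arc_norm b v + ?w)\<^sup>2"
    using N.N_diff[of u v] N.N_nonneg power_mono by blast
  also have "\<dots> \<le> (1 + s) * (arc_norm b v)\<^sup>2 + (1 + 1 / s) * ?w\<^sup>2"
  proof -
    have "0 \<le> (s * arc_norm b v - ?w)\<^sup>2 / s" using assms by simp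
    also have "\<dots> = (1 + s) * (arc_norm b v)\<^sup>2 + (1 + 1 / s) * ?w\<^sup>2 - (arc_norm b v + ?w)\<^sup>2"
      using assms by (simp add: power2_eq_square field_simps)
    finally show ?thesis by simp
  qed
  finally show ?thesis by (simp add: power_mult_distrib mult.assoc)
qed

text \<open>Approximate \<open>h\<close> by a trigonometric polynomial \<open>T\<close> and test the hypothesis on \<open>h\<close> with the polynomial
\<open>q\<close> by which the analytic part of \<open>T\<close> differs from \<open>x\<close>: this shows that \<open>q\<close> itself is small. What
remains of \<open>T\<close> after subtracting \<open>q\<close> is \<open>x\<close> plus an antianalytic part, that is, a polynomial in
\<open>cnj \<zeta>\<close>.\<close>

lemma antianalytic_approx:
  assumes h: "arc_vec n h" and d: "0 < d"
    and L: "\<And>q. \<bar>circle_mean (\<lambda>b t. vinner n (h b t) (poly_vec q (arc_point b t))) - vinner n (poly_vec q 0) x\<bar>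
        \<le> d * sqrt (circle_mean (\<lambda>b t. (vnorm n (poly_vec q (arc_point b t)))\<^sup>2))"
  shows "\<exists>Q. (\<forall>k. poly (Q k) 0 = x k) \<and>
    circle_mean (\<lambda>b t. (vnorm n (\<lambda>k. poly_vec Q (cnj (arc_point b t)) k - h b t k))\<^sup>2) \<le> 10 * d\<^sup>2"
proof -
  have "\<exists>A B. circle_mean (\<lambda>b t. (cmod (h b t k - (poly A (arc_point b t) + poly B (cnj (arc_point b t)))))\<^sup>2) \<le> d\<^sup>2 / (n + 1)"
    if "k < n" for k
    by (rule trig_approx_L2) (use h d that in \<open>auto simp: arc_vec_def\<close>)
  then have "\<forall>k. \<exists>AB. k < n \<longrightarrow> circle_mean (\<lambda>b t. (cmod (h b t k -
      (poly (fst AB) (arc_point b t) + poly (snd AB) (cnj (arc_point b t)))))\<^sup>2) \<le> d\<^sup>2 / (n + 1)"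
    by fastforce
  from choice[OF this] obtain AB where AB': "\<forall>k. k < n \<longrightarrow> circle_mean (\<lambda>b t. (cmod (h b t k -
      (poly (fst (AB k)) (arc_point b t) + poly (snd (AB k)) (cnj (arc_point b t)))))\<^sup>2) \<le> d\<^sup>2 / (n + 1)" ..
  define A0 where "A0 k = fst (AB k)" for k
  define B0 where "B0 k = snd (AB k)" for k
  have AB: "circle_mean (\<lambda>b t. (cmod (h b t k - (poly (A0 k) (arc_point b t) + poly (B0 k) (cnj (arc_point b t)))))\<^sup>2) \<le> d\<^sup>2 / (n + 1)"
    if "k < n" for k
    using AB' that unfolding A0_def B0_def by blast
  define c where "c k = poly (B0 k) 0" for k
  define B where "B k = B0 k - [:c k:]" for k
  \<comment> \<open>The constant term of the antianalytic part is counted as analytic, so that \<open>B\<close> vanishes at \<open>0\<close>.\<close>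
  define q where "q k = A0 k + [:c k:] - [:x k:]" for k
  define Q where "Q k = [:x k:] + B k" for k
  define T where "T b t k = poly (A0 k) (arc_point b t) + poly (B0 k) (cnj (arc_point b t))" for b t k
  have T_ac: "arc_vec n T" unfolding arc_vec_def T_def by (auto intro!: arc_cont_intros)
  have Q_ac: "arc_vec n (\<lambda>b t. poly_vec Q (cnj (arc_point b t)))"
    unfolding arc_vec_def poly_vec_def by (auto intro!: arc_cont_intros)
  have TQ: "poly_vec Q (cnj (arc_point b t)) k = T b t k - poly_vec q (arc_point b t) k" for b t k
    by (simp add: T_def Q_def q_def B_def poly_vec_def)
  have Th: "circle_mean (\<lambda>b t. (vnorm n (\<lambda>k. T b t k - h b t k))\<^sup>2) \<le> d\<^sup>2"
  proof -
    have "(\<lambda>b t. (vnorm n (\<lambda>k. T b t k - h b t k))\<^sup>2)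
       = (\<lambda>b t. \<Sum>k<n. (cmod (h b t k - (poly (A0 k) (arc_point b t) + poly (B0 k) (cnj (arc_point b t)))))\<^sup>2)"
      by (simp add: vnorm_def L2_set_def sum_nonneg T_def norm_minus_commute)
    then have "circle_mean (\<lambda>b t. (vnorm n (\<lambda>k. T b t k - h b t k))\<^sup>2)
      = (\<Sum>k<n. circle_mean (\<lambda>b t. (cmod (h b t k - (poly (A0 k) (arc_point b t) + poly (B0 k) (cnj (arc_point b t)))))\<^sup>2))"
      using h by (simp only:) (intro circle_mean_sum; auto intro!: arc_cont_intros simp: arc_vec_def)
    also have "\<dots> \<le> (\<Sum>k<n. d\<^sup>2 / (n + 1))" by (intro sum_mono AB) auto
    also have "\<dots> \<le> d\<^sup>2" by (simp add: field_simps)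
    finally show ?thesis .
  qed
  define S where "S = circle_mean (\<lambda>b t. (vnorm n (poly_vec q (arc_point b t)))\<^sup>2)"
  have S0: "0 \<le> S" unfolding S_def by (rule circle_mean_nonneg) (auto intro!: arc_vec_vnorm_sq arc_vec_poly)
  have B0: "circle_mean (\<lambda>b t. vinner n (poly_vec B (cnj (arc_point b t))) (poly_vec q (arc_point b t))) = 0"
  proof -
    define r where "r = (\<Sum>k<n. map_poly cnj (B k) * q k)"
    have "vinner n (poly_vec B (cnj z)) (poly_vec q z) = Re (poly r z)" for z
      by (simp add: r_def poly_sum vinner_def poly_vec_def inner_complex_def)
    moreover have "poly r 0 = 0" by (simp add: r_def poly_sum B_def c_def)
    ultimately show ?thesis by (simp add: circle_mean_poly)
  qed
  have x0: "circle_mean (\<lambda>b t. vinner n x (poly_vec q (arc_point b t))) = vinner n (poly_vec q 0) x"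
  proof -
    define r where "r = (\<Sum>k<n. [:cnj (x k):] * q k)"
    have "vinner n x (poly_vec q z) = Re (poly r z)" for z
      by (simp add: r_def poly_sum vinner_def poly_vec_def inner_complex_def)
    then show ?thesis by (simp add: circle_mean_poly vinner_commute)
  qed
  have "vinner n (T b t) (poly_vec q (arc_point b t))
     = vinner n x (poly_vec q (arc_point b t)) + ((vnorm n (poly_vec q (arc_point b t)))\<^sup>2 + vinner n (poly_vec B (cnj (arc_point b t))) (poly_vec q (arc_point b t)))" for b t
  proof -
    have "T b t = (\<lambda>k. x k + (poly_vec q (arc_point b t) k + poly_vec B (cnj (arc_point b t)) k))"
      by (simp add: T_def q_def B_def poly_vec_def fun_eq_iff)
    then show ?thesis by (simp add: vinner_add_left vnorm_sq)
  qed
  then have "circle_mean (\<lambda>b t. vinner n (T b t) (poly_vec q (arc_point b t)))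
    = circle_mean (\<lambda>b t. vinner n x (poly_vec q (arc_point b t)) + ((vnorm n (poly_vec q (arc_point b t)))\<^sup>2 + vinner n (poly_vec B (cnj (arc_point b t))) (poly_vec q (arc_point b t))))"
    by simp
  also have "\<dots> = vinner n (poly_vec q 0) x + (S + 0)"
  proof -
    have B_ac: "arc_vec n (\<lambda>b t. poly_vec B (cnj (arc_point b t)))"
      unfolding arc_vec_def poly_vec_def by (auto intro!: arc_cont_intros)
    show ?thesis
      unfolding S_def x0[symmetric] B0[symmetric]
      by (subst circle_mean_add, (intro arc_cont_add arc_vec_vinner arc_vec_vnorm_sq arc_vec_poly arc_vec_const B_ac)+)+ simp
  qed
  finally have TS: "circle_mean (\<lambda>b t. vinner n (T b t) (poly_vec q (arc_point b t))) = vinner n (poly_vec q 0) x + S" by simp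
  have "circle_mean (\<lambda>b t. vinner n (T b t) (poly_vec q (arc_point b t)))
     \<le> circle_mean (\<lambda>b t. vinner n (h b t) (poly_vec q (arc_point b t)) + ((vnorm n (\<lambda>k. T b t k - h b t k))\<^sup>2
        + 1/4 * (vnorm n (poly_vec q (arc_point b t)))\<^sup>2))"
  proof (rule circle_mean_mono)
    show "arc_cont (\<lambda>b t. vinner n (T b t) (poly_vec q (arc_point b t)))"
      by (intro arc_vec_vinner T_ac arc_vec_poly)
    show "arc_cont (\<lambda>b t. vinner n (h b t) (poly_vec q (arc_point b t)) + ((vnorm n (\<lambda>k. T b t k - h b t k))\<^sup>2
        + 1/4 * (vnorm n (poly_vec q (arc_point b t)))\<^sup>2))"
      by (intro arc_cont_add arc_cont_mult arc_cont_const arc_vec_vinner arc_vec_vnorm_sq arc_vec_poly arc_vec_diff T_ac h)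
    fix b t
    let ?y = "vnorm n (\<lambda>k. T b t k - h b t k)" and ?z = "vnorm n (poly_vec q (arc_point b t))"
    have "vinner n (T b t) (poly_vec q (arc_point b t)) = vinner n (h b t) (poly_vec q (arc_point b t)) + vinner n (\<lambda>k. T b t k - h b t k) (poly_vec q (arc_point b t))"
      by (simp add: vinner_diff_left)
    moreover have "vinner n (\<lambda>k. T b t k - h b t k) (poly_vec q (arc_point b t)) \<le> ?y * ?z"
      using vinner_le[of n "\<lambda>k. T b t k - h b t k" "poly_vec q (arc_point b t)"] by linarith
    moreover have "?y * ?z \<le> ?y\<^sup>2 + 1/4 * ?z\<^sup>2"
      using zero_le_power2[of "?y - ?z / 2"] by (simp add: power2_eq_square algebra_simps)
    ultimately show "vinner n (T b t) (poly_vec q (arc_point b t)) \<le> vinner n (h b t) (poly_vec q (arc_point b t)) + (?y\<^sup>2 + 1/4 * ?z\<^sup>2)"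
      by linarith
  qed
  also have "\<dots> = circle_mean (\<lambda>b t. vinner n (h b t) (poly_vec q (arc_point b t)))
      + (circle_mean (\<lambda>b t. (vnorm n (\<lambda>k. T b t k - h b t k))\<^sup>2) + 1/4 * S)"
    unfolding S_def circle_mean_cmult[symmetric]
    by (subst circle_mean_add, (intro arc_cont_add arc_cont_mult arc_cont_const arc_vec_vinner arc_vec_vnorm_sq arc_vec_poly arc_vec_diff T_ac h)+)+ simp
  finally have "S \<le> d * sqrt S + d\<^sup>2 + S / 4"
    using TS L[of q] Th unfolding S_def[symmetric] by linarith
  moreover have "d * sqrt S \<le> d\<^sup>2 + S / 4"
    using zero_le_power2[of "d - sqrt S / 2"] S0 by (simp add: power2_diff power_divide)
  ultimately have S: "S \<le> 4 * d\<^sup>2" by linarith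
  have "circle_mean (\<lambda>b t. (vnorm n (\<lambda>k. poly_vec Q (cnj (arc_point b t)) k - h b t k))\<^sup>2)
    \<le> circle_mean (\<lambda>b t. 2 * (vnorm n (\<lambda>k. T b t k - h b t k))\<^sup>2 + 2 * (vnorm n (poly_vec q (arc_point b t)))\<^sup>2)"
  proof (rule circle_mean_mono)
    show "arc_cont (\<lambda>b t. (vnorm n (\<lambda>k. poly_vec Q (cnj (arc_point b t)) k - h b t k))\<^sup>2)"
      by (intro arc_vec_vnorm_sq arc_vec_diff Q_ac h)
    show "arc_cont (\<lambda>b t. 2 * (vnorm n (\<lambda>k. T b t k - h b t k))\<^sup>2 + 2 * (vnorm n (poly_vec q (arc_point b t)))\<^sup>2)"
      by (intro arc_cont_add arc_cont_mult arc_cont_const arc_vec_vnorm_sq arc_vec_poly arc_vec_diff T_ac h)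
    fix b t
    let ?y = "vnorm n (\<lambda>k. T b t k - h b t k)" and ?z = "vnorm n (poly_vec q (arc_point b t))"
    have "vnorm n (\<lambda>k. poly_vec Q (cnj (arc_point b t)) k - h b t k) \<le> ?y + ?z"
      using vnorm_triangle[of n "\<lambda>k. T b t k - h b t k" "\<lambda>k. - poly_vec q (arc_point b t) k"] vnorm_scale[of n "-1" "poly_vec q (arc_point b t)"]
      by (simp add: TQ algebra_simps)
    then have "(vnorm n (\<lambda>k. poly_vec Q (cnj (arc_point b t)) k - h b t k))\<^sup>2 \<le> (?y + ?z)\<^sup>2"
      by (intro power_mono) auto
    also have "\<dots> \<le> 2 * ?y\<^sup>2 + 2 * ?z\<^sup>2"
      using sum_squares_bound[of ?y ?z] by (simp add: power2_sum)
    finally show "(vnorm n (\<lambda>k. poly_vec Q (cnj (arc_point b t)) k - h b t k))\<^sup>2 \<le> 2 * ?y\<^sup>2 + 2 * ?z\<^sup>2" .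
  qed
  also have "\<dots> = 2 * circle_mean (\<lambda>b t. (vnorm n (\<lambda>k. T b t k - h b t k))\<^sup>2) + 2 * S"
    unfolding S_def circle_mean_cmult[symmetric]
    by (intro circle_mean_add arc_cont_mult arc_cont_const arc_vec_vnorm_sq arc_vec_poly arc_vec_diff T_ac h)
  also have "\<dots> \<le> 10 * d\<^sup>2" using S Th by linarith
  finally show ?thesis by (intro exI[of _ Q]) (simp add: Q_def B_def c_def)
qed

text \<open>Conjugating the variable exchanges the arcs, so the dual energy of \<open>h\<close> becomes the energy of the
analytic polynomial obtained from it. All errors vanish when the envelope parameter and the accuracy
tend to zero together.\<close>

lemma factorization_L2:
  assumes e: "0 < e"
  shows "\<exists>Q. (\<forall>k. poly (Q k) 0 = x k) \<and> circle_mean (\<lambda>b t. (arc_norm b (poly_vec Q (arc_point b t)))\<^sup>2) \<le> (vnorm n x)\<^sup>2 + e"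
proof -
  define f where "f d = (1 + d) * ((1 + C\<^sup>2 * d) * (vnorm n x)\<^sup>2 + d) + C\<^sup>2 * (10 * (d\<^sup>2 + d))" for d :: real
  have "(f \<longlongrightarrow> f 0) (at_right 0)"
    unfolding f_def by (intro tendsto_intros)
  then have "\<forall>\<^sub>F d in at_right 0. f d < (vnorm n x)\<^sup>2 + e"
    by (rule order_tendstoD(2)) (use e in \<open>simp add: f_def\<close>)
  then have "\<forall>\<^sub>F d in at_right (0::real). f d < (vnorm n x)\<^sup>2 + e \<and> 0 < d"
    using eventually_at_right_less[of "0::real"] by (rule eventually_conj)
  then obtain d where fd: "f d < (vnorm n x)\<^sup>2 + e" and d: "0 < d"
    using eventually_happens'[OF trivial_limit_at_right_real] by blast
  obtain h where h: "arc_vec n h"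
    "circle_mean (\<lambda>b t. (arc_norm (\<not> b) (h b t))\<^sup>2) \<le> (1 + C\<^sup>2 * d) * (vnorm n x)\<^sup>2 + d"
    "\<And>q. \<bar>circle_mean (\<lambda>b t. vinner n (h b t) (poly_vec q (arc_point b t))) - vinner n (poly_vec q 0) x\<bar>
        \<le> d * sqrt (circle_mean (\<lambda>b t. (vnorm n (poly_vec q (arc_point b t)))\<^sup>2))"
    using near_minimiser[OF d d] by blast
  obtain Q where Q: "\<And>k. poly (Q k) 0 = x k"
    "circle_mean (\<lambda>b t. (vnorm n (\<lambda>k. poly_vec Q (cnj (arc_point b t)) k - h b t k))\<^sup>2) \<le> 10 * d\<^sup>2"
    using antianalytic_approx[OF h(1) d h(3)] by blast
  have Q_ac: "arc_vec n (\<lambda>b t. poly_vec Q (cnj (arc_point b t)))"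
    unfolding arc_vec_def poly_vec_def by (auto intro!: arc_cont_intros)
  have "circle_mean (\<lambda>b t. (arc_norm b (poly_vec Q (arc_point b t)))\<^sup>2) = circle_mean (\<lambda>b t. (arc_norm (\<not> b) (poly_vec Q (cnj (arc_point b t))))\<^sup>2)"
    using circle_mean_not[of "\<lambda>b t. (arc_norm b (poly_vec Q (arc_point b t)))\<^sup>2"] by (simp add: arc_not)
  also have "\<dots> \<le> circle_mean (\<lambda>b t. (1 + d) * (arc_norm (\<not> b) (h b t))\<^sup>2
      + (1 + 1 / d) * C\<^sup>2 * (vnorm n (\<lambda>k. poly_vec Q (cnj (arc_point b t)) k - h b t k))\<^sup>2)"
    by (rule circle_mean_mono)
       (intro arc_cont_add arc_cont_mult arc_cont_const arc_cont_power arc_cont_arc_norm_not arc_vec_vnorm_sq arc_vec_diff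
         Q_ac h(1) arc_norm_sq_perturb[OF d])+
  also have "\<dots> = (1 + d) * circle_mean (\<lambda>b t. (arc_norm (\<not> b) (h b t))\<^sup>2)
      + (1 + 1 / d) * C\<^sup>2 * circle_mean (\<lambda>b t. (vnorm n (\<lambda>k. poly_vec Q (cnj (arc_point b t)) k - h b t k))\<^sup>2)"
    unfolding circle_mean_cmult[symmetric]
    by (intro circle_mean_add arc_cont_mult arc_cont_const arc_cont_power arc_cont_arc_norm_not arc_vec_vnorm_sq arc_vec_diff Q_ac h(1))
  also have "\<dots> \<le> (1 + d) * ((1 + C\<^sup>2 * d) * (vnorm n x)\<^sup>2 + d) + (1 + 1 / d) * C\<^sup>2 * (10 * d\<^sup>2)"
    using d by (intro add_mono mult_left_mono h(2) Q(2)) auto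
  also have "\<dots> = f d"
    unfolding f_def using d by (simp add: power2_eq_square algebra_simps)
  finally show ?thesis using fd Q(1) by (intro exI[of _ Q]) simp
qed

end

text \<open>Taylor polynomials of the exponential keep the value \<open>1\<close> at \<open>0\<close>, which preserves the value at the
centre of the disc when the outer function is replaced by a polynomial.\<close>

lemma exp_approx:
  assumes e: "0 < e"
  shows "\<exists>S. poly S 0 = 1 \<and> (\<forall>w. cmod w \<le> K \<longrightarrow> cmod (poly S w) \<le> cmod (exp w) + e)"
proof (cases "0 \<le> K")
  case True
  have "(\<lambda>m. inverse (fact m) * K ^ m) \<longlonglongrightarrow> 0"
    using summable_LIMSEQ_zero[OF summable_exp] .
  then have "(\<lambda>m. exp K * K * (inverse (fact m) * K ^ m)) \<longlonglongrightarrow> exp K * K * 0"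
    by (intro tendsto_mult tendsto_const)
  then have "\<forall>\<^sub>F m in sequentially. exp K * K * (inverse (fact m) * K ^ m) < e"
    using e by (intro order_tendstoD(2)) auto
  then obtain m where m: "exp K * K * (inverse (fact m) * K ^ m) < e"
    unfolding eventually_sequentially by blast
  define S :: "complex poly" where "S = (\<Sum>i\<le>m. monom (1 / fact i) i)"
  have S: "poly S w = (\<Sum>i\<le>m. w ^ i / fact i)" for w
    by (simp add: S_def poly_sum poly_monom)
  have "(0::complex) ^ i / fact i = (if i = 0 then 1 else 0)" for i by (cases i) simp_all
  then have "poly S 0 = 1" by (simp add: S sum.delta)
  moreover have "cmod (poly S w) \<le> cmod (exp w) + e" if w: "cmod w \<le> K" for w
  proof -
    have "cmod (exp w - poly S w) \<le> exp \<bar>Re w\<bar> * cmod w ^ Suc m / fact m"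
      unfolding S by (rule Taylor_exp)
    also have "\<dots> \<le> exp K * K ^ Suc m / fact m"
      using w abs_Re_le_cmod[of w] True
      by (intro divide_right_mono mult_mono power_mono) auto
    also have "\<dots> = exp K * K * (inverse (fact m) * K ^ m)" by (simp add: field_simps)
    finally have "cmod (exp w - poly S w) \<le> e" using m by linarith
    then show ?thesis using norm_triangle_ineq2[of "poly S w" "exp w"] by (simp add: norm_minus_commute)
  qed
  ultimately show ?thesis by blast
next
  case False
  then show ?thesis by (intro exI[of _ 1]) (auto dest: order_trans[OF norm_ge_zero])
qed

context half_dual_pair
begin

text \<open>Divide by the outer function \<open>exp (P - P(0))\<close>, where \<open>Re P\<close> majorises the logarithm of the norm on the
circle. By Jensen's inequality \<open>exp (Re P(0))\<close> is at most about the root of the mean square, and this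
bounds the quotient everywhere on the circle.\<close>

lemma factorization_sup:
  assumes M: "vnorm n x < M"
  shows "\<exists>Q. (\<forall>k. poly (Q k) 0 = x k) \<and> (\<forall>b t. 0 \<le> t \<longrightarrow> t \<le> pi \<longrightarrow> arc_norm b (poly_vec Q (arc_point b t)) \<le> M)"
proof -
  define D where "D = (vnorm n x)\<^sup>2"
  have "((\<lambda>e. exp e * sqrt (D + 2 * e) + e) \<longlongrightarrow> exp 0 * sqrt (D + 2 * 0) + 0) (at_right 0)"
    by (intro tendsto_intros)
  then have "((\<lambda>e. exp e * sqrt (D + 2 * e) + e) \<longlongrightarrow> vnorm n x) (at_right 0)"
    by (simp add: D_def)
  then have "\<forall>\<^sub>F e in at_right 0. exp e * sqrt (D + 2 * e) + e < M"
    using M by (intro order_tendstoD(2))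
  then have "\<forall>\<^sub>F e in at_right (0::real). exp e * sqrt (D + 2 * e) + e < M \<and> 0 < e"
    using eventually_at_right_less[of "0::real"] by (rule eventually_conj)
  then obtain e where eM: "exp e * sqrt (D + 2 * e) + e < M" and e: "0 < e"
    using eventually_happens'[OF trivial_limit_at_right_real] by blast
  obtain Q where Q0: "\<And>k. poly (Q k) 0 = x k"
    and Q: "circle_mean (\<lambda>b t. (arc_norm b (poly_vec Q (arc_point b t)))\<^sup>2) \<le> D + e"
    using factorization_L2[OF e, of x] unfolding D_def by blast
  have arc_norm_nonneg: "0 \<le> arc_norm b v" for b v using fin_norm.N_nonneg[OF fin_norm_arc_norm] .
  define G where "G b t = e + (arc_norm b (poly_vec Q (arc_point b t)))\<^sup>2" for b t
  have G_pos: "0 < G b t" for b t unfolding G_def using e by (simp add: add_pos_nonneg)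
  have G_ac: "arc_cont G"
    unfolding G_def[abs_def] by (intro arc_cont_intros arc_cont_arc_norm arc_vec_poly)
  have lnG_ac: "arc_cont (\<lambda>b t. ln (G b t) / 2)"
  proof (rule arc_cont_divide, rule arc_contI)
    fix b show "continuous_on {0..pi} (\<lambda>t. ln (G b t))"
      using G_pos[of b] by (intro continuous_on_ln arc_contD[OF G_ac]) (auto simp: less_imp_neq[symmetric])
  qed
  obtain P where P: "\<And>b t. 0 \<le> t \<Longrightarrow> t \<le> pi \<Longrightarrow> ln (G b t) / 2 \<le> Re (poly P (arc_point b t))"
    and P0: "Re (poly P 0) \<le> circle_mean (\<lambda>b t. ln (G b t) / 2) + e"
    using trig_majorant[OF lnG_ac e] by blast
  define m where "m = D + 2 * e"
  have m: "0 < m" unfolding m_def D_def using e by (simp add: add_nonneg_pos)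
  \<comment> \<open>Jensen's inequality for the concave logarithm, from its tangent at \<open>m\<close>.\<close>
  have "circle_mean (\<lambda>b t. ln (G b t) / 2) \<le> ln m / 2"
  proof -
    have "circle_mean (\<lambda>b t. ln (G b t) / 2) \<le> circle_mean (\<lambda>b t. (ln m / 2 - 1 / 2) + 1 / (2 * m) * G b t)"
    proof (rule circle_mean_mono[OF lnG_ac])
      show "arc_cont (\<lambda>b t. (ln m / 2 - 1 / 2) + 1 / (2 * m) * G b t)"
        by (intro arc_cont_intros G_ac)
      fix b t
      have "ln (G b t / m) \<le> G b t / m - 1" using G_pos[of b t] m by (intro ln_le_minus_one) simp
      then have "ln (G b t) - ln m \<le> G b t / m - 1" using G_pos[of b t] m by (simp add: ln_div)
      then show "ln (G b t) / 2 \<le> (ln m / 2 - 1 / 2) + 1 / (2 * m) * G b t" by simp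
    qed
    also have "\<dots> = (ln m / 2 - 1 / 2) + 1 / (2 * m) * circle_mean G"
      unfolding circle_mean_cmult[symmetric] by (subst circle_mean_add) (intro arc_cont_intros G_ac | simp)+
    also have "circle_mean G \<le> m"
    proof -
      have "circle_mean G = e + circle_mean (\<lambda>b t. (arc_norm b (poly_vec Q (arc_point b t)))\<^sup>2)"
        unfolding G_def[abs_def] by (subst circle_mean_add) (intro arc_cont_intros arc_cont_arc_norm arc_vec_poly | simp)+
      then show ?thesis using Q by (simp add: m_def)
    qed
    finally show ?thesis using m by (simp add: field_simps)
  qed
  then have expP0: "exp (Re (poly P 0)) \<le> exp e * sqrt m"
  proof -
    assume "circle_mean (\<lambda>b t. ln (G b t) / 2) \<le> ln m / 2"
    then have "exp (Re (poly P 0)) \<le> exp (ln m / 2 + e)" using P0 by simp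
    also have "\<dots> = exp e * sqrt m"
      using m by (simp add: exp_add ln_sqrt[symmetric] mult.commute)
    finally show ?thesis .
  qed
  define W where "W = [:poly P 0:] - P"
  obtain R where R: "R > 0" "\<And>b t. 0 \<le> t \<Longrightarrow> t \<le> pi \<Longrightarrow> norm (arc_norm b (poly_vec Q (arc_point b t))) \<le> R"
    using arc_cont_bounded[OF arc_cont_arc_norm[OF arc_vec_poly]] by blast
  obtain K where K: "\<And>b t. 0 \<le> t \<Longrightarrow> t \<le> pi \<Longrightarrow> cmod (poly W (arc_point b t)) \<le> K"
    using arc_cont_bounded[OF arc_cont_poly[of W]] by blast
  obtain S where S0: "poly S 0 = 1" and S: "\<And>w. cmod w \<le> K \<Longrightarrow> cmod (poly S w) \<le> cmod (exp w) + e / R"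
    using exp_approx[of "e / R" K] e R(1) by auto
  define Q' where "Q' k = pcompose S W * Q k" for k
  have Q': "poly_vec Q' z = (\<lambda>k. poly S (poly W z) * poly_vec Q z k)" for z
    by (simp add: fun_eq_iff poly_vec_def Q'_def poly_pcompose)
  have "arc_norm b (poly_vec Q' (arc_point b t)) \<le> M" if t: "0 \<le> t" "t \<le> pi" for b t
  proof -
    let ?N = "arc_norm b (poly_vec Q (arc_point b t))" and ?w = "poly W (arc_point b t)"
    have "arc_norm b (poly_vec Q' (arc_point b t)) = cmod (poly S ?w) * ?N"
      unfolding Q' by (rule fin_norm.hom[OF fin_norm_arc_norm])
    also have "\<dots> \<le> (cmod (exp ?w) + e / R) * ?N"
      using S[OF K[OF t, of b]] arc_norm_nonneg by (intro mult_right_mono) auto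
    also have "\<dots> = cmod (exp ?w) * ?N + e / R * ?N" by (simp add: distrib_right)
    also have "e / R * ?N \<le> e / R * R"
      using R e by (intro mult_left_mono) (use R(2)[OF t, of b] in auto)
    also have "e / R * R = e" using R by simp
    also have "cmod (exp ?w) * ?N \<le> exp e * sqrt m"
    proof -
      have "?N \<le> sqrt (G b t)" unfolding G_def using e by (intro real_le_rsqrt) simp
      also have "sqrt (G b t) = exp (ln (G b t) / 2)"
        using G_pos[of b t] by (simp add: ln_sqrt[symmetric])
      also have "\<dots> \<le> exp (Re (poly P (arc_point b t)))" using P[OF t, of b] by simp
      finally have "cmod (exp ?w) * ?N \<le> cmod (exp ?w) * exp (Re (poly P (arc_point b t)))"
        by (intro mult_left_mono) auto
      also have "\<dots> = exp (Re (poly P 0))" by (simp add: W_def norm_exp_eq_Re mult_exp_exp)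
      finally show ?thesis using expP0 by linarith
    qed
    finally show ?thesis using eM unfolding m_def by linarith
  qed
  moreover have "poly (Q' k) 0 = x k" for k
    by (simp add: Q'_def poly_pcompose W_def S0 Q0)
  ultimately show ?thesis by blast
qed

end

section \<open>Maximum principles on the disc and the strip\<close>

text \<open>Averages over roots of unity recover the coefficients and values of polynomials exactly, so Cauchy
estimates and the maximum principle for vector-valued polynomials need only the triangle inequality.\<close>

definition root_of_unity :: "nat \<Rightarrow> complex" where
  "root_of_unity N = cis (2 * pi / real N)"

lemma root_of_unity_power: "root_of_unity N ^ m = cis (2 * pi * real m / real N)"
  by (simp add: root_of_unity_def Complex.DeMoivre mult.commute)

lemma norm_root_of_unity [simp]: "cmod (root_of_unity N ^ m) = 1"
  by (simp add: root_of_unity_power)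

lemma root_of_unity_power_ne_1:
  assumes "0 < j" "j < N"
  shows "root_of_unity N ^ j \<noteq> 1"
proof
  assume "root_of_unity N ^ j = 1"
  then have "cos (2 * pi * real j / real N) = 1"
    by (metis root_of_unity_power cis.sel(1) one_complex.sel(1))
  then obtain i :: int where "2 * pi * real j / real N = real_of_int i * 2 * pi"
    unfolding cos_one_2pi_int by blast
  then have "real j = real_of_int i * real N" using assms by (simp add: field_simps)
  then have "int j = i * int N" by (metis of_int_mult of_int_of_nat_eq of_int_eq_iff)
  then have "int N dvd int j" by simp
  then show False using assms by (auto dest: zdvd_imp_le)
qed

lemma sum_root_of_unity:
  assumes "0 < N" "i < N" "j < N"
  shows "(\<Sum>m<N. cnj (root_of_unity N ^ m) ^ j * (root_of_unity N ^ m) ^ i) = (if i = j then of_nat N else 0)"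
proof -
  let ?w = "root_of_unity N"
  have cn: "cnj ?w * ?w = 1" by (simp add: root_of_unity_def cis_cnj cis_mult)
  define c where "c = cnj ?w ^ j * ?w ^ i"
  have pow: "cnj (?w ^ m) ^ j * (?w ^ m) ^ i = c ^ m" for m
    by (simp add: c_def power_mult_distrib mult.commute flip: power_mult)
  show ?thesis
  proof (cases "i = j")
    case True
    then have "c = 1" using cn by (simp add: c_def flip: power_mult_distrib)
    then show ?thesis unfolding pow using True by simp
  next
    case False
    have wN: "?w ^ N = 1" using assms by (simp add: root_of_unity_power)
    have cN: "c ^ N = 1"
    proof -
      have "c ^ N = cnj (?w ^ N) ^ j * (?w ^ N) ^ i"
        by (simp add: c_def power_mult_distrib mult.commute flip: power_mult)
      then show ?thesis by (simp add: wN)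
    qed
    have "c \<noteq> 1"
    proof
      assume c1: "c = 1"
      have *: "?w ^ j * c = ?w ^ i"
      proof -
        have "?w ^ j * c = (cnj ?w * ?w) ^ j * ?w ^ i" by (simp add: c_def power_mult_distrib)
        then show ?thesis by (simp add: cn)
      qed
      then have eq: "?w ^ j = ?w ^ i" using c1 by simp
      have nz: "?w \<noteq> 0" by (simp add: root_of_unity_def)
      show False
      proof (cases "i < j")
        case True
        have "?w ^ j = ?w ^ i * ?w ^ (j - i)" using True by (simp flip: power_add)
        then have "?w ^ (j - i) = 1" using eq nz by simp
        then show False using root_of_unity_power_ne_1[of "j - i" N] True assms by auto
      next
        case ge: False
        then have "?w ^ i = ?w ^ j * ?w ^ (i - j)" by (simp flip: power_add)
        then have "?w ^ (i - j) = 1" using eq nz by simp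
        then show False using root_of_unity_power_ne_1[of "i - j" N] ge False assms by auto
      qed
    qed
    then have "(\<Sum>m<N. c ^ m) = 0" using cN by (simp add: geometric_sum)
    then show ?thesis unfolding pow using False by simp
  qed
qed

lemma coeff_average:
  assumes "0 < N" "degree p < N" "j < N"
  shows "coeff p j = (\<Sum>m<N. cnj (root_of_unity N ^ m) ^ j * poly p (root_of_unity N ^ m)) / of_nat N"
proof -
  let ?w = "root_of_unity N"
  have "(\<Sum>m<N. cnj (?w ^ m) ^ j * poly p (?w ^ m))
     = (\<Sum>m<N. \<Sum>i\<le>degree p. coeff p i * (cnj (?w ^ m) ^ j * (?w ^ m) ^ i))"
    by (simp add: poly_altdef sum_distrib_left mult.left_commute)
  also have "\<dots> = (\<Sum>i\<le>degree p. \<Sum>m<N. coeff p i * (cnj (?w ^ m) ^ j * (?w ^ m) ^ i))"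
    by (rule sum.swap)
  also have "\<dots> = (\<Sum>i\<le>degree p. coeff p i * (if i = j then of_nat N else 0))"
    unfolding sum_distrib_left[symmetric]
    by (intro sum.cong refl, subst sum_root_of_unity) (use assms in auto)
  also have "\<dots> = coeff p j * of_nat N"
    by (cases "j \<le> degree p") (simp_all add: if_distrib sum.delta' coeff_eq_0 cong: if_cong)
  finally show ?thesis using assms by simp
qed

lemma value_average:
  assumes "0 < N" "degree p < N"
  shows "poly p z = (\<Sum>m<N. poly p (z + of_real r * root_of_unity N ^ m)) / of_nat N"
proof -
  let ?q = "pcompose p [:z, of_real r:]"
  have "degree ?q \<le> degree p * degree [:z, complex_of_real r:]" by (rule degree_pcompose_le)
  also have "\<dots> \<le> degree p" by simp
  finally have deg: "degree ?q < N" using assms by linarith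
  have "poly p z = coeff ?q 0" by (simp add: poly_0_coeff_0[symmetric] poly_pcompose)
  also have "\<dots> = (\<Sum>m<N. poly ?q (root_of_unity N ^ m)) / of_nat N"
    using coeff_average[OF assms(1) deg, of 0] assms by simp
  finally show ?thesis by (simp add: poly_pcompose mult.commute)
qed

text \<open>A maximum point of largest modulus cannot lie inside: all points of the average around it would be
maximum points too, and some root of unity points outward.\<close>

lemma disc_maximum_principle:
  fixes s :: "complex \<Rightarrow> real"
  assumes cont: "continuous_on (cball 0 1) s" and N: "2 \<le> N"
    and mean: "\<And>z r. 0 \<le> r \<Longrightarrow> cmod z + r \<le> 1 \<Longrightarrow>
        s z \<le> (\<Sum>m<N. s (z + of_real r * root_of_unity N ^ m)) / real N"
    and bd: "\<And>z. cmod z = 1 \<Longrightarrow> s z \<le> M"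
    and z: "cmod z \<le> 1"
  shows "s z \<le> M"
proof -
  have "\<exists>w\<in>cball 0 1. \<forall>y\<in>cball 0 1. s y \<le> s w"
    by (rule continuous_attains_sup[OF _ _ cont]) auto
  then obtain w where w: "w \<in> cball 0 1" "\<And>y. y \<in> cball 0 1 \<Longrightarrow> s y \<le> s w" by blast
  define T where "T = {y \<in> cball 0 1. s y = s w}"
  have "closed T"
    unfolding T_def by (intro continuous_closed_preimage_constant cont) auto
  moreover have "bounded T" unfolding T_def by (rule bounded_subset[OF bounded_cball[of 0 1]]) auto
  ultimately have "compact T" by (simp add: compact_eq_bounded_closed)
  moreover have "T \<noteq> {}" using w by (auto simp: T_def)
  ultimately have "\<exists>y\<in>T. \<forall>y'\<in>T. cmod y' \<le> cmod y"
    by (intro continuous_attains_sup continuous_intros)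
  then obtain y where y: "y \<in> T" "\<And>y'. y' \<in> T \<Longrightarrow> cmod y' \<le> cmod y" by blast
  have "cmod y = 1"
  proof (rule ccontr)
    assume "cmod y \<noteq> 1"
    then have y1: "cmod y < 1" using y(1) by (auto simp: T_def)
    define r where "r = 1 - cmod y"
    have r: "0 < r" "cmod y + r \<le> 1" using y1 by (auto simp: r_def)
    let ?p = "\<lambda>m. y + of_real r * root_of_unity N ^ m"
    have inb: "?p m \<in> cball 0 1" for m
      using norm_triangle_ineq[of y "of_real r * root_of_unity N ^ m"] r by (simp add: norm_mult)
    have "(\<Sum>m<N. Re (cnj y * root_of_unity N ^ m)) = Re (cnj y * (\<Sum>m<N. root_of_unity N ^ m))"
      by (simp add: sum_distrib_left)
    also have "(\<Sum>m<N. root_of_unity N ^ m) = 0"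
      using sum_root_of_unity[of N 1 0] N by simp
    finally have sum0: "(\<Sum>m<N. Re (cnj y * root_of_unity N ^ m)) = 0" by simp
    have "\<exists>m<N. 0 \<le> Re (cnj y * root_of_unity N ^ m)"
    proof (rule ccontr)
      assume "\<not> ?thesis"
      then have "(\<Sum>m<N. Re (cnj y * root_of_unity N ^ m)) < (\<Sum>m<N. 0)"
        using N by (intro sum_strict_mono) (auto simp: not_le lessThan_empty_iff)
      then show False using sum0 by simp
    qed
    then obtain m where m: "m < N" "0 \<le> Re (cnj y * root_of_unity N ^ m)" by blast
    have sy: "s y = s w" using y(1) by (simp add: T_def)
    have "s (?p m) = s w"
    proof (rule ccontr)
      assume "s (?p m) \<noteq> s w"
      then have "s (?p m) < s w" using w(2)[OF inb] by (simp add: less_le)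
      then have "(\<Sum>m<N. s (?p m)) < (\<Sum>m<N. s w)"
        using m w(2)[OF inb] by (intro sum_strict_mono_ex1) auto
      then have "(\<Sum>m<N. s (?p m)) / real N < s w" using N by (simp add: field_simps)
      then show False using mean[of r y] r sy by simp
    qed
    then have "?p m \<in> T" using inb by (simp add: T_def)
    then have "cmod (?p m) \<le> cmod y" by (rule y(2))
    then have "(cmod (?p m))\<^sup>2 \<le> (cmod y)\<^sup>2" by (intro power_mono) auto
    moreover have "(cmod (?p m))\<^sup>2 = (cmod y)\<^sup>2 + 2 * r * Re (cnj y * root_of_unity N ^ m) + r\<^sup>2"
    proof -
      let ?v = "root_of_unity N ^ m"
      have v: "(Re ?v)\<^sup>2 + (Im ?v)\<^sup>2 = 1"
        using norm_root_of_unity[of N m] by (simp add: cmod_def)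
      have "(cmod (y + of_real r * ?v))\<^sup>2 = (cmod y)\<^sup>2 + 2 * r * Re (cnj y * ?v) + r\<^sup>2 * ((Re ?v)\<^sup>2 + (Im ?v)\<^sup>2)"
        unfolding cmod_power2 by (simp add: power2_eq_square algebra_simps)
      then show ?thesis by (simp add: v)
    qed
    ultimately have "2 * r * Re (cnj y * root_of_unity N ^ m) + r\<^sup>2 \<le> 0" by linarith
    moreover have "0 \<le> 2 * r * Re (cnj y * root_of_unity N ^ m)" using m r by simp
    moreover have "0 < r\<^sup>2" using r by simp
    ultimately show False by linarith
  qed
  then have "s w \<le> M" using bd[of y] y(1) by (simp add: T_def)
  then show ?thesis using w(2)[of z] z by simp
qed

text \<open>The Gaussian factor \<open>exp (e * (z\<^sup>2 - 1))\<close> has modulus at most \<open>1\<close> on the strip and decays along it, so the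
maximum principle applies on a long rectangle.\<close>

lemma three_lines:
  assumes cont: "continuous_on strip F" and hol: "F holomorphic_on interior strip"
    and bdd: "\<And>z. z \<in> strip \<Longrightarrow> cmod (F z) \<le> B"
    and M: "\<And>t. cmod (F (Complex 0 t)) \<le> M" "\<And>t. cmod (F (Complex 1 t)) \<le> M"
  shows "cmod (F (1/2)) \<le> M"
proof -
  have M0: "0 \<le> M" using M(1)[of 0] norm_ge_zero order_trans by blast
  have step: "cmod (F (1/2)) * exp (- 3 / 4 * e) \<le> M + e" if e: "0 < e" for e :: real
  proof -
    define G where "G z = F z * exp (of_real e * (z\<^sup>2 - 1))" for z
    have Gn: "cmod (G z) = cmod (F z) * exp (e * ((Re z)\<^sup>2 - (Im z)\<^sup>2 - 1))" for z
      by (simp add: G_def norm_mult power2_eq_square)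
    obtain T where T: "0 < T" "\<And>y. T \<le> \<bar>y\<bar> \<Longrightarrow> \<bar>B\<bar> * exp (- e * y\<^sup>2) \<le> M + e"
    proof -
      define T where "T = 1 + \<bar>B\<bar> / (e * (M + e))"
      have "\<bar>B\<bar> * exp (- e * y\<^sup>2) \<le> M + e" if y: "T \<le> \<bar>y\<bar>" for y
      proof -
        have T1: "1 \<le> T" unfolding T_def using e M0 by simp
        have "\<bar>y\<bar> \<le> \<bar>y\<bar>\<^sup>2" using y T1 by (intro self_le_power) auto
        then have "\<bar>B\<bar> / (e * (M + e)) \<le> y\<^sup>2" using y unfolding T_def by simp
        then have "\<bar>B\<bar> \<le> y\<^sup>2 * (e * (M + e))" using e M0 by (subst (asm) pos_divide_le_eq) auto
        then have "\<bar>B\<bar> \<le> (M + e) * (e * y\<^sup>2)" by (simp only: mult_ac)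
        also have "\<dots> \<le> (M + e) * exp (e * y\<^sup>2)"
          using e M0 exp_ge_add_one_self[of "e * y\<^sup>2"] by (intro mult_left_mono) linarith+
        finally show ?thesis by (simp add: exp_minus field_simps)
      qed
      moreover have "0 < T" unfolding T_def using e M0 by (simp add: add_pos_nonneg)
      ultimately show ?thesis using that by blast
    qed
    define S where "S = cbox (Complex 0 (- T)) (Complex 1 T)"
    have S: "z \<in> S \<longleftrightarrow> 0 \<le> Re z \<and> Re z \<le> 1 \<and> - T \<le> Im z \<and> Im z \<le> T" for z
      by (auto simp: S_def in_cbox_complex_iff)
    have int: "interior S = {z. 0 < Re z \<and> Re z < 1 \<and> - T < Im z \<and> Im z < T}"
      by (auto simp: S_def interior_cbox in_box_complex_iff)
    have SS: "S \<subseteq> strip" by (auto simp: S strip_def)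
    have "cmod (G (1/2)) \<le> M + e"
    proof (rule maximum_modulus_frontier[of G S])
      have "G holomorphic_on interior strip"
        unfolding G_def by (intro holomorphic_intros hol)
      then show "G holomorphic_on interior S"
        using interior_mono[OF SS] by (rule holomorphic_on_subset)
      have "continuous_on strip G"
        unfolding G_def by (intro continuous_intros cont)
      then show "continuous_on (closure S) G"
        using SS by (simp add: S_def) (rule continuous_on_subset)
      show "bounded S" by (simp add: S_def)
      show "1 / 2 \<in> S" using T by (simp add: S)
      fix z assume "z \<in> frontier S"
      then have zS: "z \<in> S" and zi: "z \<notin> interior S"
        by (auto simp: frontier_def S_def)
      have Re_sq: "(Re z)\<^sup>2 \<le> 1" using zS by (auto simp: S intro: power_le_one)
      consider "Re z = 0" | "Re z = 1" | "\<bar>Im z\<bar> = T" using zS zi T(1) unfolding int S by fastforce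
      then show "cmod (G z) \<le> M + e"
      proof cases
        case 1
        have "cmod (F z) \<le> M" using M(1)[of "Im z"] 1 by (metis complex.collapse)
        have "e * ((Re z)\<^sup>2 - (Im z)\<^sup>2 - 1) \<le> 0" using Re_sq e by (intro mult_nonneg_nonpos) (simp, use zero_le_power2[of "Im z"] in linarith)
        then have "exp (e * ((Re z)\<^sup>2 - (Im z)\<^sup>2 - 1)) \<le> 1" by (subst exp_le_one_iff)
        with \<open>cmod (F z) \<le> M\<close> have "cmod (G z) \<le> M * 1" unfolding Gn using M0 by (intro mult_mono) auto
        then show ?thesis using e by simp
      next
        case 2
        have "cmod (F z) \<le> M" using M(2)[of "Im z"] 2 by (metis complex.collapse)
        have "e * ((Re z)\<^sup>2 - (Im z)\<^sup>2 - 1) \<le> 0" using Re_sq e by (intro mult_nonneg_nonpos) (simp, use zero_le_power2[of "Im z"] in linarith)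
        then have "exp (e * ((Re z)\<^sup>2 - (Im z)\<^sup>2 - 1)) \<le> 1" by (subst exp_le_one_iff)
        with \<open>cmod (F z) \<le> M\<close> have "cmod (G z) \<le> M * 1" unfolding Gn using M0 by (intro mult_mono) auto
        then show ?thesis using e by simp
      next
        case 3
        have "cmod (F z) \<le> \<bar>B\<bar>" using bdd[of z] zS SS by fastforce
        moreover have "exp (e * ((Re z)\<^sup>2 - (Im z)\<^sup>2 - 1)) \<le> exp (- e * (Im z)\<^sup>2)"
        proof -
          have "(Re z)\<^sup>2 \<le> 1" using zS by (auto simp: S intro: power_le_one)
          then have "e * ((Re z)\<^sup>2 - (Im z)\<^sup>2 - 1) \<le> e * (- (Im z)\<^sup>2)" using e by (intro mult_left_mono) auto
          then show ?thesis by simp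
        qed
        ultimately have "cmod (G z) \<le> \<bar>B\<bar> * exp (- e * (Im z)\<^sup>2)" unfolding Gn by (intro mult_mono) auto
        then show ?thesis using T(2)[of "Im z"] 3 by simp
      qed
    qed
    moreover have "cmod (G (1/2)) = cmod (F (1/2)) * exp (- 3 / 4 * e)"
      unfolding Gn by (simp add: power2_eq_square algebra_simps)
    ultimately show ?thesis by simp
  qed
  show ?thesis
  proof (rule tendsto_le[OF trivial_limit_at_right_real])
    have "((\<lambda>e. M + e) \<longlongrightarrow> M + 0) (at_right 0)" by (intro tendsto_intros)
    then show "((\<lambda>e. M + e) \<longlongrightarrow> M) (at_right 0)" by simp
    have "((\<lambda>e. cmod (F (1/2)) * exp (- 3 / 4 * e)) \<longlongrightarrow> cmod (F (1/2)) * exp (- 3 / 4 * 0)) (at_right 0)"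
      by (intro tendsto_intros)
    then show "((\<lambda>e. cmod (F (1/2)) * exp (- 3 / 4 * e)) \<longlongrightarrow> cmod (F (1/2))) (at_right 0)" by simp
    show "\<forall>\<^sub>F e in at_right 0. cmod (F (1/2)) * exp (- 3 / 4 * e) \<le> M + e"
      using eventually_at_right_less[of "0::real"] by eventually_elim (rule step)
  qed
qed

lemma interior_strip: "interior strip = {z. 0 < Re z \<and> Re z < 1}"
proof -
  have eq: "strip = {z. 0 \<le> Re z} \<inter> {z. Re z \<le> 1}" by (auto simp: strip_def)
  have int: "interior {z. 0 \<le> Re z} = {z. 0 < Re z}" "interior {z. Re z \<le> 1} = {z. Re z < 1}"
    using interior_halfspace_ge[of "1::complex" 0] interior_halfspace_le[of "1::complex" 1] by simp_all
  show ?thesis unfolding eq interior_Int int by auto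
qed

text \<open>Since \<open>u\<close> is paired with its reflection, the sum is analytic although it contains conjugates, and at
the fixed point \<open>1/2\<close> it is a sum of squares.\<close>

lemma reflection_bound:
  fixes u :: "complex \<Rightarrow> nat \<Rightarrow> complex"
  assumes cont: "\<And>k. k < n \<Longrightarrow> continuous_on strip (\<lambda>z. u z k)"
    and hol: "\<And>k. k < n \<Longrightarrow> (\<lambda>z. u z k) holomorphic_on interior strip"
    and bdd: "\<And>k z. k < n \<Longrightarrow> z \<in> strip \<Longrightarrow> cmod (u z k) \<le> B"
    and M: "\<And>t. cmod (\<Sum>k<n. u (Complex 0 t) k * cnj (u (Complex 1 t) k)) \<le> M"
  shows "(\<Sum>k<n. (cmod (u (1/2) k))\<^sup>2) \<le> M"
proof -
  define F where "F z = (\<Sum>k<n. u z k * cnj (u (1 - cnj z) k))" for z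
  have refl: "1 - cnj z \<in> strip" if "z \<in> strip" for z using that by (simp add: strip_def)
  have refl_int: "1 - cnj z \<in> interior strip" if "z \<in> interior strip" for z
    using that by (simp add: interior_strip)
  have "cmod (F (1/2)) \<le> M"
  proof (rule three_lines)
    show "continuous_on strip F"
      unfolding F_def
    proof (intro continuous_intros cont)
      fix k assume "k \<in> {..<n}"
      then show "continuous_on strip (\<lambda>z. u (1 - cnj z) k)"
        using refl by (intro continuous_on_compose2[OF cont] continuous_intros) auto
    qed auto
    have "(\<lambda>z. cnj (u (1 - cnj z) k)) holomorphic_on interior strip" if "k < n" for k
    proof -
      have "(cnj \<circ> (\<lambda>z. u (1 - z) k) \<circ> cnj) holomorphic_on interior strip"
      proof (rule holomorphic_on_compose_cnj_cnj)
        have "((\<lambda>z. u z k) \<circ> (\<lambda>z. 1 - z)) holomorphic_on cnj ` interior strip"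
          using refl_int
          by (intro holomorphic_on_compose_gen[OF _ hol[OF that]] holomorphic_intros) auto
        then show "(\<lambda>z. u (1 - z) k) holomorphic_on cnj ` interior strip" by (simp add: o_def)
      qed simp
      then show ?thesis by (simp add: o_def)
    qed
    then show "F holomorphic_on interior strip"
      unfolding F_def by (intro holomorphic_intros hol) auto
    show "cmod (F z) \<le> real n * (B * B)" if z: "z \<in> strip" for z
    proof -
      have "cmod (F z) \<le> (\<Sum>k<n. cmod (u z k) * cmod (u (1 - cnj z) k))"
        unfolding F_def by (rule order_trans[OF norm_sum]) (simp add: norm_mult)
      also have "\<dots> \<le> (\<Sum>k<n. B * B)"
      proof (intro sum_mono mult_mono)
        fix k assume "k \<in> {..<n}"
        then have k: "k < n" by simp
        show "cmod (u z k) \<le> B" by (rule bdd[OF k z])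
        then show "0 \<le> B" using norm_ge_zero order_trans by blast
        show "cmod (u (1 - cnj z) k) \<le> B" by (rule bdd[OF k refl[OF z]])
      qed auto
      finally show ?thesis by simp
    qed
    have c0: "1 - cnj (Complex 0 t) = Complex 1 t" and c1: "1 - cnj (Complex 1 t) = Complex 0 t" for t
      by (simp_all add: complex_eq_iff)
    show "cmod (F (Complex 0 t)) \<le> M" for t unfolding F_def c0 by (rule M)
    show "cmod (F (Complex 1 t)) \<le> M" for t
    proof -
      have "F (Complex 1 t) = cnj (\<Sum>k<n. u (Complex 0 t) k * cnj (u (Complex 1 t) k))"
        unfolding F_def c1 by (simp add: mult.commute)
      then show ?thesis using M[of t] by (simp only: complex_mod_cnj)
    qed
  qed
  moreover have "F (1/2) = of_real (\<Sum>k<n. (cmod (u (1/2) k))\<^sup>2)"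
    by (simp add: F_def flip: complex_norm_square)
  ultimately have "\<bar>\<Sum>k<n. (cmod (u (1/2) k))\<^sup>2\<bar> \<le> M" by (simp only: norm_of_real)
  then show ?thesis by (rule order_trans[OF abs_ge_self])
qed

section \<open>Banach spaces of sequences and their Calderon space\<close>

definition trunc :: "nat \<Rightarrow> (nat \<Rightarrow> complex) \<Rightarrow> nat \<Rightarrow> complex" where
  "trunc n x k = (if k < n then x k else 0)"

definition unit_seq :: "nat \<Rightarrow> nat \<Rightarrow> complex" where
  "unit_seq j k = (if k = j then 1 else 0)"

lemma trunc_eq_sum: "trunc n a = (\<lambda>k. \<Sum>j<n. a j * unit_seq j k)"
  by (simp add: fun_eq_iff trunc_def unit_seq_def if_distrib sum.delta' cong: if_cong)

text \<open>The last assumption expresses completeness: absolutely convergent series converge coordinatewise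
within the space. It includes the triangle inequality and closure under addition, as series with
finitely many nonzero terms. The factor \<open>2\<close> is the bound for the coordinate functionals of a monotone
normalised basis.\<close>

locale seq_space =
  fixes V :: "(nat \<Rightarrow> complex) nspace"
  assumes scale_mem: "x \<in> elems V \<Longrightarrow> (\<lambda>k. c * x k) \<in> elems V"
    and nrm_scale: "x \<in> elems V \<Longrightarrow> nrm V (\<lambda>k. c * x k) = cmod c * nrm V x"
    and nrm_coord: "x \<in> elems V \<Longrightarrow> cmod (x k) \<le> 2 * nrm V x"
    and elems_nonempty: "elems V \<noteq> {}"
    and suminf_mem_le: "(\<And>j. y j \<in> elems V) \<Longrightarrow> summable (\<lambda>j. nrm V (y j)) \<Longrightarrow>
      (\<lambda>k. \<Sum>j. y j k) \<in> elems V \<and> nrm V (\<lambda>k. \<Sum>j. y j k) \<le> (\<Sum>j. nrm V (y j))"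
begin

lemma nrm_nonneg: "x \<in> elems V \<Longrightarrow> 0 \<le> nrm V x"
  using nrm_coord[of x 0] norm_ge_zero[of "x 0"] by linarith

lemma zero_mem: "(\<lambda>k. 0) \<in> elems V" and nrm_zero: "nrm V (\<lambda>k. 0) = 0"
proof -
  obtain x where x: "x \<in> elems V" using elems_nonempty by blast
  show "(\<lambda>k. 0) \<in> elems V" "nrm V (\<lambda>k. 0) = 0"
    using scale_mem[OF x, of 0] nrm_scale[OF x, of 0] by simp_all
qed

lemma sum_mem_le:
  assumes "finite I" "\<And>i. i \<in> I \<Longrightarrow> f i \<in> elems V"
  shows "(\<lambda>k. \<Sum>i\<in>I. f i k) \<in> elems V" "nrm V (\<lambda>k. \<Sum>i\<in>I. f i k) \<le> (\<Sum>i\<in>I. nrm V (f i))"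
proof -
  obtain g where g: "bij_betw g {..<card I} I"
    using ex_bij_betw_nat_finite[OF assms(1)] by (metis atLeast0LessThan)
  define y where "y j = (if j < card I then f (g j) else (\<lambda>k. 0))" for j
  have gI: "g j \<in> I" if "j < card I" for j using g that by (auto dest: bij_betwE)
  have y: "y j \<in> elems V" for j using assms(2) gI zero_mem by (simp add: y_def)
  have z: "j \<notin> {..<card I} \<Longrightarrow> y j k = 0" "j \<notin> {..<card I} \<Longrightarrow> nrm V (y j) = 0" for j k
    by (simp_all add: y_def nrm_zero)
  have sm: "summable (\<lambda>j. nrm V (y j))" by (rule summable_finite[of "{..<card I}"]) (use z in auto)
  have "(\<Sum>j. y j k) = (\<Sum>i\<in>I. f i k)" for k
  proof -
    have "(\<Sum>j. y j k) = (\<Sum>j<card I. y j k)" by (rule suminf_finite) (use z in auto)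
    also have "\<dots> = (\<Sum>j<card I. f (g j) k)" by (simp add: y_def)
    also have "\<dots> = (\<Sum>i\<in>I. f i k)" by (rule sum.reindex_bij_betw[OF g])
    finally show ?thesis .
  qed
  moreover have "(\<Sum>j. nrm V (y j)) = (\<Sum>i\<in>I. nrm V (f i))"
  proof -
    have "(\<Sum>j. nrm V (y j)) = (\<Sum>j<card I. nrm V (y j))" by (rule suminf_finite) (use z in auto)
    also have "\<dots> = (\<Sum>j<card I. nrm V (f (g j)))" by (simp add: y_def)
    also have "\<dots> = (\<Sum>i\<in>I. nrm V (f i))" by (rule sum.reindex_bij_betw[OF g])
    finally show ?thesis .
  qed
  ultimately show "(\<lambda>k. \<Sum>i\<in>I. f i k) \<in> elems V" "nrm V (\<lambda>k. \<Sum>i\<in>I. f i k) \<le> (\<Sum>i\<in>I. nrm V (f i))"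
    using suminf_mem_le[OF y sm] by simp_all
qed

lemma add_mem: "x \<in> elems V \<Longrightarrow> y \<in> elems V \<Longrightarrow> (\<lambda>k. x k + y k) \<in> elems V"
  and nrm_add: "x \<in> elems V \<Longrightarrow> y \<in> elems V \<Longrightarrow> nrm V (\<lambda>k. x k + y k) \<le> nrm V x + nrm V y"
  using sum_mem_le[of UNIV "\<lambda>b. if b then x else y"] by (simp_all add: UNIV_bool add.commute)

lemma diff_mem: "x \<in> elems V \<Longrightarrow> y \<in> elems V \<Longrightarrow> (\<lambda>k. x k - y k) \<in> elems V"
  using add_mem[of x "\<lambda>k. - 1 * y k"] scale_mem[of y "-1"] by simp

lemma nrm_diff: "x \<in> elems V \<Longrightarrow> y \<in> elems V \<Longrightarrow> nrm V (\<lambda>k. x k - y k) \<le> nrm V x + nrm V y"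
  using nrm_add[of x "\<lambda>k. - 1 * y k"] scale_mem[of y "-1"] nrm_scale[of y "-1"] by simp

lemma nrm_minus_commute: "x \<in> elems V \<Longrightarrow> y \<in> elems V \<Longrightarrow> nrm V (\<lambda>k. x k - y k) = nrm V (\<lambda>k. y k - x k)"
  using nrm_scale[of "\<lambda>k. x k - y k" "-1"] diff_mem[of x y] by simp

lemma tendsto_nrm_add:
  assumes "((\<lambda>w. nrm V (u w)) \<longlongrightarrow> 0) F" "((\<lambda>w. nrm V (v w)) \<longlongrightarrow> 0) F"
    "\<forall>\<^sub>F w in F. u w \<in> elems V \<and> v w \<in> elems V"
  shows "((\<lambda>w. nrm V (\<lambda>k. u w k + v w k)) \<longlongrightarrow> 0) F"
proof (rule Lim_null_comparison)
  show "\<forall>\<^sub>F w in F. norm (nrm V (\<lambda>k. u w k + v w k)) \<le> nrm V (u w) + nrm V (v w)"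
    using assms(3) by eventually_elim (simp add: nrm_add add_mem nrm_nonneg)
  show "((\<lambda>w. nrm V (u w) + nrm V (v w)) \<longlongrightarrow> 0) F"
    using tendsto_add[OF assms(1,2)] by simp
qed

lemma tendsto_nrm_scale:
  assumes "((\<lambda>w. cmod (c w) * nrm V (u w)) \<longlongrightarrow> 0) F" "\<forall>\<^sub>F w in F. u w \<in> elems V"
  shows "((\<lambda>w. nrm V (\<lambda>k. c w * u w k)) \<longlongrightarrow> 0) F"
  using assms(1)
  by (rule Lim_transform_eventually) (use assms(2) in \<open>eventually_elim, simp add: nrm_scale\<close>)

lemma tendsto_coord:
  assumes "((\<lambda>w. nrm V (\<lambda>k. u w k - d k)) \<longlongrightarrow> 0) F" "\<forall>\<^sub>F w in F. u w \<in> elems V" "d \<in> elems V"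
  shows "((\<lambda>w. u w k) \<longlongrightarrow> d k) F"
proof (rule LIM_zero_cancel, rule Lim_null_comparison)
  show "\<forall>\<^sub>F w in F. norm (u w k - d k) \<le> 2 * nrm V (\<lambda>k. u w k - d k)"
    using assms(2) by eventually_elim (use nrm_coord[OF diff_mem[OF _ assms(3)]] in blast)
  show "((\<lambda>w. 2 * nrm V (\<lambda>k. u w k - d k)) \<longlongrightarrow> 0) F"
    using tendsto_mult_left[OF assms(1), of 2] by simp
qed

text \<open>Tannery's theorem for series in a sequence space.\<close>

lemma suminf_tendsto:
  assumes y: "\<And>j s. s \<in> T \<Longrightarrow> y j s \<in> elems V" and M: "\<And>j s. s \<in> T \<Longrightarrow> nrm V (y j s) \<le> M j"
    and sM: "summable M" and t: "t \<in> T"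
    and lim: "\<And>j. ((\<lambda>s. nrm V (\<lambda>k. y j s k - y j t k)) \<longlongrightarrow> 0) (at t within T)"
  shows "((\<lambda>s. nrm V (\<lambda>k. (\<Sum>j. y j s k) - (\<Sum>j. y j t k))) \<longlongrightarrow> 0) (at t within T)"
proof (cases "at t within T = bot")
  case False
  have ev: "\<forall>\<^sub>F s in at t within T. s \<in> T" by (simp add: eventually_at_filter)
  define a where "a j s = nrm V (\<lambda>k. y j s k - y j t k)" for j s
  have a: "0 \<le> a j s" "a j s \<le> 2 * M j" if "s \<in> T" for j s
    using nrm_nonneg[OF diff_mem[OF y[OF that] y[OF t]]] nrm_diff[OF y[OF that] y[OF t], of j j] M[OF that, of j] M[OF t, of j]
    by (simp_all add: a_def)
  have s2M: "summable (\<lambda>j. 2 * M j)" using sM by (rule summable_mult)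
  have "((\<lambda>s. \<Sum>j. a j s) \<longlongrightarrow> (\<Sum>j::nat. 0)) (at t within T)"
  proof -
    have "eventually (\<lambda>(j, s). norm (a j s) \<le> 2 * M j) (at_top \<times>\<^sub>F (at t within T))"
      unfolding eventually_prod_filter
      by (rule exI[of _ "\<lambda>_. True"], rule exI[of _ "\<lambda>s. s \<in> T"]) (use ev a in auto)
    moreover have "\<And>j. ((\<lambda>s. a j s) \<longlongrightarrow> 0) (at t within T)" using lim by (simp add: a_def)
    ultimately show ?thesis using tannerys_theorem[OF _ _ s2M False, of a "\<lambda>_. 0"] by blast
  qed
  then have lim0: "((\<lambda>s. \<Sum>j. a j s) \<longlongrightarrow> 0) (at t within T)" by simp
  show ?thesis
  proof (rule Lim_null_comparison[OF _ lim0])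
    show "\<forall>\<^sub>F s in at t within T. norm (nrm V (\<lambda>k. (\<Sum>j. y j s k) - (\<Sum>j. y j t k))) \<le> (\<Sum>j. a j s)"
      using ev
    proof eventually_elim
      case (elim s)
      have sy: "summable (\<lambda>j. y j s k)" if s: "s \<in> T" for s k
      proof (rule summable_comparison_test'[OF s2M])
        show "norm (y j s k) \<le> 2 * M j" if "0 \<le> j" for j
          using nrm_coord[OF y[OF s], of j k] M[OF s, of j] by linarith
      qed
      have sa: "summable (\<lambda>j. a j s)"
        by (rule summable_comparison_test'[OF s2M]) (use a[OF elim] in auto)
      have "(\<lambda>k. (\<Sum>j. y j s k) - (\<Sum>j. y j t k)) = (\<lambda>k. \<Sum>j. y j s k - y j t k)"
        using suminf_diff[OF sy[OF elim] sy[OF t]] by (simp add: fun_eq_iff)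
      then show ?case
        using suminf_mem_le[of "\<lambda>j k. y j s k - y j t k"] sa diff_mem[OF y[OF elim] y[OF t]] nrm_nonneg
        unfolding a_def by simp
    qed
  qed
qed simp

end

lemma fun_ops:
  "(x :: nat \<Rightarrow> complex) + y = (\<lambda>k. x k + y k)" "x - y = (\<lambda>k. x k - y k)"
  "c *\<^sub>C x = (\<lambda>k. c * x k)" "(0 :: nat \<Rightarrow> complex) = (\<lambda>k. 0)"
  by (simp_all add: fun_eq_iff scaleC_fun_def scaleC_complex_def)

lemma isCont_vertical_line:
  assumes "continuous_on UNIV f"
  shows "isCont (\<lambda>t. f (Complex a t)) t"
proof -
  have "continuous_on UNIV (\<lambda>t. of_real a + \<i> * of_real t)" by (intro continuous_intros)
  then have "continuous_on UNIV (\<lambda>t. f (of_real a + \<i> * of_real t))"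
    by (rule continuous_on_compose2[OF assms]) simp
  then show ?thesis by (simp add: Complex_eq continuous_on_eq_continuous_at)
qed

locale seq_pair = X0: seq_space X0 + X1: seq_space X1
  for X0 X1 :: "(nat \<Rightarrow> complex) nspace"
begin

abbreviation "S \<equiv> sum_space X0 X1"

lemma S_elems: "x \<in> elems S \<longleftrightarrow> (\<exists>x0\<in>elems X0. \<exists>x1\<in>elems X1. x = (\<lambda>k. x0 k + x1 k))"
  by (auto simp: sum_space_def fun_ops)

lemma S_nrm: "nrm S x = Inf {nrm X0 x0 + nrm X1 x1 | x0 x1. x0 \<in> elems X0 \<and> x1 \<in> elems X1 \<and> x = (\<lambda>k. x0 k + x1 k)}"
  by (simp add: sum_space_def fun_ops)

lemma S_set_bdd: "bdd_below {nrm X0 x0 + nrm X1 x1 | x0 x1. x0 \<in> elems X0 \<and> x1 \<in> elems X1 \<and> x = (\<lambda>k. x0 k + x1 k)}"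
  by (rule bdd_belowI[of _ 0]) (auto intro!: add_nonneg_nonneg X0.nrm_nonneg X1.nrm_nonneg)

lemma S_le:
  assumes "x0 \<in> elems X0" "x1 \<in> elems X1"
  shows "(\<lambda>k. x0 k + x1 k) \<in> elems S" "nrm S (\<lambda>k. x0 k + x1 k) \<le> nrm X0 x0 + nrm X1 x1"
proof -
  show "(\<lambda>k. x0 k + x1 k) \<in> elems S" using assms unfolding S_elems by blast
  show "nrm S (\<lambda>k. x0 k + x1 k) \<le> nrm X0 x0 + nrm X1 x1"
    unfolding S_nrm by (rule cInf_lower[OF _ S_set_bdd]) (use assms in blast)
qed

lemma S_le0: "x \<in> elems X0 \<Longrightarrow> x \<in> elems S" "x \<in> elems X0 \<Longrightarrow> nrm S x \<le> nrm X0 x"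
  using S_le[OF _ X1.zero_mem, of x] by (simp_all add: X1.nrm_zero)

lemma S_le1: "x \<in> elems X1 \<Longrightarrow> x \<in> elems S" "x \<in> elems X1 \<Longrightarrow> nrm S x \<le> nrm X1 x"
  using S_le[OF X0.zero_mem, of x] by (simp_all add: X0.nrm_zero)

lemma S_approx:
  assumes "x \<in> elems S" "0 < e"
  shows "\<exists>x0 x1. x0 \<in> elems X0 \<and> x1 \<in> elems X1 \<and> x = (\<lambda>k. x0 k + x1 k) \<and> nrm X0 x0 + nrm X1 x1 < nrm S x + e"
proof -
  let ?A = "{nrm X0 x0 + nrm X1 x1 | x0 x1. x0 \<in> elems X0 \<and> x1 \<in> elems X1 \<and> x = (\<lambda>k. x0 k + x1 k)}"
  have "?A \<noteq> {}" using assms(1) unfolding S_elems by blast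
  moreover have "Inf ?A < nrm S x + e" using assms(2) by (simp add: S_nrm)
  ultimately show ?thesis using cInf_lessD[of ?A "nrm S x + e"] by blast
qed

lemma S_greatest:
  assumes "x \<in> elems S"
    "\<And>x0 x1. x0 \<in> elems X0 \<Longrightarrow> x1 \<in> elems X1 \<Longrightarrow> x = (\<lambda>k. x0 k + x1 k) \<Longrightarrow> B \<le> nrm X0 x0 + nrm X1 x1"
  shows "B \<le> nrm S x"
  unfolding S_nrm by (rule cInf_greatest) (use assms in \<open>auto simp: S_elems\<close>)

lemma S_scale_le:
  assumes "x \<in> elems S"
  shows "(\<lambda>k. c * x k) \<in> elems S" "nrm S (\<lambda>k. c * x k) \<le> cmod c * nrm S x"
proof -
  have *: "(\<lambda>k. c * x k) \<in> elems S \<and> nrm S (\<lambda>k. c * x k) \<le> cmod c * (nrm X0 x0 + nrm X1 x1)"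
    if "x0 \<in> elems X0" "x1 \<in> elems X1" "x = (\<lambda>k. x0 k + x1 k)" for x0 x1
    using S_le[OF X0.scale_mem[OF that(1), of c] X1.scale_mem[OF that(2), of c]] that
    by (simp add: X0.nrm_scale X1.nrm_scale distrib_left)
  then show "(\<lambda>k. c * x k) \<in> elems S" using assms unfolding S_elems by blast
  show "nrm S (\<lambda>k. c * x k) \<le> cmod c * nrm S x"
  proof (cases "c = 0")
    case True
    then show ?thesis using * assms unfolding S_elems by fastforce
  next
    case False
    have "nrm S (\<lambda>k. c * x k) / cmod c \<le> nrm S x"
      by (rule S_greatest[OF assms]) (use * False in \<open>simp add: field_simps\<close>)
    then show ?thesis using False by (simp add: field_simps)
  qed
qed

sublocale S: seq_space S
proof
  fix x c assume x: "x \<in> elems S"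
  show "(\<lambda>k. c * x k) \<in> elems S" by (rule S_scale_le[OF x])
  have nn: "0 \<le> nrm S x"
    by (rule S_greatest[OF x]) (intro add_nonneg_nonneg X0.nrm_nonneg X1.nrm_nonneg)
  show "nrm S (\<lambda>k. c * x k) = cmod c * nrm S x"
  proof (cases "c = 0")
    case True
    have "nrm S (\<lambda>k. 0) \<le> 0" using S_scale_le(2)[OF x, of 0] by simp
    moreover have "0 \<le> nrm S (\<lambda>k. 0)"
      by (rule S_greatest) (use S_scale_le(1)[OF x, of 0] in \<open>auto intro!: add_nonneg_nonneg X0.nrm_nonneg X1.nrm_nonneg\<close>)
    ultimately show ?thesis using True by simp
  next
    case False
    have "nrm S x \<le> cmod (1 / c) * nrm S (\<lambda>k. c * x k)"
      using S_scale_le(2)[OF S_scale_le(1)[OF x, of c], of "1 / c"] False by simp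
    then have "cmod c * nrm S x \<le> nrm S (\<lambda>k. c * x k)" using False by (simp add: norm_divide field_simps)
    then show ?thesis using S_scale_le(2)[OF x, of c] by simp
  qed
  fix k
  have "cmod (x k) / 2 \<le> nrm S x"
  proof (rule S_greatest[OF x])
    fix x0 x1 assume a: "x0 \<in> elems X0" "x1 \<in> elems X1" "x = (\<lambda>k. x0 k + x1 k)"
    show "cmod (x k) / 2 \<le> nrm X0 x0 + nrm X1 x1"
      using X0.nrm_coord[OF a(1), of k] X1.nrm_coord[OF a(2), of k] norm_triangle_ineq[of "x0 k" "x1 k"] a(3)
      by simp
  qed
  then show "cmod (x k) \<le> 2 * nrm S x" by simp
next
  show "elems S \<noteq> {}" using S_le0 X0.zero_mem by blast
next
  fix y :: "nat \<Rightarrow> nat \<Rightarrow> complex"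
  assume y: "\<And>j. y j \<in> elems S" and sm: "summable (\<lambda>j. nrm S (y j))"
  have main: "(\<lambda>k. \<Sum>j. y j k) \<in> elems S \<and> nrm S (\<lambda>k. \<Sum>j. y j k) \<le> (\<Sum>j. nrm S (y j)) + e" if e: "0 < e" for e
  proof -
    have "\<exists>x0 x1. x0 \<in> elems X0 \<and> x1 \<in> elems X1 \<and> y j = (\<lambda>k. x0 k + x1 k)
        \<and> nrm X0 x0 + nrm X1 x1 < nrm S (y j) + e * (1/2) ^ Suc j" for j
      by (rule S_approx[OF y]) (use e in simp)
    then have "\<forall>j. \<exists>p. fst p \<in> elems X0 \<and> snd p \<in> elems X1 \<and> y j = (\<lambda>k. fst p k + snd p k)
        \<and> nrm X0 (fst p) + nrm X1 (snd p) < nrm S (y j) + e * (1/2) ^ Suc j"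
      by fastforce
    from choice[OF this] obtain p where p: "\<forall>j. fst (p j) \<in> elems X0 \<and> snd (p j) \<in> elems X1 \<and>
        y j = (\<lambda>k. fst (p j) k + snd (p j) k) \<and> nrm X0 (fst (p j)) + nrm X1 (snd (p j)) < nrm S (y j) + e * (1/2) ^ Suc j" ..
    define a where "a j = fst (p j)" for j
    define b where "b j = snd (p j)" for j
    have ab: "a j \<in> elems X0" "b j \<in> elems X1" "y j = (\<lambda>k. a j k + b j k)"
      "nrm X0 (a j) + nrm X1 (b j) < nrm S (y j) + e * (1/2) ^ Suc j" for j
      using p unfolding a_def b_def by blast+
    have sg: "summable (\<lambda>j. nrm S (y j) + e * (1/2) ^ Suc j)"
      by (intro summable_add sm summable_mult sums_summable[OF power_half_series])
    have sa: "summable (\<lambda>j. nrm X0 (a j))"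
    proof (rule summable_comparison_test'[OF sg])
      show "norm (nrm X0 (a j)) \<le> nrm S (y j) + e * (1/2) ^ Suc j" if "0 \<le> j" for j
        using ab(4)[of j] X0.nrm_nonneg[OF ab(1)[of j]] X1.nrm_nonneg[OF ab(2)[of j]] by simp
    qed
    have sb: "summable (\<lambda>j. nrm X1 (b j))"
    proof (rule summable_comparison_test'[OF sg])
      show "norm (nrm X1 (b j)) \<le> nrm S (y j) + e * (1/2) ^ Suc j" if "0 \<le> j" for j
        using ab(4)[of j] X0.nrm_nonneg[OF ab(1)[of j]] X1.nrm_nonneg[OF ab(2)[of j]] by simp
    qed
    have sak: "summable (\<lambda>j. a j k)" for k
      by (rule summable_comparison_test'[OF summable_mult[OF sa, of 2]]) (rule X0.nrm_coord[OF ab(1)])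
    have sbk: "summable (\<lambda>j. b j k)" for k
      by (rule summable_comparison_test'[OF summable_mult[OF sb, of 2]]) (rule X1.nrm_coord[OF ab(2)])
    have eq: "(\<lambda>k. \<Sum>j. y j k) = (\<lambda>k. (\<Sum>j. a j k) + (\<Sum>j. b j k))"
      using suminf_add[OF sak sbk] by (simp add: fun_eq_iff ab(3))
    have A: "(\<lambda>k. \<Sum>j. a j k) \<in> elems X0" "nrm X0 (\<lambda>k. \<Sum>j. a j k) \<le> (\<Sum>j. nrm X0 (a j))"
      using X0.suminf_mem_le[OF ab(1) sa] by auto
    have B: "(\<lambda>k. \<Sum>j. b j k) \<in> elems X1" "nrm X1 (\<lambda>k. \<Sum>j. b j k) \<le> (\<Sum>j. nrm X1 (b j))"
      using X1.suminf_mem_le[OF ab(2) sb] by auto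
    have "(\<Sum>j. nrm X0 (a j)) + (\<Sum>j. nrm X1 (b j)) = (\<Sum>j. nrm X0 (a j) + nrm X1 (b j))"
      by (rule suminf_add[OF sa sb])
    also have "\<dots> \<le> (\<Sum>j. nrm S (y j) + e * (1/2) ^ Suc j)"
      by (intro suminf_le less_imp_le[OF ab(4)] summable_add sa sb sg)
    also have "\<dots> = (\<Sum>j. nrm S (y j)) + (\<Sum>j. e * (1/2) ^ Suc j)"
      by (intro suminf_add[symmetric] sm summable_mult sums_summable[OF power_half_series])
    also have "(\<Sum>j. e * (1/2::real) ^ Suc j) = e"
      using sums_unique[OF sums_mult[OF power_half_series, of e]] by simp
    finally show ?thesis
      using S_le[OF A(1) B(1)] A(2) B(2) unfolding eq by linarith
  qed
  then show "(\<lambda>k. \<Sum>j. y j k) \<in> elems S \<and> nrm S (\<lambda>k. \<Sum>j. y j k) \<le> (\<Sum>j. nrm S (y j))"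
    using field_le_epsilon zero_less_one by blast
qed

text \<open>The conditions on a function of the Calderon space on one side of the strip.\<close>

definition line_ok :: "(nat \<Rightarrow> complex) nspace \<Rightarrow> (real \<Rightarrow> nat \<Rightarrow> complex) \<Rightarrow> bool" where
  "line_ok V f \<longleftrightarrow> (\<forall>t. f t \<in> elems V) \<and> (\<exists>M. \<forall>t. nrm V (f t) \<le> M) \<and>
     (\<forall>t. ((\<lambda>s. nrm V (\<lambda>k. f s k - f t k)) \<longlongrightarrow> 0) (at t))"

abbreviation "H \<equiv> calderon_space X0 X1"

lemma H_iff: "g \<in> H \<longleftrightarrow> (\<forall>z\<in>strip. g z \<in> elems S) \<and> (\<exists>M. \<forall>z\<in>strip. nrm S (g z) \<le> M) \<and>
     (\<forall>z\<in>strip. ((\<lambda>w. nrm S (\<lambda>k. g w k - g z k)) \<longlongrightarrow> 0) (at z within strip)) \<and>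
     (\<forall>z\<in>interior strip. \<exists>d. has_nderivative S g z d) \<and>
     line_ok X0 (\<lambda>t. g (Complex 0 t)) \<and> line_ok X1 (\<lambda>t. g (Complex 1 t))"
  by (auto simp: calderon_space_def line_ok_def fun_ops(2))

lemma H_I:
  assumes "\<And>z. z \<in> strip \<Longrightarrow> g z \<in> elems S" "\<And>z. z \<in> strip \<Longrightarrow> nrm S (g z) \<le> M"
    "\<And>z. z \<in> strip \<Longrightarrow> ((\<lambda>w. nrm S (\<lambda>k. g w k - g z k)) \<longlongrightarrow> 0) (at z within strip)"
    "\<And>z. z \<in> interior strip \<Longrightarrow> \<exists>d. has_nderivative S g z d"
    "line_ok X0 (\<lambda>t. g (Complex 0 t))" "line_ok X1 (\<lambda>t. g (Complex 1 t))"
  shows "g \<in> H"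
proof -
  have "\<exists>M. \<forall>z\<in>strip. nrm S (g z) \<le> M" using assms(2) by blast
  then show ?thesis unfolding H_iff using assms(1,3-6) by simp
qed

lemma nderiv_iff: "has_nderivative S g z d \<longleftrightarrow> d \<in> elems S \<and>
    ((\<lambda>w. nrm S (\<lambda>k. inverse (w - z) * (g w k - g z k) - d k)) \<longlongrightarrow> 0) (at z)"
  by (simp add: has_nderivative_def fun_ops)

lemma eventually_strip: "z \<in> interior strip \<Longrightarrow> \<forall>\<^sub>F w in at z. w \<in> strip"
  by (metis (mono_tags, lifting) eventually_at_topological interior_subset open_interior subsetD)

lemma eventually_strip_within: "\<forall>\<^sub>F w in at z within strip. w \<in> strip"
  by (simp add: eventually_at_filter)

text \<open>Coordinates are continuous functionals on the sum space, so the scalar theory of holomorphic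
functions applies to them.\<close>

lemma nderiv_coord:
  assumes d: "has_nderivative S g z d" and g: "\<And>w. w \<in> strip \<Longrightarrow> g w \<in> elems S" and z: "z \<in> interior strip"
  shows "((\<lambda>w. g w k) has_field_derivative d k) (at z)"
proof -
  have zs: "z \<in> strip" using z interior_subset by blast
  have "((\<lambda>w. inverse (w - z) * (g w k - g z k)) \<longlongrightarrow> d k) (at z)"
  proof (rule S.tendsto_coord[where u = "\<lambda>w k. inverse (w - z) * (g w k - g z k)"])
    show "((\<lambda>w. nrm S (\<lambda>k. inverse (w - z) * (g w k - g z k) - d k)) \<longlongrightarrow> 0) (at z)" "d \<in> elems S"
      using d unfolding nderiv_iff by auto
    show "\<forall>\<^sub>F w in at z. (\<lambda>k. inverse (w - z) * (g w k - g z k)) \<in> elems S"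
      using eventually_strip[OF z] by eventually_elim (intro S.scale_mem S.diff_mem g zs)
  qed
  then show ?thesis unfolding has_field_derivative_iff by (simp add: divide_inverse mult.commute)
qed

lemma nderiv_unique:
  assumes "has_nderivative S g z d" "has_nderivative S g z d'" "\<And>w. w \<in> strip \<Longrightarrow> g w \<in> elems S" "z \<in> interior strip"
  shows "d = d'"
  using nderiv_coord[OF assms(1,3,4)] nderiv_coord[OF assms(2,3,4)] DERIV_unique by blast

lemma nderiv_add:
  assumes d: "has_nderivative S g z d" "has_nderivative S h z d'" and z: "z \<in> interior strip"
    and g: "\<And>w. w \<in> strip \<Longrightarrow> g w \<in> elems S" and h: "\<And>w. w \<in> strip \<Longrightarrow> h w \<in> elems S"
  shows "has_nderivative S (\<lambda>w k. g w k + h w k) z (\<lambda>k. d k + d' k)"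
proof -
  have zs: "z \<in> strip" using z interior_subset by blast
  have dS: "d \<in> elems S" "d' \<in> elems S" using d unfolding nderiv_iff by auto
  have "((\<lambda>w. nrm S (\<lambda>k. (inverse (w - z) * (g w k - g z k) - d k) + (inverse (w - z) * (h w k - h z k) - d' k))) \<longlongrightarrow> 0) (at z)"
  proof (rule S.tendsto_nrm_add)
    show "((\<lambda>w. nrm S (\<lambda>k. inverse (w - z) * (g w k - g z k) - d k)) \<longlongrightarrow> 0) (at z)"
      "((\<lambda>w. nrm S (\<lambda>k. inverse (w - z) * (h w k - h z k) - d' k)) \<longlongrightarrow> 0) (at z)"
      using d unfolding nderiv_iff by auto
    show "\<forall>\<^sub>F w in at z. (\<lambda>k. inverse (w - z) * (g w k - g z k) - d k) \<in> elems S \<and>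
        (\<lambda>k. inverse (w - z) * (h w k - h z k) - d' k) \<in> elems S"
      using eventually_strip[OF z] by eventually_elim (intro conjI S.diff_mem S.scale_mem g h zs dS)
  qed
  then show ?thesis unfolding nderiv_iff using S.add_mem[OF dS] by (simp add: algebra_simps)
qed

lemma nderiv_mult:
  assumes d: "has_nderivative S g z d" and f: "(f has_field_derivative f') (at z)" and z: "z \<in> interior strip"
    and g: "\<And>w. w \<in> strip \<Longrightarrow> g w \<in> elems S"
  shows "has_nderivative S (\<lambda>w k. f w * g w k) z (\<lambda>k. f z * d k + f' * g z k)"
proof -
  have zs: "z \<in> strip" using z interior_subset by blast
  have dS: "d \<in> elems S" and dl: "((\<lambda>w. nrm S (\<lambda>k. inverse (w - z) * (g w k - g z k) - d k)) \<longlongrightarrow> 0) (at z)"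
    using d unfolding nderiv_iff by auto
  have fc: "(f \<longlongrightarrow> f z) (at z)"
    using DERIV_isCont[OF f] by (simp add: isCont_def)
  have fd: "((\<lambda>w. (f w - f z) / (w - z)) \<longlongrightarrow> f') (at z)"
    using f unfolding has_field_derivative_iff .
  have "((\<lambda>w. nrm S (\<lambda>k. f w * (inverse (w - z) * (g w k - g z k) - d k)
        + ((f w - f z) * d k + ((f w - f z) / (w - z) - f') * g z k))) \<longlongrightarrow> 0) (at z)"
  proof (intro S.tendsto_nrm_add S.tendsto_nrm_scale)
    have "((\<lambda>w. cmod (f w) * nrm S (\<lambda>k. inverse (w - z) * (g w k - g z k) - d k)) \<longlongrightarrow> cmod (f z) * 0) (at z)"
      by (intro tendsto_intros fc dl)
    then show "((\<lambda>w. cmod (f w) * nrm S (\<lambda>k. inverse (w - z) * (g w k - g z k) - d k)) \<longlongrightarrow> 0) (at z)" by simp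
    have "((\<lambda>w. cmod (f w - f z) * nrm S d) \<longlongrightarrow> cmod (f z - f z) * nrm S d) (at z)"
      by (intro tendsto_intros fc)
    then show "((\<lambda>w. cmod (f w - f z) * nrm S d) \<longlongrightarrow> 0) (at z)" by simp
    have "((\<lambda>w. cmod ((f w - f z) / (w - z) - f') * nrm S (g z)) \<longlongrightarrow> cmod (f' - f') * nrm S (g z)) (at z)"
      by (intro tendsto_intros fd)
    then show "((\<lambda>w. cmod ((f w - f z) / (w - z) - f') * nrm S (g z)) \<longlongrightarrow> 0) (at z)" by simp
    show "\<forall>\<^sub>F w in at z. (\<lambda>k. inverse (w - z) * (g w k - g z k) - d k) \<in> elems S"
      using eventually_strip[OF z] by eventually_elim (intro S.diff_mem S.scale_mem g zs dS)
    show "\<forall>\<^sub>F w in at z. (\<lambda>k. f w * (inverse (w - z) * (g w k - g z k) - d k)) \<in> elems S \<and>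
       (\<lambda>k. (f w - f z) * d k + ((f w - f z) / (w - z) - f') * g z k) \<in> elems S"
      using eventually_strip[OF z] by eventually_elim (intro conjI S.diff_mem S.add_mem S.scale_mem g zs dS)
    show "\<forall>\<^sub>F w in at z. (\<lambda>k. (f w - f z) * d k) \<in> elems S \<and>
       (\<lambda>k. ((f w - f z) / (w - z) - f') * g z k) \<in> elems S"
      by (intro always_eventually allI conjI S.scale_mem g zs dS)
  qed (auto simp: dS g zs)
  moreover have "(\<lambda>k. f w * (inverse (w - z) * (g w k - g z k) - d k)
        + ((f w - f z) * d k + ((f w - f z) / (w - z) - f') * g z k))
     = (\<lambda>k. inverse (w - z) * (f w * g w k - f z * g z k) - (f z * d k + f' * g z k))" for w
    by (simp add: fun_eq_iff divide_inverse algebra_simps)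
  ultimately show ?thesis unfolding nderiv_iff
    using S.add_mem[OF S.scale_mem[OF dS] S.scale_mem[OF g[OF zs]]] by simp
qed

text \<open>An operator acting boundedly on both spaces also acts on their sum and, pointwise, on the Calderon
space.\<close>

definition bdd_op :: "((nat \<Rightarrow> complex) \<Rightarrow> nat \<Rightarrow> complex) \<Rightarrow> real \<Rightarrow> bool" where
  "bdd_op T K \<longleftrightarrow> 0 \<le> K \<and> (\<forall>x y. T (\<lambda>k. x k + y k) = (\<lambda>k. T x k + T y k)) \<and> (\<forall>c x. T (\<lambda>k. c * x k) = (\<lambda>k. c * T x k)) \<and>
    (\<forall>x\<in>elems X0. T x \<in> elems X0 \<and> nrm X0 (T x) \<le> K * nrm X0 x) \<and>
    (\<forall>x\<in>elems X1. T x \<in> elems X1 \<and> nrm X1 (T x) \<le> K * nrm X1 x)"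

lemma bdd_op_S:
  assumes T: "bdd_op T K" and x: "x \<in> elems S"
  shows "T x \<in> elems S" "nrm S (T x) \<le> K * nrm S x"
proof -
  have *: "T x \<in> elems S \<and> nrm S (T x) \<le> K * (nrm X0 x0 + nrm X1 x1)"
    if "x0 \<in> elems X0" "x1 \<in> elems X1" "x = (\<lambda>k. x0 k + x1 k)" for x0 x1
  proof -
    have "T x = (\<lambda>k. T x0 k + T x1 k)" "T x0 \<in> elems X0" "T x1 \<in> elems X1"
      "nrm X0 (T x0) \<le> K * nrm X0 x0" "nrm X1 (T x1) \<le> K * nrm X1 x1"
      using T that unfolding bdd_op_def by auto
    then show ?thesis using S_le[of "T x0" "T x1"] by (simp add: distrib_left)
  qed
  then show "T x \<in> elems S" using x unfolding S_elems by blast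
  have K: "0 \<le> K" using T by (simp add: bdd_op_def)
  show "nrm S (T x) \<le> K * nrm S x"
  proof (rule field_le_epsilon)
    fix e :: real assume e: "0 < e"
    then have "0 < e / (K + 1)" using K by simp
    from S_approx[OF x this] obtain x0 x1 where a: "x0 \<in> elems X0" "x1 \<in> elems X1" "x = (\<lambda>k. x0 k + x1 k)"
      "nrm X0 x0 + nrm X1 x1 < nrm S x + e / (K + 1)" by blast
    have "nrm S (T x) \<le> K * (nrm X0 x0 + nrm X1 x1)" using * a by blast
    also have "\<dots> \<le> K * (nrm S x + e / (K + 1))" using a K by (intro mult_left_mono) auto
    also have "\<dots> \<le> K * nrm S x + e" using K e by (simp add: field_simps)
    finally show "nrm S (T x) \<le> K * nrm S x + e" .
  qed
qed

lemma bdd_op_diff: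
  assumes "bdd_op T K" shows "T (\<lambda>k. x k - y k) = (\<lambda>k. T x k - T y k)"
proof -
  have "T (\<lambda>k. x k + - 1 * y k) = (\<lambda>k. T x k + - 1 * T y k)"
    using assms unfolding bdd_op_def by metis
  then show ?thesis by simp
qed

lemma bdd_op_tendsto:
  assumes "seq_space V" "\<And>x. x \<in> elems V \<Longrightarrow> T x \<in> elems V \<and> nrm V (T x) \<le> K * nrm V x"
    "((\<lambda>w. nrm V (u w)) \<longlongrightarrow> 0) F" "\<forall>\<^sub>F w in F. u w \<in> elems V"
  shows "((\<lambda>w. nrm V (T (u w))) \<longlongrightarrow> 0) F"
proof (rule Lim_null_comparison)
  show "\<forall>\<^sub>F w in F. norm (nrm V (T (u w))) \<le> K * nrm V (u w)"
    using assms(4) by eventually_elim (use assms(2) seq_space.nrm_nonneg[OF assms(1)] in auto)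
  show "((\<lambda>w. K * nrm V (u w)) \<longlongrightarrow> 0) F" using tendsto_mult_left[OF assms(3), of K] by simp
qed

lemma nderiv_op:
  assumes T: "bdd_op T K" and d: "has_nderivative S g z d" and z: "z \<in> interior strip"
    and g: "\<And>w. w \<in> strip \<Longrightarrow> g w \<in> elems S"
  shows "has_nderivative S (\<lambda>w. T (g w)) z (T d)"
proof -
  have zs: "z \<in> strip" using z interior_subset by blast
  have dS: "d \<in> elems S" and dl: "((\<lambda>w. nrm S (\<lambda>k. inverse (w - z) * (g w k - g z k) - d k)) \<longlongrightarrow> 0) (at z)"
    using d unfolding nderiv_iff by auto
  have "((\<lambda>w. nrm S (T (\<lambda>k. inverse (w - z) * (g w k - g z k) - d k))) \<longlongrightarrow> 0) (at z)"
  proof (rule bdd_op_tendsto[OF S.seq_space_axioms _ dl])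
    show "\<forall>\<^sub>F w in at z. (\<lambda>k. inverse (w - z) * (g w k - g z k) - d k) \<in> elems S"
      using eventually_strip[OF z] by eventually_elim (intro S.diff_mem S.scale_mem g zs dS)
  qed (use bdd_op_S[OF T] in auto)
  moreover have "T (\<lambda>k. inverse (w - z) * (g w k - g z k) - d k) = (\<lambda>k. inverse (w - z) * (T (g w) k - T (g z) k) - T d k)" for w
  proof -
    have hom: "T (\<lambda>k. c * x k) = (\<lambda>k. c * T x k)" for c x using T by (simp add: bdd_op_def)
    show ?thesis unfolding bdd_op_diff[OF T] hom by simp
  qed
  ultimately show ?thesis unfolding nderiv_iff using bdd_op_S(1)[OF T dS] by simp
qed

lemma line_ok_add:
  assumes "seq_space V" "line_ok V f" "line_ok V g"
  shows "line_ok V (\<lambda>t k. f t k + g t k)"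
proof -
  interpret V: seq_space V by fact
  have f: "f t \<in> elems V" and g: "g t \<in> elems V" for t using assms(2,3) by (auto simp: line_ok_def)
  obtain M M' where M: "\<And>t. nrm V (f t) \<le> M" "\<And>t. nrm V (g t) \<le> M'"
    using assms(2,3) unfolding line_ok_def by blast
  have "nrm V (\<lambda>k. f t k + g t k) \<le> M + M'" for t
    using V.nrm_add[OF f g, of t t] M[of t] by linarith
  moreover have "((\<lambda>s. nrm V (\<lambda>k. (f s k + g s k) - (f t k + g t k))) \<longlongrightarrow> 0) (at t)" for t
  proof -
    have "((\<lambda>s. nrm V (\<lambda>k. (f s k - f t k) + (g s k - g t k))) \<longlongrightarrow> 0) (at t)"
      by (rule V.tendsto_nrm_add)
        (use assms(2,3) V.diff_mem f g in \<open>auto simp: line_ok_def\<close>)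
    then show ?thesis by (simp add: algebra_simps)
  qed
  ultimately show ?thesis unfolding line_ok_def using V.add_mem[OF f g] by blast
qed

lemma line_ok_mult:
  assumes "seq_space V" "line_ok V g" "\<And>t. isCont f t" "\<And>t. cmod (f t) \<le> B"
  shows "line_ok V (\<lambda>t k. f t * g t k)"
proof -
  interpret V: seq_space V by fact
  have g: "g t \<in> elems V" for t using assms(2) by (auto simp: line_ok_def)
  obtain M where M: "\<And>t. nrm V (g t) \<le> M" using assms(2) unfolding line_ok_def by blast
  have B: "0 \<le> B" using assms(4)[of 0] norm_ge_zero order_trans by blast
  have "nrm V (\<lambda>k. f t * g t k) \<le> B * M" for t
    unfolding V.nrm_scale[OF g] using assms(4) M V.nrm_nonneg[OF g] B by (intro mult_mono) auto
  moreover have "((\<lambda>s. nrm V (\<lambda>k. f s * g s k - f t * g t k)) \<longlongrightarrow> 0) (at t)" for t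
  proof -
    have fc: "(f \<longlongrightarrow> f t) (at t)" using assms(3)[of t] by (simp add: isCont_def)
    have gc: "((\<lambda>s. nrm V (\<lambda>k. g s k - g t k)) \<longlongrightarrow> 0) (at t)" using assms(2) by (simp add: line_ok_def)
    have "((\<lambda>s. nrm V (\<lambda>k. f s * (g s k - g t k) + (f s - f t) * g t k)) \<longlongrightarrow> 0) (at t)"
    proof (intro V.tendsto_nrm_add V.tendsto_nrm_scale)
      have "((\<lambda>s. cmod (f s) * nrm V (\<lambda>k. g s k - g t k)) \<longlongrightarrow> cmod (f t) * 0) (at t)"
        by (intro tendsto_intros fc gc)
      then show "((\<lambda>s. cmod (f s) * nrm V (\<lambda>k. g s k - g t k)) \<longlongrightarrow> 0) (at t)" by simp
      have "((\<lambda>s. cmod (f s - f t) * nrm V (g t)) \<longlongrightarrow> cmod (f t - f t) * nrm V (g t)) (at t)"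
        by (intro tendsto_intros fc)
      then show "((\<lambda>s. cmod (f s - f t) * nrm V (g t)) \<longlongrightarrow> 0) (at t)" by simp
    qed (intro always_eventually allI conjI V.diff_mem V.scale_mem g)+
    then show ?thesis by (simp add: algebra_simps)
  qed
  ultimately show ?thesis unfolding line_ok_def using V.scale_mem[OF g] by blast
qed

lemma line_ok_op:
  assumes V: "seq_space V" "line_ok V g" and T: "\<And>x. x \<in> elems V \<Longrightarrow> T x \<in> elems V \<and> nrm V (T x) \<le> K * nrm V x"
    and K: "0 \<le> K" and Td: "\<And>x y. T (\<lambda>k. x k - y k) = (\<lambda>k. T x k - T y k)"
  shows "line_ok V (\<lambda>t. T (g t))"
proof -
  interpret V: seq_space V by fact
  have g: "g t \<in> elems V" for t using V(2) by (auto simp: line_ok_def)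
  obtain M where M: "\<And>t. nrm V (g t) \<le> M" using V(2) unfolding line_ok_def by blast
  have "nrm V (T (g t)) \<le> K * M" for t
    using T[OF g[of t]] mult_left_mono[OF M[of t] K] by linarith
  moreover have "((\<lambda>s. nrm V (\<lambda>k. T (g s) k - T (g t) k)) \<longlongrightarrow> 0) (at t)" for t
  proof -
    have "((\<lambda>s. nrm V (T (\<lambda>k. g s k - g t k))) \<longlongrightarrow> 0) (at t)"
    proof (rule bdd_op_tendsto[OF V(1) T, where u = "\<lambda>s k. g s k - g t k"])
      show "((\<lambda>s. nrm V (\<lambda>k. g s k - g t k)) \<longlongrightarrow> 0) (at t)" using V(2) by (simp add: line_ok_def)
      show "\<forall>\<^sub>F s in at t. (\<lambda>k. g s k - g t k) \<in> elems V"
        by (intro always_eventually allI V.diff_mem g)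
    qed
    then show ?thesis by (simp add: Td)
  qed
  ultimately show ?thesis unfolding line_ok_def using T[OF g] by blast
qed

lemma H_add:
  assumes g: "g \<in> H" and h: "h \<in> H"
  shows "(\<lambda>z k. g z k + h z k) \<in> H"
proof -
  note G = g[unfolded H_iff] and K = h[unfolded H_iff]
  obtain M M' where M: "\<And>z. z \<in> strip \<Longrightarrow> nrm S (g z) \<le> M" "\<And>z. z \<in> strip \<Longrightarrow> nrm S (h z) \<le> M'"
    using G K by blast
  have gS: "g z \<in> elems S" and hS: "h z \<in> elems S" if "z \<in> strip" for z using G K that by auto
  have bnd: "nrm S (\<lambda>k. g z k + h z k) \<le> M + M'" if z: "z \<in> strip" for z
    using M[OF z] S.nrm_add[OF gS[OF z] hS[OF z]] by linarith
  have cont: "((\<lambda>w. nrm S (\<lambda>k. (g w k + h w k) - (g z k + h z k))) \<longlongrightarrow> 0) (at z within strip)" if z: "z \<in> strip" for z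
  proof -
    have "((\<lambda>w. nrm S (\<lambda>k. (g w k - g z k) + (h w k - h z k))) \<longlongrightarrow> 0) (at z within strip)"
    proof (rule S.tendsto_nrm_add)
      show "\<forall>\<^sub>F w in at z within strip. (\<lambda>k. g w k - g z k) \<in> elems S \<and> (\<lambda>k. h w k - h z k) \<in> elems S"
        using eventually_strip_within by eventually_elim (intro conjI S.diff_mem gS hS z)
    qed (use G K z in auto)
    then show ?thesis by (simp add: algebra_simps)
  qed
  have der: "\<exists>d. has_nderivative S (\<lambda>w k. g w k + h w k) z d" if z: "z \<in> interior strip" for z
  proof -
    obtain d d' where "has_nderivative S g z d" "has_nderivative S h z d'" using G K z by blast
    from nderiv_add[OF this z gS hS] show ?thesis by blast
  qed
  show ?thesis
    by (rule H_I[OF S.add_mem[OF gS hS] bnd cont der])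
       (use G K in \<open>auto intro!: line_ok_add X0.seq_space_axioms X1.seq_space_axioms\<close>)
qed

lemma H_mult:
  assumes g: "g \<in> H" and fc: "continuous_on UNIV f" and fh: "f holomorphic_on interior strip"
    and fb: "\<And>z. z \<in> strip \<Longrightarrow> cmod (f z) \<le> B"
  shows "(\<lambda>z k. f z * g z k) \<in> H"
proof -
  note G = g[unfolded H_iff]
  obtain M where M: "\<And>z. z \<in> strip \<Longrightarrow> nrm S (g z) \<le> M" using G by blast
  have gS: "g z \<in> elems S" if "z \<in> strip" for z using G that by auto
  have bnd: "nrm S (\<lambda>k. f z * g z k) \<le> \<bar>B\<bar> * M" if z: "z \<in> strip" for z
    unfolding S.nrm_scale[OF gS[OF z]]
    using M[OF z] S.nrm_nonneg[OF gS[OF z]] fb[OF z] by (intro mult_mono) auto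
  have cont: "((\<lambda>w. nrm S (\<lambda>k. f w * g w k - f z * g z k)) \<longlongrightarrow> 0) (at z within strip)" if z: "z \<in> strip" for z
  proof -
    have fz: "(f \<longlongrightarrow> f z) (at z within strip)"
      using fc by (auto simp: continuous_on_def intro: tendsto_within_subset)
    have gc: "((\<lambda>w. nrm S (\<lambda>k. g w k - g z k)) \<longlongrightarrow> 0) (at z within strip)" using G z by auto
    have "((\<lambda>w. nrm S (\<lambda>k. f w * (g w k - g z k) + (f w - f z) * g z k)) \<longlongrightarrow> 0) (at z within strip)"
    proof (intro S.tendsto_nrm_add S.tendsto_nrm_scale)
      have "((\<lambda>w. cmod (f w) * nrm S (\<lambda>k. g w k - g z k)) \<longlongrightarrow> cmod (f z) * 0) (at z within strip)"
        by (intro tendsto_intros fz gc)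
      then show "((\<lambda>w. cmod (f w) * nrm S (\<lambda>k. g w k - g z k)) \<longlongrightarrow> 0) (at z within strip)" by simp
      have "((\<lambda>w. cmod (f w - f z) * nrm S (g z)) \<longlongrightarrow> cmod (f z - f z) * nrm S (g z)) (at z within strip)"
        by (intro tendsto_intros fz)
      then show "((\<lambda>w. cmod (f w - f z) * nrm S (g z)) \<longlongrightarrow> 0) (at z within strip)" by simp
      show "\<forall>\<^sub>F w in at z within strip. (\<lambda>k. g w k - g z k) \<in> elems S"
        using eventually_strip_within by eventually_elim (intro S.diff_mem gS z)
      show "\<forall>\<^sub>F w in at z within strip. g z \<in> elems S" using gS[OF z] by simp
      show "\<forall>\<^sub>F w in at z within strip. (\<lambda>k. f w * (g w k - g z k)) \<in> elems S \<and> (\<lambda>k. (f w - f z) * g z k) \<in> elems S"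
        using eventually_strip_within by eventually_elim (intro conjI S.scale_mem S.diff_mem gS z)
    qed
    then show ?thesis by (simp add: algebra_simps)
  qed
  have der: "\<exists>d. has_nderivative S (\<lambda>w k. f w * g w k) z d" if z: "z \<in> interior strip" for z
  proof -
    obtain d where d: "has_nderivative S g z d" using G z by blast
    have "(f has_field_derivative deriv f z) (at z)"
      using fh z by (simp add: holomorphic_derivI)
    from nderiv_mult[OF d this z gS] show ?thesis by blast
  qed
  have l0: "line_ok X0 (\<lambda>t k. f (Complex 0 t) * g (Complex 0 t) k)"
  proof (rule line_ok_mult[OF X0.seq_space_axioms, where B = "\<bar>B\<bar>"])
    show "isCont (\<lambda>t. f (Complex 0 t)) t" for t by (rule isCont_vertical_line[OF fc])
    show "cmod (f (Complex 0 t)) \<le> \<bar>B\<bar>" for t using fb[of "Complex 0 t"] by (simp add: strip_def)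
  qed (use G in auto)
  have l1: "line_ok X1 (\<lambda>t k. f (Complex 1 t) * g (Complex 1 t) k)"
  proof (rule line_ok_mult[OF X1.seq_space_axioms, where B = "\<bar>B\<bar>"])
    show "isCont (\<lambda>t. f (Complex 1 t)) t" for t by (rule isCont_vertical_line[OF fc])
    show "cmod (f (Complex 1 t)) \<le> \<bar>B\<bar>" for t using fb[of "Complex 1 t"] by (simp add: strip_def)
  qed (use G in auto)
  show ?thesis by (rule H_I[OF S.scale_mem[OF gS] bnd cont der l0 l1])
qed

lemma H_op:
  assumes g: "g \<in> H" and T: "bdd_op T K"
  shows "(\<lambda>z. T (g z)) \<in> H"
proof -
  note G = g[unfolded H_iff]
  obtain M where M: "\<And>z. z \<in> strip \<Longrightarrow> nrm S (g z) \<le> M" using G by blast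
  have gS: "g z \<in> elems S" if "z \<in> strip" for z using G that by auto
  have K: "0 \<le> K" using T by (simp add: bdd_op_def)
  have bnd: "nrm S (T (g z)) \<le> K * M" if z: "z \<in> strip" for z
    using bdd_op_S(2)[OF T gS[OF z]] mult_left_mono[OF M[OF z] K] by linarith
  have cont: "((\<lambda>w. nrm S (\<lambda>k. T (g w) k - T (g z) k)) \<longlongrightarrow> 0) (at z within strip)" if z: "z \<in> strip" for z
  proof -
    have "((\<lambda>w. nrm S (T (\<lambda>k. g w k - g z k))) \<longlongrightarrow> 0) (at z within strip)"
    proof (rule bdd_op_tendsto[OF S.seq_space_axioms, where T = T and K = K and u = "\<lambda>w k. g w k - g z k"])
      show "\<forall>\<^sub>F w in at z within strip. (\<lambda>k. g w k - g z k) \<in> elems S"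
        using eventually_strip_within by eventually_elim (intro S.diff_mem gS z)
    qed (use G z bdd_op_S[OF T] in auto)
    then show ?thesis by (simp add: bdd_op_diff[OF T])
  qed
  have der: "\<exists>d. has_nderivative S (\<lambda>w. T (g w)) z d" if z: "z \<in> interior strip" for z
  proof -
    obtain d where d: "has_nderivative S g z d" using G z by blast
    from nderiv_op[OF T d z gS] show ?thesis by blast
  qed
  have l0: "line_ok X0 (\<lambda>t. T (g (Complex 0 t)))"
    by (rule line_ok_op[OF X0.seq_space_axioms _ _ K bdd_op_diff[OF T]])
       (use G T in \<open>auto simp: bdd_op_def\<close>)
  have l1: "line_ok X1 (\<lambda>t. T (g (Complex 1 t)))"
    by (rule line_ok_op[OF X1.seq_space_axioms _ _ K bdd_op_diff[OF T]])
       (use G T in \<open>auto simp: bdd_op_def\<close>)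
  show ?thesis by (rule H_I[OF bdd_op_S(1)[OF T gS] bnd cont der l0 l1])
qed

lemma nderiv_zero: "has_nderivative S (\<lambda>z k. 0) z (\<lambda>k. 0)"
  by (simp add: nderiv_iff S.zero_mem S.nrm_zero)

lemma H_zero: "(\<lambda>z k. 0) \<in> H"
  unfolding H_iff line_ok_def using nderiv_zero
  by (auto simp: S.zero_mem S.nrm_zero X0.zero_mem X0.nrm_zero X1.zero_mem X1.nrm_zero)

abbreviation "hnorm \<equiv> calderon_norm X0 X1"

lemma hnorm_le:
  "(\<And>t. nrm X0 (g (Complex 0 t)) \<le> M) \<Longrightarrow> (\<And>t. nrm X1 (g (Complex 1 t)) \<le> M) \<Longrightarrow> hnorm g \<le> M"
  unfolding calderon_norm_def by (rule cSup_least) auto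

lemma hnorm_ge:
  assumes "g \<in> H"
  shows "nrm X0 (g (Complex 0 t)) \<le> hnorm g" "nrm X1 (g (Complex 1 t)) \<le> hnorm g"
proof -
  obtain M M' where M: "\<And>t. nrm X0 (g (Complex 0 t)) \<le> M" "\<And>t. nrm X1 (g (Complex 1 t)) \<le> M'"
    using assms unfolding H_iff line_ok_def by blast
  have "bdd_above (range (\<lambda>t. nrm X0 (g (Complex 0 t))) \<union> range (\<lambda>t. nrm X1 (g (Complex 1 t))))"
    by (intro bdd_above_Un[THEN iffD2] conjI bdd_aboveI2) (rule M)+
  then show "nrm X0 (g (Complex 0 t)) \<le> hnorm g" "nrm X1 (g (Complex 1 t)) \<le> hnorm g"
    unfolding calderon_norm_def by (auto intro: cSup_upper)
qed

lemma hnorm_nonneg: "g \<in> H \<Longrightarrow> 0 \<le> hnorm g"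
proof -
  assume g: "g \<in> H"
  then have "0 \<le> nrm X0 (g (Complex 0 0))" unfolding H_iff line_ok_def using X0.nrm_nonneg by blast
  then show ?thesis using hnorm_ge(1)[OF g, of 0] by linarith
qed

lemma H_coord_continuous: "g \<in> H \<Longrightarrow> continuous_on strip (\<lambda>z. g z k)"
  unfolding continuous_on_def
proof
  fix z assume g: "g \<in> H" and z: "z \<in> strip"
  note G = g[unfolded H_iff]
  show "((\<lambda>w. g w k) \<longlongrightarrow> g z k) (at z within strip)"
  proof (rule S.tendsto_coord)
    show "\<forall>\<^sub>F w in at z within strip. g w \<in> elems S"
      using eventually_strip_within by eventually_elim (use G in blast)
  qed (use G z in auto)
qed

lemma H_coord_holomorphic: "g \<in> H \<Longrightarrow> (\<lambda>z. g z k) holomorphic_on interior strip"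
proof -
  assume g: "g \<in> H"
  note G = g[unfolded H_iff]
  have "\<exists>f'. ((\<lambda>z. g z k) has_field_derivative f') (at z)" if z: "z \<in> interior strip" for z
    using nderiv_coord[OF _ _ z] G z by metis
  then show ?thesis by (simp add: holomorphic_on_open)
qed

lemma H_coord_bounded: "g \<in> H \<Longrightarrow> \<exists>B. \<forall>k. \<forall>z\<in>strip. cmod (g z k) \<le> B"
proof -
  assume g: "g \<in> H"
  note G = g[unfolded H_iff]
  obtain M where M: "\<And>z. z \<in> strip \<Longrightarrow> nrm S (g z) \<le> M" using G by blast
  have "cmod (g z k) \<le> 2 * M" if "z \<in> strip" for z k
    using S.nrm_coord[of "g z" k] M[OF that] G that by fastforce
  then show ?thesis by blast
qed

end

section \<open>Polynomials with values in a sequence space\<close>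

lemma norm_root_of_unity_base [simp]: "cmod (root_of_unity N) = 1"
  using norm_root_of_unity[of N 1] by simp

lemma exists_degree_bound:
  fixes Q :: "nat \<Rightarrow> complex poly"
  assumes "\<And>k. n \<le> k \<Longrightarrow> Q k = 0"
  shows "\<exists>N\<ge>2. \<forall>k. degree (Q k :: complex poly) < N"
proof -
  let ?N = "2 + (\<Sum>k<n. degree (Q k))"
  have "degree (Q k) < ?N" for k
  proof (cases "k < n")
    case True
    then have "degree (Q k) \<le> (\<Sum>k<n. degree (Q k))" by (intro member_le_sum) auto
    then show ?thesis by simp
  next
    case False
    then show ?thesis using assms[of k] by simp
  qed
  then show ?thesis by (intro exI[of _ ?N]) auto
qed

lemma poly_sum_lessThan:
  assumes "degree p < N"
  shows "poly p (z :: complex) = (\<Sum>i<N. z ^ i * coeff p i)"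
proof -
  have "poly p z = (\<Sum>i\<le>degree p. coeff p i * z ^ i)" by (rule poly_altdef)
  also have "\<dots> = (\<Sum>i<N. coeff p i * z ^ i)"
    by (rule sum.mono_neutral_left) (use assms in \<open>auto simp: coeff_eq_0\<close>)
  finally show ?thesis by (simp add: mult.commute)
qed

text \<open>The remainder for \<open>i + 1\<close> is \<open>w\<close> times the one for \<open>i\<close>, plus \<open>(w - z)\<^sup>2\<close> times the derivative.\<close>

lemma power_remainder:
  fixes w z :: complex
  assumes r: "0 < r" and w: "cmod w \<le> r" and z: "cmod z \<le> r"
  shows "cmod (w ^ i - z ^ i - (w - z) * (of_nat i * z ^ (i - 1))) \<le> (real i)\<^sup>2 * r ^ i / r\<^sup>2 * (cmod (w - z))\<^sup>2"
proof (induction i)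
  case (Suc i)
  let ?R = "w ^ i - z ^ i - (w - z) * (of_nat i * z ^ (i - 1))"
  have zi: "of_nat i * z ^ i = of_nat i * z ^ (i - 1) * z" by (cases i) simp_all
  have eq: "w ^ Suc i - z ^ Suc i - (w - z) * (of_nat (Suc i) * z ^ (Suc i - 1))
    = w * ?R + (w - z)\<^sup>2 * (of_nat i * z ^ (i - 1))"
  proof -
    have "w * ?R + (w - z)\<^sup>2 * (of_nat i * z ^ (i - 1))
      = w ^ Suc i - w * z ^ i - (w - z) * (of_nat i * z ^ (i - 1) * z)"
      by (simp add: power2_eq_square algebra_simps)
    also have "\<dots> = w ^ Suc i - z ^ Suc i - (w - z) * (of_nat (Suc i) * z ^ (Suc i - 1))"
      unfolding zi[symmetric] by (simp add: algebra_simps)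
    finally show ?thesis by simp
  qed
  have 2: "cmod (of_nat i * z ^ (i - 1)) \<le> real i * r ^ i / r"
  proof (cases i)
    case (Suc j)
    have "cmod z ^ j \<le> r ^ j" using z by (intro power_mono) auto
    then show ?thesis using Suc r by (simp add: norm_mult norm_power mult_left_mono del: of_nat_Suc)
  qed simp
  have "cmod (w ^ Suc i - z ^ Suc i - (w - z) * (of_nat (Suc i) * z ^ (Suc i - 1)))
     \<le> cmod w * cmod ?R + (cmod (w - z))\<^sup>2 * cmod (of_nat i * z ^ (i - 1))"
    unfolding eq by (rule order_trans[OF norm_triangle_ineq]) (simp add: norm_mult norm_power)
  also have "\<dots> \<le> r * ((real i)\<^sup>2 * r ^ i / r\<^sup>2 * (cmod (w - z))\<^sup>2) + (cmod (w - z))\<^sup>2 * (real i * r ^ i / r)"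
    using w r by (intro add_mono mult_mono Suc 2) auto
  also have "\<dots> = ((real i)\<^sup>2 + real i) * r ^ Suc i / r\<^sup>2 * (cmod (w - z))\<^sup>2"
    using r by (simp add: field_simps power2_eq_square)
  also have "\<dots> \<le> (real (Suc i))\<^sup>2 * r ^ Suc i / r\<^sup>2 * (cmod (w - z))\<^sup>2"
    using r by (intro mult_right_mono divide_right_mono) (auto simp: power2_eq_square algebra_simps)
  finally show ?case .
qed simp

definition rem_const :: "real \<Rightarrow> real" where
  "rem_const r = (\<Sum>i. (real i)\<^sup>2 * r ^ i / r\<^sup>2)"

lemma rem_const_summable:
  assumes "0 < r" "r < 1"
  shows "summable (\<lambda>i. (real i)\<^sup>2 * r ^ i / r\<^sup>2)"
proof -
  have 1: "summable (\<lambda>n. diffs (\<lambda>n. 1::real) n * x ^ n)" if "norm x < 1" for x :: real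
    by (rule termdiff_converges[of x 1]) (use that in \<open>auto intro: summable_geometric\<close>)
  have "summable (\<lambda>n. diffs (diffs (\<lambda>n. 1::real)) n * r ^ n)"
    by (rule termdiff_converges[of r 1]) (use assms 1 in auto)
  then have s: "summable (\<lambda>n. real (Suc n) * real (Suc (Suc n)) * r ^ n)"
    by (simp add: diffs_def mult_ac)
  have "summable (\<lambda>i. (real i)\<^sup>2 * r ^ i)"
  proof (rule summable_comparison_test'[OF s])
    fix i :: nat
    have "(real i)\<^sup>2 \<le> real (Suc i) * real (Suc (Suc i))" by (simp add: power2_eq_square algebra_simps)
    then show "norm ((real i)\<^sup>2 * r ^ i) \<le> real (Suc i) * real (Suc (Suc i)) * r ^ i"
      using assms by (simp add: mult_right_mono abs_mult)
  qed
  then show ?thesis by (rule summable_divide)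
qed

lemma rem_const_ge:
  assumes "0 < r" "r < 1"
  shows "(\<Sum>i<N. (real i)\<^sup>2 * r ^ i / r\<^sup>2) \<le> rem_const r"
  unfolding rem_const_def by (intro sum_le_suminf rem_const_summable assms) (use assms in auto)

text \<open>Spaces containing the finitely supported sequences; in these every vector polynomial takes its
values.\<close>

locale seq_unit = seq_space +
  assumes unit_mem: "unit_seq k \<in> elems V" and unit_nrm: "nrm V (unit_seq k) \<le> 2"
begin

lemma trunc_mem: "trunc n a \<in> elems V" and nrm_trunc: "nrm V (trunc n a) \<le> 2 * (\<Sum>k<n. cmod (a k))"
proof -
  show "trunc n a \<in> elems V"
    unfolding trunc_eq_sum by (intro sum_mem_le scale_mem unit_mem) simp
  have "nrm V (trunc n a) \<le> (\<Sum>k<n. nrm V (\<lambda>i. a k * unit_seq k i))"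
    unfolding trunc_eq_sum by (intro sum_mem_le scale_mem unit_mem) simp
  also have "\<dots> \<le> (\<Sum>k<n. cmod (a k) * 2)"
    unfolding nrm_scale[OF unit_mem] by (intro sum_mono mult_left_mono unit_nrm) simp
  finally show "nrm V (trunc n a) \<le> 2 * (\<Sum>k<n. cmod (a k))"
    by (simp add: sum_distrib_left mult.commute)
qed

context
  fixes n :: nat and Q :: "nat \<Rightarrow> complex poly"
  assumes Q: "\<And>k. n \<le> k \<Longrightarrow> Q k = 0"
begin

lemma fin_trunc: "(\<And>k. n \<le> k \<Longrightarrow> a k = 0) \<Longrightarrow> trunc n a = a"
  by (auto simp: trunc_def fun_eq_iff)

lemma poly_mem: "poly_vec Q z \<in> elems V"
  using trunc_mem[of n "poly_vec Q z"] by (simp add: fin_trunc poly_vec_def Q)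

lemma coeff_mem: "(\<lambda>k. coeff (Q k) i) \<in> elems V"
  using trunc_mem[of n "\<lambda>k. coeff (Q k) i"] by (simp add: fin_trunc Q)

lemma poly_tendsto_compose:
  assumes f: "(f \<longlongrightarrow> z) F"
  shows "((\<lambda>w. nrm V (\<lambda>k. poly_vec Q (f w) k - poly_vec Q z k)) \<longlongrightarrow> 0) F"
proof (rule Lim_null_comparison)
  have "nrm V (\<lambda>k. poly_vec Q w k - poly_vec Q z k) \<le> 2 * (\<Sum>k<n. cmod (poly_vec Q w k - poly_vec Q z k))" for w
    using nrm_trunc[of n "\<lambda>k. poly_vec Q w k - poly_vec Q z k"] by (simp add: fin_trunc poly_vec_def Q)
  then show "\<forall>\<^sub>F w in F. norm (nrm V (\<lambda>k. poly_vec Q (f w) k - poly_vec Q z k)) \<le> 2 * (\<Sum>k<n. cmod (poly_vec Q (f w) k - poly_vec Q z k))"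
    using nrm_nonneg[OF diff_mem[OF poly_mem poly_mem]] by simp
  have "((\<lambda>w. 2 * (\<Sum>k<n. cmod (poly_vec Q (f w) k - poly_vec Q z k))) \<longlongrightarrow> 2 * (\<Sum>k<n. cmod (poly_vec Q z k - poly_vec Q z k))) F"
    unfolding poly_vec_def by (intro tendsto_intros f)
  then show "((\<lambda>w. 2 * (\<Sum>k<n. cmod (poly_vec Q (f w) k - poly_vec Q z k))) \<longlongrightarrow> 0) F" by simp
qed

lemma poly_nrm_continuous: "continuous_on A (\<lambda>z. nrm V (poly_vec Q z))"
  unfolding continuous_on_def
proof
  fix z
  show "((\<lambda>w. nrm V (poly_vec Q w)) \<longlongrightarrow> nrm V (poly_vec Q z)) (at z within A)"
  proof (rule LIM_zero_cancel, rule Lim_null_comparison[OF _ poly_tendsto_compose[OF tendsto_ident_at]])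
    show "\<forall>\<^sub>F w in at z within A. norm (nrm V (poly_vec Q w) - nrm V (poly_vec Q z)) \<le> nrm V (\<lambda>k. poly_vec Q w k - poly_vec Q z k)"
    proof (rule always_eventually, rule allI)
      fix w
      show "norm (nrm V (poly_vec Q w) - nrm V (poly_vec Q z)) \<le> nrm V (\<lambda>k. poly_vec Q w k - poly_vec Q z k)"
        using nrm_add[OF diff_mem[OF poly_mem poly_mem] poly_mem, of w z z]
          nrm_add[OF diff_mem[OF poly_mem poly_mem] poly_mem, of z w w]
          nrm_minus_commute[OF poly_mem poly_mem, of z w] by simp
    qed
  qed
qed

lemma nrm_poly_average:
  assumes "0 < N" "\<And>k. degree (Q k) < N"
  shows "nrm V (poly_vec Q z) \<le> (\<Sum>m<N. nrm V (poly_vec Q (z + of_real r * root_of_unity N ^ m))) / real N"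
proof -
  have "poly_vec Q z = (\<lambda>k. (1 / of_nat N) * (\<Sum>m<N. poly_vec Q (z + of_real r * root_of_unity N ^ m) k))"
    using value_average[OF assms(1,2)] by (simp add: fun_eq_iff poly_vec_def)
  then have "nrm V (poly_vec Q z) = cmod (1 / of_nat N) * nrm V (\<lambda>k. \<Sum>m<N. poly_vec Q (z + of_real r * root_of_unity N ^ m) k)"
    using nrm_scale[OF sum_mem_le(1), of "{..<N}" "\<lambda>m. poly_vec Q (z + of_real r * root_of_unity N ^ m)" "1 / of_nat N"] poly_mem
    by simp
  also have "\<dots> \<le> cmod (1 / of_nat N) * (\<Sum>m<N. nrm V (poly_vec Q (z + of_real r * root_of_unity N ^ m)))"
    by (intro mult_left_mono sum_mem_le poly_mem) auto
  finally show ?thesis by (simp add: norm_divide)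
qed

lemma poly_maximum_principle:
  assumes M: "\<And>z. cmod z = 1 \<Longrightarrow> nrm V (poly_vec Q z) \<le> M" and z: "cmod z \<le> 1"
  shows "nrm V (poly_vec Q z) \<le> M"
proof -
  obtain N where N: "2 \<le> N" "\<And>k. degree (Q k) < N" using exists_degree_bound[of n Q] Q by blast
  show ?thesis
  proof (rule disc_maximum_principle[OF poly_nrm_continuous N(1) _ M z])
    show "nrm V (poly_vec Q z) \<le> (\<Sum>m<N. nrm V (poly_vec Q (z + of_real r * root_of_unity N ^ m))) / real N" for z r
      by (rule nrm_poly_average) (use N in auto)
  qed
qed

lemma coeff_bound:
  assumes M: "\<And>z. cmod z = 1 \<Longrightarrow> nrm V (poly_vec Q z) \<le> M" and N: "0 < N" "\<And>k. degree (Q k) < N" "i < N"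
  shows "nrm V (\<lambda>k. coeff (Q k) i) \<le> M"
proof -
  let ?f = "\<lambda>m k. cnj (root_of_unity N ^ m) ^ i * poly_vec Q (root_of_unity N ^ m) k"
  have fm: "?f m \<in> elems V" for m by (intro scale_mem poly_mem)
  have "(\<lambda>k. coeff (Q k) i) = (\<lambda>k. (1 / of_nat N) * (\<Sum>m<N. ?f m k))"
    using coeff_average[OF N(1) N(2) N(3)] by (simp add: fun_eq_iff poly_vec_def)
  then have "nrm V (\<lambda>k. coeff (Q k) i) = cmod (1 / of_nat N) * nrm V (\<lambda>k. \<Sum>m<N. ?f m k)"
    using nrm_scale[OF sum_mem_le(1), of "{..<N}" ?f "1 / of_nat N"] fm by simp
  also have "\<dots> \<le> cmod (1 / of_nat N) * (\<Sum>m<N. nrm V (?f m))"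
    by (intro mult_left_mono sum_mem_le fm) auto
  also have "\<dots> \<le> cmod (1 / of_nat N) * (\<Sum>m<N. M)"
  proof (intro mult_left_mono sum_mono)
    show "nrm V (?f m) \<le> M" for m
      unfolding nrm_scale[OF poly_mem] using M[of "root_of_unity N ^ m"]
      by (simp add: norm_power)
  qed simp
  finally show ?thesis using N(1) by (simp add: norm_divide)
qed

text \<open>The coefficients are bounded by the supremum on the circle, so the second-order remainder has a bound
that depends on the radius but not on the degree or the polynomial. This is what allows series of
vector polynomials to be differentiated term by term.\<close>

lemma poly_derivative:
  assumes M: "\<And>z. cmod z = 1 \<Longrightarrow> nrm V (poly_vec Q z) \<le> M" and r: "0 < r" "r < 1" and z: "cmod z \<le> r"
  shows "\<exists>d\<in>elems V. nrm V d \<le> M * rem_const r \<and> (\<forall>w. cmod w \<le> r \<longrightarrow>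
     nrm V (\<lambda>k. poly_vec Q w k - poly_vec Q z k - (w - z) * d k) \<le> M * rem_const r * (cmod (w - z))\<^sup>2)"
proof -
  obtain N where N: "2 \<le> N" "\<And>k. degree (Q k) < N" using exists_degree_bound[of n Q] Q by blast
  have N0: "0 < N" using N by simp
  have M0: "0 \<le> M" using M[of 1] nrm_nonneg[OF poly_mem, of 1] by simp
  define v where "v i = (\<lambda>k. coeff (Q k) i)" for i
  have v: "v i \<in> elems V" for i unfolding v_def by (rule coeff_mem)
  have vM: "nrm V (v i) \<le> M" if "i < N" for i
    unfolding v_def by (rule coeff_bound[OF M N0 N(2) that])
  have comb: "(\<lambda>k. \<Sum>i<N. c i * v i k) \<in> elems V \<and> nrm V (\<lambda>k. \<Sum>i<N. c i * v i k) \<le> M * (\<Sum>i<N. cmod (c i))" for c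
  proof -
    have "nrm V (\<lambda>k. \<Sum>i<N. c i * v i k) \<le> (\<Sum>i<N. nrm V (\<lambda>k. c i * v i k))"
      by (intro sum_mem_le scale_mem v) auto
    also have "\<dots> \<le> (\<Sum>i<N. cmod (c i) * M)"
      unfolding nrm_scale[OF v] by (intro sum_mono mult_left_mono vM) auto
    finally show ?thesis
      using sum_mem_le(1)[of "{..<N}" "\<lambda>i k. c i * v i k"] scale_mem[OF v] by (simp add: sum_distrib_left mult.commute)
  qed
  define d where "d = (\<lambda>k. \<Sum>i<N. (of_nat i * z ^ (i - 1)) * v i k)"
  have pvw: "poly_vec Q w k = (\<Sum>i<N. w ^ i * v i k)" for w k
    using poly_sum_lessThan[OF N(2)] by (simp add: poly_vec_def v_def)
  have "nrm V (\<lambda>k. poly_vec Q w k - poly_vec Q z k - (w - z) * d k) \<le> M * rem_const r * (cmod (w - z))\<^sup>2" if w: "cmod w \<le> r" for w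
  proof -
    let ?c = "\<lambda>i. w ^ i - z ^ i - (w - z) * (of_nat i * z ^ (i - 1))"
    have "(\<lambda>k. poly_vec Q w k - poly_vec Q z k - (w - z) * d k) = (\<lambda>k. \<Sum>i<N. ?c i * v i k)"
    proof
      fix k
      have "?c i * v i k = w ^ i * v i k - z ^ i * v i k - (w - z) * ((of_nat i * z ^ (i - 1)) * v i k)" for i
        by (simp add: algebra_simps)
      then show "poly_vec Q w k - poly_vec Q z k - (w - z) * d k = (\<Sum>i<N. ?c i * v i k)"
        unfolding pvw d_def by (simp add: sum_subtractf sum_distrib_left)
    qed
    then have "nrm V (\<lambda>k. poly_vec Q w k - poly_vec Q z k - (w - z) * d k) \<le> M * (\<Sum>i<N. cmod (?c i))"
      using comb[of ?c] by simp
    also have "\<dots> \<le> M * (\<Sum>i<N. (real i)\<^sup>2 * r ^ i / r\<^sup>2 * (cmod (w - z))\<^sup>2)"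
      using M0 by (intro mult_left_mono sum_mono power_remainder r w z)
    also have "\<dots> = M * ((\<Sum>i<N. (real i)\<^sup>2 * r ^ i / r\<^sup>2) * (cmod (w - z))\<^sup>2)"
      by (simp add: sum_distrib_right)
    also have "\<dots> \<le> M * (rem_const r * (cmod (w - z))\<^sup>2)"
      using M0 by (intro mult_left_mono mult_right_mono rem_const_ge r) auto
    finally show ?thesis by (simp add: mult.assoc)
  qed
  moreover have "nrm V d \<le> M * rem_const r"
  proof -
    have "nrm V d \<le> M * (\<Sum>i<N. cmod (of_nat i * z ^ (i - 1)))"
      using comb[of "\<lambda>i. of_nat i * z ^ (i - 1)"] by (simp add: d_def)
    also have "\<dots> \<le> M * (\<Sum>i<N. (real i)\<^sup>2 * r ^ i / r\<^sup>2)"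
    proof (intro mult_left_mono sum_mono M0)
      fix i
      show "cmod (of_nat i * z ^ (i - 1)) \<le> (real i)\<^sup>2 * r ^ i / r\<^sup>2"
      proof (cases i)
        case (Suc j)
        have "r ^ j * r \<le> r ^ j" using r by (simp add: mult_left_le)
        then have "r ^ j \<le> r ^ j / r" using r by (simp add: pos_le_divide_eq)
        moreover have "cmod z ^ j \<le> r ^ j" using z by (intro power_mono) auto
        ultimately have "cmod z ^ j \<le> r ^ j / r" by linarith
        then have "real i * cmod z ^ j \<le> (real i)\<^sup>2 * (r ^ j / r)"
          using Suc r by (intro mult_mono) (auto simp: power2_eq_square)
        then show ?thesis using Suc r by (simp add: norm_mult norm_power power2_eq_square mult.assoc del: of_nat_Suc)
      qed simp
    qed
    also have "\<dots> \<le> M * rem_const r" by (intro mult_left_mono rem_const_ge r M0)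
    finally show ?thesis .
  qed
  moreover have "d \<in> elems V" using comb[of "\<lambda>i. of_nat i * z ^ (i - 1)"] by (simp add: d_def)
  ultimately show ?thesis by blast
qed

end

end

section \<open>The strip as a disc\<close>

text \<open>The conformal map of the strip onto the disc that sends \<open>1/2\<close> to the centre, the left side to the lower
and the right side to the upper arc.\<close>

definition strip_map :: "complex \<Rightarrow> complex" where
  "strip_map z = (exp (\<i> * of_real pi * z) - \<i>) / (exp (\<i> * of_real pi * z) + \<i>)"

lemma strip_exp: "Im (exp (\<i> * of_real pi * z)) = exp (- pi * Im z) * sin (pi * Re z)"
  by (simp add: Im_exp)

lemma strip_exp_nonneg: "z \<in> strip \<Longrightarrow> 0 \<le> Im (exp (\<i> * of_real pi * z))"
  unfolding strip_exp strip_def by (auto intro!: mult_nonneg_nonneg sin_ge_zero simp: mult_left_le)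

lemma strip_exp_pos: "z \<in> interior strip \<Longrightarrow> 0 < Im (exp (\<i> * of_real pi * z))"
  unfolding strip_exp interior_strip by (auto intro!: mult_pos_pos sin_gt_zero)

lemma strip_map_denom: "z \<in> strip \<Longrightarrow> exp (\<i> * of_real pi * z) + \<i> \<noteq> 0"
proof
  assume "z \<in> strip" "exp (\<i> * of_real pi * z) + \<i> = 0"
  then show False using strip_exp_nonneg[of z] by (auto simp: complex_eq_iff)
qed

lemma cayley_norm:
  assumes "0 \<le> Im w"
  shows "cmod (w - \<i>) \<le> cmod (w + \<i>)" "0 < Im w \<Longrightarrow> cmod (w - \<i>) < cmod (w + \<i>)"
  using assms by (auto simp: cmod_def power2_eq_square algebra_simps)

lemma norm_strip_map: "z \<in> strip \<Longrightarrow> cmod (strip_map z) \<le> 1"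
  unfolding strip_map_def norm_divide using cayley_norm(1)[OF strip_exp_nonneg[of z]]
  by (auto simp: divide_le_eq_1)

lemma norm_strip_map_less: "z \<in> interior strip \<Longrightarrow> cmod (strip_map z) < 1"
proof -
  assume z: "z \<in> interior strip"
  then have "z \<in> strip" using interior_subset by blast
  then show ?thesis
    unfolding strip_map_def norm_divide
    using cayley_norm(2)[OF strip_exp_nonneg[of z] strip_exp_pos[OF z]] strip_map_denom[of z]
    by (simp add: divide_less_eq_1)
qed

lemma continuous_strip_map: "continuous_on strip strip_map"
  unfolding strip_map_def[abs_def] using strip_map_denom by (intro continuous_intros) auto

lemma holomorphic_strip_map: "strip_map holomorphic_on interior strip"
  unfolding strip_map_def[abs_def] using strip_map_denom interior_subset
  by (intro holomorphic_intros) blast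

lemma exp_half_pi: "exp (\<i> * of_real pi / 2) = \<i>"
  by (simp add: exp_eq_polar complex_eq_iff)

lemma strip_map_half: "strip_map (1/2) = 0"
  by (simp add: strip_map_def exp_half_pi)

lemma exp_pi_Complex: "exp (\<i> * of_real pi * Complex a t) = exp (- pi * t) *\<^sub>R cis (pi * a)"
  by (simp add: exp_eq_polar complex_eq_iff)

lemma cayley_real: "(of_real s - \<i>) / (of_real s + \<i>) = (of_real s - \<i>)\<^sup>2 / of_real (s\<^sup>2 + 1)"
proof -
  have prod: "(of_real s + \<i>) * (of_real s - \<i>) = of_real (s\<^sup>2 + 1)"
    by (simp add: algebra_simps power2_eq_square)
  have "of_real s - \<i> \<noteq> 0" by (auto simp: complex_eq_iff)
  then have "(of_real s - \<i>) / (of_real s + \<i>)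
      = ((of_real s - \<i>) * (of_real s - \<i>)) / ((of_real s + \<i>) * (of_real s - \<i>))"
    by simp
  then show ?thesis unfolding prod by (simp only: power2_eq_square)
qed

lemma on_arc:
  assumes "cmod z = 1"
  shows "Im z \<le> 0 \<Longrightarrow> \<exists>t. 0 \<le> t \<and> t \<le> pi \<and> z = arc_point False t"
    "0 \<le> Im z \<Longrightarrow> \<exists>t. 0 \<le> t \<and> t \<le> pi \<and> z = arc_point True t"
proof -
  have sq: "(Re z)\<^sup>2 + (Im z)\<^sup>2 = 1" using assms by (simp add: cmod_def)
  have Re1: "\<bar>Re z\<bar> \<le> 1" using abs_Re_le_cmod[of z] assms by simp
  define t where "t = arccos (Re z)"
  have t: "0 \<le> t" "t \<le> pi" "cos t = Re z" "sin t = \<bar>Im z\<bar>"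
  proof -
    show "0 \<le> t" "t \<le> pi" "cos t = Re z"
      using Re1 by (auto simp: t_def abs_le_iff intro!: arccos_lbound arccos_ubound)
    have "sin t = sqrt (1 - (Re z)\<^sup>2)" using Re1 by (simp add: t_def sin_arccos abs_le_iff)
    also have "1 - (Re z)\<^sup>2 = (Im z)\<^sup>2" using sq by simp
    finally show "sin t = \<bar>Im z\<bar>" by simp
  qed
  show "\<exists>t. 0 \<le> t \<and> t \<le> pi \<and> z = arc_point False t" if "Im z \<le> 0"
    using t that by (intro exI[of _ t]) (auto simp: arc_point_def complex_eq_iff)
  show "\<exists>t. 0 \<le> t \<and> t \<le> pi \<and> z = arc_point True t" if "0 \<le> Im z"
    using t that by (intro exI[of _ t]) (auto simp: arc_point_def complex_eq_iff)
qed

text \<open>On the sides the exponential is real, positive on the left and negative on the right.\<close>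

lemma strip_map_sides:
  "\<exists>s. 0 \<le> s \<and> s \<le> pi \<and> strip_map (Complex 0 t) = arc_point False s"
  "\<exists>s. 0 \<le> s \<and> s \<le> pi \<and> strip_map (Complex 1 t) = arc_point True s"
proof -
  let ?e = "exp (- pi * t)"
  have nrm: "cmod ((of_real s - \<i>) / (of_real s + \<i>)) = 1" for s
  proof -
    have "cmod (of_real s - \<i>) = cmod (of_real s + \<i>)" by (simp add: cmod_def)
    moreover have "cmod (of_real s + \<i>) \<noteq> 0" by (auto simp: complex_eq_iff)
    ultimately show ?thesis by (simp add: norm_divide)
  qed
  have Im: "Im ((of_real s - \<i>) / (of_real s + \<i>)) = - 2 * s / (s\<^sup>2 + 1)" for s
    unfolding cayley_real by (simp add: power2_eq_square)
  have 0: "strip_map (Complex 0 t) = (of_real ?e - \<i>) / (of_real ?e + \<i>)"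
    unfolding strip_map_def exp_pi_Complex by (simp add: scaleR_conv_of_real)
  have 1: "strip_map (Complex 1 t) = (of_real (- ?e) - \<i>) / (of_real (- ?e) + \<i>)"
    unfolding strip_map_def exp_pi_Complex by (simp add: scaleR_conv_of_real)
  have "0 < ?e\<^sup>2 + 1" by (simp add: add_pos_pos)
  then have "- 2 * ?e / (?e\<^sup>2 + 1) \<le> 0" "0 \<le> - 2 * (- ?e) / ((- ?e)\<^sup>2 + 1)"
    by (simp_all add: divide_le_0_iff less_imp_le)
  then show "\<exists>s. 0 \<le> s \<and> s \<le> pi \<and> strip_map (Complex 0 t) = arc_point False s"
    "\<exists>s. 0 \<le> s \<and> s \<le> pi \<and> strip_map (Complex 1 t) = arc_point True s"
    unfolding 0 1 by (intro on_arc nrm; simp only: Im)+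
qed

lemma exists_unimodular_rotation: "\<exists>c. cmod c = 1 \<and> c * s = of_real (cmod s)"
proof (cases "s = 0")
  case False
  have "cnj s * s = of_real (cmod s) * of_real (cmod s)"
    using complex_norm_square[of s] by (simp add: power2_eq_square mult.commute)
  then show ?thesis using False by (intro exI[of _ "cnj s / of_real (cmod s)"]) (simp add: norm_divide)
qed (auto intro: exI[of _ 1])

section \<open>Interpolation between a space and its antidual\<close>

text \<open>What is used of a space with a monotone basis and its antidual: truncations are contractions on both,
and the second norm of a finite sequence is the dual of the first.\<close>

locale interp_pair = seq_pair +
  assumes trunc0: "x \<in> elems X0 \<Longrightarrow> trunc n x \<in> elems X0 \<and> nrm X0 (trunc n x) \<le> nrm X0 x"
    and trunc1: "x \<in> elems X1 \<Longrightarrow> trunc n x \<in> elems X1 \<and> nrm X1 (trunc n x) \<le> nrm X1 x"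
    and unit0: "unit_seq k \<in> elems X0 \<and> nrm X0 (unit_seq k) \<le> 2"
    and unit1: "unit_seq k \<in> elems X1 \<and> nrm X1 (unit_seq k) \<le> 2"
    and pairing: "x \<in> elems X0 \<Longrightarrow> y \<in> elems X1 \<Longrightarrow> cmod (\<Sum>k<n. x k * cnj (y k)) \<le> nrm X0 x * nrm X1 y"
    and dual_norm: "(\<And>a. a \<in> elems X0 \<Longrightarrow> cmod (\<Sum>k<n. a k * cnj (b k)) \<le> K * nrm X0 a) \<Longrightarrow> 0 \<le> K \<Longrightarrow>
      nrm X1 (trunc n b) \<le> K"
begin

sublocale U0: seq_unit X0 by standard (use unit0 in auto)
sublocale U1: seq_unit X1 by standard (use unit1 in auto)
sublocale US: seq_unit S
proof
  fix k
  show "unit_seq k \<in> elems S" "nrm S (unit_seq k) \<le> 2"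
    using S_le0[of "unit_seq k"] unit0[of k] by auto
qed

lemma vnorm_le_sum: "vnorm n a \<le> (\<Sum>k<n. cmod (a k))" and sum_le_vnorm: "(\<Sum>k<n. cmod (a k)) \<le> real n * vnorm n a"
proof -
  show "vnorm n a \<le> (\<Sum>k<n. cmod (a k))" unfolding vnorm_def by (rule L2_set_le_sum) simp
  have "(\<Sum>k<n. cmod (a k)) \<le> (\<Sum>k<n. vnorm n a)" by (intro sum_mono norm_le_vnorm) auto
  then show "(\<Sum>k<n. cmod (a k)) \<le> real n * vnorm n a" by simp
qed

lemma fin_norm_section:
  assumes V: "seq_unit V"
  shows "fin_norm n (\<lambda>a. nrm V (trunc n a)) (2 * real n + 1)"
proof -
  interpret V: seq_unit V by fact
  have ta: "trunc n (\<lambda>k. a k + b k) = (\<lambda>k. trunc n a k + trunc n b k)" for a b by (auto simp: trunc_def)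
  have tc: "trunc n (\<lambda>k. c * a k) = (\<lambda>k. c * trunc n a k)" for a c by (auto simp: trunc_def)
  show ?thesis
  proof
    fix a b :: "nat \<Rightarrow> complex" and c
    show "nrm V (trunc n (\<lambda>k. a k + b k)) \<le> nrm V (trunc n a) + nrm V (trunc n b)"
      unfolding ta by (intro V.nrm_add V.trunc_mem)
    show "nrm V (trunc n (\<lambda>k. c * a k)) = cmod c * nrm V (trunc n a)"
      unfolding tc by (intro V.nrm_scale V.trunc_mem)
    have "nrm V (trunc n a) \<le> 2 * (real n * vnorm n a)"
      using V.nrm_trunc[of n a] sum_le_vnorm[where n = n and a = a] by linarith
    moreover have "(2 * real n + 1) * vnorm n a = 2 * (real n * vnorm n a) + vnorm n a"
      by (simp add: algebra_simps)
    ultimately show "nrm V (trunc n a) \<le> (2 * real n + 1) * vnorm n a"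
      using vnorm_nonneg[of n a] by linarith
    have "vnorm n a \<le> (\<Sum>k<n. cmod (a k))" by (rule vnorm_le_sum)
    also have "\<dots> \<le> (\<Sum>k<n. 2 * nrm V (trunc n a))"
    proof (intro sum_mono)
      fix k assume "k \<in> {..<n}"
      then show "cmod (a k) \<le> 2 * nrm V (trunc n a)"
        using V.nrm_coord[OF V.trunc_mem, of n a k] by (simp add: trunc_def)
    qed
    finally have "vnorm n a \<le> real n * (2 * nrm V (trunc n a))" by simp
    then show "vnorm n a \<le> (2 * real n + 1) * nrm V (trunc n a)"
      using V.nrm_nonneg[OF V.trunc_mem, of n a] by (simp add: algebra_simps)
  qed simp
qed

lemma vinner_Re: "vinner n a b = Re (\<Sum>k<n. a k * cnj (b k))"
  by (simp add: vinner_def inner_complex_def)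

text \<open>Sequences of length \<open>n\<close> with the two norms form a dual pair. The real part of the pairing is enough,
since a unimodular factor makes its value positive.\<close>

lemma half_dual_sections:
  "half_dual_pair n (\<lambda>a. nrm X0 (trunc n a)) (\<lambda>a. nrm X1 (trunc n a)) (2 * real n + 1)"
proof -
  interpret A: fin_norm n "\<lambda>a. nrm X0 (trunc n a)" "2 * real n + 1" by (rule fin_norm_section) (rule U0.seq_unit_axioms)
  interpret B: fin_norm n "\<lambda>a. nrm X1 (trunc n a)" "2 * real n + 1" by (rule fin_norm_section) (rule U1.seq_unit_axioms)
  show ?thesis
  proof
    fix a b
    have "(\<Sum>k<n. a k * cnj (b k)) = (\<Sum>k<n. trunc n a k * cnj (trunc n b k))" by (simp add: trunc_def)
    then have "vinner n a b \<le> cmod (\<Sum>k<n. trunc n a k * cnj (trunc n b k))"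
      unfolding vinner_Re by (simp only: complex_Re_le_cmod)
    then show "vinner n a b \<le> nrm X0 (trunc n a) * nrm X1 (trunc n b)"
      using pairing[OF U0.trunc_mem[of n a] U1.trunc_mem[of n b], of n] by linarith
  next
    fix b K assume le: "\<And>a. vinner n a b \<le> K * nrm X0 (trunc n a)" and K: "0 \<le> K"
    show "nrm X1 (trunc n b) \<le> K"
    proof (rule dual_norm[OF _ K])
      fix a assume a: "a \<in> elems X0"
      let ?s = "\<Sum>k<n. a k * cnj (b k)"
      obtain c where c: "cmod c = 1" "c * ?s = of_real (cmod ?s)"
        using exists_unimodular_rotation by blast
      have "cmod ?s = Re (\<Sum>k<n. (c * a k) * cnj (b k))"
        using c(2) by (simp add: sum_distrib_left mult.assoc)
      also have "\<dots> \<le> K * nrm X0 (trunc n (\<lambda>k. c * a k))" using le[of "\<lambda>k. c * a k"] by (simp add: vinner_Re)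
      also have "\<dots> = K * nrm X0 (trunc n a)" by (simp add: A.hom c(1))
      also have "\<dots> \<le> K * nrm X0 a" using trunc0[OF a, of n] K by (intro mult_left_mono) auto
      finally show "cmod ?s \<le> K * nrm X0 a" .
    qed
  qed
qed

lemma finite_factorization:
  assumes "vnorm n x < M"
  shows "\<exists>Q. (\<forall>k\<ge>n. Q k = 0) \<and> poly_vec Q 0 = trunc n x \<and>
    (\<forall>t. 0 \<le> t \<longrightarrow> t \<le> pi \<longrightarrow> nrm X0 (poly_vec Q (arc_point False t)) \<le> M \<and> nrm X1 (poly_vec Q (arc_point True t)) \<le> M)"
proof -
  interpret D: half_dual_pair n "\<lambda>a. nrm X0 (trunc n a)" "\<lambda>a. nrm X1 (trunc n a)" "2 * real n + 1"
    by (rule half_dual_sections)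
  obtain Q where Q: "\<And>k. poly (Q k) 0 = x k"
    "\<And>b t. 0 \<le> t \<Longrightarrow> t \<le> pi \<Longrightarrow> D.arc_norm b (poly_vec Q (arc_point b t)) \<le> M"
    using D.factorization_sup[OF assms] by blast
  define Q' where "Q' k = (if k < n then Q k else 0)" for k
  have Q': "poly_vec Q' z = trunc n (poly_vec Q z)" for z by (auto simp: poly_vec_def Q'_def trunc_def)
  have "poly_vec Q' 0 = trunc n x" unfolding Q' by (auto simp: poly_vec_def trunc_def Q(1))
  then show ?thesis
    using Q(2)[of _ False] Q(2)[of _ True] by (intro exI[of _ Q']) (auto simp: Q' D.arc_norm_def, auto simp: Q'_def)
qed

text \<open>On the sides \<open>reflection_bound\<close> pairs an element of one space with an element of the other.\<close>

lemma H_value_l2: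
  assumes g: "g \<in> H"
  shows "(\<Sum>k<n. (cmod (g (1/2) k))\<^sup>2) \<le> (hnorm g)\<^sup>2"
proof -
  obtain B where B: "\<And>k z. z \<in> strip \<Longrightarrow> cmod (g z k) \<le> B" using H_coord_bounded[OF g] by blast
  have mem: "g (Complex 0 t) \<in> elems X0" "g (Complex 1 t) \<in> elems X1" for t
    using g unfolding H_iff line_ok_def by auto
  show ?thesis
  proof (rule reflection_bound[OF H_coord_continuous[OF g] H_coord_holomorphic[OF g] B])
    fix t
    have "cmod (\<Sum>k<n. g (Complex 0 t) k * cnj (g (Complex 1 t) k)) \<le> nrm X0 (g (Complex 0 t)) * nrm X1 (g (Complex 1 t))"
      by (rule pairing) (rule mem)+
    also have "\<dots> \<le> hnorm g * hnorm g"
      by (intro mult_mono hnorm_ge g hnorm_nonneg X0.nrm_nonneg X1.nrm_nonneg mem)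
    finally show "cmod (\<Sum>k<n. g (Complex 0 t) k * cnj (g (Complex 1 t) k)) \<le> (hnorm g)\<^sup>2"
      by (simp add: power2_eq_square)
  qed auto
qed

lemma half_interior: "1/2 \<in> interior strip" "1/2 \<in> strip"
  by (simp add: interior_strip, simp add: strip_def)

text \<open>The quotient \<open>g(z) / (z - 1/2)\<close> takes the value \<open>g'(1/2)\<close> at \<open>1/2\<close>, and on the sides division by
\<open>z - 1/2\<close> costs at most a factor \<open>2\<close>.\<close>

lemma H_deriv_l2:
  assumes g: "g \<in> H" and g0: "g (1/2) = (\<lambda>k. 0)" and d: "has_nderivative S g (1/2) d"
  shows "(\<Sum>k<n. (cmod (d k))\<^sup>2) \<le> (2 * hnorm g)\<^sup>2"
proof -
  have gS: "g z \<in> elems S" if "z \<in> strip" for z using g that unfolding H_iff by auto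
  define u where "u z k = (if z = 1/2 then deriv (\<lambda>z. g z k) (1/2) else (g z k - g (1/2) k) / (z - 1/2))" for z k
  have u_eq: "u z k = g z k / (z - 1/2)" if "z \<noteq> 1/2" for z k using that by (simp add: u_def g0)
  have hol: "(\<lambda>z. u z k) holomorphic_on interior strip" for k
    unfolding u_def by (rule pole_lemma_open[OF H_coord_holomorphic[OF g] open_interior])
  have cont: "continuous_on strip (\<lambda>z. u z k)" for k
    unfolding continuous_on_eq_continuous_within
  proof
    fix z assume z: "z \<in> strip"
    show "continuous (at z within strip) (\<lambda>z. u z k)"
    proof (cases "z = 1/2")
      case True
      have "isCont (\<lambda>z. u z k) (1/2)"
        using holomorphic_on_imp_continuous_on[OF hol[of k]] half_interior(1)
        by (simp add: continuous_on_eq_continuous_at)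
      then show ?thesis unfolding True by (rule continuous_at_imp_continuous_at_within)
    next
      case False
      have "continuous (at z within strip) (\<lambda>z. g z k)"
        using H_coord_continuous[OF g, of k] z by (simp add: continuous_on_eq_continuous_within)
      then have "((\<lambda>w. g w k / (w - 1/2)) \<longlongrightarrow> g z k / (z - 1/2)) (at z within strip)"
        using False unfolding continuous_within by (intro tendsto_intros) auto
      then have "((\<lambda>w. u w k) \<longlongrightarrow> g z k / (z - 1/2)) (at z within strip)"
      proof (rule Lim_transform_eventually)
        have "\<forall>\<^sub>F w in at z within strip. w \<noteq> 1/2"
          by (rule tendsto_imp_eventually_ne[OF tendsto_ident_at False])
        then show "\<forall>\<^sub>F w in at z within strip. g w k / (w - 1/2) = u w k"
          by eventually_elim (simp add: u_eq)
      qed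
      then show ?thesis unfolding continuous_within using u_eq[OF False] by simp
    qed
  qed
  obtain B where B: "\<And>k z. z \<in> strip \<Longrightarrow> cmod (g z k) \<le> B" using H_coord_bounded[OF g] by blast
  have B0: "0 \<le> B" using B[OF half_interior(2), of 0] norm_ge_zero order_trans by blast
  have cb: "cball (1/2) (1/4) \<subseteq> strip"
  proof
    fix z :: complex assume "z \<in> cball (1/2) (1/4)"
    then have "\<bar>Re (1/2 - z)\<bar> \<le> 1/4" using abs_Re_le_cmod[of "1/2 - z"] by (simp add: dist_norm)
    then have "0 \<le> Re z" "Re z \<le> 1" by (simp_all add: abs_if split: if_splits)
    then show "z \<in> strip" by (simp add: strip_def)
  qed
  have "\<exists>R. \<forall>z\<in>cball (1/2) (1/4). cmod (u z k) \<le> R" for k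
    using compact_imp_bounded[OF compact_continuous_image[OF continuous_on_subset[OF cont[of k] cb] compact_cball]]
    unfolding bounded_iff by auto
  then obtain R where R: "\<And>k z. z \<in> cball (1/2) (1/4) \<Longrightarrow> cmod (u z k) \<le> R k" by metis
  define R' where "R' = 4 * B + (\<Sum>k<n. \<bar>R k\<bar>)"
  have bdd: "cmod (u z k) \<le> R'" if k: "k < n" and z: "z \<in> strip" for k z
  proof (cases "z \<in> cball (1/2) (1/4)")
    case True
    have "\<bar>R k\<bar> \<le> (\<Sum>k<n. \<bar>R k\<bar>)" using k by (intro member_le_sum) auto
    then show ?thesis using R[OF True, of k] B0 unfolding R'_def by linarith
  next
    case False
    then have far: "1/4 < cmod (z - 1/2)" by (simp add: dist_norm norm_minus_commute)
    have "z \<noteq> 1/2"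
    proof
      assume "z = 1/2"
      then have "cmod (z - 1/2) = 0" by (simp only: diff_self norm_zero)
      then show False using far by linarith
    qed
    then have "cmod (u z k) = cmod (g z k) / cmod (z - 1/2)" by (simp add: u_eq norm_divide)
    also have "\<dots> \<le> B / (1/4)" using B[OF z, of k] B0 far by (intro frac_le) auto
    finally show ?thesis unfolding R'_def by (simp add: add_increasing2 sum_nonneg)
  qed
  have mem: "g (Complex 0 t) \<in> elems X0" "g (Complex 1 t) \<in> elems X1" for t
    using g unfolding H_iff line_ok_def by auto
  have "(\<Sum>k<n. (cmod (u (1/2) k))\<^sup>2) \<le> (2 * hnorm g)\<^sup>2"
  proof (rule reflection_bound[OF cont hol bdd])
    fix t
    let ?a = "Complex 0 t - 1/2" and ?b = "Complex 1 t - 1/2"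
    have ne: "Complex 0 t \<noteq> 1/2" "Complex 1 t \<noteq> 1/2" by (auto simp: complex_eq_iff)
    have half: "1/2 \<le> cmod ?a" "1/2 \<le> cmod ?b"
      using abs_Re_le_cmod[of ?a] abs_Re_le_cmod[of ?b] by simp_all
    have "(\<Sum>k<n. u (Complex 0 t) k * cnj (u (Complex 1 t) k))
       = (\<Sum>k<n. g (Complex 0 t) k * cnj (g (Complex 1 t) k)) / (?a * cnj ?b)"
      unfolding u_eq[OF ne(1)] u_eq[OF ne(2)] by (simp add: sum_divide_distrib)
    then have "cmod (\<Sum>k<n. u (Complex 0 t) k * cnj (u (Complex 1 t) k))
       = cmod (\<Sum>k<n. g (Complex 0 t) k * cnj (g (Complex 1 t) k)) / (cmod ?a * cmod ?b)"
      by (simp add: norm_divide norm_mult del: complex_cnj_diff)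
    also have "\<dots> \<le> (hnorm g * hnorm g) / (1/2 * (1/2))"
    proof (rule frac_le)
      have "cmod (\<Sum>k<n. g (Complex 0 t) k * cnj (g (Complex 1 t) k)) \<le> nrm X0 (g (Complex 0 t)) * nrm X1 (g (Complex 1 t))"
        by (rule pairing) (rule mem)+
      also have "\<dots> \<le> hnorm g * hnorm g"
        by (intro mult_mono hnorm_ge g hnorm_nonneg X0.nrm_nonneg X1.nrm_nonneg mem)
      finally show "cmod (\<Sum>k<n. g (Complex 0 t) k * cnj (g (Complex 1 t) k)) \<le> hnorm g * hnorm g" .
      show "1/2 * (1/2) \<le> cmod ?a * cmod ?b" using half by (intro mult_mono) auto
    qed auto
    finally show "cmod (\<Sum>k<n. u (Complex 0 t) k * cnj (u (Complex 1 t) k)) \<le> (2 * hnorm g)\<^sup>2"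
      by (simp add: power2_eq_square)
  qed
  moreover have "u (1/2) k = d k" for k
    using DERIV_imp_deriv[OF nderiv_coord[OF d gS half_interior(1), of k]] by (simp add: u_def)
  ultimately show ?thesis by simp
qed

end

lemma vnorm_power2: "(vnorm n x)\<^sup>2 = (\<Sum>k<n. (cmod (x k))\<^sup>2)"
  by (simp add: vnorm_def L2_set_def sum_nonneg)

lemma ell2_iff: "x \<in> elems ell2 \<longleftrightarrow> summable (\<lambda>k. (cmod (x k))\<^sup>2)"
  and ell2_nrm: "nrm ell2 x = sqrt (\<Sum>k. (cmod (x k))\<^sup>2)"
  by (simp_all add: ell2_def)

lemma vnorm_le_ell2: "x \<in> elems ell2 \<Longrightarrow> vnorm n x \<le> nrm ell2 x"
  unfolding ell2_iff ell2_nrm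
  by (rule real_le_rsqrt) (auto simp: vnorm_power2 intro!: sum_le_suminf)

lemma ell2_leI:
  assumes "\<And>n. vnorm n x \<le> B"
  shows "x \<in> elems ell2" "nrm ell2 x \<le> B"
proof -
  have B: "0 \<le> B" using assms[of 0] vnorm_nonneg order_trans by blast
  have le: "(\<Sum>k<n. (cmod (x k))\<^sup>2) \<le> B\<^sup>2" for n
    unfolding vnorm_power2[symmetric] using assms by (intro power_mono) auto
  have sm: "summable (\<lambda>k. (cmod (x k))\<^sup>2)" by (rule summableI_nonneg_bounded[OF _ le]) simp
  then show "x \<in> elems ell2" by (simp add: ell2_iff)
  have "(\<Sum>k. (cmod (x k))\<^sup>2) \<le> B\<^sup>2" by (rule suminf_le_const[OF sm le])
  then show "nrm ell2 x \<le> B" unfolding ell2_nrm using B by (intro real_le_lsqrt) (auto intro: suminf_nonneg sm)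
qed

lemma ell2_nonneg: "x \<in> elems ell2 \<Longrightarrow> 0 \<le> nrm ell2 x"
  using vnorm_le_ell2[of x 0] vnorm_nonneg[of 0 x] by linarith

lemma ell2_add:
  assumes "x \<in> elems ell2" "y \<in> elems ell2"
  shows "(\<lambda>k. x k + y k) \<in> elems ell2" "nrm ell2 (\<lambda>k. x k + y k) \<le> nrm ell2 x + nrm ell2 y"
proof -
  have "vnorm n (\<lambda>k. x k + y k) \<le> nrm ell2 x + nrm ell2 y" for n
    using vnorm_triangle[of n x y] vnorm_le_ell2[OF assms(1), of n] vnorm_le_ell2[OF assms(2), of n] by linarith
  then show "(\<lambda>k. x k + y k) \<in> elems ell2" "nrm ell2 (\<lambda>k. x k + y k) \<le> nrm ell2 x + nrm ell2 y"
    using ell2_leI by blast+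
qed

lemma ell2_scale:
  assumes "x \<in> elems ell2"
  shows "(\<lambda>k. c * x k) \<in> elems ell2" "nrm ell2 (\<lambda>k. c * x k) = cmod c * nrm ell2 x"
proof -
  have eq: "(\<lambda>k. (cmod (c * x k))\<^sup>2) = (\<lambda>k. (cmod c)\<^sup>2 * (cmod (x k))\<^sup>2)"
    by (simp add: norm_mult power_mult_distrib)
  show "(\<lambda>k. c * x k) \<in> elems ell2" using assms unfolding ell2_iff eq by (rule summable_mult)
  show "nrm ell2 (\<lambda>k. c * x k) = cmod c * nrm ell2 x"
    using assms unfolding ell2_iff ell2_nrm eq by (simp add: suminf_mult real_sqrt_mult)
qed

lemma ell2_diff:
  assumes "x \<in> elems ell2" "y \<in> elems ell2"
  shows "(\<lambda>k. x k - y k) \<in> elems ell2" "nrm ell2 (\<lambda>k. x k - y k) \<le> nrm ell2 x + nrm ell2 y"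
  using ell2_add[OF assms(1) ell2_scale(1)[OF assms(2), of "-1"]] ell2_scale(2)[OF assms(2), of "-1"] by simp_all

lemma ell2_zero: "(\<lambda>k. 0) \<in> elems ell2" "nrm ell2 (\<lambda>k. 0) = 0"
  by (simp_all add: ell2_iff ell2_nrm)

lemma ell2_sum:
  assumes "finite I" "\<And>i. i \<in> I \<Longrightarrow> f i \<in> elems ell2"
  shows "(\<lambda>k. \<Sum>i\<in>I. f i k) \<in> elems ell2 \<and> nrm ell2 (\<lambda>k. \<Sum>i\<in>I. f i k) \<le> (\<Sum>i\<in>I. nrm ell2 (f i))"
  using assms
proof (induction I rule: finite_induct)
  case (insert i I)
  then have "(\<lambda>k. \<Sum>i\<in>I. f i k) \<in> elems ell2" "nrm ell2 (\<lambda>k. \<Sum>i\<in>I. f i k) \<le> (\<Sum>i\<in>I. nrm ell2 (f i))" by auto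
  then show ?case using insert.hyps ell2_add[of "f i" "\<lambda>k. \<Sum>i\<in>I. f i k"] insert.prems[of i] by simp
qed (simp add: ell2_zero)

text \<open>By the parallelogram law, one of \<open>x + y\<close> and \<open>x - y\<close> has norm square at most the sum of the two squares.\<close>

lemma ell2_sign_step:
  assumes x: "x \<in> elems ell2" and y: "y \<in> elems ell2"
  shows "\<exists>c\<in>{1, -1 :: complex}. (nrm ell2 (\<lambda>k. x k + c * y k))\<^sup>2 \<le> (nrm ell2 x)\<^sup>2 + (nrm ell2 y)\<^sup>2"
proof -
  have sq: "(nrm ell2 v)\<^sup>2 = (\<Sum>k. (cmod (v k))\<^sup>2)" if "v \<in> elems ell2" for v
    using that unfolding ell2_iff ell2_nrm by (simp add: suminf_nonneg)
  note s = x[unfolded ell2_iff] y[unfolded ell2_iff] ell2_add(1)[OF x y, unfolded ell2_iff] ell2_diff(1)[OF x y, unfolded ell2_iff]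
  have par: "(cmod (x k + y k))\<^sup>2 + (cmod (x k - y k))\<^sup>2 = 2 * (cmod (x k))\<^sup>2 + 2 * (cmod (y k))\<^sup>2" for k
    unfolding cmod_power2 by (simp add: power2_eq_square algebra_simps)
  have "(nrm ell2 (\<lambda>k. x k + y k))\<^sup>2 + (nrm ell2 (\<lambda>k. x k - y k))\<^sup>2
      = (\<Sum>k. (cmod (x k + y k))\<^sup>2 + (cmod (x k - y k))\<^sup>2)"
    unfolding sq[OF ell2_add(1)[OF x y]] sq[OF ell2_diff(1)[OF x y]] by (rule suminf_add[OF s(3,4)])
  also have "\<dots> = 2 * (nrm ell2 x)\<^sup>2 + 2 * (nrm ell2 y)\<^sup>2"
    unfolding par sq[OF x] sq[OF y] suminf_mult[OF s(1), symmetric] suminf_mult[OF s(2), symmetric]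
    by (intro suminf_add[symmetric] summable_mult s)
  finally have "(nrm ell2 (\<lambda>k. x k + y k))\<^sup>2 \<le> (nrm ell2 x)\<^sup>2 + (nrm ell2 y)\<^sup>2 \<or>
      (nrm ell2 (\<lambda>k. x k - y k))\<^sup>2 \<le> (nrm ell2 x)\<^sup>2 + (nrm ell2 y)\<^sup>2" by linarith
  then show ?thesis by auto
qed

text \<open>The signs are chosen greedily, one summand at a time.\<close>

lemma ell2_signs:
  assumes "\<And>i. i < n \<Longrightarrow> d i \<in> elems ell2" "\<And>i. i < n \<Longrightarrow> nrm ell2 (d i) \<le> K"
  shows "\<exists>c. (\<forall>i. c i = 1 \<or> c i = (-1 :: complex)) \<and> (nrm ell2 (\<lambda>k. \<Sum>i<n. c i * d i k))\<^sup>2 \<le> real n * K\<^sup>2"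
  using assms
proof (induction n)
  case 0
  show ?case by (rule exI[of _ "\<lambda>_. 1"]) (simp add: ell2_zero)
next
  case (Suc n)
  have "\<exists>c. (\<forall>i. c i = 1 \<or> c i = (-1 :: complex)) \<and> (nrm ell2 (\<lambda>k. \<Sum>i<n. c i * d i k))\<^sup>2 \<le> real n * K\<^sup>2"
    by (rule Suc.IH) (use Suc.prems in auto)
  then obtain c where c: "\<And>i. c i = 1 \<or> c i = (-1 :: complex)" "(nrm ell2 (\<lambda>k. \<Sum>i<n. c i * d i k))\<^sup>2 \<le> real n * K\<^sup>2"
    by blast
  have S: "(\<lambda>k. \<Sum>i<n. c i * d i k) \<in> elems ell2"
    by (rule ell2_sum[THEN conjunct1]) (use Suc.prems in \<open>auto intro: ell2_scale\<close>)
  have dn: "d n \<in> elems ell2" using Suc.prems by simp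
  obtain e where e: "e \<in> {1, -1 :: complex}"
    "(nrm ell2 (\<lambda>k. (\<Sum>i<n. c i * d i k) + e * d n k))\<^sup>2 \<le> (nrm ell2 (\<lambda>k. \<Sum>i<n. c i * d i k))\<^sup>2 + (nrm ell2 (d n))\<^sup>2"
    using ell2_sign_step[OF S dn] by blast
  have "(nrm ell2 (d n))\<^sup>2 \<le> K\<^sup>2" using Suc.prems ell2_nonneg[OF dn] by (intro power_mono) auto
  then have "(nrm ell2 (\<lambda>k. \<Sum>i<Suc n. (c(n := e)) i * d i k))\<^sup>2 \<le> real (Suc n) * K\<^sup>2"
    using e(2) c(2) by (simp add: algebra_simps)
  moreover have "\<forall>i. (c(n := e)) i = 1 \<or> (c(n := e)) i = -1" using c(1) e(1) by auto
  ultimately show ?case by blast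
qed

lemma ell2_tail:
  assumes x: "x \<in> elems ell2" and e: "0 < e"
  shows "\<exists>N0. \<forall>N\<ge>N0. \<forall>n. (\<Sum>k\<in>{N..<n}. (cmod (x k))\<^sup>2) < e\<^sup>2"
proof -
  have "0 < e\<^sup>2" using e by simp
  then obtain N0 where "\<forall>m\<ge>N0. \<forall>n. norm (\<Sum>k\<in>{m..<n}. (cmod (x k))\<^sup>2) < e\<^sup>2"
    using x unfolding ell2_iff summable_Cauchy by blast
  then show ?thesis by (intro exI[of _ N0]) (auto simp: abs_of_nonneg sum_nonneg)
qed

context interp_pair
begin

text \<open>The maximum principle bounds the terms in the sum space on the whole disc, which gives uniform
convergence there; the quadratic remainder estimates add up to differentiability inside.\<close>

lemma series_in_H:
  assumes Q: "\<And>j k. n j \<le> k \<Longrightarrow> Q j k = 0"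
    and b0: "\<And>j t. 0 \<le> t \<Longrightarrow> t \<le> pi \<Longrightarrow> nrm X0 (poly_vec (Q j) (arc_point False t)) \<le> M j"
    and b1: "\<And>j t. 0 \<le> t \<Longrightarrow> t \<le> pi \<Longrightarrow> nrm X1 (poly_vec (Q j) (arc_point True t)) \<le> M j"
    and sM: "summable M"
  shows "(\<lambda>z k. \<Sum>j. poly_vec (Q j) (strip_map z) k) \<in> H" "hnorm (\<lambda>z k. \<Sum>j. poly_vec (Q j) (strip_map z) k) \<le> suminf M"
proof -
  have pm0: "poly_vec (Q j) z \<in> elems X0" and pm1: "poly_vec (Q j) z \<in> elems X1" and pmS: "poly_vec (Q j) z \<in> elems S" for j z
    by (rule U0.poly_mem[OF Q] U1.poly_mem[OF Q] US.poly_mem[OF Q]; assumption)+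
  have circ: "nrm S (poly_vec (Q j) z) \<le> M j" if z1: "cmod z = 1" for j z
  proof (cases "Im z \<le> 0")
    case True
    then obtain t where "0 \<le> t" "t \<le> pi" "z = arc_point False t" using on_arc(1)[OF z1] by blast
    then show ?thesis using S_le0(2)[OF pm0[of j z]] b0[of t j] by simp
  next
    case False
    then obtain t where "0 \<le> t" "t \<le> pi" "z = arc_point True t" using on_arc(2)[OF z1] by fastforce
    then show ?thesis using S_le1(2)[OF pm1[of j z]] b1[of t j] by simp
  qed
  have disc: "nrm S (poly_vec (Q j) z) \<le> M j" if "cmod z \<le> 1" for j z
    by (rule US.poly_maximum_principle[OF Q circ that])
  have M0: "0 \<le> M j" for j using circ[of 1 j] S.nrm_nonneg[OF pmS[of j 1]] by simp
  define G where "G z k = (\<Sum>j. poly_vec (Q j) z k)" for z k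
  have series: "G z \<in> elems V \<and> nrm V (G z) \<le> suminf M"
    if V: "seq_unit V" and le: "\<And>j. nrm V (poly_vec (Q j) z) \<le> M j" for V z
  proof -
    interpret V: seq_unit V by (rule V)
    have vm: "poly_vec (Q j) z \<in> elems V" for j by (rule V.poly_mem[OF Q])
    have s: "summable (\<lambda>j. nrm V (poly_vec (Q j) z))"
      by (rule summable_comparison_test'[OF sM]) (use le V.nrm_nonneg[OF vm] in auto)
    show ?thesis
      using V.suminf_mem_le[of "\<lambda>j. poly_vec (Q j) z", OF vm s] suminf_le[OF le s sM]
      unfolding G_def[abs_def] by linarith
  qed
  have GS: "G z \<in> elems S" "nrm S (G z) \<le> suminf M" if "cmod z \<le> 1" for z
    using series[OF US.seq_unit_axioms disc[OF that]] by auto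
  have side0: "nrm X0 (poly_vec (Q j) (strip_map (Complex 0 t))) \<le> M j" for j t
    using strip_map_sides(1)[of t] b0[of _ j] by auto
  have side1: "nrm X1 (poly_vec (Q j) (strip_map (Complex 1 t))) \<le> M j" for j t
    using strip_map_sides(2)[of t] b1[of _ j] by auto
  note G0 = series[OF U0.seq_unit_axioms side0] and G1 = series[OF U1.seq_unit_axioms side1]
  have cphi: "((\<lambda>s. strip_map (Complex a s)) \<longlongrightarrow> strip_map (Complex a t)) (at t)" if "0 \<le> a" "a \<le> 1" for a t
  proof -
    have "continuous_on UNIV (\<lambda>s. strip_map (Complex a s))"
    proof (rule continuous_on_compose2[OF continuous_strip_map])
      show "continuous_on UNIV (Complex a)" by (auto simp: Complex_eq intro!: continuous_intros)
      show "range (Complex a) \<subseteq> strip" using that by (auto simp: strip_def)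
    qed
    then show ?thesis by (simp add: continuous_on_def)
  qed
  have "line_ok X0 (\<lambda>t. G (strip_map (Complex 0 t)))"
    unfolding line_ok_def
  proof (intro conjI allI)
    fix t
    show "((\<lambda>s. nrm X0 (\<lambda>k. G (strip_map (Complex 0 s)) k - G (strip_map (Complex 0 t)) k)) \<longlongrightarrow> 0) (at t)"
      unfolding G_def
    proof (rule X0.suminf_tendsto[where T = UNIV and M = M and y = "\<lambda>j s. poly_vec (Q j) (strip_map (Complex 0 s))"])
      show "((\<lambda>s. nrm X0 (\<lambda>k. poly_vec (Q j) (strip_map (Complex 0 s)) k - poly_vec (Q j) (strip_map (Complex 0 t)) k)) \<longlongrightarrow> 0) (at t)" for j
        by (rule U0.poly_tendsto_compose[OF Q cphi]) auto
    qed (auto intro: pm0 side0 sM)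
  qed (use G0 in auto)
  moreover have "line_ok X1 (\<lambda>t. G (strip_map (Complex 1 t)))"
    unfolding line_ok_def
  proof (intro conjI allI)
    fix t
    show "((\<lambda>s. nrm X1 (\<lambda>k. G (strip_map (Complex 1 s)) k - G (strip_map (Complex 1 t)) k)) \<longlongrightarrow> 0) (at t)"
      unfolding G_def
    proof (rule X1.suminf_tendsto[where T = UNIV and M = M and y = "\<lambda>j s. poly_vec (Q j) (strip_map (Complex 1 s))"])
      show "((\<lambda>s. nrm X1 (\<lambda>k. poly_vec (Q j) (strip_map (Complex 1 s)) k - poly_vec (Q j) (strip_map (Complex 1 t)) k)) \<longlongrightarrow> 0) (at t)" for j
        by (rule U1.poly_tendsto_compose[OF Q cphi]) auto
    qed (auto intro: pm1 side1 sM)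
  qed (use G1 in auto)
  moreover have "((\<lambda>w. nrm S (\<lambda>k. G (strip_map w) k - G (strip_map z) k)) \<longlongrightarrow> 0) (at z within strip)" if z: "z \<in> strip" for z
    unfolding G_def
  proof (rule S.suminf_tendsto[where T = strip and M = M and y = "\<lambda>j s. poly_vec (Q j) (strip_map s)"])
    have tz: "(strip_map \<longlongrightarrow> strip_map z) (at z within strip)"
      using continuous_strip_map z by (auto simp: continuous_on_def)
    show "((\<lambda>w. nrm S (\<lambda>k. poly_vec (Q j) (strip_map w) k - poly_vec (Q j) (strip_map z) k)) \<longlongrightarrow> 0) (at z within strip)" for j
      by (rule US.poly_tendsto_compose[where n = "n j", OF _ tz]) (rule Q)
  qed (use z in \<open>auto intro: pmS disc norm_strip_map sM\<close>)
  moreover have "\<exists>d. has_nderivative S (\<lambda>z. G (strip_map z)) z d" if z: "z \<in> interior strip" for z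
  proof -
    let ?z = "strip_map z"
    define r where "r = (1 + cmod ?z) / 2"
    have zr: "cmod ?z < r" and r: "0 < r" "r < 1"
      using norm_strip_map_less[OF z] by (simp_all add: r_def add_pos_nonneg)
    have "\<exists>d\<in>elems S. nrm S d \<le> M j * rem_const r \<and> (\<forall>w. cmod w \<le> r \<longrightarrow>
     nrm S (\<lambda>k. poly_vec (Q j) w k - poly_vec (Q j) ?z k - (w - ?z) * d k) \<le> M j * rem_const r * (cmod (w - ?z))\<^sup>2)" for j
      by (rule US.poly_derivative[OF Q circ r less_imp_le[OF zr]])
    then have "\<forall>j. \<exists>d. d \<in> elems S \<and> nrm S d \<le> M j * rem_const r \<and> (\<forall>w. cmod w \<le> r \<longrightarrow>
     nrm S (\<lambda>k. poly_vec (Q j) w k - poly_vec (Q j) ?z k - (w - ?z) * d k) \<le> M j * rem_const r * (cmod (w - ?z))\<^sup>2)"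
      by blast
    from choice[OF this] obtain d where d': "\<forall>j. d j \<in> elems S \<and> nrm S (d j) \<le> M j * rem_const r \<and> (\<forall>w. cmod w \<le> r \<longrightarrow>
     nrm S (\<lambda>k. poly_vec (Q j) w k - poly_vec (Q j) ?z k - (w - ?z) * d j k) \<le> M j * rem_const r * (cmod (w - ?z))\<^sup>2)" ..
    then have d: "\<And>j. d j \<in> elems S" "\<And>j. nrm S (d j) \<le> M j * rem_const r"
      "\<And>j w. cmod w \<le> r \<Longrightarrow> nrm S (\<lambda>k. poly_vec (Q j) w k - poly_vec (Q j) ?z k - (w - ?z) * d j k) \<le> M j * rem_const r * (cmod (w - ?z))\<^sup>2"
      by blast+
    define A where "A = suminf M * rem_const r"
    have sMr: "summable (\<lambda>j. M j * rem_const r)" using sM by (rule summable_mult2)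
    have sd: "summable (\<lambda>j. nrm S (d j))"
      by (rule summable_comparison_test'[OF sMr]) (use d S.nrm_nonneg[OF d(1)] in auto)
    define D where "D k = (\<Sum>j. d j k)" for k
    have DS: "D \<in> elems S" using S.suminf_mem_le[OF d(1) sd] unfolding D_def[abs_def] by blast
    have sdk: "summable (\<lambda>j. d j k)" for k
      by (rule summable_comparison_test'[OF summable_mult[OF sd, of 2]]) (rule S.nrm_coord[OF d(1)])
    have sQ: "summable (\<lambda>j. poly_vec (Q j) w k)" if "cmod w \<le> 1" for w k
    proof (rule summable_comparison_test'[OF summable_mult[OF sM, of 2]])
      show "norm (poly_vec (Q j) w k) \<le> 2 * M j" if "0 \<le> j" for j
        using S.nrm_coord[OF pmS[of j w], of k] disc[OF \<open>cmod w \<le> 1\<close>, of j] by linarith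
    qed
    define R where "R w k = G w k - G ?z k - (w - ?z) * D k" for w k
    have R: "R w \<in> elems S \<and> nrm S (R w) \<le> A * (cmod (w - ?z))\<^sup>2" if w: "cmod w \<le> r" for w
    proof -
      have w1: "cmod w \<le> 1" and z1: "cmod ?z \<le> 1" using w r zr by linarith+
      let ?y = "\<lambda>j k. poly_vec (Q j) w k - poly_vec (Q j) ?z k - (w - ?z) * d j k"
      have yS: "?y j \<in> elems S" for j
        by (intro S.diff_mem S.scale_mem pmS d)
      have sb: "summable (\<lambda>j. M j * rem_const r * (cmod (w - ?z))\<^sup>2)" using sMr by (rule summable_mult2)
      have sy: "summable (\<lambda>j. nrm S (?y j))"
        by (rule summable_comparison_test'[OF sb]) (use d(3)[OF w] S.nrm_nonneg[OF yS] in auto)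
      have "R w k = (\<Sum>j. ?y j k)" for k
      proof -
        have "(\<Sum>j. ?y j k) = (\<Sum>j. poly_vec (Q j) w k - poly_vec (Q j) ?z k) - (\<Sum>j. (w - ?z) * d j k)"
          by (intro suminf_diff[symmetric] summable_diff sQ w1 z1 summable_mult sdk)
        also have "\<dots> = (\<Sum>j. poly_vec (Q j) w k) - (\<Sum>j. poly_vec (Q j) ?z k) - (w - ?z) * (\<Sum>j. d j k)"
          using suminf_diff[OF sQ[OF w1] sQ[OF z1], of k k] suminf_mult[OF sdk, of "w - ?z" k] by simp
        finally show ?thesis by (simp add: R_def G_def D_def)
      qed
      then have Req: "R w = (\<lambda>k. \<Sum>j. ?y j k)" by (simp add: fun_eq_iff)
      have "(\<Sum>j. nrm S (?y j)) \<le> (\<Sum>j. M j * rem_const r * (cmod (w - ?z))\<^sup>2)"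
        by (rule suminf_le[OF d(3)[OF w] sy sb])
      also have "\<dots> = A * (cmod (w - ?z))\<^sup>2"
        using suminf_mult2[OF sM, of "rem_const r"] suminf_mult2[OF sMr, of "(cmod (w - ?z))\<^sup>2"] by (simp add: A_def)
      finally show ?thesis using S.suminf_mem_le[of ?y, OF yS sy] unfolding Req by linarith
    qed
    define f' where "f' = deriv strip_map z"
    have fd: "(strip_map has_field_derivative f') (at z)"
      unfolding f'_def by (rule holomorphic_derivI[OF holomorphic_strip_map open_interior z])
    then have fq: "((\<lambda>w. (strip_map w - ?z) / (w - z)) \<longlongrightarrow> f') (at z)" unfolding has_field_derivative_iff .
    have fc: "(strip_map \<longlongrightarrow> ?z) (at z)" using DERIV_isCont[OF fd] by (simp add: isCont_def)
    have ev: "\<forall>\<^sub>F w in at z. cmod (strip_map w) < r"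
      using tendsto_norm[OF fc] zr by (rule order_tendstoD(2))
    have "((\<lambda>w. nrm S (\<lambda>k. inverse (w - z) * R (strip_map w) k + ((strip_map w - ?z) / (w - z) - f') * D k)) \<longlongrightarrow> 0) (at z)"
    proof (rule S.tendsto_nrm_add)
      show "((\<lambda>w. nrm S (\<lambda>k. inverse (w - z) * R (strip_map w) k)) \<longlongrightarrow> 0) (at z)"
      proof (rule Lim_null_comparison)
        show "\<forall>\<^sub>F w in at z. norm (nrm S (\<lambda>k. inverse (w - z) * R (strip_map w) k))
            \<le> A * (cmod ((strip_map w - ?z) / (w - z)) * cmod (strip_map w - ?z))"
          using ev
        proof eventually_elim
          case (elim w)
          have Rw: "R (strip_map w) \<in> elems S" "nrm S (R (strip_map w)) \<le> A * (cmod (strip_map w - ?z))\<^sup>2"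
            using R[of "strip_map w"] elim by auto
          have "norm (nrm S (\<lambda>k. inverse (w - z) * R (strip_map w) k)) = inverse (cmod (w - z)) * nrm S (R (strip_map w))"
            using S.nrm_nonneg[OF Rw(1)] by (simp add: S.nrm_scale[OF Rw(1)] norm_inverse)
          also have "\<dots> \<le> inverse (cmod (w - z)) * (A * (cmod (strip_map w - ?z))\<^sup>2)"
            by (intro mult_left_mono Rw) simp
          also have "\<dots> = A * (cmod ((strip_map w - ?z) / (w - z)) * cmod (strip_map w - ?z))"
            by (simp add: norm_mult norm_inverse power2_eq_square divide_inverse)
          finally show ?case .
        qed
        have "((\<lambda>w. A * (cmod ((strip_map w - ?z) / (w - z)) * cmod (strip_map w - ?z))) \<longlongrightarrow> A * (cmod f' * cmod (?z - ?z))) (at z)"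
          by (intro tendsto_intros fq fc)
        then show "((\<lambda>w. A * (cmod ((strip_map w - ?z) / (w - z)) * cmod (strip_map w - ?z))) \<longlongrightarrow> 0) (at z)" by simp
      qed
      show "((\<lambda>w. nrm S (\<lambda>k. ((strip_map w - ?z) / (w - z) - f') * D k)) \<longlongrightarrow> 0) (at z)"
      proof (rule S.tendsto_nrm_scale)
        have "((\<lambda>w. cmod ((strip_map w - ?z) / (w - z) - f') * nrm S D) \<longlongrightarrow> cmod (f' - f') * nrm S D) (at z)"
          by (intro tendsto_intros fq)
        then show "((\<lambda>w. cmod ((strip_map w - ?z) / (w - z) - f') * nrm S D) \<longlongrightarrow> 0) (at z)" by simp
      qed (simp add: DS)
      show "\<forall>\<^sub>F w in at z. (\<lambda>k. inverse (w - z) * R (strip_map w) k) \<in> elems S \<and>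
          (\<lambda>k. ((strip_map w - ?z) / (w - z) - f') * D k) \<in> elems S"
        using ev by eventually_elim (use R DS in \<open>auto intro!: S.scale_mem\<close>)
    qed
    moreover have "(\<lambda>k. inverse (w - z) * R (strip_map w) k + ((strip_map w - ?z) / (w - z) - f') * D k)
      = (\<lambda>k. inverse (w - z) * (G (strip_map w) k - G ?z k) - f' * D k)" for w
      by (simp add: R_def fun_eq_iff divide_inverse algebra_simps)
    ultimately have "has_nderivative S (\<lambda>z. G (strip_map z)) z (\<lambda>k. f' * D k)"
      unfolding nderiv_iff using S.scale_mem[OF DS] by simp
    then show ?thesis by blast
  qed
  ultimately have "(\<lambda>z. G (strip_map z)) \<in> H"
    by (intro H_I[where M = "suminf M"] GS norm_strip_map)
  moreover have "hnorm (\<lambda>z. G (strip_map z)) \<le> suminf M"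
    by (rule hnorm_le) (use G0 G1 in auto)
  moreover have "(\<lambda>z k. \<Sum>j. poly_vec (Q j) (strip_map z) k) = (\<lambda>z. G (strip_map z))"
    by (simp add: fun_eq_iff G_def)
  ultimately show "(\<lambda>z k. \<Sum>j. poly_vec (Q j) (strip_map z) k) \<in> H" "hnorm (\<lambda>z k. \<Sum>j. poly_vec (Q j) (strip_map z) k) \<le> suminf M"
    by simp_all
qed

text \<open>The first block carries almost the whole norm, the later ones form a series of total norm at most a
prescribed amount; each block is lifted by \<open>finite_factorization\<close>.\<close>

lemma ell2_lift:
  assumes x: "x \<in> elems ell2" and M: "nrm ell2 x < M"
  shows "\<exists>g\<in>H. g (1/2) = x \<and> hnorm g \<le> M"
proof -
  define e where "e = (M - nrm ell2 x) / 2"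
  have e: "0 < e" using M by (simp add: e_def)
  have "\<exists>N0. \<forall>N\<ge>N0. \<forall>n. (\<Sum>k\<in>{N..<n}. (cmod (x k))\<^sup>2) < (e * (1/2) ^ Suc j)\<^sup>2" for j
    by (rule ell2_tail[OF x]) (use e in simp)
  then have "\<forall>j. \<exists>N0. \<forall>N\<ge>N0. \<forall>n. (\<Sum>k\<in>{N..<n}. (cmod (x k))\<^sup>2) < (e * (1/2) ^ Suc j)\<^sup>2" by blast
  from choice[OF this] obtain N0 where "\<forall>j. \<forall>N\<ge>N0 j. \<forall>n. (\<Sum>k\<in>{N..<n}. (cmod (x k))\<^sup>2) < (e * (1/2) ^ Suc j)\<^sup>2" ..
  then have N0: "\<And>j N n. N0 j \<le> N \<Longrightarrow> (\<Sum>k\<in>{N..<n}. (cmod (x k))\<^sup>2) < (e * (1/2) ^ Suc j)\<^sup>2" by blast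
  \<comment> \<open>Cumulative sums make the cut points increasing; adding \<open>j\<close> makes them exhaust all coordinates.\<close>
  define N where "N j = (\<Sum>i\<le>j. N0 i) + j" for j
  have N_Suc: "N j \<le> N (Suc j)" for j by (simp add: N_def)
  have N_ge: "N0 j \<le> N j" "j \<le> N j" for j
    using member_le_sum[of j "{..j}" N0] by (simp_all add: N_def trans_le_add1)
  define y where "y j = (case j of 0 \<Rightarrow> trunc (N 0) x | Suc i \<Rightarrow> (\<lambda>k. trunc (N (Suc i)) x k - trunc (N i) x k))" for j
  define B where "B j = (case j of 0 \<Rightarrow> nrm ell2 x + e | Suc i \<Rightarrow> e * (1/2) ^ Suc i)" for j
  have yB: "vnorm (N j) (y j) < B j" for j
  proof (cases j)
    case 0
    have "vnorm (N 0) (trunc (N 0) x) = vnorm (N 0) x" by (simp add: vnorm_def L2_set_def trunc_def)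
    then show ?thesis using 0 vnorm_le_ell2[OF x, of "N 0"] e by (simp add: y_def B_def)
  next
    case (Suc i)
    have "(vnorm (N j) (y j))\<^sup>2 = (\<Sum>k<N (Suc i). if N i \<le> k then (cmod (x k))\<^sup>2 else 0)"
      unfolding vnorm_power2 Suc by (intro sum.cong) (auto simp: y_def trunc_def)
    also have "\<dots> = (\<Sum>k\<in>{N i..<N (Suc i)}. (cmod (x k))\<^sup>2)"
      by (rule sum.mono_neutral_cong_right) auto
    also have "\<dots> < (B j)\<^sup>2" using N0[OF N_ge(1), of i] by (simp add: B_def Suc)
    finally show ?thesis using e by (intro power2_less_imp_less[of "vnorm (N j) (y j)" "B j"]) (auto simp: B_def Suc)
  qed
  have "\<exists>Q. (\<forall>k\<ge>N j. Q k = 0) \<and> poly_vec Q 0 = trunc (N j) (y j) \<and>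
    (\<forall>t. 0 \<le> t \<longrightarrow> t \<le> pi \<longrightarrow> nrm X0 (poly_vec Q (arc_point False t)) \<le> B j \<and> nrm X1 (poly_vec Q (arc_point True t)) \<le> B j)" for j
    by (rule finite_factorization[OF yB])
  then have "\<forall>j. \<exists>Q. (\<forall>k\<ge>N j. Q k = 0) \<and> poly_vec Q 0 = trunc (N j) (y j) \<and>
    (\<forall>t. 0 \<le> t \<longrightarrow> t \<le> pi \<longrightarrow> nrm X0 (poly_vec Q (arc_point False t)) \<le> B j \<and> nrm X1 (poly_vec Q (arc_point True t)) \<le> B j)" by blast
  from choice[OF this] obtain Q where "\<forall>j. (\<forall>k\<ge>N j. Q j k = 0) \<and> poly_vec (Q j) 0 = trunc (N j) (y j) \<and>
    (\<forall>t. 0 \<le> t \<longrightarrow> t \<le> pi \<longrightarrow> nrm X0 (poly_vec (Q j) (arc_point False t)) \<le> B j \<and> nrm X1 (poly_vec (Q j) (arc_point True t)) \<le> B j)" ..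
  then have Q: "\<And>j k. N j \<le> k \<Longrightarrow> Q j k = 0" "\<And>j. poly_vec (Q j) 0 = trunc (N j) (y j)"
    "\<And>j t. 0 \<le> t \<Longrightarrow> t \<le> pi \<Longrightarrow> nrm X0 (poly_vec (Q j) (arc_point False t)) \<le> B j"
    "\<And>j t. 0 \<le> t \<Longrightarrow> t \<le> pi \<Longrightarrow> nrm X1 (poly_vec (Q j) (arc_point True t)) \<le> B j"
    by blast+
  have sB: "B sums M"
  proof -
    have "(\<lambda>j. B (Suc j)) sums (e * 1)"
      unfolding B_def by (simp only: nat.case) (intro sums_mult power_half_series)
    then have "B sums (e * 1 + B 0)" by (simp add: sums_Suc_iff)
    then show ?thesis by (simp add: B_def e_def field_simps)
  qed
  let ?g = "\<lambda>z k. \<Sum>j. poly_vec (Q j) (strip_map z) k"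
  have g: "?g \<in> H" "hnorm ?g \<le> suminf B"
    by (rule series_in_H[OF Q(1,3,4) sums_summable[OF sB]]; assumption)+
  have "?g (1/2) k = x k" for k
  proof -
    have "poly_vec (Q j) 0 = y j" for j
      using N_Suc by (cases j) (auto simp: Q(2) y_def trunc_def fun_eq_iff dest: order.strict_trans2)
    then have gy: "?g (1/2) k = (\<Sum>j. y j k)" by (simp add: strip_map_half)
    have part: "(\<Sum>j<Suc m. y j k) = trunc (N m) x k" for m
      by (induction m) (simp_all add: y_def)
    have "(\<lambda>m. \<Sum>j<m. y j k) \<longlonglongrightarrow> x k"
    proof (rule tendsto_eventually)
      have "(\<Sum>j<m. y j k) = x k" if mk: "Suc (Suc k) \<le> m" for m
      proof -
        obtain m' where m': "m = Suc m'" "Suc k \<le> m'" using mk by (cases m) auto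
        then show ?thesis using part[of m'] N_ge(2)[of m'] by (simp add: trunc_def)
      qed
      then show "\<forall>\<^sub>F m in sequentially. (\<Sum>j<m. y j k) = x k" unfolding eventually_sequentially by blast
    qed
    then have "(\<lambda>j. y j k) sums x k" unfolding sums_def .
    then show ?thesis using gy sums_unique by metis
  qed
  then show ?thesis using g sums_unique[OF sB] by (intro bexI[of _ ?g]) auto
qed

theorem interp_eq_ell2: "same_nspace (interp_space X0 X1 (1/2)) ell2"
proof -
  have H_l2: "g (1/2) \<in> elems ell2 \<and> nrm ell2 (g (1/2)) \<le> hnorm g" if g: "g \<in> H" for g
  proof -
    have "vnorm n (g (1/2)) \<le> hnorm g" for n
      by (rule power2_le_imp_le) (use H_value_l2[OF g, of n] hnorm_nonneg[OF g] in \<open>auto simp: vnorm_power2\<close>)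
    then show ?thesis using ell2_leI by blast
  qed
  have elems: "elems (interp_space X0 X1 (1/2)) = elems ell2"
  proof (intro equalityI subsetI)
    fix x assume "x \<in> elems (interp_space X0 X1 (1/2))"
    then show "x \<in> elems ell2" using H_l2 by (auto simp: interp_space_def)
  next
    fix x assume x: "x \<in> elems ell2"
    obtain g where "g \<in> H" "g (1/2) = x" using ell2_lift[OF x, of "nrm ell2 x + 1"] by auto
    then show "x \<in> elems (interp_space X0 X1 (1/2))" by (auto simp: interp_space_def intro!: exI[of _ g])
  qed
  moreover have "nrm (interp_space X0 X1 (1/2)) x = nrm ell2 x" if x: "x \<in> elems ell2" for x
  proof -
    let ?A = "{hnorm g | g. g \<in> H \<and> g (complex_of_real (1/2)) = x}"
    have nrm: "nrm (interp_space X0 X1 (1/2)) x = Inf ?A" by (simp add: interp_space_def)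
    have lower: "nrm ell2 x \<le> a" if "a \<in> ?A" for a using that H_l2 by auto
    have ex: "\<exists>a\<in>?A. a \<le> M" if "nrm ell2 x < M" for M
      using ell2_lift[OF x that] by auto
    have "nrm ell2 x \<le> Inf ?A"
      by (rule cInf_greatest) (use ex[of "nrm ell2 x + 1"] lower in auto)
    moreover have "Inf ?A \<le> nrm ell2 x"
    proof (rule dense_ge)
      fix M assume "nrm ell2 x < M"
      then obtain a where a: "a \<in> ?A" "a \<le> M" using ex by blast
      have bdd: "bdd_below ?A" using lower by (rule bdd_belowI)
      show "Inf ?A \<le> M" by (rule order_trans[OF cInf_lower[OF a(1) bdd] a(2)])
    qed
    ultimately show ?thesis unfolding nrm by simp
  qed
  ultimately show ?thesis unfolding same_nspace_def by simp
qed

end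

section \<open>Singularity of the twisted sum\<close>

text \<open>A vector on which the last functional does not vanish spans a complement of the kernel of that
functional.\<close>

lemma separated_finite_dimensional:
  fixes U :: "((nat \<Rightarrow> complex) \<times> (nat \<Rightarrow> complex)) set"
  assumes "csubspace U" "\<And>u. u \<in> U \<Longrightarrow> (\<And>k. k < N \<Longrightarrow> snd u k = 0) \<Longrightarrow> u = 0"
  shows "\<exists>F. finite F \<and> U \<subseteq> cspan F"
  using assms
proof (induction N arbitrary: U)
  case 0
  then have "U \<subseteq> cspan {}" using complex_vector.span_zero by fastforce
  then show ?case by blast
next
  case (Suc N)
  note sub = \<open>csubspace U\<close>
  define U' where "U' = {u \<in> U. snd u N = 0}"
  have sub': "csubspace U'"
    using sub unfolding U'_def complex_vector.subspace_def
    by (auto simp: scaleC_prod_def scaleC_fun_def scaleC_complex_def)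
  have "\<exists>F. finite F \<and> U' \<subseteq> cspan F"
  proof (rule Suc.IH[OF sub'])
    fix u assume u: "u \<in> U'" "\<And>k. k < N \<Longrightarrow> snd u k = 0"
    show "u = 0"
    proof (rule Suc.prems(2))
      show "u \<in> U" using u by (simp add: U'_def)
      show "snd u k = 0" if "k < Suc N" for k using that u by (auto simp: U'_def less_Suc_eq)
    qed
  qed
  then obtain F where F: "finite F" "U' \<subseteq> cspan F" by blast
  show ?case
  proof (cases "U' = U")
    case True
    then show ?thesis using F by blast
  next
    case False
    then obtain u0 where u0: "u0 \<in> U" "snd u0 N \<noteq> 0" by (auto simp: U'_def)
    have "u \<in> cspan (insert u0 F)" if u: "u \<in> U" for u
    proof -
      let ?c = "snd u N / snd u0 N"
      have "u - ?c *\<^sub>C u0 \<in> U"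
        using sub u u0 by (intro complex_vector.subspace_diff complex_vector.subspace_scale)
      moreover have "snd (u - ?c *\<^sub>C u0) N = 0"
        using u0 by (simp add: scaleC_prod_def scaleC_fun_def scaleC_complex_def)
      ultimately have "u - ?c *\<^sub>C u0 \<in> cspan F" using F(2) by (auto simp: U'_def)
      then have "u - ?c *\<^sub>C u0 \<in> cspan (insert u0 F)"
        using complex_vector.span_mono[of F "insert u0 F"] by blast
      moreover have "?c *\<^sub>C u0 \<in> cspan (insert u0 F)"
        by (intro complex_vector.span_scale complex_vector.span_base) simp
      ultimately have "(u - ?c *\<^sub>C u0) + ?c *\<^sub>C u0 \<in> cspan (insert u0 F)"
        by (rule complex_vector.span_add)
      then show ?thesis by simp
    qed
    then show ?thesis using F(1) by (intro exI[of _ "insert u0 F"]) auto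
  qed
qed

lemma ell2_disjoint:
  fixes y :: "nat \<Rightarrow> nat \<Rightarrow> complex" and c :: "nat \<Rightarrow> complex" and n :: nat
  assumes y: "\<And>i. i < n \<Longrightarrow> y i \<in> elems ell2" and c: "\<And>i. cmod (c i) = 1"
    and dis: "\<And>i j k. i < n \<Longrightarrow> j < n \<Longrightarrow> i \<noteq> j \<Longrightarrow> y i k = 0 \<or> y j k = 0"
  shows "(nrm ell2 (\<lambda>k. \<Sum>i<n. c i * y i k))\<^sup>2 = (\<Sum>i<n. (nrm ell2 (y i))\<^sup>2)"
proof -
  have sq: "(nrm ell2 v)\<^sup>2 = (\<Sum>k. (cmod (v k))\<^sup>2)" if "v \<in> elems ell2" for v
    using that unfolding ell2_iff ell2_nrm by (simp add: suminf_nonneg)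
  have pt: "(cmod (\<Sum>i<n. c i * y i k))\<^sup>2 = (\<Sum>i<n. (cmod (y i k))\<^sup>2)" for k
  proof (cases "\<exists>i0<n. y i0 k \<noteq> 0")
    case True
    then obtain i0 where i0: "i0 < n" "y i0 k \<noteq> 0" by blast
    have z: "y i k = 0" if "i \<in> {..<n} - {i0}" for i using dis[of i i0 k] i0 that by auto
    have "(\<Sum>i<n. c i * y i k) = c i0 * y i0 k"
      using i0 z by (subst sum.remove[of _ i0]) auto
    moreover have "(\<Sum>i<n. (cmod (y i k))\<^sup>2) = (cmod (y i0 k))\<^sup>2"
      using i0 z by (subst sum.remove[of _ i0]) auto
    ultimately show ?thesis by (simp add: norm_mult c)
  qed simp
  have "(\<lambda>k. \<Sum>i<n. c i * y i k) \<in> elems ell2"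
    by (rule ell2_sum[THEN conjunct1]) (use y ell2_scale in auto)
  then have "(nrm ell2 (\<lambda>k. \<Sum>i<n. c i * y i k))\<^sup>2 = (\<Sum>k. \<Sum>i<n. (cmod (y i k))\<^sup>2)"
    by (simp add: sq pt)
  also have "\<dots> = (\<Sum>i<n. \<Sum>k. (cmod (y i k))\<^sup>2)"
    by (rule suminf_sum) (use y in \<open>simp add: ell2_iff\<close>)
  finally show ?thesis using y by (simp add: sq)
qed

definition seg :: "nat \<Rightarrow> nat \<Rightarrow> (nat \<Rightarrow> complex) \<Rightarrow> nat \<Rightarrow> complex" where
  "seg a b x k = (if a \<le> k \<and> k < b then x k else 0)"

context interp_pair
begin

lemma seg_bdd_op:
  assumes "a \<le> b"
  shows "bdd_op (seg a b) 2"
proof -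
  have eq: "seg a b x = (\<lambda>k. trunc b x k - trunc a x k)" for x
    using assms by (auto simp: seg_def trunc_def fun_eq_iff)
  have "seg a b x \<in> elems X0 \<and> nrm X0 (seg a b x) \<le> 2 * nrm X0 x" if "x \<in> elems X0" for x
    using X0.nrm_diff[of "trunc b x" "trunc a x"] X0.diff_mem[of "trunc b x" "trunc a x"] trunc0[OF that, of a] trunc0[OF that, of b]
    unfolding eq by auto
  moreover have "seg a b x \<in> elems X1 \<and> nrm X1 (seg a b x) \<le> 2 * nrm X1 x" if "x \<in> elems X1" for x
    using X1.nrm_diff[of "trunc b x" "trunc a x"] X1.diff_mem[of "trunc b x" "trunc a x"] trunc1[OF that, of a] trunc1[OF that, of b]
    unfolding eq by auto
  ultimately show ?thesis unfolding bdd_op_def by (auto simp: seg_def fun_eq_iff)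
qed

lemma H_cmult:
  assumes g: "g \<in> H"
  shows "(\<lambda>z k. c * g z k) \<in> H"
  by (rule H_mult[OF g, of "\<lambda>_. c" "cmod c"]) auto

lemma H_gS: "g \<in> H \<Longrightarrow> z \<in> strip \<Longrightarrow> g z \<in> elems S"
  by (simp add: H_iff)

lemma H_side: "g \<in> H \<Longrightarrow> g (Complex 0 t) \<in> elems X0" "g \<in> H \<Longrightarrow> g (Complex 1 t) \<in> elems X1"
  by (simp_all add: H_iff line_ok_def)

lemma hnorm_add:
  assumes g: "g \<in> H" and h: "h \<in> H"
  shows "hnorm (\<lambda>z k. g z k + h z k) \<le> hnorm g + hnorm h"
proof (rule hnorm_le)
  fix t
  show "nrm X0 (\<lambda>k. g (Complex 0 t) k + h (Complex 0 t) k) \<le> hnorm g + hnorm h"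
    using X0.nrm_add[OF H_side(1)[OF g, of t] H_side(1)[OF h, of t]] hnorm_ge(1)[OF g, of t] hnorm_ge(1)[OF h, of t] by linarith
  show "nrm X1 (\<lambda>k. g (Complex 1 t) k + h (Complex 1 t) k) \<le> hnorm g + hnorm h"
    using X1.nrm_add[OF H_side(2)[OF g, of t] H_side(2)[OF h, of t]] hnorm_ge(2)[OF g, of t] hnorm_ge(2)[OF h, of t] by linarith
qed

lemma hnorm_cmult:
  assumes g: "g \<in> H" and c: "cmod c \<le> 1"
  shows "hnorm (\<lambda>z k. c * g z k) \<le> hnorm g"
proof (rule hnorm_le)
  fix t
  show "nrm X0 (\<lambda>k. c * g (Complex 0 t) k) \<le> hnorm g"
    unfolding X0.nrm_scale[OF H_side(1)[OF g]]
    using mult_right_mono[OF c X0.nrm_nonneg[OF H_side(1)[OF g, of t]]] hnorm_ge(1)[OF g, of t] by linarith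
  show "nrm X1 (\<lambda>k. c * g (Complex 1 t) k) \<le> hnorm g"
    unfolding X1.nrm_scale[OF H_side(2)[OF g]]
    using mult_right_mono[OF c X1.nrm_nonneg[OF H_side(2)[OF g, of t]]] hnorm_ge(2)[OF g, of t] by linarith
qed

lemma hnorm_op:
  assumes g: "g \<in> H" and T: "bdd_op T K"
  shows "hnorm (\<lambda>z. T (g z)) \<le> K * hnorm g"
proof (rule hnorm_le)
  fix t
  have K: "0 \<le> K" using T by (simp add: bdd_op_def)
  have "nrm X0 (T (g (Complex 0 t))) \<le> K * nrm X0 (g (Complex 0 t))"
    using T H_side(1)[OF g] unfolding bdd_op_def by blast
  then show "nrm X0 (T (g (Complex 0 t))) \<le> K * hnorm g"
    using mult_left_mono[OF hnorm_ge(1)[OF g, of t] K] by linarith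
  have "nrm X1 (T (g (Complex 1 t))) \<le> K * nrm X1 (g (Complex 1 t))"
    using T H_side(2)[OF g] unfolding bdd_op_def by blast
  then show "nrm X1 (T (g (Complex 1 t))) \<le> K * hnorm g"
    using mult_left_mono[OF hnorm_ge(2)[OF g, of t] K] by linarith
qed

lemma nderiv_cmult:
  assumes "g \<in> H" "has_nderivative S g (1/2) d"
  shows "has_nderivative S (\<lambda>z k. c * g z k) (1/2) (\<lambda>k. c * d k)"
  using nderiv_mult[OF assms(2) DERIV_const[of c] half_interior(1) H_gS[OF assms(1)]] by simp

lemma H_sum:
  assumes "finite I" "\<And>i. i \<in> I \<Longrightarrow> f i \<in> H \<and> has_nderivative S (f i) (1/2) (d i)"
  shows "(\<lambda>z k. \<Sum>i\<in>I. f i z k) \<in> H \<and> has_nderivative S (\<lambda>z k. \<Sum>i\<in>I. f i z k) (1/2) (\<lambda>k. \<Sum>i\<in>I. d i k)"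
  using assms
proof (induction I rule: finite_induct)
  case empty
  show ?case using H_zero nderiv_zero by simp
next
  case (insert i I)
  then have IH: "(\<lambda>z k. \<Sum>i\<in>I. f i z k) \<in> H" "has_nderivative S (\<lambda>z k. \<Sum>i\<in>I. f i z k) (1/2) (\<lambda>k. \<Sum>i\<in>I. d i k)"
    and fi: "f i \<in> H" "has_nderivative S (f i) (1/2) (d i)" by auto
  show ?case
    using H_add[OF fi(1) IH(1)] nderiv_add[OF fi(2) IH(2) half_interior(1) H_gS[OF fi(1)] H_gS[OF IH(1)]] insert.hyps
    by simp
qed

text \<open>The difference of the two functions vanishes at \<open>1/2\<close>. In particular, another choice of the lifts
changes the derivation only by a bounded map.\<close>

lemma H_deriv_diff:
  assumes g: "g \<in> H" "has_nderivative S g (1/2) d" and h: "h \<in> H" "has_nderivative S h (1/2) d'"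
    and eq: "g (1/2) = h (1/2)"
  shows "(\<lambda>k. d k - d' k) \<in> elems ell2" "nrm ell2 (\<lambda>k. d k - d' k) \<le> 2 * (hnorm g + hnorm h)"
proof -
  let ?f = "\<lambda>z k. g z k + - 1 * h z k"
  have f: "?f \<in> H" by (rule H_add[OF g(1) H_cmult[OF h(1)]])
  have fd: "has_nderivative S ?f (1/2) (\<lambda>k. d k + - 1 * d' k)"
    using nderiv_add[OF g(2) nderiv_cmult[OF h, of "-1"] half_interior(1) H_gS[OF g(1)] H_gS[OF H_cmult[OF h(1)]]] .
  have fn: "hnorm ?f \<le> hnorm g + hnorm h"
    using hnorm_add[OF g(1) H_cmult[OF h(1), of "-1"]] hnorm_cmult[OF h(1), of "-1"] by simp
  have "vnorm n (\<lambda>k. d k - d' k) \<le> 2 * (hnorm g + hnorm h)" for n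
  proof -
    have sq: "(vnorm n (\<lambda>k. d k - d' k))\<^sup>2 \<le> (2 * hnorm ?f)\<^sup>2"
      using H_deriv_l2[OF f _ fd, of n] eq by (simp add: vnorm_power2)
    have "0 \<le> 2 * hnorm ?f" by (rule mult_nonneg_nonneg[OF zero_le_numeral hnorm_nonneg[OF f]])
    with sq have "vnorm n (\<lambda>k. d k - d' k) \<le> 2 * hnorm ?f" by (rule power2_le_imp_le)
    then show ?thesis by (rule order_trans) (rule mult_left_mono[OF fn], simp)
  qed
  then show "(\<lambda>k. d k - d' k) \<in> elems ell2" "nrm ell2 (\<lambda>k. d k - d' k) \<le> 2 * (hnorm g + hnorm h)"
    using ell2_leI by blast+
qed

end

lemma ell2_seg_tail:
  assumes x: "x \<in> elems ell2" and e: "0 < e"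
  shows "\<exists>m'>m. nrm ell2 (\<lambda>k. x k - trunc m' x k) \<le> e"
proof -
  obtain N0 where N0: "\<And>N n. N0 \<le> N \<Longrightarrow> (\<Sum>k\<in>{N..<n}. (cmod (x k))\<^sup>2) < e\<^sup>2"
    using ell2_tail[OF x e] by blast
  define m' where "m' = max N0 (Suc m)"
  have "vnorm n (\<lambda>k. x k - trunc m' x k) \<le> e" for n
  proof -
    have "(vnorm n (\<lambda>k. x k - trunc m' x k))\<^sup>2 = (\<Sum>k<n. if m' \<le> k then (cmod (x k))\<^sup>2 else 0)"
      unfolding vnorm_power2 by (intro sum.cong) (auto simp: trunc_def)
    also have "\<dots> = (\<Sum>k\<in>{m'..<n}. (cmod (x k))\<^sup>2)"
      by (rule sum.mono_neutral_cong_right) auto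
    also have "\<dots> < e\<^sup>2" by (rule N0) (simp add: m'_def)
    finally have lt: "(vnorm n (\<lambda>k. x k - trunc m' x k))\<^sup>2 < e\<^sup>2" .
    show ?thesis by (rule power2_le_imp_le[OF less_imp_le[OF lt]]) (use e in simp)
  qed
  then have "nrm ell2 (\<lambda>k. x k - trunc m' x k) \<le> e" by (rule ell2_leI)
  moreover have "m < m'" by (simp add: m'_def)
  ultimately show ?thesis by blast
qed

lemma ell2_trunc: "x \<in> elems ell2 \<Longrightarrow> trunc m x \<in> elems ell2"
proof -
  assume x: "x \<in> elems ell2"
  have "vnorm n (trunc m x) \<le> nrm ell2 x" for n
  proof -
    have "vnorm n (trunc m x) \<le> vnorm n x"
      unfolding vnorm_def by (rule L2_set_mono) (auto simp: trunc_def)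
    then show ?thesis using vnorm_le_ell2[OF x, of n] by linarith
  qed
  then show ?thesis by (rule ell2_leI)
qed

lemma ell2_pos:
  assumes "x \<in> elems ell2" "x k \<noteq> 0"
  shows "0 < nrm ell2 x"
proof -
  have "0 < cmod (x k)" using assms by simp
  also have "\<dots> \<le> vnorm (Suc k) x" by (rule norm_le_vnorm) simp
  also have "\<dots> \<le> nrm ell2 x" by (rule vnorm_le_ell2[OF assms(1)])
  finally show ?thesis .
qed

text \<open>The upper estimates that make the twisted sum singular: sums of \<open>n\<close> successive blocks supported
after \<open>n\<close> grow at most like \<open>n\<^bsup>\<alpha>\<^esup>\<close> in the first space and like \<open>n\<^bsup>1-\<alpha>\<^esup>\<close> in the second.\<close>

locale asymptotic_pair = interp_pair +
  fixes \<alpha> Ca :: real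
  assumes \<alpha>: "0 \<le> \<alpha>" "\<alpha> \<le> 1" "\<alpha> \<noteq> 1/2" and Ca: "0 \<le> Ca"
    and upper0: "\<And>n m y K. 1 \<le> n \<Longrightarrow> n \<le> m 0 \<Longrightarrow> (\<And>i. m i < m (Suc i)) \<Longrightarrow> 0 \<le> K \<Longrightarrow>
      (\<And>i. i < n \<Longrightarrow> y i \<in> elems X0 \<and> nrm X0 (y i) \<le> K) \<Longrightarrow>
      (\<And>i k. i < n \<Longrightarrow> y i k \<noteq> 0 \<Longrightarrow> m i \<le> k \<and> k < m (Suc i)) \<Longrightarrow>
      nrm X0 (\<lambda>k. \<Sum>i<n. y i k) \<le> Ca * K * real n powr \<alpha>"
    and upper1: "\<And>n m y K. 1 \<le> n \<Longrightarrow> n \<le> m 0 \<Longrightarrow> (\<And>i. m i < m (Suc i)) \<Longrightarrow> 0 \<le> K \<Longrightarrow>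
      (\<And>i. i < n \<Longrightarrow> y i \<in> elems X1 \<and> nrm X1 (y i) \<le> K) \<Longrightarrow>
      (\<And>i k. i < n \<Longrightarrow> y i k \<noteq> 0 \<Longrightarrow> m i \<le> k \<and> k < m (Suc i)) \<Longrightarrow>
      nrm X1 (\<lambda>k. \<Sum>i<n. y i k) \<le> Ca * K * real n powr (1 - \<alpha>)"
begin

text \<open>The scalar function \<open>n\<^bsup>-(\<alpha> + (1 - 2 \<alpha>) z)\<^esup>\<close>, which compensates the growth of block sums on both sides
at once.\<close>

definition balance :: "nat \<Rightarrow> complex \<Rightarrow> complex" where
  "balance n z = exp (- (of_real \<alpha> + of_real (1 - 2 * \<alpha>) * z) * of_real (ln (real n)))"

lemma norm_balance: "cmod (balance n z) = exp (- (\<alpha> + (1 - 2 * \<alpha>) * Re z) * ln (real n))"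
  by (simp add: balance_def norm_exp_eq_Re)

lemma balance_sides:
  assumes "1 \<le> n"
  shows "cmod (balance n (Complex 0 t)) = real n powr - \<alpha>" "cmod (balance n (Complex 1 t)) = real n powr - (1 - \<alpha>)"
  using assms by (simp_all add: norm_balance powr_def algebra_simps)

lemma balance_half:
  assumes "1 \<le> n"
  shows "balance n (1/2) = of_real (1 / sqrt (real n))"
proof -
  have "balance n (1/2) = of_real (exp (- (1/2) * ln (real n)))"
    by (simp add: balance_def exp_of_real[symmetric] field_simps)
  also have "exp (- (1/2) * ln (real n)) = 1 / sqrt (real n)"
    using assms by (simp add: exp_minus ln_sqrt[symmetric] field_simps)
  finally show ?thesis .
qed

lemma balance_deriv:
  "(balance n has_field_derivative (- of_real (1 - 2 * \<alpha>) * of_real (ln (real n)) * balance n z)) (at z)"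
  unfolding balance_def[abs_def] by (auto intro!: derivative_eq_intros simp: algebra_simps)

lemma H_balance:
  assumes g: "g \<in> H" and n: "1 \<le> n"
  shows "(\<lambda>z k. balance n z * g z k) \<in> H"
proof (rule H_mult[OF g])
  show "continuous_on UNIV (balance n)"
    unfolding balance_def[abs_def] by (intro continuous_intros)
  show "balance n holomorphic_on interior strip"
    unfolding balance_def[abs_def] by (intro holomorphic_intros)
  fix z assume "z \<in> strip"
  then have "0 \<le> (1 - Re z) * \<alpha> + Re z * (1 - \<alpha>)"
    using \<alpha> by (auto simp: strip_def intro!: add_nonneg_nonneg)
  then have "0 \<le> \<alpha> + (1 - 2 * \<alpha>) * Re z" by (simp add: algebra_simps)
  then have "- (\<alpha> + (1 - 2 * \<alpha>) * Re z) * ln (real n) \<le> 0"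
    using n by (intro mult_nonpos_nonneg) auto
  then show "cmod (balance n z) \<le> 1" unfolding norm_balance by simp
qed

context
  fixes B :: "(nat \<Rightarrow> complex) \<Rightarrow> complex \<Rightarrow> nat \<Rightarrow> complex"
  assumes B: "bounded_selection X0 X1 (1/2) B"
begin

abbreviation "Om \<equiv> induced_map X0 X1 (1/2) B"

lemma B_mem: "x \<in> elems ell2 \<Longrightarrow> B x \<in> H" "x \<in> elems ell2 \<Longrightarrow> B x (1/2) = x"
  using B interp_eq_ell2 unfolding bounded_selection_def same_nspace_def by auto

lemma B_bound: "\<exists>CB\<ge>0. \<forall>x\<in>elems ell2. hnorm (B x) \<le> CB * nrm ell2 x"
proof -
  obtain C where "\<forall>x\<in>elems (interp_space X0 X1 (1/2)). hnorm (B x) \<le> C * nrm (interp_space X0 X1 (1/2)) x"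
    using B unfolding bounded_selection_def by blast
  then have C: "\<And>x. x \<in> elems ell2 \<Longrightarrow> hnorm (B x) \<le> C * nrm ell2 x"
    using interp_eq_ell2 unfolding same_nspace_def by simp
  have "hnorm (B x) \<le> \<bar>C\<bar> * nrm ell2 x" if x: "x \<in> elems ell2" for x
    using C[OF x] mult_right_mono[OF abs_ge_self[of C] ell2_nonneg[OF x]] by linarith
  then show ?thesis by (intro exI[of _ "\<bar>C\<bar>"]) auto
qed

lemma Om_deriv:
  assumes x: "x \<in> elems ell2"
  shows "has_nderivative S (B x) (1/2) (Om x)"
proof -
  obtain d where d: "has_nderivative S (B x) (1/2) d"
    using B_mem(1)[OF x] half_interior(1) unfolding H_iff by blast
  have "\<exists>!d. has_nderivative S (B x) (1/2) d"
  proof (rule ex1I[where a = d])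
    show "has_nderivative S (B x) (1/2) d" by (rule d)
    fix d' assume "has_nderivative S (B x) (1/2) d'"
    then show "d' = d"
      by (rule nderiv_unique[OF _ d]) (use H_gS[OF B_mem(1)[OF x]] half_interior(1) in auto)
  qed
  from theI'[OF this] show ?thesis unfolding induced_map_def by simp
qed

text \<open>On \<open>U\<close> the first component depends linearly on the second one and differs from \<open>\<Omega>\<close> by a bounded map.
For fixed \<open>n\<close>, compare the derivative at \<open>1/2\<close> of the balanced sum of lifts with this linear map: the
difference consists of a bounded part and of \<open>(1 - 2 \<alpha>) * ln n\<close> times a vector whose norm is at
least \<open>1/2\<close>.\<close>

lemma not_bounded_linear_perturbation:
  assumes sub: "csubspace U" and US: "U \<subseteq> elems (twisted_sum S Om ell2)" and inj: "inj_on snd U"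
    and K: "\<And>u. u \<in> U \<Longrightarrow> nrm (twisted_sum S Om ell2) u \<le> K * nrm ell2 (snd u)"
    and inf: "infinite_dimensional U"
  shows False
proof -
  have UD: "snd u \<in> elems ell2" "(\<lambda>k. fst u k - Om (snd u) k) \<in> elems ell2"
    "nrm ell2 (\<lambda>k. fst u k - Om (snd u) k) \<le> \<bar>K\<bar> * nrm ell2 (snd u)" if u: "u \<in> U" for u
  proof -
    obtain w x where ux: "u = (w, x)" by (cases u)
    have "x \<in> elems ell2" "w - Om x \<in> elems ell2" using US u by (auto simp: twisted_sum_def ux)
    moreover have "nrm ell2 (w - Om x) + nrm ell2 x \<le> K * nrm ell2 x"
      using K[OF u] by (simp add: twisted_sum_def ux)
    moreover have "K * nrm ell2 x \<le> \<bar>K\<bar> * nrm ell2 x" using ell2_nonneg[OF \<open>x \<in> elems ell2\<close>] by (intro mult_right_mono) auto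
    ultimately show "snd u \<in> elems ell2" "(\<lambda>k. fst u k - Om (snd u) k) \<in> elems ell2"
      "nrm ell2 (\<lambda>k. fst u k - Om (snd u) k) \<le> \<bar>K\<bar> * nrm ell2 (snd u)"
      using ell2_nonneg[OF \<open>x \<in> elems ell2\<close>] by (auto simp: ux fun_ops)
  qed
  have U0: "0 \<in> U" using sub by (rule complex_vector.subspace_0)
  have far: "\<exists>u\<in>U. nrm ell2 (snd u) = 1 \<and> (\<forall>k<m. snd u k = 0)" for m
  proof -
    have "\<not> (\<forall>u\<in>U. (\<forall>k<m. snd u k = 0) \<longrightarrow> u = 0)"
      using separated_finite_dimensional[OF sub, of m] inf unfolding infinite_dimensional_def by blast
    then obtain u where u: "u \<in> U" "\<And>k. k < m \<Longrightarrow> snd u k = 0" "u \<noteq> 0" by blast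
    have "\<exists>k. snd u k \<noteq> 0"
    proof (rule ccontr)
      assume "\<not> ?thesis"
      then have "snd u = snd 0" by (simp add: fun_eq_iff)
      then show False using inj_onD[OF inj _ u(1) U0] u(3) by simp
    qed
    then obtain k where "snd u k \<noteq> 0" by blast
    then have pos: "0 < nrm ell2 (snd u)" using ell2_pos UD(1)[OF u(1)] by blast
    let ?v = "of_real (1 / nrm ell2 (snd u)) *\<^sub>C u"
    have sv: "snd ?v = (\<lambda>k. of_real (1 / nrm ell2 (snd u)) * snd u k)"
      by (simp add: scaleC_prod_def fun_ops)
    have "?v \<in> U" using sub u(1) by (rule complex_vector.subspace_scale)
    moreover have "nrm ell2 (snd ?v) = 1"
      unfolding sv ell2_scale(2)[OF UD(1)[OF u(1)]] norm_of_real using pos by simp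
    moreover have "\<forall>k<m. snd ?v k = 0" unfolding sv using u(2) by simp
    ultimately show ?thesis by blast
  qed
  obtain CB where CB: "0 \<le> CB" "\<And>x. x \<in> elems ell2 \<Longrightarrow> hnorm (B x) \<le> CB * nrm ell2 x"
    using B_bound by blast
  define K1 where "K1 = 8 * CB + \<bar>K\<bar>"
  define K2 where "K2 = 2 * Ca * CB + CB"
  have main: "\<bar>1 - 2 * \<alpha>\<bar> * ln (real n) \<le> 2 * (K1 + 2 * K2) + (2 * CB + \<bar>K\<bar>)" if n16: "16 \<le> n" for n :: nat
  proof -
    have n1: "1 \<le> n" and n0: "0 < real n" using n16 by auto
    \<comment> \<open>The error \<open>1/n\<close> is small enough for \<open>n\<close> of them to remain bounded.\<close>
    have "\<exists>p. fst p \<in> U \<and> nrm ell2 (snd (fst p)) = 1 \<and> (\<forall>k<m. snd (fst p) k = 0) \<and> m < snd p \<and>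
        nrm ell2 (\<lambda>k. snd (fst p) k - trunc (snd p) (snd (fst p)) k) \<le> 1 / real n" for m
    proof -
      obtain u where u: "u \<in> U" "nrm ell2 (snd u) = 1" "\<forall>k<m. snd u k = 0" using far by blast
      obtain m' where "m < m'" "nrm ell2 (\<lambda>k. snd u k - trunc m' (snd u) k) \<le> 1 / real n"
        using ell2_seg_tail[OF UD(1)[OF u(1)], of "1 / real n" m] n0 by auto
      then show ?thesis using u by (intro exI[of _ "(u, m')"]) simp
    qed
    then have "\<forall>m. \<exists>p. fst p \<in> U \<and> nrm ell2 (snd (fst p)) = 1 \<and> (\<forall>k<m. snd (fst p) k = 0) \<and> m < snd p \<and>
        nrm ell2 (\<lambda>k. snd (fst p) k - trunc (snd p) (snd (fst p)) k) \<le> 1 / real n" by blast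
    from choice[OF this] obtain p where p: "\<forall>m. fst (p m) \<in> U \<and> nrm ell2 (snd (fst (p m))) = 1 \<and>
        (\<forall>k<m. snd (fst (p m)) k = 0) \<and> m < snd (p m) \<and>
        nrm ell2 (\<lambda>k. snd (fst (p m)) k - trunc (snd (p m)) (snd (fst (p m))) k) \<le> 1 / real n" ..
    define uf where "uf m = fst (p m)" for m
    define mf where "mf m = snd (p m)" for m
    have uf: "\<And>m. uf m \<in> U" "\<And>m. nrm ell2 (snd (uf m)) = 1" "\<And>m k. k < m \<Longrightarrow> snd (uf m) k = 0"
      "\<And>m. m < mf m" "\<And>m. nrm ell2 (\<lambda>k. snd (uf m) k - trunc (mf m) (snd (uf m)) k) \<le> 1 / real n"
      using p unfolding uf_def mf_def by blast+
    define m where "m i = (mf ^^ i) n" for i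
    define x where "x i = snd (uf (m i))" for i
    define w where "w i = fst (uf (m i))" for i
    define r where "r i = (\<lambda>k. x i k - trunc (m (Suc i)) (x i) k)" for i
    have m_Suc: "m (Suc i) = mf (m i)" for i by (simp add: m_def)
    have m0: "n \<le> m 0" and mS: "m i < m (Suc i)" for i using uf(4) by (simp_all add: m_def)
    have m_mono: "m i \<le> m j" if "i \<le> j" for i j by (rule lift_Suc_mono_le[of m, OF _ that]) (rule less_imp_le[OF mS])
    have uU: "uf (m i) \<in> U" for i by (rule uf(1))
    have x2: "x i \<in> elems ell2" and x1: "nrm ell2 (x i) = 1" for i using UD(1)[OF uU] uf(2) by (simp_all add: x_def)
    have xz: "x i k = 0" if "k < m i" for i k using uf(3) that by (simp add: x_def)
    have r2: "r i \<in> elems ell2" for i unfolding r_def by (intro ell2_diff ell2_trunc x2)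
    have rn: "nrm ell2 (r i) \<le> 1 / real n" for i using uf(5)[of "m i"] by (simp add: r_def x_def m_Suc)
    have xr: "seg (m i) (m (Suc i)) (x i) k + r i k = x i k" for i k
      using xz[of k i] by (auto simp: seg_def r_def trunc_def)
    define T where "T i = seg (m i) (m (Suc i))" for i
    have T: "bdd_op (T i) 2" for i unfolding T_def by (rule seg_bdd_op) (simp add: less_imp_le mS)
    \<comment> \<open>Cutting the lift of \<open>x i\<close> to its block loses only \<open>r i\<close>, which is lifted separately; at \<open>1/2\<close>
      the two parts add up to \<open>x i\<close> exactly.\<close>
    define h where "h i = (\<lambda>z k. T i (B (x i) z) k + B (r i) z k)" for i
    define hd where "hd i = (\<lambda>k. T i (Om (x i)) k + Om (r i) k)" for i
    have Th: "(\<lambda>z. T i (B (x i) z)) \<in> H" for i by (rule H_op[OF B_mem(1)[OF x2] T])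
    have hH: "h i \<in> H" for i unfolding h_def by (rule H_add[OF Th B_mem(1)[OF r2]])
    have hhalf: "h i (1/2) = x i" for i
      using xr[of i] by (simp add: h_def B_mem(2)[OF x2] B_mem(2)[OF r2] T_def fun_eq_iff)
    have hder: "has_nderivative S (h i) (1/2) (hd i)" for i
      unfolding h_def hd_def
      by (rule nderiv_add[OF nderiv_op[OF T Om_deriv[OF x2] half_interior(1) H_gS[OF B_mem(1)[OF x2]]]
            Om_deriv[OF r2] half_interior(1) H_gS[OF Th] H_gS[OF B_mem(1)[OF r2]]])
    have Bx: "hnorm (B (x i)) \<le> CB" for i using CB(2)[OF x2, of i] by (simp add: x1)
    have Br: "hnorm (B (r i)) \<le> CB / real n" for i
      using CB(2)[OF r2, of i] mult_left_mono[OF rn[of i] CB(1)] by simp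
    have CBn: "CB / real n \<le> CB" using divide_left_mono[of 1 "real n" CB] CB(1) n1 by simp
    have hn: "hnorm (h i) \<le> 3 * CB" for i
      using hnorm_add[OF Th B_mem(1)[OF r2], of i i] hnorm_op[OF B_mem(1)[OF x2] T, of i i] Bx[of i] Br[of i] CBn
      unfolding h_def by linarith
    define d where "d i = (\<lambda>k. hd i k - w i k)" for i
    have d: "d i \<in> elems ell2" "nrm ell2 (d i) \<le> K1" for i
    proof -
      note a = H_deriv_diff[OF hH hder B_mem(1)[OF x2] Om_deriv[OF x2], of i i]
      have a1: "(\<lambda>k. hd i k - Om (x i) k) \<in> elems ell2" "nrm ell2 (\<lambda>k. hd i k - Om (x i) k) \<le> 2 * (3 * CB + CB)"
        using a hn[of i] Bx[of i] by (simp_all add: hhalf B_mem(2)[OF x2])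
      have b: "(\<lambda>k. w i k - Om (x i) k) \<in> elems ell2" "nrm ell2 (\<lambda>k. w i k - Om (x i) k) \<le> \<bar>K\<bar>"
        using UD(2,3)[OF uU[of i]] x1[of i] by (simp_all add: w_def x_def)
      have "d i = (\<lambda>k. (hd i k - Om (x i) k) - (w i k - Om (x i) k))" by (simp add: d_def)
      then show "d i \<in> elems ell2" "nrm ell2 (d i) \<le> K1"
        using ell2_diff[OF a1(1) b(1)] a1(2) b(2) by (simp_all add: K1_def)
    qed
    obtain c where c: "\<And>i. c i = 1 \<or> c i = (-1 :: complex)"
      and cd: "(nrm ell2 (\<lambda>k. \<Sum>i<n. c i * d i k))\<^sup>2 \<le> real n * K1\<^sup>2"
      using ell2_signs[of n d K1] d by blast
    have c1: "cmod (c i) = 1" for i using c[of i] by auto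
    define s where "s k = (\<Sum>i<n. c i * x i k)" for k
    define G0 where "G0 = (\<lambda>z k. \<Sum>i<n. c i * h i z k)"
    have G0: "G0 \<in> H" "has_nderivative S G0 (1/2) (\<lambda>k. \<Sum>i<n. c i * hd i k)"
      using H_sum[of "{..<n}" "\<lambda>i z k. c i * h i z k" "\<lambda>i k. c i * hd i k"] H_cmult[OF hH] nderiv_cmult[OF hH hder]
      by (simp_all add: G0_def)
    have G0half: "G0 (1/2) = s" by (simp add: G0_def s_def[abs_def] hhalf)
    define q where "q = 1 / sqrt (real n)"
    have q: "0 < q" using n0 by (simp add: q_def)
    define G where "G = (\<lambda>z k. balance n z * G0 z k)"
    have GH: "G \<in> H" unfolding G_def by (rule H_balance[OF G0(1) n1])
    define G' where "G' = (\<lambda>k. of_real q * (\<Sum>i<n. c i * hd i k) + (- of_real (1 - 2 * \<alpha>) * of_real (ln (real n)) * of_real q) * s k)"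
    have Gder: "has_nderivative S G (1/2) G'"
      using nderiv_mult[OF G0(2) balance_deriv half_interior(1) H_gS[OF G0(1)], of n]
      unfolding G_def G'_def G0half balance_half[OF n1] q_def .
    define xh where "xh = (\<lambda>k. of_real q * s k)"
    have Ghalf: "G (1/2) = xh" by (simp add: G_def xh_def G0half balance_half[OF n1] q_def)
    have Gn: "hnorm G \<le> K2"
    proof (rule hnorm_le)
      fix t
      have supp: "m i \<le> k \<and> k < m (Suc i)" if "c i * T i v k \<noteq> 0" for i k v
        using that by (auto simp: T_def seg_def split: if_splits)
      have fin: "real n powr - a * (Ca * (2 * CB) * real n powr a + CB) \<le> K2" if a: "0 \<le> a" for a
      proof -
        have "real n powr - a \<le> 1" using ge_one_powr_ge_zero[of "real n" a] n1 a by (simp add: powr_minus_divide divide_le_eq_1)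
        then have "real n powr - a * CB \<le> CB" using CB(1) mult_right_mono[of "real n powr - a" 1 CB] by simp
        moreover have "real n powr - a * real n powr a = 1" using n0 by (simp flip: powr_add)
        then have "real n powr - a * (Ca * (2 * CB) * real n powr a) = 2 * Ca * CB"
          by (metis (no_types, opaque_lifting) mult.assoc mult.commute mult.right_neutral)
        ultimately show ?thesis unfolding K2_def distrib_left by linarith
      qed
      { let ?z = "Complex 0 t"
        have "nrm X0 (\<lambda>k. \<Sum>i<n. c i * T i (B (x i) ?z) k) \<le> Ca * (2 * CB) * real n powr \<alpha>"
        proof (rule upper0[OF n1 m0 mS])
          fix i
          have "nrm X0 (T i (B (x i) ?z)) \<le> 2 * nrm X0 (B (x i) ?z)" "T i (B (x i) ?z) \<in> elems X0"
            using T[of i] H_side(1)[OF B_mem(1)[OF x2]] unfolding bdd_op_def by blast+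
          then show "(\<lambda>k. c i * T i (B (x i) ?z) k) \<in> elems X0 \<and> nrm X0 (\<lambda>k. c i * T i (B (x i) ?z) k) \<le> 2 * CB"
            using hnorm_ge(1)[OF B_mem(1)[OF x2], of i t] Bx[of i] X0.scale_mem X0.nrm_scale[of "T i (B (x i) ?z)" "c i"] c1[of i] by simp
        qed (use CB(1) supp in auto)
        moreover have "(\<lambda>k. \<Sum>i<n. c i * T i (B (x i) ?z) k) \<in> elems X0"
          by (intro X0.sum_mem_le X0.scale_mem H_side(1)[OF Th]) simp
        moreover have "(\<lambda>k. \<Sum>i<n. c i * B (r i) ?z k) \<in> elems X0"
          by (intro X0.sum_mem_le X0.scale_mem H_side(1)[OF B_mem(1)[OF r2]]) simp
        moreover have "nrm X0 (\<lambda>k. \<Sum>i<n. c i * B (r i) ?z k) \<le> (\<Sum>i<n. CB / real n)"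
        proof (rule order_trans[OF X0.sum_mem_le(2) sum_mono])
          fix i
          show "(\<lambda>k. c i * B (r i) ?z k) \<in> elems X0" by (intro X0.scale_mem H_side(1)[OF B_mem(1)[OF r2]])
          show "nrm X0 (\<lambda>k. c i * B (r i) ?z k) \<le> CB / real n"
            using hnorm_ge(1)[OF B_mem(1)[OF r2], of i t] Br[of i] X0.nrm_scale[OF H_side(1)[OF B_mem(1)[OF r2]], of "c i" i t] c1[of i] by simp
        qed auto
        moreover have "G0 ?z = (\<lambda>k. (\<Sum>i<n. c i * T i (B (x i) ?z) k) + (\<Sum>i<n. c i * B (r i) ?z k))"
          by (simp add: G0_def h_def distrib_left sum.distrib)
        ultimately have "nrm X0 (G0 ?z) \<le> Ca * (2 * CB) * real n powr \<alpha> + CB"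
          using X0.nrm_add[of "\<lambda>k. \<Sum>i<n. c i * T i (B (x i) ?z) k" "\<lambda>k. \<Sum>i<n. c i * B (r i) ?z k"] n0 by simp
        then have "real n powr - \<alpha> * nrm X0 (G0 ?z) \<le> real n powr - \<alpha> * (Ca * (2 * CB) * real n powr \<alpha> + CB)"
          by (intro mult_left_mono) auto
        then show "nrm X0 (G ?z) \<le> K2"
          unfolding G_def X0.nrm_scale[OF H_side(1)[OF G0(1)]] balance_sides[OF n1] using fin[OF \<alpha>(1)] by linarith }
      { let ?z = "Complex 1 t"
        have "nrm X1 (\<lambda>k. \<Sum>i<n. c i * T i (B (x i) ?z) k) \<le> Ca * (2 * CB) * real n powr (1 - \<alpha>)"
        proof (rule upper1[OF n1 m0 mS])
          fix i
          have "nrm X1 (T i (B (x i) ?z)) \<le> 2 * nrm X1 (B (x i) ?z)" "T i (B (x i) ?z) \<in> elems X1"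
            using T[of i] H_side(2)[OF B_mem(1)[OF x2]] unfolding bdd_op_def by blast+
          then show "(\<lambda>k. c i * T i (B (x i) ?z) k) \<in> elems X1 \<and> nrm X1 (\<lambda>k. c i * T i (B (x i) ?z) k) \<le> 2 * CB"
            using hnorm_ge(2)[OF B_mem(1)[OF x2], of i t] Bx[of i] X1.scale_mem X1.nrm_scale[of "T i (B (x i) ?z)" "c i"] c1[of i] by simp
        qed (use CB(1) supp in auto)
        moreover have "(\<lambda>k. \<Sum>i<n. c i * T i (B (x i) ?z) k) \<in> elems X1"
          by (intro X1.sum_mem_le X1.scale_mem H_side(2)[OF Th]) simp
        moreover have "(\<lambda>k. \<Sum>i<n. c i * B (r i) ?z k) \<in> elems X1"
          by (intro X1.sum_mem_le X1.scale_mem H_side(2)[OF B_mem(1)[OF r2]]) simp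
        moreover have "nrm X1 (\<lambda>k. \<Sum>i<n. c i * B (r i) ?z k) \<le> (\<Sum>i<n. CB / real n)"
        proof (rule order_trans[OF X1.sum_mem_le(2) sum_mono])
          fix i
          show "(\<lambda>k. c i * B (r i) ?z k) \<in> elems X1" by (intro X1.scale_mem H_side(2)[OF B_mem(1)[OF r2]])
          show "nrm X1 (\<lambda>k. c i * B (r i) ?z k) \<le> CB / real n"
            using hnorm_ge(2)[OF B_mem(1)[OF r2], of i t] Br[of i] X1.nrm_scale[OF H_side(2)[OF B_mem(1)[OF r2]], of "c i" i t] c1[of i] by simp
        qed auto
        moreover have "G0 ?z = (\<lambda>k. (\<Sum>i<n. c i * T i (B (x i) ?z) k) + (\<Sum>i<n. c i * B (r i) ?z k))"
          by (simp add: G0_def h_def distrib_left sum.distrib)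
        ultimately have "nrm X1 (G0 ?z) \<le> Ca * (2 * CB) * real n powr (1 - \<alpha>) + CB"
          using X1.nrm_add[of "\<lambda>k. \<Sum>i<n. c i * T i (B (x i) ?z) k" "\<lambda>k. \<Sum>i<n. c i * B (r i) ?z k"] n0 by simp
        then have "real n powr - (1 - \<alpha>) * nrm X1 (G0 ?z) \<le> real n powr - (1 - \<alpha>) * (Ca * (2 * CB) * real n powr (1 - \<alpha>) + CB)"
          by (intro mult_left_mono) auto
        then show "nrm X1 (G ?z) \<le> K2"
          unfolding G_def X1.nrm_scale[OF H_side(2)[OF G0(1)]] balance_sides[OF n1] using fin[of "1 - \<alpha>"] \<alpha>(2) by linarith }
    qed
    define u where "u = (\<Sum>i<n. (of_real q * c i) *\<^sub>C uf (m i))"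
    have uin: "u \<in> U"
      unfolding u_def by (intro complex_vector.subspace_sum[OF sub] complex_vector.subspace_scale[OF sub] uU)
    have fs: "snd u k = (\<Sum>i<n. of_real q * c i * x i k)" "fst u k = (\<Sum>i<n. of_real q * c i * w i k)" for k
    proof -
      have "snd (\<Sum>i\<in>I. (of_real q * c i) *\<^sub>C uf (m i)) k = (\<Sum>i\<in>I. of_real q * c i * x i k) \<and>
        fst (\<Sum>i\<in>I. (of_real q * c i) *\<^sub>C uf (m i)) k = (\<Sum>i\<in>I. of_real q * c i * w i k)" if "finite I" for I
        using that by (induction I rule: finite_induct) (simp_all add: scaleC_prod_def fun_ops x_def w_def)
      from this[of "{..<n}"] show "snd u k = (\<Sum>i<n. of_real q * c i * x i k)" "fst u k = (\<Sum>i<n. of_real q * c i * w i k)"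
        unfolding u_def by auto
    qed
    have sndu: "snd u = xh" by (simp add: fun_eq_iff fs xh_def s_def sum_distrib_left mult.assoc)
    have xh2: "xh \<in> elems ell2" using UD(1)[OF uin] by (simp add: sndu)
    have e1: "(\<lambda>k. G' k - Om xh k) \<in> elems ell2" "nrm ell2 (\<lambda>k. G' k - Om xh k) \<le> 2 * (K2 + CB * nrm ell2 xh)"
      using H_deriv_diff[OF GH Gder B_mem(1)[OF xh2] Om_deriv[OF xh2]] Gn CB(2)[OF xh2]
      by (simp_all add: Ghalf B_mem(2)[OF xh2])
    have e2: "(\<lambda>k. fst u k - Om xh k) \<in> elems ell2" "nrm ell2 (\<lambda>k. fst u k - Om xh k) \<le> \<bar>K\<bar> * nrm ell2 xh"
      using UD(2,3)[OF uin] by (simp_all add: sndu)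
    define D where "D = (\<lambda>k. of_real q * (\<Sum>i<n. c i * d i k))"
    have sd: "(\<lambda>k. \<Sum>i<n. c i * d i k) \<in> elems ell2"
      by (rule ell2_sum[THEN conjunct1]) (use d ell2_scale in auto)
    have D: "D \<in> elems ell2" "nrm ell2 D \<le> K1"
    proof -
      show "D \<in> elems ell2" unfolding D_def by (rule ell2_scale[OF sd])
      have K10: "0 \<le> K1" using CB(1) by (simp add: K1_def)
      have "nrm ell2 (\<lambda>k. \<Sum>i<n. c i * d i k) \<le> sqrt (real n * K1\<^sup>2)" by (rule real_le_rsqrt[OF cd])
      also have "\<dots> = sqrt (real n) * K1" using K10 by (simp add: real_sqrt_mult)
      finally show "nrm ell2 D \<le> K1"
        unfolding D_def ell2_scale(2)[OF sd] norm_of_real q_def using n0 by (simp add: field_simps)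
    qed
    have "(\<lambda>k. of_real ((1 - 2 * \<alpha>) * ln (real n)) * xh k)
        = (\<lambda>k. (D k - (G' k - Om xh k)) + (fst u k - Om xh k))"
    proof
      fix k
      have "D k = of_real q * (\<Sum>i<n. c i * hd i k) - fst u k"
        by (simp add: D_def d_def fs sum_distrib_left sum_subtractf right_diff_distrib mult.assoc)
      then show "of_real ((1 - 2 * \<alpha>) * ln (real n)) * xh k = (D k - (G' k - Om xh k)) + (fst u k - Om xh k)"
        by (simp add: G'_def xh_def algebra_simps)
    qed
    then have "nrm ell2 (\<lambda>k. of_real ((1 - 2 * \<alpha>) * ln (real n)) * xh k) \<le> K1 + 2 * (K2 + CB * nrm ell2 xh) + \<bar>K\<bar> * nrm ell2 xh"
      using ell2_add(2)[OF ell2_diff(1)[OF D(1) e1(1)] e2(1)] ell2_diff(2)[OF D(1) e1(1)] D(2) e1(2) e2(2) by simp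
    then have up: "\<bar>1 - 2 * \<alpha>\<bar> * ln (real n) * nrm ell2 xh \<le> K1 + 2 * (K2 + CB * nrm ell2 xh) + \<bar>K\<bar> * nrm ell2 xh"
      unfolding ell2_scale(2)[OF xh2] norm_of_real using n1 by (simp add: abs_mult)
    have xlow: "1/2 \<le> nrm ell2 xh"
    proof -
      define y where "y i = trunc (m (Suc i)) (x i)" for i
      have y2: "y i \<in> elems ell2" for i unfolding y_def by (rule ell2_trunc[OF x2])
      have yn: "1 - 1 / real n \<le> nrm ell2 (y i)" for i
      proof -
        have "x i = (\<lambda>k. y i k + r i k)" by (simp add: y_def r_def)
        then have "1 \<le> nrm ell2 (y i) + nrm ell2 (r i)" using ell2_add(2)[OF y2[of i] r2[of i]] x1[of i] by simp
        then show ?thesis using rn[of i] by linarith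
      qed
      have ysup: "m i \<le> k \<and> k < m (Suc i)" if "y i k \<noteq> 0" for i k
        using that xz[of k i] by (auto simp: y_def trunc_def not_le[symmetric] split: if_splits)
      have dis: "y i k = 0 \<or> y j k = 0" if "i \<noteq> j" for i j k
      proof (rule ccontr)
        assume "\<not> ?thesis"
        then have "m i \<le> k" "k < m (Suc i)" "m j \<le> k" "k < m (Suc j)" using ysup by auto
        then show False using that m_mono[of "Suc i" j] m_mono[of "Suc j" i] by (cases "i < j") auto
      qed
      have "(nrm ell2 (\<lambda>k. \<Sum>i<n. c i * y i k))\<^sup>2 = (\<Sum>i<n. (nrm ell2 (y i))\<^sup>2)"
        by (rule ell2_disjoint) (use y2 c1 dis in auto)
      also have "\<dots> \<ge> (\<Sum>i<n. (1 - 1 / real n)\<^sup>2)"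
        using n1 by (intro sum_mono power_mono yn) auto
      finally have "real n * (1 - 1 / real n)\<^sup>2 \<le> (nrm ell2 (\<lambda>k. \<Sum>i<n. c i * y i k))\<^sup>2" by simp
      then have sqle: "(sqrt (real n) * (1 - 1 / real n))\<^sup>2 \<le> (nrm ell2 (\<lambda>k. \<Sum>i<n. c i * y i k))\<^sup>2"
        by (simp add: power_mult_distrib)
      have "(\<lambda>k. \<Sum>i<n. c i * y i k) \<in> elems ell2"
        by (rule ell2_sum[THEN conjunct1]) (use y2 ell2_scale in auto)
      then have "sqrt (real n) * (1 - 1 / real n) \<le> nrm ell2 (\<lambda>k. \<Sum>i<n. c i * y i k)"
        by (intro power2_le_imp_le[OF sqle] ell2_nonneg)
      moreover have "nrm ell2 (\<lambda>k. \<Sum>i<n. c i * r i k) \<le> 1"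
      proof -
        have "nrm ell2 (\<lambda>k. \<Sum>i<n. c i * r i k) \<le> (\<Sum>i<n. nrm ell2 (\<lambda>k. c i * r i k))"
          by (rule ell2_sum[THEN conjunct2]) (use r2 ell2_scale in auto)
        also have "\<dots> \<le> (\<Sum>i<n. 1 / real n)"
          by (intro sum_mono) (use ell2_scale(2)[OF r2] rn c1 in simp)
        finally show ?thesis using n0 by simp
      qed
      moreover have "nrm ell2 (\<lambda>k. \<Sum>i<n. c i * y i k) \<le> nrm ell2 s + nrm ell2 (\<lambda>k. \<Sum>i<n. c i * r i k)"
      proof -
        have s2: "s \<in> elems ell2" unfolding s_def[abs_def]
          by (rule ell2_sum[THEN conjunct1]) (use x2 ell2_scale in auto)
        have r2': "(\<lambda>k. \<Sum>i<n. c i * r i k) \<in> elems ell2"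
          by (rule ell2_sum[THEN conjunct1]) (use r2 ell2_scale in auto)
        have "(\<lambda>k. \<Sum>i<n. c i * y i k) = (\<lambda>k. s k - (\<Sum>i<n. c i * r i k))"
          by (simp add: s_def y_def r_def sum_subtractf[symmetric] algebra_simps)
        then show ?thesis using ell2_diff(2)[OF s2 r2'] by simp
      qed
      ultimately have s_low: "sqrt (real n) * (1 - 1 / real n) - 1 \<le> nrm ell2 s" by linarith
      have s2: "s \<in> elems ell2" unfolding s_def[abs_def]
        by (rule ell2_sum[THEN conjunct1]) (use x2 ell2_scale in auto)
      have sq4: "4 \<le> sqrt (real n)" using n16 by (intro real_le_rsqrt) auto
      have "1 / real n \<le> 1 / 16" using n16 by (intro divide_left_mono) auto
      then have "sqrt (real n) * (15 / 16) - 1 \<le> sqrt (real n) * (1 - 1 / real n) - 1"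
        by (intro diff_right_mono mult_left_mono) auto
      then have "sqrt (real n) / 2 \<le> nrm ell2 s" using s_low sq4 by linarith
      then have "q * (sqrt (real n) / 2) \<le> q * nrm ell2 s" using q by (intro mult_left_mono) auto
      moreover have "q * (sqrt (real n) / 2) = 1/2" using n0 by (simp add: q_def)
      moreover have "nrm ell2 xh = q * nrm ell2 s"
        unfolding xh_def ell2_scale(2)[OF s2] using q by simp
      ultimately show ?thesis by simp
    qed
    have K12: "0 \<le> K1 + 2 * K2" using CB(1) Ca by (simp add: K1_def K2_def)
    have "(\<bar>1 - 2 * \<alpha>\<bar> * ln (real n) - (2 * CB + \<bar>K\<bar>)) * nrm ell2 xh \<le> K1 + 2 * K2"
      using up by (simp add: algebra_simps)
    also have "K1 + 2 * K2 \<le> 2 * (K1 + 2 * K2) * nrm ell2 xh"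
      using mult_left_mono[OF xlow K12] by argo
    finally have "\<bar>1 - 2 * \<alpha>\<bar> * ln (real n) - (2 * CB + \<bar>K\<bar>) \<le> 2 * (K1 + 2 * K2)"
      using xlow by (subst (asm) mult_le_cancel_right) auto
    then show ?thesis by linarith
  qed
  define L where "L = (2 * (K1 + 2 * K2) + (2 * CB + \<bar>K\<bar>)) / \<bar>1 - 2 * \<alpha>\<bar>"
  have a0: "0 < \<bar>1 - 2 * \<alpha>\<bar>" using \<alpha>(3) by simp
  obtain n where n: "exp L < real n" using reals_Archimedean2 by blast
  define n' where "n' = max 16 n"
  have "exp L < real n'" using n by (simp add: n'_def)
  then have "L < ln (real n')" by (metis exp_gt_zero ln_exp ln_less_cancel_iff order.strict_trans)
  then have "2 * (K1 + 2 * K2) + (2 * CB + \<bar>K\<bar>) < \<bar>1 - 2 * \<alpha>\<bar> * ln (real n')"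
    using a0 by (simp add: L_def pos_divide_less_eq mult.commute)
  then show False using main[of n'] by (simp add: n'_def)
qed

theorem twisted_sum_singular: "strictly_singular (twisted_sum S Om ell2) ell2 snd"
  unfolding strictly_singular_def iso_onto_image_def
  using not_bounded_linear_perturbation by blast

end

end

section \<open>Spaces with a monotone basis and their antiduals\<close>

lemma lp_norm_upper:
  assumes p: "1 \<le> p" and n: "1 \<le> n" and K: "0 \<le> K" "\<And>i. i < n \<Longrightarrow> cmod (a i) \<le> K"
  shows "lp_norm p n a \<le> K * real n powr (if p = \<infinity> then 0 else 1 / real_of_ereal p)"
proof (cases "p = \<infinity>")
  case True
  have "Max ((\<lambda>i. cmod (a i)) ` {..<n}) \<le> K"
    using n K by (subst Max_le_iff) (auto simp: lessThan_empty_iff)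
  then show ?thesis using True n by (simp add: lp_norm_def)
next
  case False
  then obtain r where r: "p = ereal r" "1 \<le> r" using p by (cases p) auto
  have "(\<Sum>i<n. cmod (a i) powr r) \<le> (\<Sum>i<n. K powr r)"
    using K r by (intro sum_mono powr_mono2) auto
  then have "(\<Sum>i<n. cmod (a i) powr r) powr (1 / r) \<le> (real n * K powr r) powr (1 / r)"
    using r by (intro powr_mono2) (auto intro: sum_nonneg)
  also have "\<dots> = K * real n powr (1 / r)"
    using r K by (cases "K = 0") (simp_all add: powr_mult powr_powr)
  finally show ?thesis using r by (simp add: lp_norm_def)
qed

text \<open>Hoelder's inequality against the constant function, derived termwise from Young's inequality after
normalising the \<open>\<ell>\<^sub>p\<close> norm.\<close>

lemma lp_norm_lower:
  assumes p: "1 \<le> p" and n: "1 \<le> n"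
  shows "(\<Sum>i<n. cmod (a i)) \<le> real n powr (1 - (if p = \<infinity> then 0 else 1 / real_of_ereal p)) * lp_norm p n a"
proof (cases "p = \<infinity>")
  case True
  have "(\<Sum>i<n. cmod (a i)) \<le> (\<Sum>i<n. Max ((\<lambda>i. cmod (a i)) ` {..<n}))"
    by (intro sum_mono Max_ge) auto
  then show ?thesis using True n by (simp add: lp_norm_def)
next
  case False
  then obtain r where r: "p = ereal r" "1 \<le> r" using p by (cases p) auto
  define A where "A = (\<Sum>i<n. cmod (a i) powr r)"
  have lp: "lp_norm p n a = A powr (1 / r)" using r by (simp add: lp_norm_def A_def)
  have A0: "0 \<le> A" unfolding A_def by (intro sum_nonneg) simp
  show ?thesis
  proof (cases "A = 0")
    case True
    then have "\<forall>i\<in>{..<n}. cmod (a i) powr r = 0"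
      unfolding A_def by (subst (asm) sum_nonneg_eq_0_iff) auto
    then show ?thesis by (simp add: lp True)
  next
    case nz: False
    then have A: "0 < A" using A0 by simp
    define L where "L = A powr (1 / r)"
    have L: "0 < L" using A by (simp add: L_def)
    define t where "t i = cmod (a i) * real n powr (1 / r) / L" for i
    have t0: "0 \<le> t i" for i using L by (simp add: t_def)
    have young: "t i \<le> 1 / r * (t i powr r) + (1 - 1 / r)" for i
    proof (cases "t i = 0")
      case False
      then have "0 < t i" using t0[of i] by simp
      then have "(t i powr r) powr (1 / r) * 1 powr (1 - 1 / r) \<le> 1 / r * (t i powr r) + (1 - 1 / r) * 1"
        using r by (intro Youngs_inequality_0) auto
      then show ?thesis using r t0[of i] by (simp add: powr_powr)
    qed (use r in simp)
    have tp: "t i powr r = cmod (a i) powr r * real n / A" for i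
    proof -
      have "t i powr r = cmod (a i) powr r * (real n powr (1 / r)) powr r / L powr r"
        using L by (simp add: t_def powr_mult powr_divide)
      also have "\<dots> = cmod (a i) powr r * real n / A" using r n A by (simp add: L_def powr_powr)
      finally show ?thesis .
    qed
    have "(\<Sum>i<n. t i) \<le> (\<Sum>i<n. 1 / r * (t i powr r) + (1 - 1 / r))" by (intro sum_mono young)
    also have "\<dots> = 1 / r * (A * real n / A) + real n * (1 - 1 / r)"
      by (simp add: tp sum.distrib A_def sum_divide_distrib sum_distrib_right sum_distrib_left)
    also have "\<dots> = real n" using A by (simp add: field_simps)
    finally have "(\<Sum>i<n. cmod (a i)) * (real n powr (1 / r) / L) \<le> real n"
      by (simp add: t_def sum_distrib_right sum_divide_distrib)
    then have "(\<Sum>i<n. cmod (a i)) * real n powr (1 / r) \<le> real n * L"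
      using L by (simp add: field_simps)
    then have "(\<Sum>i<n. cmod (a i)) \<le> real n * L / real n powr (1 / r)"
      using n by (simp add: pos_le_divide_eq)
    also have "\<dots> = real n powr (1 - 1 / r) * L" using n by (simp add: powr_diff)
    finally show ?thesis unfolding lp L_def[symmetric] using r by simp
  qed
qed

lemma bounded_linear_scaleC: "bounded_linear (\<lambda>x :: 'a::complex_normed_vector. c *\<^sub>C x)"
proof (rule bounded_linear_intro[where K = "cmod c"])
  fix x y :: 'a and r :: real
  show "c *\<^sub>C (x + y) = c *\<^sub>C x + c *\<^sub>C y" by (rule scaleC_add_right)
  show "c *\<^sub>C r *\<^sub>R x = r *\<^sub>R c *\<^sub>C x"
    by (simp add: scaleR_scaleC scaleC_scaleC mult.commute)
  show "norm (c *\<^sub>C x) \<le> norm x * cmod c" by (simp add: norm_scaleC mult.commute)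
qed

locale monotone_normalized_basis =
  fixes e :: "nat \<Rightarrow> 'a::complex_banach"
  assumes basis: "schauder_basis e" and norm_e [simp]: "norm (e n) = 1"
    and monotone: "norm (\<Sum>i<n. coords e x i *\<^sub>C e i) \<le> norm x"
begin

lemma coords_sums: "(\<lambda>n. coords e x n *\<^sub>C e n) sums x"
  using theI'[of "\<lambda>a. (\<lambda>n. a n *\<^sub>C e n) sums x"] basis unfolding schauder_basis_def coords_def by blast

lemma coords_eqI: "(\<lambda>n. a n *\<^sub>C e n) sums x \<Longrightarrow> coords e x = a"
  using basis coords_sums unfolding schauder_basis_def by blast

lemma coords_add: "coords e (x + y) = (\<lambda>k. coords e x k + coords e y k)"
  by (rule coords_eqI) (simp add: scaleC_add_left sums_add coords_sums)

lemma coords_scale: "coords e (c *\<^sub>C x) = (\<lambda>k. c * coords e x k)"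
proof (rule coords_eqI)
  have "(\<lambda>n. c *\<^sub>C (coords e x n *\<^sub>C e n)) sums (c *\<^sub>C x)"
    by (rule bounded_linear.sums[OF bounded_linear_scaleC coords_sums])
  then show "(\<lambda>n. (c * coords e x n) *\<^sub>C e n) sums (c *\<^sub>C x)" by (simp add: scaleC_scaleC)
qed

lemma coords_inj: "coords e x = coords e y \<Longrightarrow> x = y"
  using coords_sums[of x] coords_sums[of y] sums_unique2 by metis

lemma coords_finite: "coords e (\<Sum>i<n. a i *\<^sub>C e i) = trunc n a"
proof (rule coords_eqI)
  have "(\<lambda>i. trunc n a i *\<^sub>C e i) sums (\<Sum>i<n. trunc n a i *\<^sub>C e i)"
    by (rule sums_finite) (auto simp: trunc_def complex_vector.scale_zero_left)
  then show "(\<lambda>i. trunc n a i *\<^sub>C e i) sums (\<Sum>i<n. a i *\<^sub>C e i)" by (simp add: trunc_def)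
qed

lemma coords_e: "coords e (e j) = unit_seq j"
proof -
  have "(\<Sum>i<Suc j. unit_seq j i *\<^sub>C e i) = e j"
    by (simp add: unit_seq_def complex_vector.scale_zero_left complex_vector.scale_one)
  then show ?thesis using coords_finite[where n = "Suc j" and a = "unit_seq j"] by (auto simp: trunc_def unit_seq_def fun_eq_iff)
qed

definition proj :: "nat \<Rightarrow> 'a \<Rightarrow> 'a" where
  "proj n x = (\<Sum>i<n. coords e x i *\<^sub>C e i)"

lemma coords_proj: "coords e (proj n x) = trunc n (coords e x)"
  unfolding proj_def by (rule coords_finite)

lemma norm_proj: "norm (proj n x) \<le> norm x"
  unfolding proj_def by (rule monotone)

lemma proj_add: "proj n (x + y) = proj n x + proj n y"
  by (simp add: proj_def coords_add scaleC_add_left sum.distrib)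

lemma proj_scale: "proj n (c *\<^sub>C x) = c *\<^sub>C proj n x"
  by (simp add: proj_def coords_scale scaleC_scaleC complex_vector.scale_sum_right)

lemma bounded_linear_complexI:
  fixes f :: "'a \<Rightarrow> 'b::complex_normed_vector"
  assumes "\<And>x y. f (x + y) = f x + f y" "\<And>c x. f (c *\<^sub>C x) = c *\<^sub>C f x" "\<And>x. norm (f x) \<le> norm x * K"
  shows "bounded_linear f"
  by (rule bounded_linear_intro[of f K]) (simp_all add: assms scaleR_scaleC)

lemma coord_bound: "cmod (coords e x k) \<le> 2 * norm x"
proof -
  have "coords e x k *\<^sub>C e k = proj (Suc k) x - proj k x" by (simp add: proj_def)
  then have "norm (coords e x k *\<^sub>C e k) \<le> norm (proj (Suc k) x) + norm (proj k x)"
    by (simp add: norm_triangle_ineq4)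
  then show ?thesis using norm_proj[of "Suc k" x] norm_proj[of k x] by (simp add: norm_scaleC)
qed

lemma bounded_linear_coords: "bounded_linear (\<lambda>x. coords e x k)"
proof (rule bounded_linear_complexI[where K = 2])
  show "norm (coords e x k) \<le> norm x * 2" for x using coord_bound[of x k] by simp
qed (simp_all add: coords_add coords_scale scaleC_complex_def)

lemma inv_coords [simp]: "inv (coords e) (coords e x) = x"
  by (rule inv_f_f) (auto intro: injI coords_inj)

lemma coord_space_elems: "elems (coord_space e) = range (coords e)"
  and coord_space_nrm: "nrm (coord_space e) (coords e x) = norm x"
  by (simp_all add: coord_space_def)

lemma seq_space_coord_space: "seq_space (coord_space e)"
proof
  fix x c k assume "x \<in> elems (coord_space e)"
  then obtain v where x: "x = coords e v" by (auto simp: coord_space_elems)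
  show "(\<lambda>k. c * x k) \<in> elems (coord_space e)"
    by (simp add: x coord_space_elems flip: coords_scale)
  show "nrm (coord_space e) (\<lambda>k. c * x k) = cmod c * nrm (coord_space e) x"
    by (simp add: x coord_space_nrm norm_scaleC flip: coords_scale)
  show "cmod (x k) \<le> 2 * nrm (coord_space e) x"
    by (simp add: x coord_space_nrm coord_bound)
next
  show "elems (coord_space e) \<noteq> {}" by (simp add: coord_space_elems)
next
  fix y :: "nat \<Rightarrow> nat \<Rightarrow> complex"
  assume y: "\<And>j. y j \<in> elems (coord_space e)" and sm: "summable (\<lambda>j. nrm (coord_space e) (y j))"
  define v where "v j = inv (coords e) (y j)" for j
  have yv: "y j = coords e (v j)" for j
    using y[of j] by (auto simp: v_def coord_space_elems)
  have sn: "summable (\<lambda>j. norm (v j))" using sm by (simp add: yv coord_space_nrm)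
  then have "summable v" by (rule summable_norm_cancel)
  then have vs: "v sums suminf v" by (rule summable_sums)
  have "(\<lambda>k. \<Sum>j. y j k) = coords e (suminf v)"
    using bounded_linear.sums[OF bounded_linear_coords vs] by (auto simp: fun_eq_iff yv sums_iff)
  then show "(\<lambda>k. \<Sum>j. y j k) \<in> elems (coord_space e) \<and>
      nrm (coord_space e) (\<lambda>k. \<Sum>j. y j k) \<le> (\<Sum>j. nrm (coord_space e) (y j))"
    using summable_norm[OF sn] by (simp add: coord_space_elems coord_space_nrm yv)
qed

lemma cdual_iff: "f \<in> cdual \<longleftrightarrow> bounded_linear f \<and> (\<forall>c x. f (c *\<^sub>C x) = c * f x)"
  by (simp add: cdual_def)

lemma cdualI:
  fixes f :: "'a \<Rightarrow> complex"
  assumes "\<And>x y. f (x + y) = f x + f y" "\<And>c x. f (c *\<^sub>C x) = c * f x" "\<And>x. cmod (f x) \<le> K * norm x"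
  shows "f \<in> cdual" "0 \<le> K \<Longrightarrow> onorm f \<le> K"
proof -
  have "bounded_linear f"
    by (rule bounded_linear_complexI[where K = K]) (use assms in \<open>simp_all add: scaleC_complex_def mult.commute\<close>)
  then show "f \<in> cdual" using assms(2) by (simp add: cdual_iff)
  show "onorm f \<le> K" if "0 \<le> K" using that assms(3) by (rule onorm_bound)
qed

lemma cdual_bound: "f \<in> cdual \<Longrightarrow> cmod (f x) \<le> onorm f * norm x"
  by (auto simp: cdual_iff intro: onorm)

lemma cdual_add: "f \<in> cdual \<Longrightarrow> f (x + y) = f x + f y"
  by (simp add: cdual_iff bounded_linear.linear linear_add)

lemma cdual_diff: "f \<in> cdual \<Longrightarrow> f (x - y) = f x - f y"
  by (simp add: cdual_iff bounded_linear.linear linear_diff)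

lemma cdual_scale: "f \<in> cdual \<Longrightarrow> f (c *\<^sub>C x) = c * f x"
  by (simp add: cdual_iff)

lemma onorm_nonneg: "f \<in> cdual \<Longrightarrow> 0 \<le> onorm f"
  by (auto simp: cdual_iff intro: onorm_pos_le)

lemma cdual_sum: "f \<in> cdual \<Longrightarrow> f (\<Sum>i\<in>I. g i) = (\<Sum>i\<in>I. f (g i))"
  by (simp add: cdual_iff bounded_linear.linear linear_sum)

lemma cdual_sums: "f \<in> cdual \<Longrightarrow> (\<lambda>k. coords e x k * f (e k)) sums f x"
  using bounded_linear.sums[OF _ coords_sums, of f x] by (simp add: cdual_iff)

lemma cdual_eqI: "f \<in> cdual \<Longrightarrow> g \<in> cdual \<Longrightarrow> (\<And>k. f (e k) = g (e k)) \<Longrightarrow> f = g"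
  by (rule ext) (metis (no_types, lifting) cdual_sums sums_cong sums_unique2)

lemma anti_coords_inj: "inj_on (anti_coords e) cdual"
  by (rule inj_onI, rule cdual_eqI) (auto simp: anti_coords_def fun_eq_iff)

lemma antidual_elems: "elems (antidual_space e) = anti_coords e ` cdual"
  and antidual_nrm: "f \<in> cdual \<Longrightarrow> nrm (antidual_space e) (anti_coords e f) = onorm f"
  by (simp_all add: antidual_space_def inv_into_f_f anti_coords_inj)

lemma cdual_cmult:
  fixes f :: "'a \<Rightarrow> complex"
  assumes f: "f \<in> cdual"
  shows "(\<lambda>x. c * f x) \<in> cdual" "onorm (\<lambda>x. c * f x) \<le> cmod c * onorm f"
proof -
  have a: "c * f (x + y) = c * f x + c * f y" for x y by (simp add: cdual_add[OF f] distrib_left)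
  have s: "c * f (b *\<^sub>C x) = b * (c * f x)" for b x by (simp add: cdual_scale[OF f])
  have b: "cmod (c * f x) \<le> cmod c * onorm f * norm x" for x
    using mult_left_mono[OF cdual_bound[OF f, of x] norm_ge_zero[of c]] by (simp add: norm_mult mult.assoc)
  show "(\<lambda>x. c * f x) \<in> cdual" by (rule cdualI(1)[where f = "\<lambda>x. c * f x", OF a s b])
  show "onorm (\<lambda>x. c * f x) \<le> cmod c * onorm f"
    by (rule cdualI(2)[where f = "\<lambda>x. c * f x", OF a s b]) (simp add: onorm_nonneg[OF f])
qed

lemma onorm_cmult:
  fixes f :: "'a \<Rightarrow> complex"
  assumes f: "f \<in> cdual"
  shows "onorm (\<lambda>x. c * f x) = cmod c * onorm f"
proof (cases "c = 0")
  case True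
  then show ?thesis using onorm_nonneg[OF cdual_cmult(1)[OF f, of c]] cdual_cmult(2)[OF f, of c] by simp
next
  case False
  have "onorm f \<le> cmod (1 / c) * onorm (\<lambda>x. c * f x)"
    using cdual_cmult(2)[OF cdual_cmult(1)[OF f, of c], of "1 / c"] False by simp
  then have "cmod c * onorm f \<le> onorm (\<lambda>x. c * f x)"
    using False by (simp add: norm_divide field_simps)
  then show ?thesis using cdual_cmult(2)[OF f, of c] by simp
qed

lemma seq_space_antidual_space: "seq_space (antidual_space e)"
proof
  fix x c k assume "x \<in> elems (antidual_space e)"
  then obtain f where f: "f \<in> cdual" and x: "x = anti_coords e f" by (auto simp: antidual_elems)
  have cx: "(\<lambda>k. c * x k) = anti_coords e (\<lambda>v. cnj c * f v)" by (simp add: x anti_coords_def)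
  show "(\<lambda>k. c * x k) \<in> elems (antidual_space e)"
    unfolding cx antidual_elems by (intro imageI cdual_cmult f)
  show "nrm (antidual_space e) (\<lambda>k. c * x k) = cmod c * nrm (antidual_space e) x"
    unfolding cx antidual_nrm[OF cdual_cmult(1)[OF f]] onorm_cmult[OF f] by (simp add: x antidual_nrm[OF f])
  show "cmod (x k) \<le> 2 * nrm (antidual_space e) x"
    unfolding x antidual_nrm[OF f] using cdual_bound[OF f, of "e k"] onorm_nonneg[OF f] by (simp add: anti_coords_def)
next
  have "(\<lambda>x. 0) \<in> (cdual :: ('a \<Rightarrow> complex) set)" by (simp add: cdual_iff bounded_linear_zero)
  then show "elems (antidual_space e) \<noteq> {}" by (auto simp: antidual_elems)
next
  fix y :: "nat \<Rightarrow> nat \<Rightarrow> complex"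
  assume y: "\<And>j. y j \<in> elems (antidual_space e)" and sm: "summable (\<lambda>j. nrm (antidual_space e) (y j))"
  define f where "f j = inv_into cdual (anti_coords e) (y j)" for j
  have f: "f j \<in> cdual" and yf: "y j = anti_coords e (f j)" for j
    using y[of j] by (auto simp: f_def antidual_elems inv_into_into f_inv_into_f)
  have sn: "summable (\<lambda>j. onorm (f j))" using sm by (simp add: yf antidual_nrm f)
  define F where "F v = (\<Sum>j. f j v)" for v
  have sb: "summable (\<lambda>j. onorm (f j) * norm v)" for v using sn by (rule summable_mult2)
  have sfn: "summable (\<lambda>j. cmod (f j v))" for v
    by (rule summable_comparison_test'[OF sb[of v]]) (simp add: cdual_bound f)
  have sf: "summable (\<lambda>j. f j v)" for v by (rule summable_norm_cancel[OF sfn])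
  have b: "cmod (F v) \<le> (\<Sum>j. onorm (f j)) * norm v" for v
  proof -
    have "cmod (F v) \<le> (\<Sum>j. cmod (f j v))" unfolding F_def by (rule summable_norm[OF sfn])
    also have "\<dots> \<le> (\<Sum>j. onorm (f j) * norm v)" by (intro suminf_le sfn sb cdual_bound f)
    also have "\<dots> = (\<Sum>j. onorm (f j)) * norm v" by (rule suminf_mult2[OF sn, symmetric])
    finally show ?thesis .
  qed
  have a: "F (u + v) = F u + F v" for u v
    unfolding F_def cdual_add[OF f] by (rule suminf_add[OF sf sf, symmetric])
  have s: "F (c *\<^sub>C v) = c * F v" for c v
    unfolding F_def cdual_scale[OF f] by (rule suminf_mult[OF sf])
  have F: "F \<in> cdual" "onorm F \<le> (\<Sum>j. onorm (f j))"
    by (rule cdualI(1)[where f = F, OF a s b], rule cdualI(2)[where f = F, OF a s b suminf_nonneg[OF sn onorm_nonneg[OF f]]])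
  have "(\<lambda>k. \<Sum>j. y j k) = anti_coords e F"
    using bounded_linear.suminf[OF bounded_linear_cnj sf] by (simp add: fun_eq_iff yf anti_coords_def F_def)
  then show "(\<lambda>k. \<Sum>j. y j k) \<in> elems (antidual_space e) \<and>
      nrm (antidual_space e) (\<lambda>k. \<Sum>j. y j k) \<le> (\<Sum>j. nrm (antidual_space e) (y j))"
    using F by (simp add: antidual_elems antidual_nrm f yf)
qed

lemma cdual_proj:
  assumes f: "f \<in> cdual"
  shows "(\<lambda>x. f (proj n x)) \<in> cdual" "onorm (\<lambda>x. f (proj n x)) \<le> onorm f"
proof -
  have b: "cmod (f (proj n x)) \<le> onorm f * norm x" for x
    using cdual_bound[OF f, of "proj n x"] mult_left_mono[OF norm_proj[of n x] onorm_nonneg[OF f]] by linarith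
  have a: "f (proj n (x + y)) = f (proj n x) + f (proj n y)" for x y by (simp add: proj_add cdual_add[OF f])
  have s: "f (proj n (c *\<^sub>C x)) = c * f (proj n x)" for c x by (simp add: proj_scale cdual_scale[OF f])
  show "(\<lambda>x. f (proj n x)) \<in> cdual" by (rule cdualI(1)[where f = "\<lambda>x. f (proj n x)", OF a s b])
  show "onorm (\<lambda>x. f (proj n x)) \<le> onorm f" by (rule cdualI(2)[where f = "\<lambda>x. f (proj n x)", OF a s b onorm_nonneg[OF f]])
qed

lemma proj_e: "proj n (e k) = (if k < n then e k else 0)"
  by (rule coords_inj)
     (auto simp: coords_proj coords_e trunc_def unit_seq_def fun_eq_iff coords_scale[of 0 "e k", simplified complex_vector.scale_zero_left])

text \<open>Monotonicity of the basis makes the projections, and with them their adjoints, contractions; so the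
functional given by finitely many coefficients has the same norm on the whole space as on the span of
the corresponding basis vectors.\<close>

lemma interp_pair_antidual: "interp_pair (coord_space e) (antidual_space e)"
proof -
  interpret C: seq_space "coord_space e" by (rule seq_space_coord_space)
  interpret A: seq_space "antidual_space e" by (rule seq_space_antidual_space)
  show ?thesis
  proof
    fix x n assume "x \<in> elems (coord_space e)"
    then obtain v where x: "x = coords e v" by (auto simp: coord_space_elems)
    show "trunc n x \<in> elems (coord_space e) \<and> nrm (coord_space e) (trunc n x) \<le> nrm (coord_space e) x"
      by (simp add: x coord_space_elems coord_space_nrm norm_proj flip: coords_proj)
  next
    fix x n assume "x \<in> elems (antidual_space e)"
    then obtain f where f: "f \<in> cdual" and x: "x = anti_coords e f" by (auto simp: antidual_elems)
    have "f 0 = 0" using cdual_diff[OF f, of 0 0] by simp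
    then have tx: "trunc n x = anti_coords e (\<lambda>v. f (proj n v))"
      by (auto simp: x anti_coords_def trunc_def proj_e fun_eq_iff)
    show "trunc n x \<in> elems (antidual_space e) \<and> nrm (antidual_space e) (trunc n x) \<le> nrm (antidual_space e) x"
      unfolding tx antidual_nrm[OF cdual_proj(1)[OF f]] using cdual_proj[OF f] by (simp add: x antidual_nrm[OF f] antidual_elems)
  next
    fix k
    have "nrm (coord_space e) (coords e (e k)) = 1" by (simp only: coord_space_nrm norm_e)
    then show "unit_seq k \<in> elems (coord_space e) \<and> nrm (coord_space e) (unit_seq k) \<le> 2"
      unfolding coords_e[symmetric] by (simp add: coord_space_elems)
    have c: "(\<lambda>x. coords e x k) \<in> cdual" "onorm (\<lambda>x. coords e x k) \<le> 2"
      by (rule cdualI(1)[where K = 2], simp_all only: coords_add coords_scale coord_bound)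
         (rule cdualI(2)[where K = 2], simp_all add: coords_add coords_scale coord_bound)
    have u: "unit_seq k = anti_coords e (\<lambda>x. coords e x k)"
      by (auto simp: anti_coords_def coords_e unit_seq_def fun_eq_iff)
    show "unit_seq k \<in> elems (antidual_space e) \<and> nrm (antidual_space e) (unit_seq k) \<le> 2"
      unfolding u antidual_nrm[OF c(1)] using c by (simp add: antidual_elems)
  next
    fix x y n assume "x \<in> elems (coord_space e)" "y \<in> elems (antidual_space e)"
    then obtain v f where f: "f \<in> cdual" and x: "x = coords e v" and y: "y = anti_coords e f"
      by (auto simp: coord_space_elems antidual_elems)
    have "(\<Sum>k<n. x k * cnj (y k)) = f (proj n v)"
      by (simp add: x y anti_coords_def proj_def cdual_sum[OF f] cdual_scale[OF f])
    then show "cmod (\<Sum>k<n. x k * cnj (y k)) \<le> nrm (coord_space e) x * nrm (antidual_space e) y"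
      using cdual_bound[OF f, of "proj n v"] mult_left_mono[OF norm_proj[of n v] onorm_nonneg[OF f]]
      by (simp add: x y coord_space_nrm antidual_nrm[OF f] mult.commute)
  next
    fix b :: "nat \<Rightarrow> complex" and n K
    assume le: "\<And>a. a \<in> elems (coord_space e) \<Longrightarrow> cmod (\<Sum>k<n. a k * cnj (b k)) \<le> K * nrm (coord_space e) a" and K: "0 \<le> K"
    define F where "F x = (\<Sum>k<n. coords e x k * cnj (b k))" for x
    have bd: "cmod (F x) \<le> K * norm x" for x
      using le[of "coords e x"] by (simp add: F_def coord_space_elems coord_space_nrm)
    have a: "F (x + y) = F x + F y" for x y by (simp add: F_def coords_add distrib_right sum.distrib)
    have s: "F (c *\<^sub>C x) = c * F x" for c x by (simp add: F_def coords_scale sum_distrib_left mult.assoc)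
    have F: "F \<in> cdual" "onorm F \<le> K"
      by (rule cdualI(1)[where f = F, OF a s bd], rule cdualI(2)[where f = F, OF a s bd K])
    have "trunc n b = anti_coords e F"
      by (auto simp: fun_eq_iff trunc_def anti_coords_def F_def coords_e unit_seq_def if_distrib if_distribR sum.delta cong: if_cong)
    then show "nrm (antidual_space e) (trunc n b) \<le> K" using F by (simp add: antidual_nrm)
  qed
qed

text \<open>Vectors of the blocks are normalised; a zero vector is replaced by a basis vector of its block with
coefficient zero.\<close>

lemma asymptotic_blocks:
  assumes as: "asymptotically_lp p e"
  shows "\<exists>C\<ge>1. \<forall>n m v. 1 \<le> n \<longrightarrow> n \<le> m 0 \<longrightarrow> (\<forall>i. m i < m (Suc i)) \<longrightarrow>
     (\<forall>i k. i < n \<longrightarrow> coords e (v i) k \<noteq> 0 \<longrightarrow> m i \<le> k \<and> k < m (Suc i)) \<longrightarrow>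
     lp_norm p n (\<lambda>i. of_real (norm (v i))) / C \<le> norm (\<Sum>i<n. v i) \<and>
     norm (\<Sum>i<n. v i) \<le> C * lp_norm p n (\<lambda>i. of_real (norm (v i)))"
proof -
  obtain C where C: "1 \<le> C" and asC: "\<forall>n\<ge>1. \<forall>x :: nat \<Rightarrow> 'a.
       (\<forall>i<n. norm (x i) = 1 \<and> finite (supp e (x i)) \<and> supp e (x i) \<subseteq> {n..}) \<and>
       (\<forall>i j. i < j \<and> j < n \<longrightarrow> (\<forall>k\<in>supp e (x i). \<forall>l\<in>supp e (x j). k < l))
       \<longrightarrow> (\<forall>a :: nat \<Rightarrow> complex.
              lp_norm p n a / C \<le> norm (\<Sum>i<n. a i *\<^sub>C x i) \<and>
              norm (\<Sum>i<n. a i *\<^sub>C x i) \<le> C * lp_norm p n a)"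
    using as unfolding asymptotically_lp_def by blast
  have "lp_norm p n (\<lambda>i. of_real (norm (v i))) / C \<le> norm (\<Sum>i<n. v i) \<and>
     norm (\<Sum>i<n. v i) \<le> C * lp_norm p n (\<lambda>i. of_real (norm (v i)))"
    if n: "1 \<le> n" and m0: "n \<le> m 0" and mS: "\<forall>i. m i < m (Suc i)"
      and v: "\<forall>i k. i < n \<longrightarrow> coords e (v i) k \<noteq> 0 \<longrightarrow> m i \<le> k \<and> k < m (Suc i)" for n m v
  proof -
    have m_mono: "m i \<le> m j" if "i \<le> j" for i j
      by (rule lift_Suc_mono_le[OF _ that]) (use mS less_imp_le in blast)
    define u where "u i = (if v i = 0 then e (m i) else of_real (1 / norm (v i)) *\<^sub>C v i)" for i
    have vu: "of_real (norm (v i)) *\<^sub>C u i = v i" for i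
      by (simp add: u_def scaleC_scaleC scaleC_one complex_vector.scale_zero_left flip: of_real_mult)
    have un: "norm (u i) = 1" for i by (simp add: u_def norm_scaleC norm_divide)
    have us: "supp e (u i) \<subseteq> {m i..<m (Suc i)}" if "i < n" for i
    proof
      fix k assume k: "k \<in> supp e (u i)"
      show "k \<in> {m i..<m (Suc i)}"
      proof (cases "v i = 0")
        case True
        then have "k = m i" using k by (auto simp: supp_def u_def coords_e unit_seq_def split: if_splits)
        then show ?thesis using mS by simp
      next
        case False
        then have "coords e (v i) k \<noteq> 0" using k by (auto simp: supp_def u_def coords_scale)
        then show ?thesis using v that by auto
      qed
    qed
    have uu: "(\<forall>i<n. norm (u i) = 1 \<and> finite (supp e (u i)) \<and> supp e (u i) \<subseteq> {n..}) \<and>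
       (\<forall>i j. i < j \<and> j < n \<longrightarrow> (\<forall>k\<in>supp e (u i). \<forall>l\<in>supp e (u j). k < l))"
    proof (intro conjI allI impI ballI)
      fix i assume i: "i < n"
      show "norm (u i) = 1" by (rule un)
      show "finite (supp e (u i))" using us[OF i] finite_subset by blast
      show "supp e (u i) \<subseteq> {n..}" using us[OF i] m_mono[of 0 i] m0 by fastforce
    next
      fix i j k l assume ij: "i < j \<and> j < n" and k: "k \<in> supp e (u i)" and l: "l \<in> supp e (u j)"
      then have "k < m (Suc i)" "m j \<le> l" using us[of i] us[of j] by auto
      then show "k < l" using m_mono[of "Suc i" j] ij by linarith
    qed
    show ?thesis
      using asC[THEN spec, THEN mp, OF n, THEN spec, THEN mp, OF uu, THEN spec, of "\<lambda>i. of_real (norm (v i))"]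
      by (simp only: vu)
  qed
  then show ?thesis using C by blast
qed

text \<open>The estimate in the antidual is dual to the lower \<open>\<ell>\<^sub>p\<close> estimate: a sum of functionals on consecutive
intervals only sees the projections of a vector to these intervals, and the sum of these projections
is again a projection of the vector, of norm at most twice as large.\<close>

lemma asymptotic_pair_antidual:
  assumes p: "1 \<le> p" "p \<noteq> 2" and as: "asymptotically_lp p e"
  shows "\<exists>\<alpha> Ca. asymptotic_pair (coord_space e) (antidual_space e) \<alpha> Ca"
proof -
  interpret P: interp_pair "coord_space e" "antidual_space e" by (rule interp_pair_antidual)
  obtain C where C: "1 \<le> C"
    and blocks: "\<And>n m v. 1 \<le> n \<Longrightarrow> n \<le> m 0 \<Longrightarrow> \<forall>i. m i < m (Suc i) \<Longrightarrow>
     \<forall>i k. i < n \<longrightarrow> coords e (v i) k \<noteq> 0 \<longrightarrow> m i \<le> k \<and> k < m (Suc i) \<Longrightarrow>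
     lp_norm p n (\<lambda>i. of_real (norm (v i))) / C \<le> norm (\<Sum>i<n. v i) \<and>
     norm (\<Sum>i<n. v i) \<le> C * lp_norm p n (\<lambda>i. of_real (norm (v i)))"
    using asymptotic_blocks[OF as] by blast
  define \<alpha> where "\<alpha> = (if p = \<infinity> then 0 else 1 / real_of_ereal p)"
  have \<alpha>: "0 \<le> \<alpha>" "\<alpha> \<le> 1" "\<alpha> \<noteq> 1/2"
    using p by (cases p; force simp: \<alpha>_def divide_simps)+
  have "asymptotic_pair (coord_space e) (antidual_space e) \<alpha> (2 * C)"
  proof
    show "0 \<le> \<alpha>" "\<alpha> \<le> 1" "\<alpha> \<noteq> 1/2" "0 \<le> 2 * C" using \<alpha> C by auto
  next
    fix n :: nat and m y K
    assume n: "1 \<le> n" and m0: "n \<le> m 0" and mS: "\<And>i. m i < m (Suc i)" and K: "0 \<le> K"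
      and y: "\<And>i. i < n \<Longrightarrow> y i \<in> elems (coord_space e) \<and> nrm (coord_space e) (y i) \<le> K"
      and ys: "\<And>i k. i < n \<Longrightarrow> y i k \<noteq> 0 \<Longrightarrow> m i \<le> k \<and> k < m (Suc i)"
    define v where "v i = inv (coords e) (y i)" for i
    have yv: "y i = coords e (v i)" if "i < n" for i
      using y[OF that] by (auto simp: v_def coord_space_elems)
    have vK: "norm (v i) \<le> K" if "i < n" for i using y[OF that] by (simp add: yv[OF that] coord_space_nrm)
    have sum: "(\<lambda>k. \<Sum>i<n. y i k) = coords e (\<Sum>i<n. v i)"
    proof -
      have "coords e (\<Sum>i<n. v i) k = (\<Sum>i<n. coords e (v i) k)" for k
        by (rule linear_sum[OF bounded_linear.linear[OF bounded_linear_coords]])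
      then show ?thesis by (simp add: fun_eq_iff yv)
    qed
    have "norm (\<Sum>i<n. v i) \<le> C * lp_norm p n (\<lambda>i. of_real (norm (v i)))"
      using blocks[of n m v] n m0 mS ys yv by auto
    also have "\<dots> \<le> C * (K * real n powr \<alpha>)"
      unfolding \<alpha>_def using C vK by (intro mult_left_mono lp_norm_upper p n K) auto
    also have "\<dots> \<le> 2 * C * K * real n powr \<alpha>"
      using C K by simp
    finally show "nrm (coord_space e) (\<lambda>k. \<Sum>i<n. y i k) \<le> 2 * C * K * real n powr \<alpha>"
      unfolding sum coord_space_nrm .
  next
    fix n :: nat and m y K
    assume n: "1 \<le> n" and m0: "n \<le> m 0" and mS: "\<And>i. m i < m (Suc i)" and K: "0 \<le> K"
      and y: "\<And>i. i < n \<Longrightarrow> y i \<in> elems (antidual_space e) \<and> nrm (antidual_space e) (y i) \<le> K"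
      and ys: "\<And>i k. i < n \<Longrightarrow> y i k \<noteq> 0 \<Longrightarrow> m i \<le> k \<and> k < m (Suc i)"
    define f where "f i = inv_into cdual (anti_coords e) (y i)" for i
    have f: "f i \<in> cdual" and yf: "y i = anti_coords e (f i)" if "i < n" for i
      using y[OF that] by (auto simp: f_def antidual_elems inv_into_into f_inv_into_f)
    have fK: "onorm (f i) \<le> K" if "i < n" for i using y[OF that] by (simp add: yf[OF that] antidual_nrm f[OF that])
    define F where "F x = (\<Sum>i<n. f i x)" for x
    have bound: "cmod (F x) \<le> 2 * C * K * real n powr (1 - \<alpha>) * norm x" for x
    proof -
      define v where "v i = proj (m (Suc i)) x - proj (m i) x" for i
      have cv: "coords e (v i) k = (if m i \<le> k \<and> k < m (Suc i) then coords e x k else 0)" for i k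
      proof -
        have "coords e (v i) k = coords e (proj (m (Suc i)) x) k - coords e (proj (m i) x) k"
          unfolding v_def by (rule linear_diff[OF bounded_linear.linear[OF bounded_linear_coords]])
        then show ?thesis using mS[of i] by (auto simp: coords_proj trunc_def)
      qed
      have fv: "f i (v i) = f i x" if i: "i < n" for i
      proof -
        have "coords e (v i) k * f i (e k) = coords e x k * f i (e k)" for k
        proof (cases "f i (e k) = 0")
          case False
          then have "y i k \<noteq> 0" by (simp add: yf[OF i] anti_coords_def)
          then show ?thesis using ys[OF i] by (auto simp: cv)
        qed simp
        then have "(\<lambda>k. coords e (v i) k * f i (e k)) = (\<lambda>k. coords e x k * f i (e k))" by (rule ext)
        then show ?thesis using cdual_sums[OF f[OF i], of "v i"] sums_unique2[OF cdual_sums[OF f[OF i], of x]] by simp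
      qed
      have tele: "(\<Sum>i<j. v i) = proj (m j) x - proj (m 0) x" for j
        by (induction j) (simp_all add: v_def)
      have "cmod (F x) \<le> (\<Sum>i<n. cmod (f i (v i)))"
        unfolding F_def by (rule order_trans[OF norm_sum]) (simp add: fv)
      also have "\<dots> \<le> (\<Sum>i<n. K * norm (v i))"
      proof (rule sum_mono)
        fix i assume "i \<in> {..<n}"
        then have i: "i < n" by simp
        show "cmod (f i (v i)) \<le> K * norm (v i)"
          using cdual_bound[OF f[OF i], of "v i"] mult_right_mono[OF fK[OF i] norm_ge_zero[of "v i"]] by linarith
      qed
      also have "\<dots> = K * (\<Sum>i<n. cmod (of_real (norm (v i))))" by (simp add: sum_distrib_left)
      also have "\<dots> \<le> K * (real n powr (1 - \<alpha>) * lp_norm p n (\<lambda>i. of_real (norm (v i))))"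
        unfolding \<alpha>_def by (intro mult_left_mono lp_norm_lower p n K)
      also have "\<dots> \<le> K * (real n powr (1 - \<alpha>) * (C * (2 * norm x)))"
      proof (intro mult_left_mono K)
        have "lp_norm p n (\<lambda>i. of_real (norm (v i))) / C \<le> norm (\<Sum>i<n. v i)"
          using blocks[of n m v] n m0 mS by (auto simp: cv)
        also have "\<dots> \<le> norm (proj (m n) x) + norm (proj (m 0) x)"
          unfolding tele by (rule norm_triangle_ineq4)
        also have "\<dots> \<le> 2 * norm x" using norm_proj[of "m n" x] norm_proj[of "m 0" x] by simp
        finally show "lp_norm p n (\<lambda>i. of_real (norm (v i))) \<le> C * (2 * norm x)"
          using C by (simp add: pos_divide_le_eq mult.commute)
      qed simp
      finally show ?thesis by (simp add: mult_ac)
    qed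
    have a: "F (x + y) = F x + F y" for x y by (simp add: F_def f cdual_add sum.distrib)
    have s: "F (c *\<^sub>C x) = c * F x" for c x by (simp add: F_def f cdual_scale sum_distrib_left)
    have K0: "0 \<le> 2 * C * K * real n powr (1 - \<alpha>)" using C K by simp
    have F: "F \<in> cdual" "onorm F \<le> 2 * C * K * real n powr (1 - \<alpha>)"
      by (rule cdualI(1)[where f = F, OF a s bound], rule cdualI(2)[where f = F, OF a s bound K0])
    have "(\<lambda>k. \<Sum>i<n. y i k) = anti_coords e F"
      by (simp add: fun_eq_iff anti_coords_def F_def yf)
    then show "nrm (antidual_space e) (\<lambda>k. \<Sum>i<n. y i k) \<le> 2 * C * K * real n powr (1 - \<alpha>)"
      using F by (simp add: antidual_nrm)
  qed
  then show ?thesis by blast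
qed

end

theorem proposition6p3:
  fixes e :: "nat \<Rightarrow> 'a::complex_banach" and p :: ereal
  assumes "1 \<le> p" and "p \<noteq> 2"
    and "reflexive_space TYPE('a)"
    and "schauder_basis e" and "normalized_basis e" and "monotone_basis e"
    and "asymptotically_lp p e"
  shows "same_nspace (interp_space (coord_space e) (antidual_space e) (1/2)) ell2 \<and>
    (\<forall>B. bounded_selection (coord_space e) (antidual_space e) (1/2) B \<longrightarrow>
       strictly_singular
         (twisted_sum (sum_space (coord_space e) (antidual_space e))
            (induced_map (coord_space e) (antidual_space e) (1/2) B) ell2)
         ell2 snd)"
proof -
  interpret monotone_normalized_basis e
    by standard (use assms in \<open>auto simp: normalized_basis_def monotone_basis_def\<close>)
  obtain \<alpha> Ca where "asymptotic_pair (coord_space e) (antidual_space e) \<alpha> Ca"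
    using asymptotic_pair_antidual assms by blast
  then interpret A: asymptotic_pair "coord_space e" "antidual_space e" \<alpha> Ca .
  show ?thesis using A.interp_eq_ell2 A.twisted_sum_singular by blast
qed

end
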